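(* Let $(I_p)_{p}$ be a sieving system, i.e. for each prime $p$ a set $I_p\subseteq \mathbb{Z}/p\mathbb{Z}$ of residue classes, satisfying the following conditions: (a) $|I_p|\le p-1$ for all primes $p$; (b) there is $B\in\mathbb{N}$ with $|I_p|\le B$ for all $p$; (c) there is a constant $C_1>0$ with $\prod_{p\le x}(1-|I_p|/p)\sim C_1/\log x$ as $x\to\infty$; (e) for each $\nu\in\{1,\ldots,B\}$ the limit $\rho_\nu=\lim_{x\to\infty}\#\{p\le x: |I_p|=\nu\}/(x/\log x)$ exists; (f) for every integer $v\ge 1$ one has $N(v)\ll v^{0.49}$, where for nonzero integers $v$, $N(v)=\#\{p:\ v \bmod p\in I_p-I_p\}$; (g) there are positive constants $c_1,c_2$ such that: for every $u\ge 10$, every choice, for each prime $q$ with $|I_q|\ge 1$, of a nonzero integer $m_q$ with $m_q\bmod q\in I_q-I_q$, every integer $w$ with $|w|\le u$ and every integer $k\ge 1$, \[ \#\{q \text{ prime}:\ |I_q|\ge 1,\ 0<|m_q|\le u,\ m_q+w\ne 0,\ N(m_q+w)\ge k\}\ll u(\log u)^{c_1}e^{-c_2k}. \] For $x\ge 2$ let $S_x=\mathbb{Z}\setminus\bigcup_{p\le x}I_p$. Then for every $\varepsilon>0$ and all sufficiently large $x$, the set $S_x$ has a gap of size at least $x(\log x)^{C(1)-\varepsilon}$, i.e. there is an interval of real numbers of length at least $x(\log x)^{C(1)-\varepsilon}$ containing no element of $S_x$.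
   Context: Here $p,q$ always denote primes. For a residue class set $I_p\subseteq\mathbb{Z}/p\mathbb{Z}$, $I_p-I_p=\{a-a': a,a'\in I_p\}\subseteq \mathbb{Z}/p\mathbb{Z}$, and in $\bigcup_{p\le x}I_p$ each residue class is regarded as a subset of $\mathbb{Z}$. For $\rho>0$, $C(\rho):=\sup\{\delta>0:\ 6\cdot 10^{2\delta}/\log(1/(2\delta))<\rho\}$, and $C(1)$ is this quantity at $\rho=1$.
   Formalization: The supremum defining C(ρ) is taken over 0<δ<1/2 instead of all δ>0: every δ>1/2 makes log(1/(2δ)) negative and satisfies the inequality, so C(1) as written would be infinite. *)

theory Defs
  imports
    "HOL-Computational_Algebra.Primes"
    "HOL-Library.Landau_Symbols"
begin

text \<open>
  Residue classes modulo \<open>p\<close> are represented by their least nonnegative representatives, so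
  \<open>\<int>/p\<int>\<close> is \<open>{0..<int p}\<close> and the class of \<open>n\<close> is \<open>n mod int p\<close>. The values of a
  sieving system at non-prime indices are unconstrained and never used.
\<close>

definition sieving_system :: "(nat \<Rightarrow> int set) \<Rightarrow> bool" where
  "sieving_system I \<longleftrightarrow> (\<forall>p. prime p \<longrightarrow> I p \<subseteq> {0..<int p})"

definition diff_classes :: "nat \<Rightarrow> int set \<Rightarrow> int set" where
  "diff_classes p A = {(a - a') mod int p | a a'. a \<in> A \<and> a' \<in> A}"

definition diff_primes :: "(nat \<Rightarrow> int set) \<Rightarrow> int \<Rightarrow> nat set" where
  "diff_primes I v = {p. prime p \<and> v mod int p \<in> diff_classes p (I p)}"

text \<open>
  The function \<open>N\<close>. Since \<open>card\<close> is \<open>0\<close> on infinite sets, an upper bound on this number is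
  meaningful only together with finiteness of \<^const>\<open>diff_primes\<close>.
\<close>

definition num_diff_primes :: "(nat \<Rightarrow> int set) \<Rightarrow> int \<Rightarrow> nat" where
  "num_diff_primes I v = card (diff_primes I v)"

definition sieved_set :: "(nat \<Rightarrow> int set) \<Rightarrow> real \<Rightarrow> int set" where
  "sieved_set I x = UNIV - (\<Union>p\<in>{p. prime p \<and> real p \<le> x}. {n. n mod int p \<in> I p})"

text \<open>
  The constant \<open>C(\<rho>)\<close>. The restriction \<open>\<delta> < 1/2\<close> makes \<open>ln (1 / (2 * \<delta>))\<close> positive;
  for \<open>\<delta> > 1/2\<close> the quotient is negative, so without it the set would be unbounded.
\<close>

definition gap_exponent :: "real \<Rightarrow> real" where
  "gap_exponent \<rho> =
     Sup {\<delta>. 0 < \<delta> \<and> \<delta> < 1/2 \<and> 6 * 10 powr (2 * \<delta>) / ln (1 / (2 * \<delta>)) < \<rho>}"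

text \<open>
  An interval of any kind that avoids \<open>S\<close> contains the open interval with the same endpoints,
  so only open intervals are considered.
\<close>

definition has_gap :: "int set \<Rightarrow> real \<Rightarrow> bool" where
  "has_gap S L \<longleftrightarrow> (\<exists>a b :: real. b - a \<ge> L \<and> {a<..<b} \<inter> of_int ` S = {})"

end

theory Submission
  imports Defs "HOL-Library.FuncSet" "HOL-Real_Asymp.Real_Asymp" "HOL-Number_Theory.Cong"
begin

text \<open>
  Let \<open>Y\<close> be about \<open>x (ln x) powr \<delta>\<close> with \<open>\<delta>\<close> close to \<open>C(1)\<close>, so \<open>\<delta> \<le> 1/800\<close>. By the Chinese
  remainder theorem it suffices to translate the sets \<open>I p\<close>, \<open>p \<le> x\<close>, independently so that they
  cover \<open>{1..Y}\<close>. The primes \<open>p \<le> x / ln x\<close> get random translations. For a medium prime \<open>q\<close> and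
  a residue \<open>r\<close> the progression of all \<open>n\<close> with \<open>n - r\<close> in \<open>I q\<close> is weighted by \<open>lam\<close>, the inverse
  of the probability that its members left by the primes \<open>p \<le> w\<close>, \<open>w\<close> a power of \<open>ln x\<close>, survive
  all the other small primes. These weights have exact first moments; their variances are small because (f) and (g)
  bound the number of primes \<open>p\<close> at which two progressions interact. Hence for almost all survivors
  the weighted number of progressions through them is at least about \<open>(10/11) ^ j / 10\<close> in the block
  \<open>j\<close> of medium primes. A Roedl nibble with one stage per block, in which each stage
  keeps a point with probability \<open>10/11\<close> and the survival of small sets is almost independent,
  covers all but a proportion \<open>(ln x) powr (-\<delta>)\<close> of the survivors. The remaining points are
  removed one by one by the primes in \<open>(x/2, x]\<close>.
\<close>

section \<open>The nibble\<close>

text \<open>The obstacle is the length of a progression: for \<open>q\<close> near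
  \<open>Y / H\<close> it can have about \<open>H\<close> points, and all of them survive the small
  primes only with probability roughly (ln x) powr (-H). Weights normalised by so small a random
  quantity have controlled second moments only relative to the primes above some \<open>w\<close>, a
  power of \<open>H\<close>. As the density left by the primes up to \<open>w\<close> is about C1 /
  ln w, a level contributes its sum of |I q| / q times about ln x / ln w. If the exponent of ln x in
  \<open>H\<close> grows geometrically from level to level, all levels contribute equally, and their
  number is dictated by the total 11 ln (11/10) that a nibble of ratio 10/11 consumes. Each stage
  turns its error into a multiple of the square root, so an initial \<open>\<eta>\<close> ends as
  \<eta> powr (1 / 2 ^ m). With m close to \<delta> ln ln x / ln (11/10), 2 ^ m is a small power of
  ln x, and this loss is affordable against edges of order (ln x) powr 0.4. Both demands can be met
  because \<delta> is tiny.\<close>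

definition averaging :: "'v set \<Rightarrow> (('v set \<Rightarrow> real) \<Rightarrow> real) \<Rightarrow> bool" where
  "averaging V \<Phi> \<longleftrightarrow> (\<forall>F G. (\<forall>W\<subseteq>V. F W \<le> G W) \<longrightarrow> \<Phi> F \<le> \<Phi> G)
     \<and> (\<forall>F G. \<Phi> (\<lambda>W. F W + G W) = \<Phi> F + \<Phi> G)
     \<and> (\<forall>c F. \<Phi> (\<lambda>W. c * F W) = c * \<Phi> F) \<and> \<Phi> (\<lambda>_. 1) = 1"

text \<open>\<open>averaging V \<Phi>\<close> stands for the expectation over a random subset of
  \<open>V\<close>. Monotonicity, additivity, homogeneity and normalisation replace a probability
  space, so a stage can be composed with an earlier functional without product measures. Functions
  are compared on subsets of \<open>V\<close> only, because no other set occurs.\<close>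

lemma averaging_mono:
  "averaging V \<Phi> \<Longrightarrow> (\<And>W. W \<subseteq> V \<Longrightarrow> F W \<le> G W) \<Longrightarrow> \<Phi> F \<le> \<Phi> G"
  unfolding averaging_def by blast

lemma averaging_cong:
  assumes "averaging V \<Phi>" "\<And>W. W \<subseteq> V \<Longrightarrow> F W = G W"
  shows "\<Phi> F = \<Phi> G"
  by (rule antisym; rule averaging_mono[OF assms(1)]; simp add: assms(2))

lemma averaging_add: "averaging V \<Phi> \<Longrightarrow> \<Phi> (\<lambda>W. F W + G W) = \<Phi> F + \<Phi> G"
  unfolding averaging_def by blast

lemma averaging_scale: "averaging V \<Phi> \<Longrightarrow> \<Phi> (\<lambda>W. c * F W) = c * \<Phi> F"
  unfolding averaging_def by blast

lemma averaging_const: "averaging V \<Phi> \<Longrightarrow> \<Phi> (\<lambda>_. c) = c"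
  using averaging_scale[of V \<Phi> c "\<lambda>_. 1"] unfolding averaging_def by auto

lemma averaging_diff:
  assumes "averaging V \<Phi>"
  shows "\<Phi> (\<lambda>W. F W - G W) = \<Phi> F - \<Phi> G"
  using averaging_add[OF assms, of F "\<lambda>W. (-1) * G W"] averaging_scale[OF assms, of "-1" G] by simp

lemma averaging_sum:
  assumes "averaging V \<Phi>" "finite S"
  shows "\<Phi> (\<lambda>W. \<Sum>i\<in>S. F i W) = (\<Sum>i\<in>S. \<Phi> (F i))"
  using assms(2)
  by (induction S rule: finite_induct)
     (simp_all add: averaging_const[OF assms(1)] averaging_add[OF assms(1)])

lemma averaging_abs:
  assumes "averaging V \<Phi>"
  shows "\<bar>\<Phi> F\<bar> \<le> \<Phi> (\<lambda>W. \<bar>F W\<bar>)"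
proof -
  have "\<Phi> F \<le> \<Phi> (\<lambda>W. \<bar>F W\<bar>)" by (rule averaging_mono[OF assms]) simp
  moreover have "-1 * \<Phi> F \<le> \<Phi> (\<lambda>W. \<bar>F W\<bar>)"
    unfolding averaging_scale[OF assms, symmetric] by (rule averaging_mono[OF assms]) simp
  ultimately show ?thesis by simp
qed

text \<open>Jensen in the form \<open>\<bar>Z\<bar> \<le> (Z\<^sup>2 / a + a) / 2\<close>, which only needs linearity.\<close>

lemma averaging_abs_le_sqrt:
  assumes av: "averaging V \<Phi>" and sec: "\<Phi> (\<lambda>W. (Z W)\<^sup>2) \<le> a\<^sup>2" and a: "a > 0"
  shows "\<Phi> (\<lambda>W. \<bar>Z W\<bar>) \<le> a"
proof -
  have "\<Phi> (\<lambda>W. \<bar>Z W\<bar>) \<le> \<Phi> (\<lambda>W. (1 / (2 * a)) * (Z W)\<^sup>2 + a / 2)"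
  proof (rule averaging_mono[OF av])
    fix W
    have "0 \<le> (\<bar>Z W\<bar> - a)\<^sup>2" by simp
    hence "2 * a * \<bar>Z W\<bar> \<le> (Z W)\<^sup>2 + a\<^sup>2"
      by (simp add: power2_diff algebra_simps)
    thus "\<bar>Z W\<bar> \<le> (1 / (2 * a)) * (Z W)\<^sup>2 + a / 2"
      using a by (simp add: field_simps power2_eq_square)
  qed
  also have "\<dots> = (1 / (2 * a)) * \<Phi> (\<lambda>W. (Z W)\<^sup>2) + a / 2"
    by (simp add: averaging_add[OF av] averaging_scale[OF av, of "1/(2*a)"] averaging_const[OF av] del: times_divide_eq_left)
  also have "\<dots> \<le> (1 / (2 * a)) * a\<^sup>2 + a / 2"
    using sec a by (intro add_right_mono mult_left_mono) auto
  also have "\<dots> = a" using a by (simp add: power2_eq_square)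
  finally show ?thesis .
qed

text \<open>One pass of the nibble: the edges of the indices in a list are removed independently, index
  \<open>q\<close> taking its outcome \<open>\<omega>\<close> with probability \<open>\<nu> q \<omega>\<close> and no edge with the remaining probability.\<close>

primrec stage_avg ::
  "('q \<Rightarrow> 'o set) \<Rightarrow> ('q \<Rightarrow> 'o \<Rightarrow> 'v set) \<Rightarrow> ('q \<Rightarrow> 'o \<Rightarrow> real) \<Rightarrow> 'q list \<Rightarrow>
     ('v set \<Rightarrow> real) \<Rightarrow> 'v set \<Rightarrow> real" where
  "stage_avg Om ed \<nu> [] F U = F U"
| "stage_avg Om ed \<nu> (q # qs) F U =
     (\<Sum>\<omega>\<in>Om q. \<nu> q \<omega> * stage_avg Om ed \<nu> qs F (U - ed q \<omega>))
       + (1 - (\<Sum>\<omega>\<in>Om q. \<nu> q \<omega>)) * stage_avg Om ed \<nu> qs F U"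

definition subprob :: "'o set \<Rightarrow> ('o \<Rightarrow> real) \<Rightarrow> bool" where
  "subprob S \<nu> \<longleftrightarrow> finite S \<and> (\<forall>\<omega>\<in>S. \<nu> \<omega> \<ge> 0) \<and> (\<Sum>\<omega>\<in>S. \<nu> \<omega>) \<le> 1"

lemma stage_avg_mono:
  assumes "\<forall>q\<in>set qs. subprob (Om q) (\<nu> q)" "\<forall>W\<subseteq>U. F W \<le> G W"
  shows "stage_avg Om ed \<nu> qs F U \<le> stage_avg Om ed \<nu> qs G U"
  using assms
proof (induction qs arbitrary: U)
  case (Cons q qs)
  have 1: "stage_avg Om ed \<nu> qs F U \<le> stage_avg Om ed \<nu> qs G U"
    using Cons.prems by (intro Cons.IH) auto
  have 2: "stage_avg Om ed \<nu> qs F (U - ed q \<omega>) \<le> stage_avg Om ed \<nu> qs G (U - ed q \<omega>)" for \<omega>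
    using Cons.prems by (intro Cons.IH) auto
  have "subprob (Om q) (\<nu> q)" using Cons.prems by simp
  thus ?case unfolding stage_avg.simps subprob_def
    by (intro add_mono sum_mono mult_left_mono 1 2) auto
qed simp

lemma stage_avg_add:
  "stage_avg Om ed \<nu> qs (\<lambda>W. F W + G W) U = stage_avg Om ed \<nu> qs F U + stage_avg Om ed \<nu> qs G U"
  by (induction qs arbitrary: U) (simp_all add: sum.distrib algebra_simps)

lemma stage_avg_scale:
  "stage_avg Om ed \<nu> qs (\<lambda>W. c * F W) U = c * stage_avg Om ed \<nu> qs F U"
  by (induction qs arbitrary: U) (simp_all add: sum_distrib_left algebra_simps)

lemma stage_avg_one: "stage_avg Om ed \<nu> qs (\<lambda>_. 1) U = 1"
  by (induction qs arbitrary: U) simp_all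

text \<open>The indices of one stage act independently, because \<open>\<nu>\<close> is fixed before
  the stage and does not react to removals inside it; hence the probability that \<open>e\<close>
  survives is a product.\<close>

lemma stage_avg_indicator:
  "stage_avg Om ed \<nu> qs (\<lambda>W. of_bool (e \<subseteq> W)) U =
     of_bool (e \<subseteq> U) * (\<Prod>q\<leftarrow>qs. 1 - (\<Sum>\<omega>\<in>Om q. \<nu> q \<omega> * of_bool (e \<inter> ed q \<omega> \<noteq> {})))"
proof (induction qs arbitrary: U)
  case (Cons q qs)
  let ?R = "\<Prod>q\<leftarrow>qs. 1 - (\<Sum>\<omega>\<in>Om q. \<nu> q \<omega> * of_bool (e \<inter> ed q \<omega> \<noteq> {}))"
  have "(of_bool (e \<subseteq> U - ed q \<omega>) :: real) = of_bool (e \<subseteq> U) * (1 - of_bool (e \<inter> ed q \<omega> \<noteq> {}))" for \<omega>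
    by (auto simp: of_bool_def)
  hence "stage_avg Om ed \<nu> (q # qs) (\<lambda>W. of_bool (e \<subseteq> W)) U =
     (\<Sum>\<omega>\<in>Om q. \<nu> q \<omega> * (of_bool (e \<subseteq> U) * (1 - of_bool (e \<inter> ed q \<omega> \<noteq> {})) * ?R))
       + (1 - (\<Sum>\<omega>\<in>Om q. \<nu> q \<omega>)) * (of_bool (e \<subseteq> U) * ?R)"
    using Cons.IH by (simp only: stage_avg.simps)
  also have "(\<Sum>\<omega>\<in>Om q. \<nu> q \<omega> * (of_bool (e \<subseteq> U) * (1 - of_bool (e \<inter> ed q \<omega> \<noteq> {})) * ?R)) =
     of_bool (e \<subseteq> U) * ?R * ((\<Sum>\<omega>\<in>Om q. \<nu> q \<omega>) - (\<Sum>\<omega>\<in>Om q. \<nu> q \<omega> * of_bool (e \<inter> ed q \<omega> \<noteq> {})))"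
    by (simp only: sum_subtractf[symmetric] sum_distrib_left)
       (intro sum.cong refl, simp add: algebra_simps)
  finally show ?case by (simp add: algebra_simps)
qed simp

lemma weighted_average_witness:
  assumes "subprob S \<nu>"
  shows "(\<exists>\<omega>\<in>S. f \<omega> \<le> (\<Sum>\<omega>\<in>S. \<nu> \<omega> * f \<omega>) + (1 - (\<Sum>\<omega>\<in>S. \<nu> \<omega>)) * c)
       \<or> c \<le> (\<Sum>\<omega>\<in>S. \<nu> \<omega> * f \<omega>) + (1 - (\<Sum>\<omega>\<in>S. \<nu> \<omega>)) * (c::real)"
proof (rule ccontr)
  let ?A = "(\<Sum>\<omega>\<in>S. \<nu> \<omega> * f \<omega>) + (1 - (\<Sum>\<omega>\<in>S. \<nu> \<omega>)) * c"
  assume "\<not> ?thesis"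
  hence f: "\<And>\<omega>. \<omega> \<in> S \<Longrightarrow> f \<omega> > ?A" and c: "c > ?A" by auto
  have fin: "finite S" and nn: "\<And>\<omega>. \<omega> \<in> S \<Longrightarrow> \<nu> \<omega> \<ge> 0" and s1: "(\<Sum>\<omega>\<in>S. \<nu> \<omega>) \<le> 1"
    using assms by (auto simp: subprob_def)
  show False
  proof (cases "(\<Sum>\<omega>\<in>S. \<nu> \<omega>) = 1")
    case True
    have "\<exists>\<omega>\<in>S. \<nu> \<omega> > 0"
    proof (rule ccontr)
      assume "\<not> ?thesis"
      hence "\<And>\<omega>. \<omega> \<in> S \<Longrightarrow> \<nu> \<omega> = 0" using nn by force
      thus False using True by simp
    qed
    then obtain p where p: "p \<in> S" "\<nu> p > 0" by blast
    have "(\<Sum>\<omega>\<in>S. \<nu> \<omega> * ?A) < (\<Sum>\<omega>\<in>S. \<nu> \<omega> * f \<omega>)"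
    proof (rule sum_strict_mono_ex1[OF fin])
      show "\<forall>\<omega>\<in>S. \<nu> \<omega> * ?A \<le> \<nu> \<omega> * f \<omega>"
        by (intro ballI mult_left_mono less_imp_le f nn)
      show "\<exists>\<omega>\<in>S. \<nu> \<omega> * ?A < \<nu> \<omega> * f \<omega>"
        by (intro bexI[of _ p] mult_strict_left_mono f p)
    qed
    moreover have "(\<Sum>\<omega>\<in>S. \<nu> \<omega> * ?A) = ?A" using True by (simp add: sum_distrib_right[symmetric] del: distrib_left)
    ultimately show False using True by simp
  next
    case False
    have "(\<Sum>\<omega>\<in>S. \<nu> \<omega> * ?A) \<le> (\<Sum>\<omega>\<in>S. \<nu> \<omega> * f \<omega>)"
      by (intro sum_mono mult_left_mono less_imp_le[OF f] nn)
    moreover have "(1 - (\<Sum>\<omega>\<in>S. \<nu> \<omega>)) * ?A < (1 - (\<Sum>\<omega>\<in>S. \<nu> \<omega>)) * c"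
      using False s1 c by (intro mult_strict_left_mono) auto
    ultimately have "(\<Sum>\<omega>\<in>S. \<nu> \<omega> * ?A) + (1 - (\<Sum>\<omega>\<in>S. \<nu> \<omega>)) * ?A < ?A"
      by (rule add_le_less_mono)
    moreover have "(\<Sum>\<omega>\<in>S. \<nu> \<omega> * a) + (1 - (\<Sum>\<omega>\<in>S. \<nu> \<omega>)) * a = a" for a
      unfolding sum_distrib_right[symmetric] by (simp add: left_diff_distrib)
    ultimately show False by (simp only: less_irrefl)
  qed
qed

text \<open>Derandomisation by conditional expectations: the indices are fixed one after the other,
  each time with an outcome that does not raise the average over the remaining ones. The value {}
  records the event that an index removes nothing.\<close>

lemma stage_avg_witness:
  assumes "\<forall>q\<in>set qs. subprob (Om q) (\<nu> q)" "distinct qs"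
  shows "\<exists>g. (\<forall>q\<in>set qs. g q \<in> insert {} (ed q ` Om q))
           \<and> F (U - (\<Union>q\<in>set qs. g q)) \<le> stage_avg Om ed \<nu> qs F U"
  using assms
proof (induction qs arbitrary: U)
  case (Cons q qs)
  have sp: "subprob (Om q) (\<nu> q)" using Cons.prems by simp
  have "\<exists>X\<in>insert {} (ed q ` Om q). stage_avg Om ed \<nu> qs F (U - X) \<le> stage_avg Om ed \<nu> (q # qs) F U"
    using weighted_average_witness[OF sp, of "\<lambda>\<omega>. stage_avg Om ed \<nu> qs F (U - ed q \<omega>)" "stage_avg Om ed \<nu> qs F U"]
    by auto
  then obtain X where X: "X \<in> insert {} (ed q ` Om q)"
     "stage_avg Om ed \<nu> qs F (U - X) \<le> stage_avg Om ed \<nu> (q # qs) F U" by blast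
  obtain g where g: "\<forall>q\<in>set qs. g q \<in> insert {} (ed q ` Om q)"
     "F (U - X - (\<Union>q\<in>set qs. g q)) \<le> stage_avg Om ed \<nu> qs F (U - X)"
    using Cons.IH[of "U - X"] Cons.prems by auto
  have eq: "(\<Union>p\<in>set (q # qs). (g(q := X)) p) = X \<union> (\<Union>p\<in>set qs. g p)"
    using Cons.prems by auto
  have "F (U - (\<Union>p\<in>set (q # qs). (g(q := X)) p)) \<le> stage_avg Om ed \<nu> (q # qs) F U"
    unfolding eq using g X by (simp add: Diff_eq Int_assoc)
  moreover have "\<forall>p\<in>set (q # qs). (g(q := X)) p \<in> insert {} (ed p ` Om p)"
    using g X by auto
  ultimately show ?case by blast
qed simp

text \<open>The law \<open>\<nu>\<close> may depend on the set at the start of the stage. This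
  freedom lets the nibble renormalise the edges that are still intact.\<close>

lemma averaging_stage:
  assumes "averaging V \<Phi>" "\<And>W. W \<subseteq> V \<Longrightarrow> \<forall>q\<in>set qs. subprob (Om q) (\<nu> W q)"
  shows "averaging V (\<lambda>F. \<Phi> (\<lambda>W. stage_avg Om ed (\<nu> W) qs F W))"
  unfolding averaging_def
proof (intro conjI allI impI)
  fix F G :: "'a set \<Rightarrow> real" assume "\<forall>W\<subseteq>V. F W \<le> G W"
  thus "\<Phi> (\<lambda>W. stage_avg Om ed (\<nu> W) qs F W) \<le> \<Phi> (\<lambda>W. stage_avg Om ed (\<nu> W) qs G W)"
    by (intro averaging_mono[OF assms(1)] stage_avg_mono assms(2)) auto
qed (simp_all add: stage_avg_add averaging_add[OF assms(1)] stage_avg_scale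
       averaging_scale[OF assms(1)] stage_avg_one averaging_const[OF assms(1)])

text \<open>The set \<open>C\<close> is empty for the total weight of an index and a single vertex for the weight
  of the edges through that vertex.\<close>

lemma edge_weight_second_moment:
  fixes c :: "'i \<Rightarrow> real" and e :: "'i \<Rightarrow> 'v set" and r :: nat
  assumes av: "averaging V \<Phi>" and finV: "finite V" and finJ: "finite J"
    and c: "\<And>i. i \<in> J \<Longrightarrow> c i \<ge> 0"
    and e: "\<And>i. i \<in> J \<Longrightarrow> e i \<subseteq> V \<and> card (e i) \<le> r \<and> C \<subseteq> e i"
    and CV: "C \<subseteq> V" "card C \<le> r"
    and \<beta>: "0 < \<beta>" "\<beta> \<le> 1"
    and prob: "\<And>f. f \<subseteq> V \<Longrightarrow> card f \<le> 2 * r \<Longrightarrow> \<bar>\<Phi> (\<lambda>W. of_bool (f \<subseteq> W)) - \<beta> ^ card f\<bar> \<le> E"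
    and E: "E \<ge> 0"
    and S: "(\<Sum>i\<in>J. \<Sum>j\<in>J. c i * c j * of_bool (e i \<inter> e j \<noteq> C)) \<le> S"
  defines "b \<equiv> 1 / \<beta>" and "m \<equiv> (\<Sum>i\<in>J. c i)"
  shows "\<Phi> (\<lambda>W. of_bool (C \<subseteq> W) * ((\<Sum>i\<in>J. c i * b ^ card (e i) * of_bool (e i \<subseteq> W)) - m * b ^ card C)\<^sup>2)
           \<le> S * b ^ r + 4 * m\<^sup>2 * b ^ (2 * r) * E"
proof -
  define k where "k = card C"
  define g where "g = m * b ^ k"
  define Z where "Z = (\<lambda>W. \<Sum>i\<in>J. c i * b ^ card (e i) * of_bool (e i \<subseteq> W))"
  have b1: "b \<ge> 1" using \<beta> by (simp add: b_def)
  have bb: "b ^ n * \<beta> ^ n = 1" for n using \<beta> by (simp add: b_def power_mult_distrib[symmetric])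
  have bpow: "b ^ i \<le> b ^ j" if "i \<le> j" for i j using b1 that by (simp add: power_increasing)
  have m0: "m \<ge> 0" unfolding m_def using c by (simp add: sum_nonneg)
  have pt: "of_bool (C \<subseteq> W) * (Z W - g)\<^sup>2 = (Z W)\<^sup>2 - 2 * g * Z W + g\<^sup>2 * of_bool (C \<subseteq> W)" for W
  proof (cases "C \<subseteq> W")
    case False
    hence "Z W = 0" unfolding Z_def using e by (intro sum.neutral) fastforce
    thus ?thesis using False by simp
  qed (simp add: power2_diff)
  have P: "\<Phi> (\<lambda>W. of_bool (f \<subseteq> W)) \<le> \<beta> ^ card f + E" "\<Phi> (\<lambda>W. of_bool (f \<subseteq> W)) \<ge> \<beta> ^ card f - E"
    if "f \<subseteq> V" "card f \<le> 2 * r" for f using prob[OF that] by auto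
  have Z1: "\<Phi> Z \<ge> m - m * b ^ r * E"
  proof -
    have "\<Phi> Z = (\<Sum>i\<in>J. c i * b ^ card (e i) * \<Phi> (\<lambda>W. of_bool (e i \<subseteq> W)))"
      unfolding Z_def by (simp add: averaging_sum[OF av finJ] averaging_scale[OF av])
    also have "\<dots> \<ge> (\<Sum>i\<in>J. c i * (1 - b ^ r * E))"
    proof (rule sum_mono)
      fix i assume i: "i \<in> J"
      have "1 - b ^ r * E \<le> b ^ card (e i) * \<beta> ^ card (e i) - b ^ card (e i) * E"
        using bpow[of "card (e i)" r] e[OF i] E by (simp add: bb mult_right_mono)
      also have "\<dots> = b ^ card (e i) * (\<beta> ^ card (e i) - E)" by (simp add: algebra_simps)
      also have "\<dots> \<le> b ^ card (e i) * \<Phi> (\<lambda>W. of_bool (e i \<subseteq> W))"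
        using e[OF i] b1 by (intro mult_left_mono P) auto
      finally show "c i * (1 - b ^ r * E) \<le> c i * b ^ card (e i) * \<Phi> (\<lambda>W. of_bool (e i \<subseteq> W))"
        using c[OF i] by (simp add: mult.assoc mult_left_mono)
    qed
    finally have "(\<Sum>i\<in>J. c i * (1 - b ^ r * E)) \<le> \<Phi> Z" .
    also have "(\<Sum>i\<in>J. c i * (1 - b ^ r * E)) = m * (1 - b ^ r * E)"
      unfolding m_def by (rule sum_distrib_right[symmetric])
    finally show ?thesis by (simp add: right_diff_distrib mult.assoc)
  qed
  \<comment> \<open>A pair with \<open>e i \<inter> e j = C\<close> contributes its weight times
    \<open>b ^ k\<close>. These terms total at most \<open>m\<^sup>2 * b ^ k\<close>, which cancels
    later against the cross term and the square of the mean; all other pairs are charged to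
    \<open>S\<close> with the crude factor \<open>b ^ r\<close>.\<close>
  have Z2: "\<Phi> (\<lambda>W. (Z W)\<^sup>2) \<le> m\<^sup>2 * b ^ k + S * b ^ r + m\<^sup>2 * b ^ (2 * r) * E"
  proof -
    have "(Z W)\<^sup>2 = (\<Sum>i\<in>J. \<Sum>j\<in>J. c i * c j * b ^ (card (e i) + card (e j)) * of_bool (e i \<union> e j \<subseteq> W))" for W
      unfolding Z_def power2_eq_square sum_product
      by (intro sum.cong refl) (auto simp: power_add of_bool_def)
    hence "\<Phi> (\<lambda>W. (Z W)\<^sup>2) = (\<Sum>i\<in>J. \<Sum>j\<in>J. c i * c j * b ^ (card (e i) + card (e j)) * \<Phi> (\<lambda>W. of_bool (e i \<union> e j \<subseteq> W)))"
      by (simp add: averaging_sum[OF av finJ] averaging_scale[OF av] del: Un_subset_iff)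
    also have "\<dots> \<le> (\<Sum>i\<in>J. \<Sum>j\<in>J. c i * c j * (b ^ k + b ^ (2 * r) * E) + c i * c j * of_bool (e i \<inter> e j \<noteq> C) * b ^ r)"
    proof (intro sum_mono)
      fix i j assume i: "i \<in> J" and j: "j \<in> J"
      let ?n = "card (e i) + card (e j)"
      have fin: "finite (e i)" "finite (e j)" using e[OF i] e[OF j] finV by (auto intro: finite_subset)
      have cd: "?n = card (e i \<union> e j) + card (e i \<inter> e j)" using card_Un_Int[OF fin] by simp
      have ncd: "card (e i \<union> e j) \<le> 2 * r" "?n \<le> 2 * r" using cd e[OF i] e[OF j] by linarith+
      have "b ^ ?n * \<Phi> (\<lambda>W. of_bool (e i \<union> e j \<subseteq> W)) \<le> b ^ ?n * (\<beta> ^ card (e i \<union> e j) + E)"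
        using e[OF i] e[OF j] b1 ncd by (intro mult_left_mono P) auto
      also have "\<dots> = b ^ card (e i \<inter> e j) * (b ^ card (e i \<union> e j) * \<beta> ^ card (e i \<union> e j)) + b ^ ?n * E"
        by (simp add: cd power_add algebra_simps)
      also have "\<dots> = b ^ card (e i \<inter> e j) + b ^ ?n * E" by (simp add: bb)
      also have "\<dots> \<le> (b ^ k + of_bool (e i \<inter> e j \<noteq> C) * b ^ r) + b ^ (2 * r) * E"
      proof (intro add_mono mult_right_mono E bpow ncd)
        have "card (e i \<inter> e j) \<le> r" using e[OF i] fin card_mono[of "e i" "e i \<inter> e j"] by force
        thus "b ^ card (e i \<inter> e j) \<le> b ^ k + of_bool (e i \<inter> e j \<noteq> C) * b ^ r"
          using bpow[of "card (e i \<inter> e j)" r] b1 by (auto simp: k_def of_bool_def add_increasing)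
      qed
      finally have "c i * c j * (b ^ ?n * \<Phi> (\<lambda>W. of_bool (e i \<union> e j \<subseteq> W)))
          \<le> c i * c j * ((b ^ k + of_bool (e i \<inter> e j \<noteq> C) * b ^ r) + b ^ (2 * r) * E)"
        using c[OF i] c[OF j] by (intro mult_left_mono) auto
      thus "c i * c j * b ^ ?n * \<Phi> (\<lambda>W. of_bool (e i \<union> e j \<subseteq> W))
          \<le> c i * c j * (b ^ k + b ^ (2 * r) * E) + c i * c j * of_bool (e i \<inter> e j \<noteq> C) * b ^ r"
        by (simp add: algebra_simps)
    qed
    also have "\<dots> = m\<^sup>2 * (b ^ k + b ^ (2 * r) * E) + (\<Sum>i\<in>J. \<Sum>j\<in>J. c i * c j * of_bool (e i \<inter> e j \<noteq> C)) * b ^ r"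
      by (simp only: sum.distrib sum_distrib_right[symmetric] power2_eq_square m_def sum_product)
    also have "\<dots> \<le> m\<^sup>2 * (b ^ k + b ^ (2 * r) * E) + S * b ^ r"
      using S b1 by (intro add_left_mono mult_right_mono) auto
    finally show ?thesis by (simp add: algebra_simps)
  qed
  have PC: "\<Phi> (\<lambda>W. of_bool (C \<subseteq> W)) \<le> \<beta> ^ k + E" unfolding k_def using CV by (intro P) auto
  have kr: "k \<le> r" using CV by (simp add: k_def)
  have g0: "g \<ge> 0" using m0 b1 by (simp add: g_def)
  have "\<Phi> (\<lambda>W. of_bool (C \<subseteq> W) * (Z W - g)\<^sup>2) = \<Phi> (\<lambda>W. (Z W)\<^sup>2) - 2 * g * \<Phi> Z + g\<^sup>2 * \<Phi> (\<lambda>W. of_bool (C \<subseteq> W))"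
    unfolding pt averaging_add[OF av] averaging_diff[OF av] averaging_scale[OF av] ..
  also have "\<dots> \<le> (m\<^sup>2 * b ^ k + S * b ^ r + m\<^sup>2 * b ^ (2 * r) * E) - 2 * g * (m - m * b ^ r * E) + g\<^sup>2 * (\<beta> ^ k + E)"
    by (intro add_mono diff_mono Z2 mult_left_mono Z1 PC) (use g0 in simp_all)
  also have "\<dots> = S * b ^ r + m\<^sup>2 * E * (b ^ (2 * r) + 2 * b ^ (k + r) + b ^ (2 * k))"
  proof -
    have "g\<^sup>2 * \<beta> ^ k = m\<^sup>2 * b ^ k * (b ^ k * \<beta> ^ k)"
      by (simp add: g_def power2_eq_square)
    hence "g\<^sup>2 * (\<beta> ^ k + E) = m\<^sup>2 * b ^ k + m\<^sup>2 * (b ^ k * b ^ k) * E"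
      by (simp add: bb distrib_left) (simp add: g_def power2_eq_square)
    moreover have "b ^ (2 * r) = b ^ r * b ^ r" "b ^ (k + r) = b ^ k * b ^ r" "b ^ (2 * k) = b ^ k * b ^ k"
      by (simp_all add: power_add mult_2)
    moreover have "2 * g * (m - m * b ^ r * E) = 2 * m\<^sup>2 * b ^ k - 2 * m\<^sup>2 * (b ^ k * b ^ r) * E"
      by (simp add: g_def power2_eq_square right_diff_distrib)
    ultimately show ?thesis by (simp add: distrib_left mult.assoc mult.left_commute)
  qed
  also have "\<dots> \<le> S * b ^ r + m\<^sup>2 * E * (b ^ (2 * r) + 2 * b ^ (2 * r) + b ^ (2 * r))"
    using E kr by (intro add_left_mono mult_left_mono add_mono bpow) auto
  also have "\<dots> = S * b ^ r + 4 * m\<^sup>2 * b ^ (2 * r) * E" by simp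
  finally show ?thesis unfolding Z_def g_def k_def .
qed

text \<open>An inverse probability estimate of the total mass of \<open>\<mu>\<close>: if each edge
  survives with probability \<open>\<beta> ^ card e\<close> and b = 1 / \<beta>, its mean is the sum
  of \<open>\<mu>\<close>.\<close>

definition edge_avg_weight ::
  "'o set \<Rightarrow> ('o \<Rightarrow> real) \<Rightarrow> ('o \<Rightarrow> 'v set) \<Rightarrow> real \<Rightarrow> 'v set \<Rightarrow> real" where
  "edge_avg_weight S \<mu> ed b W = (\<Sum>\<omega>\<in>S. \<mu> \<omega> * b ^ card (ed \<omega>) * of_bool (ed \<omega> \<subseteq> W))"

text \<open>The conditional law used by the nibble: an edge is kept only if it still lies in the current
  set \<open>W\<close>, reweighted by the inverse of the probability \<open>\<beta> ^ card e\<close> of this event, and an index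
  whose total weight exceeds \<open>1 + t\<close> is skipped.\<close>

definition nibble_law ::
  "('q \<Rightarrow> 'o set) \<Rightarrow> ('q \<Rightarrow> 'o \<Rightarrow> real) \<Rightarrow> ('q \<Rightarrow> 'o \<Rightarrow> 'v set) \<Rightarrow> real \<Rightarrow> real \<Rightarrow> 'v set \<Rightarrow> 'q \<Rightarrow> 'o \<Rightarrow> real"
  where
  "nibble_law Om \<mu> ed t b W q \<omega> =
     (if edge_avg_weight (Om q) (\<mu> q) (ed q) b W \<le> 1 + t
      then \<mu> q \<omega> * b ^ card (ed q \<omega>) * of_bool (ed q \<omega> \<subseteq> W) / (1 + t) else 0)"

lemma subprob_nibble_law:
  assumes "finite (Om q)" "\<And>\<omega>. \<omega> \<in> Om q \<Longrightarrow> \<mu> q \<omega> \<ge> 0" "b \<ge> 0" "t > 0"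
  shows "subprob (Om q) (nibble_law Om \<mu> ed t b W q)"
proof (cases "edge_avg_weight (Om q) (\<mu> q) (ed q) b W \<le> 1 + t")
  case True
  hence "(\<Sum>\<omega>\<in>Om q. nibble_law Om \<mu> ed t b W q \<omega>) = edge_avg_weight (Om q) (\<mu> q) (ed q) b W / (1 + t)"
    by (simp add: nibble_law_def edge_avg_weight_def sum_divide_distrib)
  thus ?thesis using assms True by (auto simp: subprob_def nibble_law_def)
qed (use assms in \<open>auto simp: subprob_def nibble_law_def\<close>)

section \<open>Incidence counts, and products compared with exponentials\<close>

lemma sum_of_bool_mem:
  assumes "finite A"
  shows "(\<Sum>v\<in>A. of_bool (v \<in> B)) = (of_nat (card (A \<inter> B)) :: real)"
  using assms by (simp add: of_bool_def sum.If_cases Int_def)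

lemma hit_le_sum:
  assumes "finite A"
  shows "(of_bool (A \<inter> B \<noteq> {}) :: real) \<le> (\<Sum>v\<in>A. of_bool (v \<in> B))"
proof (cases "A \<inter> B = {}")
  case False
  hence "card (A \<inter> B) \<ge> 1" using assms by (simp add: Suc_le_eq card_gt_0_iff)
  thus ?thesis by (simp add: sum_of_bool_mem[OF assms])
qed (simp add: sum_nonneg)

text \<open>With k > 0 common points the left side is k - 1 and the right side k (k - 1). The excess
  of the union bound is thus charged to pairs of vertices, which codegrees control.\<close>

lemma sum_minus_hit_le:
  assumes "finite A"
  shows "(\<Sum>v\<in>A. of_bool (v \<in> B)) - (of_bool (A \<inter> B \<noteq> {}) :: real)
           \<le> (\<Sum>u\<in>A. \<Sum>v\<in>A - {u}. of_bool (u \<in> B \<and> v \<in> B))"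
proof (cases "A \<inter> B = {}")
  case False
  define k where "k = card (A \<inter> B)"
  have k1: "k \<ge> 1" using False assms by (simp add: k_def Suc_le_eq card_gt_0_iff)
  have inner: "(\<Sum>v\<in>A - {u}. of_bool (u \<in> B \<and> v \<in> B)) = (of_bool (u \<in> B) * (real k - 1) :: real)" if "u \<in> A" for u
  proof (cases "u \<in> B")
    case True
    have "(\<Sum>v\<in>A - {u}. of_bool (u \<in> B \<and> v \<in> B)) = real (card ((A - {u}) \<inter> B))"
      using True sum_of_bool_mem[of "A - {u}" B] assms by simp
    also have "(A - {u}) \<inter> B = (A \<inter> B) - {u}" by auto
    also have "card \<dots> = k - 1" using True that assms by (simp add: k_def)
    finally show ?thesis using True k1 by (simp add: of_nat_diff)
  qed simp
  have "(\<Sum>u\<in>A. \<Sum>v\<in>A - {u}. of_bool (u \<in> B \<and> v \<in> B)) = (\<Sum>u\<in>A. of_bool (u \<in> B) * (real k - 1))"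
    by (intro sum.cong refl inner)
  also have "\<dots> = real k * (real k - 1)"
    using sum_of_bool_mem[OF assms, of B] by (simp only: sum_distrib_right[symmetric] k_def)
  also have "\<dots> \<ge> real k - 1" using k1 by (simp add: mult_le_cancel_right1)
  finally show ?thesis using False by (simp add: sum_of_bool_mem[OF assms] k_def)
next
  case True
  hence "(\<Sum>v\<in>A. of_bool (v \<in> B)) = (0 :: real)" by (simp add: sum_of_bool_mem[OF assms])
  thus ?thesis using True by (simp add: sum_nonneg)
qed

text \<open>Each factor differs from its exponential by at most the square of \<open>x q\<close>,
  and since all factors lie in [0, 1] the differences simply add up.\<close>

lemma abs_prod_one_minus_exp:
  fixes x :: "'a \<Rightarrow> real"
  assumes "finite Q" "\<And>q. q \<in> Q \<Longrightarrow> 0 \<le> x q \<and> x q \<le> 1"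
  shows "\<bar>(\<Prod>q\<in>Q. 1 - x q) - exp (- (\<Sum>q\<in>Q. x q))\<bar> \<le> (\<Sum>q\<in>Q. (x q)\<^sup>2)"
proof -
  have e: "exp (- (\<Sum>q\<in>Q. x q)) = (\<Prod>q\<in>Q. exp (- x q))"
    using assms(1) by (simp add: exp_sum sum_negf[symmetric] del: sum_negf)
  have "norm ((\<Prod>q\<in>Q. 1 - x q) - (\<Prod>q\<in>Q. exp (- x q))) \<le> (\<Sum>q\<in>Q. norm ((1 - x q) - exp (- x q)))"
    using assms by (intro norm_prod_diff) auto
  also have "\<dots> \<le> (\<Sum>q\<in>Q. (x q)\<^sup>2)"
  proof (rule sum_mono)
    fix q assume q: "q \<in> Q"
    have x: "0 \<le> x q" "x q \<le> 1" using assms(2)[OF q] by auto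
    have l: "1 - x q \<le> exp (- x q)" using exp_ge_add_one_self[of "- x q"] by simp
    have "1 + x q \<le> exp (x q)" by (rule exp_ge_add_one_self)
    hence "exp (- x q) \<le> 1 / (1 + x q)"
      using x by (simp add: exp_minus field_simps)
    also have "\<dots> \<le> 1 - x q + (x q)\<^sup>2"
    proof -
      have "(1 - x q + (x q)\<^sup>2) * (1 + x q) = 1 + x q ^ 3" by (simp add: algebra_simps power2_eq_square power3_eq_cube)
      thus ?thesis using x by (simp add: divide_le_eq)
    qed
    finally show "norm ((1 - x q) - exp (- x q)) \<le> (x q)\<^sup>2" using l by simp
  qed
  finally show ?thesis by (simp add: e)
qed

lemma abs_exp_minus_diff:
  fixes x y :: real assumes "x \<ge> 0" "y \<ge> 0"
  shows "\<bar>exp (- x) - exp (- y)\<bar> \<le> \<bar>x - y\<bar>"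
proof -
  have *: "exp (- x) - exp (- y) \<le> y - x" if "0 \<le> x" "x \<le> y" for x y :: real
  proof -
    have le: "1 - exp (- (y - x)) \<le> y - x" using exp_ge_add_one_self[of "- (y - x)"] by linarith
    have "exp (- x) - exp (- y) = exp (- x) * (1 - exp (- (y - x)))" by (simp add: algebra_simps exp_add[symmetric])
    also have "\<dots> \<le> 1 * (y - x)"
      using that by (intro mult_mono le) auto
    finally show ?thesis by simp
  qed
  show ?thesis
  proof (cases "x \<le> y")
    case True
    thus ?thesis using *[of x y] assms by (simp add: abs_if)
  next
    case False
    thus ?thesis using *[of y x] assms by (simp add: abs_if)
  qed
qed

section \<open>One stage of the nibble on a regular weighted hypergraph\<close>

locale nibble_stage =
  fixes V :: "'v set" and qs :: "'q list" and Om :: "'q \<Rightarrow> 'o set"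
    and \<mu> :: "'q \<Rightarrow> 'o \<Rightarrow> real" and ed :: "'q \<Rightarrow> 'o \<Rightarrow> 'v set"
    and r :: nat and \<eta> D :: real
  assumes finV: "finite V" and dist: "distinct qs"
    and prob: "\<And>q. q \<in> set qs \<Longrightarrow> subprob (Om q) (\<mu> q)"
    and edge: "\<And>q \<omega>. q \<in> set qs \<Longrightarrow> \<omega> \<in> Om q \<Longrightarrow> ed q \<omega> \<subseteq> V \<and> card (ed q \<omega>) \<le> r"
    and small: "\<And>q v. q \<in> set qs \<Longrightarrow> v \<in> V \<Longrightarrow> (\<Sum>\<omega>\<in>Om q. \<mu> q \<omega> * of_bool (v \<in> ed q \<omega>)) \<le> \<eta>"
    and codeg: "\<And>u v. u \<in> V \<Longrightarrow> v \<in> V \<Longrightarrow> u \<noteq> v \<Longrightarrow>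
      (\<Sum>q\<in>set qs. \<Sum>\<omega>\<in>Om q. \<mu> q \<omega> * of_bool (u \<in> ed q \<omega> \<and> v \<in> ed q \<omega>)) \<le> \<eta>"
    and deg: "\<And>v. v \<in> V \<Longrightarrow> (\<Sum>q\<in>set qs. \<Sum>\<omega>\<in>Om q. \<mu> q \<omega> * of_bool (v \<in> ed q \<omega>)) = D"
    and r1: "r \<ge> 1" and \<eta>: "\<eta> > 0"
begin

lemma mu_nonneg: "q \<in> set qs \<Longrightarrow> \<omega> \<in> Om q \<Longrightarrow> \<mu> q \<omega> \<ge> 0"
  and fin_Om: "q \<in> set qs \<Longrightarrow> finite (Om q)"
  and mu_sum: "q \<in> set qs \<Longrightarrow> sum (\<mu> q) (Om q) \<le> 1"
  using prob unfolding subprob_def by auto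

lemma fin_edge: "q \<in> set qs \<Longrightarrow> \<omega> \<in> Om q \<Longrightarrow> finite (ed q \<omega>)"
  using edge finV finite_subset by blast

text \<open>The second moment bound with empty \<open>C\<close>. Two edges of the same index seldom
  meet, since each of the at most \<open>r\<close> vertices of the one carries weight at most
  \<open>\<eta>\<close> in this index.\<close>

lemma index_weight_variance:
  assumes av: "averaging V \<Phi>" and \<beta>: "0 < \<beta>" "\<beta> \<le> 1" and q: "q \<in> set qs"
    and P: "\<And>f. f \<subseteq> V \<Longrightarrow> card f \<le> 2 * r \<Longrightarrow> \<bar>\<Phi> (\<lambda>W. of_bool (f \<subseteq> W)) - \<beta> ^ card f\<bar> \<le> E"
    and E: "\<eta> \<le> E"
  shows "\<Phi> (\<lambda>W. (edge_avg_weight (Om q) (\<mu> q) (ed q) (1 / \<beta>) W - sum (\<mu> q) (Om q))\<^sup>2)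
           \<le> 5 * r * (1 / \<beta>) ^ (2 * r) * E"
proof -
  have S: "(\<Sum>i\<in>Om q. \<Sum>j\<in>Om q. \<mu> q i * \<mu> q j * of_bool (ed q i \<inter> ed q j \<noteq> {})) \<le> r * \<eta>"
  proof -
    have "(\<Sum>i\<in>Om q. \<Sum>j\<in>Om q. \<mu> q i * \<mu> q j * of_bool (ed q i \<inter> ed q j \<noteq> {})) \<le> (\<Sum>i\<in>Om q. \<mu> q i * (r * \<eta>))"
    proof (rule sum_mono)
      fix i assume i: "i \<in> Om q"
      have "(\<Sum>j\<in>Om q. \<mu> q j * of_bool (ed q i \<inter> ed q j \<noteq> {})) \<le> (\<Sum>j\<in>Om q. \<mu> q j * (\<Sum>v\<in>ed q i. of_bool (v \<in> ed q j)))"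
        by (intro sum_mono mult_left_mono hit_le_sum fin_edge[OF q i] mu_nonneg[OF q])
      also have "\<dots> = (\<Sum>v\<in>ed q i. \<Sum>j\<in>Om q. \<mu> q j * of_bool (v \<in> ed q j))"
        by (simp only: sum_distrib_left) (rule sum.swap)
      also have "\<dots> \<le> (\<Sum>v\<in>ed q i. \<eta>)"
        using edge[OF q i] by (intro sum_mono small[OF q]) auto
      also have "\<dots> \<le> r * \<eta>" using edge[OF q i] \<eta> by (simp add: mult_right_mono)
      finally have "\<mu> q i * (\<Sum>j\<in>Om q. \<mu> q j * of_bool (ed q i \<inter> ed q j \<noteq> {})) \<le> \<mu> q i * (r * \<eta>)"
        using mu_nonneg[OF q i] by (rule mult_left_mono)
      thus "(\<Sum>j\<in>Om q. \<mu> q i * \<mu> q j * of_bool (ed q i \<inter> ed q j \<noteq> {})) \<le> \<mu> q i * (r * \<eta>)"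
        by (simp only: sum_distrib_left mult.assoc)
    qed
    also have "\<dots> = sum (\<mu> q) (Om q) * (r * \<eta>)" by (simp only: sum_distrib_right)
    also have "\<dots> \<le> 1 * (r * \<eta>)" using mu_sum[OF q] \<eta> by (intro mult_right_mono) auto
    finally show ?thesis by simp
  qed
  have b1: "1 / \<beta> \<ge> 1" using \<beta> by simp
  have E0: "E \<ge> 0" using E \<eta> by simp
  have "\<Phi> (\<lambda>W. of_bool ({} \<subseteq> W) * ((\<Sum>i\<in>Om q. \<mu> q i * (1 / \<beta>) ^ card (ed q i) * of_bool (ed q i \<subseteq> W)) - sum (\<mu> q) (Om q) * (1 / \<beta>) ^ card ({} :: 'v set))\<^sup>2)
      \<le> r * \<eta> * (1 / \<beta>) ^ r + 4 * (sum (\<mu> q) (Om q))\<^sup>2 * (1 / \<beta>) ^ (2 * r) * E"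
    using edge[OF q] fin_Om[OF q] mu_nonneg[OF q] P S \<beta> E0
    by (intro edge_weight_second_moment[OF av finV]) auto
  also have "\<dots> \<le> r * E * (1 / \<beta>) ^ (2 * r) + 4 * 1 * (1 / \<beta>) ^ (2 * r) * E"
  proof (intro add_mono mult_mono)
    show "(1 / \<beta>) ^ r \<le> (1 / \<beta>) ^ (2 * r)" using b1 by (intro power_increasing) auto
    show "(sum (\<mu> q) (Om q))\<^sup>2 \<le> 1"
      using mu_sum[OF q] mu_nonneg[OF q] by (simp add: power_le_one sum_nonneg)
  qed (use E0 E \<eta> \<beta> in auto)
  also have "\<dots> \<le> r * E * (1 / \<beta>) ^ (2 * r) + 4 * r * (1 / \<beta>) ^ (2 * r) * E"
    using r1 E0 \<beta> by (intro add_left_mono mult_right_mono) auto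
  finally show ?thesis by (simp add: edge_avg_weight_def algebra_simps)
qed

definition vertex_weight :: "real \<Rightarrow> 'v \<Rightarrow> 'v set \<Rightarrow> real" where
  "vertex_weight b v W = (\<Sum>q\<in>set qs. \<Sum>\<omega>\<in>Om q.
     \<mu> q \<omega> * b ^ card (ed q \<omega>) * of_bool (ed q \<omega> \<subseteq> W) * of_bool (v \<in> ed q \<omega>))"

text \<open>The second moment bound with \<open>C\<close> = {v}. Edges through \<open>v\<close>
  sharing a further vertex \<open>u\<close> are counted by the codegree of \<open>u\<close> and
  \<open>v\<close>. Here \<open>D\<close> is the degree in the full set \<open>V\<close>; surviving
  edges are inflated so that the weight at a surviving vertex stays centred at
  \<open>D / \<beta>\<close>.\<close>

lemma vertex_weight_variance:
  assumes av: "averaging V \<Phi>" and \<beta>: "0 < \<beta>" "\<beta> \<le> 1" and v: "v \<in> V"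
    and P: "\<And>f. f \<subseteq> V \<Longrightarrow> card f \<le> 2 * r \<Longrightarrow> \<bar>\<Phi> (\<lambda>W. of_bool (f \<subseteq> W)) - \<beta> ^ card f\<bar> \<le> E"
    and E: "\<eta> \<le> E" and D: "0 \<le> D" "D \<le> 1"
  shows "\<Phi> (\<lambda>W. of_bool (v \<in> W) * (vertex_weight (1 / \<beta>) v W - D / \<beta>)\<^sup>2)
           \<le> 5 * r * (1 / \<beta>) ^ (2 * r) * E"
proof -
  define A where "A = Sigma (set qs) Om"
  define J where "J = {i \<in> A. v \<in> ed (fst i) (snd i)}"
  define c where "c = (\<lambda>i. \<mu> (fst i) (snd i))"
  define e where "e = (\<lambda>i. ed (fst i) (snd i))"
  have finA: "finite A" using fin_Om by (auto simp: A_def)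
  hence finJ: "finite J" by (simp add: J_def)
  have sumJ: "(\<Sum>i\<in>J. f (fst i) (snd i)) = (\<Sum>q\<in>set qs. \<Sum>\<omega>\<in>Om q. f q \<omega> * of_bool (v \<in> ed q \<omega>))"
    for f :: "'q \<Rightarrow> 'o \<Rightarrow> real"
  proof -
    have "(\<Sum>i\<in>J. f (fst i) (snd i)) = (\<Sum>i\<in>A. f (fst i) (snd i) * of_bool (v \<in> ed (fst i) (snd i)))"
      unfolding J_def by (rule sum.mono_neutral_cong_left[OF finA]) auto
    also have "\<dots> = (\<Sum>q\<in>set qs. \<Sum>\<omega>\<in>Om q. f q \<omega> * of_bool (v \<in> ed q \<omega>))"
      unfolding A_def
      by (subst sum.Sigma, simp, simp add: fin_Om, rule sum.cong[OF refl], simp add: case_prod_beta)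
    finally show ?thesis .
  qed
  have JD: "q \<in> set qs" "\<omega> \<in> Om q" "v \<in> ed q \<omega>" if "(q, \<omega>) \<in> J" for q \<omega>
    using that by (auto simp: J_def A_def)
  have c0: "c i \<ge> 0" if "i \<in> J" for i using that JD mu_nonneg by (cases i) (auto simp: c_def)
  have ei: "e i \<subseteq> V \<and> card (e i) \<le> r \<and> {v} \<subseteq> e i" if "i \<in> J" for i
    using that JD edge by (cases i) (force simp: e_def)
  have m: "(\<Sum>i\<in>J. c i) = D" unfolding c_def sumJ using deg[OF v] by simp
  have S: "(\<Sum>i\<in>J. \<Sum>j\<in>J. c i * c j * of_bool (e i \<inter> e j \<noteq> {v})) \<le> D * (r * \<eta>)"
  proof -
    have "(\<Sum>i\<in>J. \<Sum>j\<in>J. c i * c j * of_bool (e i \<inter> e j \<noteq> {v})) \<le> (\<Sum>i\<in>J. c i * (r * \<eta>))"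
    proof (rule sum_mono)
      fix i assume i: "i \<in> J"
      have fi: "finite (e i)" using ei[OF i] finV finite_subset by blast
      have "(\<Sum>j\<in>J. c j * of_bool (e i \<inter> e j \<noteq> {v})) \<le> (\<Sum>j\<in>J. c j * (\<Sum>u\<in>e i - {v}. of_bool (u \<in> e j)))"
      proof (intro sum_mono mult_left_mono c0)
        fix j assume j: "j \<in> J"
        have "(of_bool (e i \<inter> e j \<noteq> {v}) :: real) = of_bool ((e i - {v}) \<inter> e j \<noteq> {})"
          using ei[OF i] ei[OF j] by (auto simp: of_bool_def)
        also have "\<dots> \<le> (\<Sum>u\<in>e i - {v}. of_bool (u \<in> e j))"
          by (rule hit_le_sum) (use fi in simp)
        finally show "(of_bool (e i \<inter> e j \<noteq> {v}) :: real) \<le> (\<Sum>u\<in>e i - {v}. of_bool (u \<in> e j))" .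
      qed
      also have "\<dots> = (\<Sum>u\<in>e i - {v}. \<Sum>j\<in>J. c j * of_bool (u \<in> e j))"
        by (simp only: sum_distrib_left) (rule sum.swap)
      also have "\<dots> \<le> (\<Sum>u\<in>e i - {v}. \<eta>)"
      proof (rule sum_mono)
        fix u assume u: "u \<in> e i - {v}"
        have "(\<Sum>j\<in>J. c j * of_bool (u \<in> e j)) =
          (\<Sum>q\<in>set qs. \<Sum>\<omega>\<in>Om q. \<mu> q \<omega> * of_bool (u \<in> ed q \<omega>) * of_bool (v \<in> ed q \<omega>))"
          unfolding c_def e_def by (rule sumJ)
        also have "\<dots> = (\<Sum>q\<in>set qs. \<Sum>\<omega>\<in>Om q. \<mu> q \<omega> * of_bool (u \<in> ed q \<omega> \<and> v \<in> ed q \<omega>))"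
          by (intro sum.cong refl) (auto simp: of_bool_def)
        also have "\<dots> \<le> \<eta>" using u ei[OF i] v by (intro codeg) auto
        finally show "(\<Sum>j\<in>J. c j * of_bool (u \<in> e j)) \<le> \<eta>" .
      qed
      also have "\<dots> = card (e i - {v}) * \<eta>" by simp
      also have "\<dots> \<le> r * \<eta>"
      proof (intro mult_right_mono)
        have "card (e i - {v}) \<le> card (e i)" using fi by (intro card_mono) auto
        thus "real (card (e i - {v})) \<le> real r" using ei[OF i] by linarith
      qed (use \<eta> in simp)
      finally have "c i * (\<Sum>j\<in>J. c j * of_bool (e i \<inter> e j \<noteq> {v})) \<le> c i * (r * \<eta>)"
        using c0[OF i] by (rule mult_left_mono)
      thus "(\<Sum>j\<in>J. c i * c j * of_bool (e i \<inter> e j \<noteq> {v})) \<le> c i * (r * \<eta>)"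
        by (simp only: sum_distrib_left mult.assoc)
    qed
    also have "\<dots> = D * (r * \<eta>)" by (simp only: m sum_distrib_right[symmetric])
    finally show ?thesis .
  qed
  have b1: "1 / \<beta> \<ge> 1" using \<beta> by simp
  have E0: "E \<ge> 0" using E \<eta> by simp
  have vw: "vertex_weight (1 / \<beta>) v W = (\<Sum>i\<in>J. c i * (1 / \<beta>) ^ card (e i) * of_bool (e i \<subseteq> W))" for W
    unfolding vertex_weight_def c_def e_def by (rule sumJ[symmetric])
  have "\<Phi> (\<lambda>W. of_bool ({v} \<subseteq> W) * ((\<Sum>i\<in>J. c i * (1 / \<beta>) ^ card (e i) * of_bool (e i \<subseteq> W)) - sum c J * (1 / \<beta>) ^ card {v})\<^sup>2)
      \<le> D * (r * \<eta>) * (1 / \<beta>) ^ r + 4 * (sum c J)\<^sup>2 * (1 / \<beta>) ^ (2 * r) * E"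
    using ei c0 P S \<beta> E0 v r1
    by (intro edge_weight_second_moment[OF av finV finJ]) auto
  also have "\<dots> \<le> 1 * (r * E) * (1 / \<beta>) ^ (2 * r) + 4 * 1 * (1 / \<beta>) ^ (2 * r) * E"
  proof (intro add_mono mult_mono)
    show "(1 / \<beta>) ^ r \<le> (1 / \<beta>) ^ (2 * r)" using b1 by (intro power_increasing) auto
    show "(sum c J)\<^sup>2 \<le> 1" using D by (simp add: m power_le_one)
  qed (use E0 E \<eta> \<beta> D in auto)
  also have "\<dots> \<le> r * E * (1 / \<beta>) ^ (2 * r) + 4 * r * (1 / \<beta>) ^ (2 * r) * E"
    using r1 E0 \<beta> by (intro add_mono mult_right_mono) auto
  finally show ?thesis by (simp add: vw m algebra_simps)
qed

text \<open>On the event that \<open>e\<close> survives so far, the conditional probability that it survives the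
  stage differs from \<open>\<kappa> ^ - card e\<close> by the deviations of the two kinds of weights from their means.\<close>

lemma survival_deviation:
  assumes \<beta>: "0 < \<beta>" "\<beta> \<le> 1" and t: "0 < t" and \<kappa>: "\<kappa> > 1" and D: "D = (1 + t) * \<beta> * ln \<kappa>" "D \<le> 1"
    and e: "e \<subseteq> V" "e \<subseteq> W"
  defines "b \<equiv> 1 / \<beta>" and "n \<equiv> card e"
  defines "X \<equiv> \<lambda>q. edge_avg_weight (Om q) (\<mu> q) (ed q) b W"
  shows "\<bar>(\<Prod>q\<leftarrow>qs. 1 - (\<Sum>\<omega>\<in>Om q. nibble_law Om \<mu> ed t b W q \<omega> * of_bool (e \<inter> ed q \<omega> \<noteq> {}))) - (1 / \<kappa>) ^ n\<bar>
     \<le> 2 * (real n)\<^sup>2 * b ^ (2 * r) * \<eta>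
       + (\<Sum>v\<in>e. \<bar>of_bool (v \<in> W) * (vertex_weight b v W - D / \<beta>)\<bar>
            + (\<Sum>q\<in>set qs. b ^ r / t\<^sup>2 * (X q - sum (\<mu> q) (Om q))\<^sup>2 * (\<Sum>\<omega>\<in>Om q. \<mu> q \<omega> * of_bool (v \<in> ed q \<omega>))))"
proof -
  define \<nu> where "\<nu> = nibble_law Om \<mu> ed t b W"
  define x where "x = (\<lambda>q. \<Sum>\<omega>\<in>Om q. \<nu> q \<omega> * of_bool (e \<inter> ed q \<omega> \<noteq> {}))"
  define dg where "dg = (\<lambda>q v. \<Sum>\<omega>\<in>Om q. \<mu> q \<omega> * of_bool (v \<in> ed q \<omega>))"
  define L where "L = ln \<kappa>"
  have L0: "L > 0" using \<kappa> by (simp add: L_def)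
  have D0: "D > 0" unfolding D(1) using \<beta> t L0 by (simp add: L_def)
  have b1: "b \<ge> 1" using \<beta> by (simp add: b_def)
  have fine: "finite e" using e finV finite_subset by blast
  have br: "b ^ card (ed q \<omega>) \<le> b ^ r" if "q \<in> set qs" "\<omega> \<in> Om q" for q \<omega>
    using b1 edge[OF that] by (intro power_increasing) auto
  have \<nu>0: "0 \<le> \<nu> q \<omega>" if "q \<in> set qs" "\<omega> \<in> Om q" for q \<omega>
    using mu_nonneg[OF that] b1 t by (simp add: \<nu>_def nibble_law_def)
  have \<nu>1: "\<nu> q \<omega> \<le> \<mu> q \<omega> * b ^ r" if "q \<in> set qs" "\<omega> \<in> Om q" for q \<omega>
  proof -
    have "\<nu> q \<omega> \<le> \<mu> q \<omega> * b ^ card (ed q \<omega>) / (1 + t)"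
      using mu_nonneg[OF that] b1 t by (auto simp: \<nu>_def nibble_law_def of_bool_def intro!: divide_right_mono)
    also have "\<dots> \<le> \<mu> q \<omega> * b ^ card (ed q \<omega>) / 1"
      using mu_nonneg[OF that] b1 t by (intro divide_left_mono) auto
    also have "\<dots> \<le> \<mu> q \<omega> * b ^ r" using mu_nonneg[OF that] br[OF that] by (simp add: mult_left_mono)
    finally show ?thesis .
  qed
  have spnu: "subprob (Om q) (\<nu> q)" if "q \<in> set qs" for q
    unfolding \<nu>_def using that fin_Om mu_nonneg b1 t by (intro subprob_nibble_law) auto
  have x01: "0 \<le> x q \<and> x q \<le> 1" if q: "q \<in> set qs" for q
  proof
    show "0 \<le> x q" unfolding x_def using \<nu>0[OF q] by (intro sum_nonneg) auto
    have "x q \<le> sum (\<nu> q) (Om q)" unfolding x_def using \<nu>0[OF q] by (intro sum_mono) (auto simp: of_bool_def)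
    also have "\<dots> \<le> 1" using spnu[OF q] by (simp add: subprob_def)
    finally show "x q \<le> 1" .
  qed
  have xdg: "x q \<le> (\<Sum>v\<in>e. b ^ r * dg q v)" if q: "q \<in> set qs" for q
  proof -
    have "x q \<le> (\<Sum>\<omega>\<in>Om q. (\<mu> q \<omega> * b ^ r) * (\<Sum>v\<in>e. of_bool (v \<in> ed q \<omega>)))"
      unfolding x_def using \<nu>0[OF q] \<nu>1[OF q] mu_nonneg[OF q] b1
      by (intro sum_mono mult_mono hit_le_sum fine) auto
    also have "\<dots> = (\<Sum>v\<in>e. \<Sum>\<omega>\<in>Om q. (\<mu> q \<omega> * b ^ r) * of_bool (v \<in> ed q \<omega>))"
      by (simp only: sum_distrib_left) (rule sum.swap)
    also have "\<dots> = (\<Sum>v\<in>e. b ^ r * dg q v)"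
      unfolding dg_def sum_distrib_left by (intro sum.cong refl) (simp add: mult_ac)
    finally show ?thesis .
  qed
  have dg_small: "dg q v \<le> \<eta>" if "q \<in> set qs" "v \<in> e" for q v
    unfolding dg_def using small that e by blast
  have dg_sum: "(\<Sum>q\<in>set qs. dg q v) = D" if "v \<in> e" for v
    unfolding dg_def using deg that e by blast
  have dg0: "dg q v \<ge> 0" if "q \<in> set qs" for q v
    unfolding dg_def using mu_nonneg[OF that] by (intro sum_nonneg) auto
  have xsmall: "x q \<le> n * (b ^ r * \<eta>)" if q: "q \<in> set qs" for q
  proof -
    have "x q \<le> (\<Sum>v\<in>e. b ^ r * \<eta>)"
      using xdg[OF q] dg_small[OF q] b1 by (meson order.trans sum_mono mult_left_mono zero_le_power zero_le_one)
    thus ?thesis by (simp add: n_def)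
  qed
  have xsum: "(\<Sum>q\<in>set qs. x q) \<le> n * b ^ r"
  proof -
    have "(\<Sum>q\<in>set qs. x q) \<le> (\<Sum>q\<in>set qs. \<Sum>v\<in>e. b ^ r * dg q v)" by (intro sum_mono xdg)
    also have "\<dots> = (\<Sum>v\<in>e. b ^ r * (\<Sum>q\<in>set qs. dg q v))"
      by (simp only: sum_distrib_left) (rule sum.swap)
    also have "\<dots> = (\<Sum>v\<in>e. b ^ r * D)" using dg_sum by simp
    also have "\<dots> \<le> n * b ^ r" using D(2) b1 by (simp add: n_def mult_left_mono mult_left_le)
    finally show ?thesis .
  qed
  \<comment> \<open>Each \<open>x q\<close> is of order \<open>\<eta>\<close> while their sum is
    bounded, so the squares add up to order \<open>\<eta>\<close>, apart from powers of
    \<open>b\<close> and \<open>n\<close>.\<close>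
  have sq: "(\<Sum>q\<in>set qs. (x q)\<^sup>2) \<le> (real n)\<^sup>2 * b ^ (2 * r) * \<eta>"
  proof -
    have "(\<Sum>q\<in>set qs. (x q)\<^sup>2) \<le> (\<Sum>q\<in>set qs. (n * (b ^ r * \<eta>)) * x q)"
      unfolding power2_eq_square using x01 xsmall by (intro sum_mono mult_right_mono) auto
    also have "\<dots> = (n * (b ^ r * \<eta>)) * (\<Sum>q\<in>set qs. x q)" by (simp only: sum_distrib_left)
    also have "\<dots> \<le> (n * (b ^ r * \<eta>)) * (n * b ^ r)"
      using xsum b1 \<eta> by (intro mult_left_mono) auto
    also have "\<dots> = (real n)\<^sup>2 * (b ^ r * b ^ r) * \<eta>" by (simp add: power2_eq_square mult_ac)
    also have "b ^ r * b ^ r = b ^ (2 * r)" by (simp add: mult_2 power_add)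
    finally show ?thesis .
  qed
  \<comment> \<open>\<open>y v\<close> adds the probabilities with which the indices hit the single
    vertex \<open>v\<close>. The sum of the \<open>y v\<close> differs from that of the
    \<open>x q\<close> only through edges meeting \<open>e\<close> in two vertices.\<close>
  define y where "y = (\<lambda>v. \<Sum>q\<in>set qs. \<Sum>\<omega>\<in>Om q. \<nu> q \<omega> * of_bool (v \<in> ed q \<omega>))"
  have xy1: "(\<Sum>q\<in>set qs. x q) \<le> (\<Sum>v\<in>e. y v)"
  proof -
    have "(\<Sum>q\<in>set qs. x q) \<le> (\<Sum>q\<in>set qs. \<Sum>\<omega>\<in>Om q. \<nu> q \<omega> * (\<Sum>v\<in>e. of_bool (v \<in> ed q \<omega>)))"
      unfolding x_def using \<nu>0 by (intro sum_mono mult_left_mono hit_le_sum fine) auto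
    also have "\<dots> = (\<Sum>v\<in>e. y v)"
      unfolding y_def sum_distrib_left
      by (subst sum.swap[of _ "set qs" e], rule sum.cong[OF refl], rule sum.swap)
    finally show ?thesis .
  qed
  have xy2: "(\<Sum>v\<in>e. y v) - (\<Sum>q\<in>set qs. x q) \<le> (real n)\<^sup>2 * b ^ r * \<eta>"
  proof -
    have "(\<Sum>v\<in>e. y v) = (\<Sum>q\<in>set qs. \<Sum>\<omega>\<in>Om q. \<nu> q \<omega> * (\<Sum>v\<in>e. of_bool (v \<in> ed q \<omega>)))"
      unfolding y_def sum_distrib_left
      by (subst sum.swap[of _ "set qs" e], rule sum.cong[OF refl], rule sum.swap)
    hence "(\<Sum>v\<in>e. y v) - (\<Sum>q\<in>set qs. x q) = (\<Sum>q\<in>set qs. \<Sum>\<omega>\<in>Om q. \<nu> q \<omega> * ((\<Sum>v\<in>e. of_bool (v \<in> ed q \<omega>)) - of_bool (e \<inter> ed q \<omega> \<noteq> {})))"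
      by (simp only: x_def sum_subtractf[symmetric] right_diff_distrib)
    also have "\<dots> \<le> (\<Sum>q\<in>set qs. \<Sum>\<omega>\<in>Om q. (\<mu> q \<omega> * b ^ r) * (\<Sum>u\<in>e. \<Sum>v\<in>e - {u}. of_bool (u \<in> ed q \<omega> \<and> v \<in> ed q \<omega>)))"
      using \<nu>0 \<nu>1 mu_nonneg b1 hit_le_sum[OF fine]
      by (intro sum_mono mult_mono sum_minus_hit_le fine) auto
    also have "\<dots> = (\<Sum>u\<in>e. \<Sum>v\<in>e - {u}. \<Sum>q\<in>set qs. \<Sum>\<omega>\<in>Om q. (\<mu> q \<omega> * b ^ r) * of_bool (u \<in> ed q \<omega> \<and> v \<in> ed q \<omega>))"
    proof -
      have "(\<Sum>\<omega>\<in>Om q. (\<mu> q \<omega> * b ^ r) * (\<Sum>u\<in>e. \<Sum>v\<in>e - {u}. of_bool (u \<in> ed q \<omega> \<and> v \<in> ed q \<omega>)))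
        = (\<Sum>u\<in>e. \<Sum>v\<in>e - {u}. \<Sum>\<omega>\<in>Om q. (\<mu> q \<omega> * b ^ r) * of_bool (u \<in> ed q \<omega> \<and> v \<in> ed q \<omega>))" for q
        unfolding sum_distrib_left
        by (subst sum.swap, rule sum.cong[OF refl], rule sum.swap)
      thus ?thesis
        by (simp only:) (subst sum.swap, rule sum.cong[OF refl], rule sum.swap)
    qed
    also have "\<dots> \<le> (\<Sum>u\<in>e. \<Sum>v\<in>e - {u}. b ^ r * \<eta>)"
    proof (intro sum_mono)
      fix u v assume uv: "u \<in> e" "v \<in> e - {u}"
      have "(\<Sum>q\<in>set qs. \<Sum>\<omega>\<in>Om q. (\<mu> q \<omega> * b ^ r) * of_bool (u \<in> ed q \<omega> \<and> v \<in> ed q \<omega>))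
          = b ^ r * (\<Sum>q\<in>set qs. \<Sum>\<omega>\<in>Om q. \<mu> q \<omega> * of_bool (u \<in> ed q \<omega> \<and> v \<in> ed q \<omega>))"
        unfolding sum_distrib_left by (intro sum.cong refl) (simp add: mult_ac)
      also have "\<dots> \<le> b ^ r * \<eta>" using uv e b1 by (intro mult_left_mono codeg) auto
      finally show "(\<Sum>q\<in>set qs. \<Sum>\<omega>\<in>Om q. (\<mu> q \<omega> * b ^ r) * of_bool (u \<in> ed q \<omega> \<and> v \<in> ed q \<omega>)) \<le> b ^ r * \<eta>" .
    qed
    also have "\<dots> \<le> (\<Sum>u\<in>e. real n * (b ^ r * \<eta>))"
    proof (rule sum_mono)
      fix u assume "u \<in> e"
      have "card (e - {u}) \<le> n" unfolding n_def using fine by (intro card_mono) auto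
      thus "(\<Sum>v\<in>e - {u}. b ^ r * \<eta>) \<le> real n * (b ^ r * \<eta>)"
        using b1 \<eta> by (simp add: mult_right_mono)
    qed
    also have "\<dots> = (real n)\<^sup>2 * b ^ r * \<eta>" by (simp add: n_def power2_eq_square)
    finally show ?thesis .
  qed
  have yL: "\<bar>y v - L\<bar> \<le> \<bar>of_bool (v \<in> W) * (vertex_weight b v W - D / \<beta>)\<bar> + (\<Sum>q\<in>set qs. b ^ r / t\<^sup>2 * (X q - sum (\<mu> q) (Om q))\<^sup>2 * dg q v)"
    if v: "v \<in> e" for v
  proof -
    define h where "h = (\<lambda>q. \<Sum>\<omega>\<in>Om q. \<mu> q \<omega> * b ^ card (ed q \<omega>) * of_bool (ed q \<omega> \<subseteq> W) * of_bool (v \<in> ed q \<omega>))"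
    have yh: "y v = (\<Sum>q\<in>set qs. (if X q \<le> 1 + t then h q / (1 + t) else 0))"
      unfolding y_def \<nu>_def nibble_law_def X_def h_def
      by (intro sum.cong refl) (simp add: sum_divide_distrib)
    have h0: "0 \<le> h q" if "q \<in> set qs" for q
      unfolding h_def using mu_nonneg[OF that] b1 by (intro sum_nonneg) auto
    have hdg: "h q \<le> b ^ r * dg q v" if q: "q \<in> set qs" for q
    proof -
      have "h q \<le> (\<Sum>\<omega>\<in>Om q. \<mu> q \<omega> * b ^ r * 1 * of_bool (v \<in> ed q \<omega>))"
        unfolding h_def using mu_nonneg[OF q] br[OF q] b1
        by (intro sum_mono mult_right_mono mult_mono mult_left_mono) auto
      also have "\<dots> = b ^ r * dg q v"
        unfolding dg_def sum_distrib_left by (intro sum.cong refl) (simp add: mult_ac)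
      finally show ?thesis .
    qed
    have vw: "vertex_weight b v W = (\<Sum>q\<in>set qs. h q)" by (simp add: vertex_weight_def h_def)
    have "vertex_weight b v W / (1 + t) - y v = (\<Sum>q\<in>set qs. if X q \<le> 1 + t then 0 else h q / (1 + t))"
      unfolding vw yh sum_divide_distrib sum_subtractf[symmetric] by (intro sum.cong refl) simp
    also have "\<bar>\<dots>\<bar> \<le> (\<Sum>q\<in>set qs. b ^ r / t\<^sup>2 * (X q - sum (\<mu> q) (Om q))\<^sup>2 * dg q v)"
    proof (rule order.trans[OF sum_abs], rule sum_mono)
      fix q assume q: "q \<in> set qs"
      show "\<bar>if X q \<le> 1 + t then 0 else h q / (1 + t)\<bar> \<le> b ^ r / t\<^sup>2 * (X q - sum (\<mu> q) (Om q))\<^sup>2 * dg q v"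
      proof (cases "X q \<le> 1 + t")
        case False
        \<comment> \<open>A skipped index has weight above \<open>1 + t\<close> although its mean is
          at most 1, so the squared deviation divided by \<open>t\<^sup>2\<close> dominates the
          indicator of being skipped.\<close>
        have "X q - sum (\<mu> q) (Om q) \<ge> t" using False mu_sum[OF q] by simp
        hence "t\<^sup>2 \<le> (X q - sum (\<mu> q) (Om q))\<^sup>2" using t by (intro power_mono) auto
        hence 1: "1 \<le> (X q - sum (\<mu> q) (Om q))\<^sup>2 / t\<^sup>2" using t by (simp add: le_divide_eq)
        have "h q / (1 + t) \<le> h q / 1" using h0[OF q] t by (intro divide_left_mono) auto
        also have "\<dots> \<le> b ^ r * dg q v * 1" using hdg[OF q] by simp
        also have "\<dots> \<le> b ^ r * dg q v * ((X q - sum (\<mu> q) (Om q))\<^sup>2 / t\<^sup>2)"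
          using 1 b1 dg0[OF q] by (intro mult_left_mono) auto
        finally show ?thesis using False h0[OF q] t by (simp add: mult_ac)
      qed (use b1 dg0[OF q] in simp)
    qed
    finally have A: "\<bar>vertex_weight b v W / (1 + t) - y v\<bar> \<le> (\<Sum>q\<in>set qs. b ^ r / t\<^sup>2 * (X q - sum (\<mu> q) (Om q))\<^sup>2 * dg q v)" .
    \<comment> \<open>The factor \<open>1 + t\<close> in \<open>D\<close> offsets the division by
      \<open>1 + t\<close> in \<open>nibble_law\<close>, which centres the hitting rate of a vertex
      at \<open>ln \<kappa>\<close>.\<close>
    have "D / \<beta> = (1 + t) * L" using \<beta> by (simp add: D(1) L_def)
    hence "vertex_weight b v W / (1 + t) - L = (vertex_weight b v W - D / \<beta>) / (1 + t)"
      using t by (simp add: diff_divide_distrib)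
    hence "\<bar>vertex_weight b v W / (1 + t) - L\<bar> = \<bar>vertex_weight b v W - D / \<beta>\<bar> / (1 + t)"
      using t by simp
    also have "\<dots> \<le> \<bar>vertex_weight b v W - D / \<beta>\<bar> / 1" using t by (intro divide_left_mono) auto
    finally show ?thesis using A v e(2) by auto
  qed
  have "\<bar>(\<Prod>q\<leftarrow>qs. 1 - x q) - (1 / \<kappa>) ^ n\<bar> \<le> (\<Sum>q\<in>set qs. (x q)\<^sup>2) + \<bar>(\<Sum>q\<in>set qs. x q) - n * L\<bar>"
  proof -
    have "(\<Prod>q\<leftarrow>qs. 1 - x q) = (\<Prod>q\<in>set qs. 1 - x q)" using dist by (simp add: prod.distinct_set_conv_list)
    moreover have "\<bar>(\<Prod>q\<in>set qs. 1 - x q) - exp (- (\<Sum>q\<in>set qs. x q))\<bar> \<le> (\<Sum>q\<in>set qs. (x q)\<^sup>2)"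
      using x01 by (intro abs_prod_one_minus_exp) auto
    moreover have "\<bar>exp (- (\<Sum>q\<in>set qs. x q)) - exp (- (n * L))\<bar> \<le> \<bar>(\<Sum>q\<in>set qs. x q) - n * L\<bar>"
      using x01 L0 by (intro abs_exp_minus_diff sum_nonneg) auto
    moreover have "exp (- (n * L)) = (1 / \<kappa>) ^ n"
      using \<kappa> by (simp add: L_def exp_minus exp_of_nat_mult power_one_over inverse_eq_divide)
    ultimately show ?thesis by linarith
  qed
  also have "\<bar>(\<Sum>q\<in>set qs. x q) - n * L\<bar> \<le> (real n)\<^sup>2 * b ^ r * \<eta> + (\<Sum>v\<in>e. \<bar>y v - L\<bar>)"
  proof -
    have "(\<Sum>v\<in>e. y v) - n * L = (\<Sum>v\<in>e. y v - L)" by (simp add: sum_subtractf n_def)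
    also have "\<bar>\<dots>\<bar> \<le> (\<Sum>v\<in>e. \<bar>y v - L\<bar>)" by (rule sum_abs)
    finally show ?thesis using xy1 xy2 by linarith
  qed
  also have "(real n)\<^sup>2 * b ^ r * \<eta> \<le> (real n)\<^sup>2 * b ^ (2 * r) * \<eta>"
    using b1 \<eta> by (intro mult_right_mono mult_left_mono power_increasing) auto
  also have "(\<Sum>v\<in>e. \<bar>y v - L\<bar>) \<le> (\<Sum>v\<in>e. \<bar>of_bool (v \<in> W) * (vertex_weight b v W - D / \<beta>)\<bar> + (\<Sum>q\<in>set qs. b ^ r / t\<^sup>2 * (X q - sum (\<mu> q) (Om q))\<^sup>2 * dg q v))"
    by (intro sum_mono yL)
  finally show ?thesis using sq unfolding x_def \<nu>_def dg_def by linarith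
qed

text \<open>The conditional deviation is integrated. The variance of the vertex weights enters
  through its square root, which turns an error \<open>E\<close> before the stage into one of order
  \<open>sqrt E\<close> after it. Sets of up to \<open>2 * r\<close> points are tracked because
  second moments involve unions of two edges.\<close>

lemma stage_survival:
  assumes av: "averaging V \<Phi>" and \<beta>: "0 < \<beta>" "\<beta> \<le> 1" and t: "0 < t" "t \<le> 1" and \<kappa>: "\<kappa> > 1"
    and D: "D = (1 + t) * \<beta> * ln \<kappa>" "D \<le> 1"
    and P: "\<And>f. f \<subseteq> V \<Longrightarrow> card f \<le> 2 * r \<Longrightarrow> \<bar>\<Phi> (\<lambda>W. of_bool (f \<subseteq> W)) - \<beta> ^ card f\<bar> \<le> E"
    and E: "\<eta> \<le> E" "E \<le> 1" and e: "e \<subseteq> V" "card e \<le> 2 * r"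
  shows "\<bar>\<Phi> (\<lambda>W. stage_avg Om ed (nibble_law Om \<mu> ed t (1 / \<beta>) W) qs (\<lambda>W. of_bool (e \<subseteq> W)) W) - (\<beta> / \<kappa>) ^ card e\<bar>
           \<le> 24 * (real r)\<^sup>2 * (1 / \<beta>) ^ (4 * r) / t\<^sup>2 * sqrt E"
proof -
  define b where "b = 1 / \<beta>"
  define n where "n = card e"
  define X where "X = (\<lambda>W q. edge_avg_weight (Om q) (\<mu> q) (ed q) b W)"
  define V2 where "V2 = 5 * r * b ^ (2 * r) * E"
  define Pr where "Pr = (\<lambda>W. \<Prod>q\<leftarrow>qs. 1 - (\<Sum>\<omega>\<in>Om q. nibble_law Om \<mu> ed t b W q \<omega> * of_bool (e \<inter> ed q \<omega> \<noteq> {})))"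
  define R where "R = (\<lambda>W. 2 * (real n)\<^sup>2 * b ^ (2 * r) * \<eta>
       + (\<Sum>v\<in>e. \<bar>of_bool (v \<in> W) * (vertex_weight b v W - D / \<beta>)\<bar>
            + (\<Sum>q\<in>set qs. (b ^ r / t\<^sup>2 * (\<Sum>\<omega>\<in>Om q. \<mu> q \<omega> * of_bool (v \<in> ed q \<omega>))) * (X W q - sum (\<mu> q) (Om q))\<^sup>2)))"
  have b1: "b \<ge> 1" using \<beta> by (simp add: b_def)
  have E0: "E > 0" using E \<eta> by simp
  have V20: "V2 > 0" using b1 E0 r1 by (simp add: V2_def)
  have fine: "finite e" using e finV finite_subset by blast
  have D0: "D > 0" unfolding D(1) using \<beta> t \<kappa> by simp
  have nr: "real n \<le> 2 * r" using e by (simp add: n_def)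
  have "\<bar>\<Phi> (\<lambda>W. of_bool (e \<subseteq> W) * Pr W - (1 / \<kappa>) ^ n * of_bool (e \<subseteq> W))\<bar> \<le> \<Phi> R"
  proof (rule order.trans[OF averaging_abs[OF av]], rule averaging_mono[OF av])
    fix W assume W: "W \<subseteq> V"
    have R0: "R W \<ge> 0" unfolding R_def using b1 \<eta> mu_nonneg
      by (intro add_nonneg_nonneg sum_nonneg mult_nonneg_nonneg divide_nonneg_nonneg) auto
    show "\<bar>of_bool (e \<subseteq> W) * Pr W - (1 / \<kappa>) ^ n * of_bool (e \<subseteq> W)\<bar> \<le> R W"
    proof (cases "e \<subseteq> W")
      case True
      have "\<bar>Pr W - (1 / \<kappa>) ^ n\<bar> \<le> R W"
        using survival_deviation[OF \<beta> t(1) \<kappa> D e(1) True] unfolding Pr_def R_def n_def b_def X_def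
        by (simp add: mult_ac)
      thus ?thesis using True by simp
    qed (use R0 in simp)
  qed
  also have "\<Phi> R = 2 * (real n)\<^sup>2 * b ^ (2 * r) * \<eta> + (\<Sum>v\<in>e. \<Phi> (\<lambda>W. \<bar>of_bool (v \<in> W) * (vertex_weight b v W - D / \<beta>)\<bar>)
     + (\<Sum>q\<in>set qs. (b ^ r / t\<^sup>2 * (\<Sum>\<omega>\<in>Om q. \<mu> q \<omega> * of_bool (v \<in> ed q \<omega>))) * \<Phi> (\<lambda>W. (X W q - sum (\<mu> q) (Om q))\<^sup>2)))"
    unfolding R_def averaging_add[OF av] averaging_const[OF av] averaging_sum[OF av fine]
      averaging_sum[OF av finite_set] averaging_scale[OF av] ..
  also have "\<dots> \<le> 2 * (real n)\<^sup>2 * b ^ (2 * r) * \<eta> + (\<Sum>v\<in>e. sqrt V2 + b ^ r / t\<^sup>2 * V2)"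
  proof (intro add_left_mono sum_mono add_mono)
    fix v assume v: "v \<in> e"
    hence vV: "v \<in> V" using e by auto
    show "\<Phi> (\<lambda>W. \<bar>of_bool (v \<in> W) * (vertex_weight b v W - D / \<beta>)\<bar>) \<le> sqrt V2"
    proof (rule averaging_abs_le_sqrt[OF av])
      have "(of_bool (v \<in> W) * (vertex_weight b v W - D / \<beta>))\<^sup>2 = of_bool (v \<in> W) * (vertex_weight b v W - D / \<beta>)\<^sup>2" for W
        by (simp add: power_mult_distrib)
      thus "\<Phi> (\<lambda>W. (of_bool (v \<in> W) * (vertex_weight b v W - D / \<beta>))\<^sup>2) \<le> (sqrt V2)\<^sup>2"
        using vertex_weight_variance[OF av \<beta> vV P E(1)] D(2) D0 V20 by (simp add: b_def V2_def)
    qed (use V20 in simp)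
    have "(\<Sum>q\<in>set qs. (b ^ r / t\<^sup>2 * (\<Sum>\<omega>\<in>Om q. \<mu> q \<omega> * of_bool (v \<in> ed q \<omega>))) * \<Phi> (\<lambda>W. (X W q - sum (\<mu> q) (Om q))\<^sup>2))
        \<le> (\<Sum>q\<in>set qs. (b ^ r / t\<^sup>2 * (\<Sum>\<omega>\<in>Om q. \<mu> q \<omega> * of_bool (v \<in> ed q \<omega>))) * V2)"
    proof (intro sum_mono mult_left_mono)
      fix q assume q: "q \<in> set qs"
      show "\<Phi> (\<lambda>W. (X W q - sum (\<mu> q) (Om q))\<^sup>2) \<le> V2"
        using index_weight_variance[OF av \<beta> q P E(1)] unfolding X_def b_def V2_def by simp
      show "0 \<le> b ^ r / t\<^sup>2 * (\<Sum>\<omega>\<in>Om q. \<mu> q \<omega> * of_bool (v \<in> ed q \<omega>))"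
        using b1 mu_nonneg[OF q] by (intro mult_nonneg_nonneg sum_nonneg) auto
    qed
    also have "\<dots> = b ^ r / t\<^sup>2 * V2 * D"
      unfolding sum_distrib_right[symmetric] sum_distrib_left[symmetric] deg[OF vV] by (simp add: mult_ac)
    also have "\<dots> \<le> b ^ r / t\<^sup>2 * V2 * 1" using D b1 V20 by (intro mult_left_mono) auto
    finally show "(\<Sum>q\<in>set qs. (b ^ r / t\<^sup>2 * (\<Sum>\<omega>\<in>Om q. \<mu> q \<omega> * of_bool (v \<in> ed q \<omega>))) * \<Phi> (\<lambda>W. (X W q - sum (\<mu> q) (Om q))\<^sup>2)) \<le> b ^ r / t\<^sup>2 * V2" by simp
  qed
  also have "\<dots> = 2 * (real n)\<^sup>2 * b ^ (2 * r) * \<eta> + n * (sqrt V2 + b ^ r / t\<^sup>2 * V2)" by (simp add: n_def)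
  also have "\<dots> \<le> 23 * (real r)\<^sup>2 * b ^ (4 * r) / t\<^sup>2 * sqrt E"
  proof -
    \<comment> \<open>The constant 23 is 8 for squares and codegrees, 5 for the vertex weights and
      10 for the skipped indices. The missing unit of 24 is the error inherited from earlier stages,
      added at the end.\<close>
    define G where "G = (real r)\<^sup>2 * b ^ (4 * r) / t\<^sup>2 * sqrt E"
    have sE: "E \<le> sqrt E" using E E0 by (simp add: real_le_rsqrt power2_eq_square mult_left_le)
    have bp: "b ^ i \<le> b ^ (4 * r)" if "i \<le> 4 * r" for i using b1 that by (intro power_increasing)
    have t2: "1 \<le> 1 / t\<^sup>2" using t by (simp add: power_le_one)
    have base: "(real r)\<^sup>2 * b ^ i * sqrt E \<le> G" if "i \<le> 4 * r" for i
    proof -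
      have "(real r)\<^sup>2 * b ^ i * sqrt E * 1 \<le> (real r)\<^sup>2 * b ^ (4 * r) * sqrt E * (1 / t\<^sup>2)"
        using bp[OF that] t2 b1 E0 by (intro mult_mono) auto
      thus ?thesis by (simp add: G_def)
    qed
    have "2 * (real n)\<^sup>2 * b ^ (2 * r) * \<eta> \<le> 2 * (2 * real r)\<^sup>2 * b ^ (2 * r) * sqrt E"
      using nr b1 E sE \<eta> by (intro mult_mono power_mono) auto
    also have "\<dots> = 8 * ((real r)\<^sup>2 * b ^ (2 * r) * sqrt E)" by (simp add: power2_eq_square)
    also have "\<dots> \<le> 8 * G" by (intro mult_left_mono base) auto
    finally have 1: "2 * (real n)\<^sup>2 * b ^ (2 * r) * \<eta> \<le> 8 * G" .
    have "V2 \<le> (5 / 2 * r * b ^ r * sqrt E)\<^sup>2"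
    proof -
      have "V2 = 5 * real r * (b ^ (2 * r) * E)" by (simp add: V2_def)
      also have "\<dots> \<le> (25 / 4 * (real r)\<^sup>2) * (b ^ (2 * r) * E)"
        using r1 b1 E0 by (intro mult_right_mono) (auto simp: power2_eq_square)
      also have "\<dots> = (5 / 2 * r * b ^ r * sqrt E)\<^sup>2"
        using E0 by (simp add: power_mult_distrib power_even_eq) (simp add: power2_eq_square)
      finally show ?thesis .
    qed
    hence sV: "sqrt V2 \<le> 5 / 2 * r * b ^ r * sqrt E"
      using b1 E0 by (intro real_le_lsqrt) auto
    have "real n * sqrt V2 \<le> (2 * real r) * (5 / 2 * r * b ^ r * sqrt E)"
      using nr sV V20 by (intro mult_mono) auto
    also have "\<dots> = 5 * ((real r)\<^sup>2 * b ^ r * sqrt E)" by (simp add: power2_eq_square)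
    also have "\<dots> \<le> 5 * G" by (intro mult_left_mono base) auto
    finally have 2: "real n * sqrt V2 \<le> 5 * G" .
    have "real n * (b ^ r / t\<^sup>2 * V2) \<le> (2 * real r) * (b ^ r / t\<^sup>2 * V2)"
      using nr b1 V20 by (intro mult_right_mono) auto
    also have "\<dots> = 10 * (real r)\<^sup>2 * b ^ (3 * r) / t\<^sup>2 * E"
    proof -
      have "b ^ (3 * r) = b ^ r * b ^ (2 * r)" by (simp add: power_add[symmetric])
      thus ?thesis by (simp add: V2_def power2_eq_square)
    qed
    also have "\<dots> \<le> 10 * (real r)\<^sup>2 * b ^ (4 * r) / t\<^sup>2 * sqrt E"
      using sE b1 E0 bp[of "3 * r"] by (intro mult_mono divide_right_mono) auto
    also have "\<dots> = 10 * G" by (simp add: G_def)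
    finally have 3: "real n * (b ^ r / t\<^sup>2 * V2) \<le> 10 * G" .
    have "2 * (real n)\<^sup>2 * b ^ (2 * r) * \<eta> + real n * (sqrt V2 + b ^ r / t\<^sup>2 * V2) \<le> 23 * G"
      unfolding distrib_left[of "real n"] using 1 2 3 by linarith
    thus ?thesis by (simp add: G_def)
  qed
  finally have main: "\<bar>\<Phi> (\<lambda>W. of_bool (e \<subseteq> W) * Pr W - (1 / \<kappa>) ^ n * of_bool (e \<subseteq> W))\<bar>
      \<le> 23 * (real r)\<^sup>2 * b ^ (4 * r) / t\<^sup>2 * sqrt E" .
  have "\<Phi> (\<lambda>W. of_bool (e \<subseteq> W) * Pr W - (1 / \<kappa>) ^ n * of_bool (e \<subseteq> W)) =
      \<Phi> (\<lambda>W. of_bool (e \<subseteq> W) * Pr W) - (1 / \<kappa>) ^ n * \<Phi> (\<lambda>W. of_bool (e \<subseteq> W))"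
    by (simp add: averaging_diff[OF av] averaging_scale[OF av])
  moreover have "\<bar>(1 / \<kappa>) ^ n * \<Phi> (\<lambda>W. of_bool (e \<subseteq> W)) - (\<beta> / \<kappa>) ^ n\<bar> \<le> (real r)\<^sup>2 * b ^ (4 * r) / t\<^sup>2 * sqrt E"
  proof -
    have "(1 / \<kappa>) ^ n * \<Phi> (\<lambda>W. of_bool (e \<subseteq> W)) - (\<beta> / \<kappa>) ^ n = (1 / \<kappa>) ^ n * (\<Phi> (\<lambda>W. of_bool (e \<subseteq> W)) - \<beta> ^ n)"
      by (simp add: power_divide algebra_simps)
    also have "\<bar>\<dots>\<bar> \<le> 1 * E"
      unfolding abs_mult using P[OF e] \<kappa> by (intro mult_mono) (auto simp: n_def power_le_one)
    also have "\<dots> \<le> 1 * 1 / 1 * sqrt E" using E E0 by (simp add: real_le_rsqrt power2_eq_square mult_left_le)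
    also have "\<dots> \<le> (real r)\<^sup>2 * b ^ (4 * r) / t\<^sup>2 * sqrt E"
      using r1 b1 E0 t by (intro mult_right_mono frac_le mult_mono) (auto simp: power_le_one)
    finally show ?thesis .
  qed
  moreover have "\<Phi> (\<lambda>W. stage_avg Om ed (nibble_law Om \<mu> ed t (1 / \<beta>) W) qs (\<lambda>W. of_bool (e \<subseteq> W)) W) = \<Phi> (\<lambda>W. of_bool (e \<subseteq> W) * Pr W)"
    unfolding stage_avg_indicator Pr_def b_def ..
  ultimately show ?thesis using main unfolding n_def b_def by simp
qed

end

text \<open>\<open>F\<close> is averaged over stage \<open>j\<close> given the set at its start, and
  the result is handed to the earlier stages, so the last stage is innermost. Before stage
  \<open>j\<close> a point is left with probability about \<open>(1 / \<kappa>) ^ j\<close>, whence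
  the inflation factor \<open>\<kappa> ^ j\<close>.\<close>

primrec nibble_process ::
  "'v set \<Rightarrow> (nat \<Rightarrow> 'q list) \<Rightarrow> ('q \<Rightarrow> 'o set) \<Rightarrow> ('q \<Rightarrow> 'o \<Rightarrow> real) \<Rightarrow> ('q \<Rightarrow> 'o \<Rightarrow> 'v set) \<Rightarrow>
     real \<Rightarrow> real \<Rightarrow> nat \<Rightarrow> ('v set \<Rightarrow> real) \<Rightarrow> real" where
  "nibble_process V qs Om \<mu> ed t \<kappa> 0 F = F V"
| "nibble_process V qs Om \<mu> ed t \<kappa> (Suc j) F =
     nibble_process V qs Om \<mu> ed t \<kappa> j (\<lambda>W. stage_avg Om ed (nibble_law Om \<mu> ed t (\<kappa> ^ j) W) (qs j) F W)"

text \<open>After each stage the survival of at most \<open>2 * r\<close> points is nearly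
  independent, which is exactly the input of the next stage. At the end only single points matter:
  \<open>num\<close> keeps the accumulated error below the main term, so the mean number of points
  left is at most twice the main term, and an outcome no worse than the mean is selected.\<close>

lemma nibble_covering_regular:
  fixes V :: "'v set" and Q :: "nat \<Rightarrow> 'q set" and Om :: "'q \<Rightarrow> 'o set" and r m :: nat
  assumes finV: "finite V" and finQ: "\<And>j. j < m \<Longrightarrow> finite (Q j)"
    and disj: "\<And>i j. i < m \<Longrightarrow> j < m \<Longrightarrow> i \<noteq> j \<Longrightarrow> Q i \<inter> Q j = {}"
    and prob: "\<And>j q. j < m \<Longrightarrow> q \<in> Q j \<Longrightarrow> subprob (Om q) (\<mu> q)"
    and edge: "\<And>j q \<omega>. j < m \<Longrightarrow> q \<in> Q j \<Longrightarrow> \<omega> \<in> Om q \<Longrightarrow> ed q \<omega> \<subseteq> V \<and> card (ed q \<omega>) \<le> r"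
    and small: "\<And>j q v. j < m \<Longrightarrow> q \<in> Q j \<Longrightarrow> v \<in> V \<Longrightarrow> (\<Sum>\<omega>\<in>Om q. \<mu> q \<omega> * of_bool (v \<in> ed q \<omega>)) \<le> \<eta>"
    and codeg: "\<And>j u v. j < m \<Longrightarrow> u \<in> V \<Longrightarrow> v \<in> V \<Longrightarrow> u \<noteq> v \<Longrightarrow>
      (\<Sum>q\<in>Q j. \<Sum>\<omega>\<in>Om q. \<mu> q \<omega> * of_bool (u \<in> ed q \<omega> \<and> v \<in> ed q \<omega>)) \<le> \<eta>"
    and deg: "\<And>j v. j < m \<Longrightarrow> v \<in> V \<Longrightarrow>
      (\<Sum>q\<in>Q j. \<Sum>\<omega>\<in>Om q. \<mu> q \<omega> * of_bool (v \<in> ed q \<omega>)) = (1 + t) * (1 / \<kappa>) ^ j * ln \<kappa>"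
    and r1: "r \<ge> 1" and \<eta>: "\<eta> > 0" and t: "0 < t" "t \<le> 1" and \<kappa>: "\<kappa> > 1" "(1 + t) * ln \<kappa> \<le> 1"
    and num: "(24 * (real r)\<^sup>2 * \<kappa> ^ (4 * r * m) / t\<^sup>2)\<^sup>2 * \<eta> powr (1 / 2 ^ m) \<le> (1 / \<kappa>) ^ m"
  shows "\<exists>g. (\<forall>j<m. \<forall>q\<in>Q j. g q \<in> insert {} (ed q ` Om q))
           \<and> real (card (V - (\<Union>j<m. \<Union>q\<in>Q j. g q))) \<le> 2 * (1 / \<kappa>) ^ m * card V"
proof -
  define qs where "qs = (\<lambda>j. SOME l. set l = Q j \<and> distinct l)"
  have qs: "set (qs j) = Q j" "distinct (qs j)" if "j < m" for j
    using someI_ex[OF finite_distinct_list[OF finQ[OF that]]] unfolding qs_def by auto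
  define \<Phi> where "\<Phi> = nibble_process V qs Om \<mu> ed t \<kappa>"
  define \<Gamma> where "\<Gamma> = 24 * (real r)\<^sup>2 * \<kappa> ^ (4 * r * m) / t\<^sup>2"
  \<comment> \<open>Chosen to satisfy \<open>\<Gamma> * sqrt (E j) = E (Suc j)\<close>, the
    recursion that a stage produces.\<close>
  define E where "E = (\<lambda>j::nat. \<Gamma>\<^sup>2 * \<eta> powr (1 / 2 ^ j))"
  have spl: "subprob (Om q) (nibble_law Om \<mu> ed t (\<kappa> ^ j) W q)" if "j < m" "q \<in> Q j" for j q W
    using prob[OF that] \<kappa> t by (intro subprob_nibble_law) (auto simp: subprob_def)
  have \<Gamma>1: "\<Gamma> \<ge> 1"
  proof -
    have "1 * 1 * 1 / 1 \<le> \<Gamma>" unfolding \<Gamma>_def using r1 \<kappa> t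
      by (intro frac_le mult_mono) (auto simp: power_le_one one_le_power)
    thus ?thesis by simp
  qed
  have \<kappa>m: "(1 / \<kappa>) ^ m \<le> 1" using \<kappa> by (intro power_le_one) auto
  have Em: "E m \<le> (1 / \<kappa>) ^ m" using num by (simp add: E_def \<Gamma>_def)
  have \<eta>1: "\<eta> \<le> 1"
  proof (rule ccontr)
    assume "\<not> \<eta> \<le> 1"
    hence "1 < \<eta> powr (1 / 2 ^ m)" by (intro gr_one_powr) auto
    hence "1 * 1 < \<Gamma>\<^sup>2 * \<eta> powr (1 / 2 ^ m)" using \<Gamma>1 by (intro mult_le_less_imp_less) auto
    thus False using Em \<kappa>m by (simp add: E_def)
  qed
  have E1: "E j \<le> 1" if "j \<le> m" for j
  proof -
    have "\<eta> powr (1 / 2 ^ j) \<le> \<eta> powr (1 / 2 ^ m)"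
      using that \<eta> \<eta>1 by (intro powr_mono') (auto intro!: divide_left_mono power_increasing)
    hence "E j \<le> E m" unfolding E_def by (intro mult_left_mono) auto
    thus ?thesis using Em \<kappa>m by linarith
  qed
  have \<eta>E: "\<eta> \<le> E j" for j
  proof -
    have "\<eta> = \<eta> powr 1" using \<eta> by simp
    also have "\<dots> \<le> \<eta> powr (1 / 2 ^ j)" using \<eta> \<eta>1 by (intro powr_mono') auto
    finally have "1 * \<eta> \<le> \<Gamma>\<^sup>2 * \<eta> powr (1 / 2 ^ j)" using \<Gamma>1 \<eta> by (intro mult_mono) auto
    thus ?thesis by (simp add: E_def)
  qed
  have stage: "nibble_stage V (qs j) Om \<mu> ed r \<eta> ((1 + t) * (1 / \<kappa>) ^ j * ln \<kappa>)" if j: "j < m" for j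
    using finV prob[OF j] edge[OF j] small[OF j] codeg[OF j] deg[OF j] r1 \<eta> qs[OF j]
    by unfold_locales auto
  have inv: "averaging V (\<Phi> j) \<and> (\<forall>e\<subseteq>V. card e \<le> 2 * r \<longrightarrow> \<bar>\<Phi> j (\<lambda>W. of_bool (e \<subseteq> W)) - ((1 / \<kappa>) ^ j) ^ card e\<bar> \<le> E j)"
    if "j \<le> m" for j
    using that
  proof (induction j)
    case 0
    show ?case using \<eta>E[of 0] \<eta> by (auto simp: \<Phi>_def averaging_def)
  next
    case (Suc j)
    hence j: "j < m" and av: "averaging V (\<Phi> j)"
      and P: "\<And>e. e \<subseteq> V \<Longrightarrow> card e \<le> 2 * r \<Longrightarrow> \<bar>\<Phi> j (\<lambda>W. of_bool (e \<subseteq> W)) - ((1 / \<kappa>) ^ j) ^ card e\<bar> \<le> E j"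
      by auto
    have inv\<kappa>: "1 / (1 / \<kappa>) ^ j = \<kappa> ^ j" by (simp add: power_one_over)
    have \<Phi>S: "\<Phi> (Suc j) = (\<lambda>F. \<Phi> j (\<lambda>W. stage_avg Om ed (nibble_law Om \<mu> ed t (\<kappa> ^ j) W) (qs j) F W))"
      by (auto simp: \<Phi>_def)
    have "averaging V (\<Phi> (Suc j))"
      unfolding \<Phi>S using spl[OF j] qs[OF j] by (intro averaging_stage[OF av]) auto
    moreover have "\<bar>\<Phi> (Suc j) (\<lambda>W. of_bool (e \<subseteq> W)) - ((1 / \<kappa>) ^ Suc j) ^ card e\<bar> \<le> E (Suc j)"
      if e: "e \<subseteq> V" "card e \<le> 2 * r" for e
    proof -
      have kj: "0 < (1 / \<kappa>) ^ j" "(1 / \<kappa>) ^ j \<le> 1" using \<kappa> by (auto intro!: power_le_one)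
      have "(1 + t) * (1 / \<kappa>) ^ j * ln \<kappa> \<le> (1 + t) * 1 * ln \<kappa>"
        using kj \<kappa> t by (intro mult_right_mono mult_left_mono) auto
      hence D1: "(1 + t) * (1 / \<kappa>) ^ j * ln \<kappa> \<le> 1" using \<kappa> by simp
      have "\<bar>\<Phi> j (\<lambda>W. stage_avg Om ed (nibble_law Om \<mu> ed t (1 / (1 / \<kappa>) ^ j) W) (qs j) (\<lambda>W. of_bool (e \<subseteq> W)) W) - ((1 / \<kappa>) ^ j / \<kappa>) ^ card e\<bar>
           \<le> 24 * (real r)\<^sup>2 * (1 / (1 / \<kappa>) ^ j) ^ (4 * r) / t\<^sup>2 * sqrt (E j)"
        using j e D1 kj \<kappa>(1) t
        by (intro nibble_stage.stage_survival[OF stage[OF j] av] P \<eta>E E1) auto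
      also have "\<dots> \<le> \<Gamma> * sqrt (E j)"
      proof -
        have "(\<kappa> ^ j) ^ (4 * r) \<le> \<kappa> ^ (4 * r * m)"
          using \<kappa> j by (simp add: power_mult[symmetric] mult.commute power_increasing)
        thus ?thesis unfolding \<Gamma>_def inv\<kappa> using \<eta>E[of j] \<eta>
          by (intro mult_right_mono divide_right_mono mult_left_mono) auto
      qed
      also have "\<dots> = E (Suc j)"
      proof -
        have "sqrt (E j) = \<Gamma> * sqrt (\<eta> powr (1 / 2 ^ j))"
          using \<Gamma>1 by (simp add: E_def real_sqrt_mult)
        also have "sqrt (\<eta> powr (1 / 2 ^ j)) = \<eta> powr (1 / 2 ^ Suc j)"
          by (simp add: powr_half_sqrt[symmetric] powr_powr mult.commute)
        finally show ?thesis by (simp add: E_def power2_eq_square)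
      qed
      finally show ?thesis by (simp add: \<Phi>S inv\<kappa>)
    qed
    ultimately show ?case by blast
  qed
  \<comment> \<open>The earlier stages are fixed first, with the average over stage \<open>j\<close>
    as objective; only then is stage \<open>j\<close> derandomised on the set that they
    leave.\<close>
  have wit: "\<exists>g. (\<forall>i<j. \<forall>q\<in>Q i. g q \<in> insert {} (ed q ` Om q)) \<and> F (V - (\<Union>i<j. \<Union>q\<in>Q i. g q)) \<le> \<Phi> j F"
    if "j \<le> m" for j F
    using that
  proof (induction j arbitrary: F)
    case 0
    show ?case by (simp add: \<Phi>_def)
  next
    case (Suc j)
    hence j: "j < m" by simp
    define G where "G = (\<lambda>W. stage_avg Om ed (nibble_law Om \<mu> ed t (\<kappa> ^ j) W) (qs j) F W)"
    obtain g where g: "\<forall>i<j. \<forall>q\<in>Q i. g q \<in> insert {} (ed q ` Om q)" "G (V - (\<Union>i<j. \<Union>q\<in>Q i. g q)) \<le> \<Phi> j G"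
      using Suc.IH[OF less_imp_le[OF j], of G] by (elim exE conjE)
    define W where "W = V - (\<Union>i<j. \<Union>q\<in>Q i. g q)"
    have "\<forall>q\<in>set (qs j). subprob (Om q) (nibble_law Om \<mu> ed t (\<kappa> ^ j) W q)"
      using spl[OF j] qs(1)[OF j] by blast
    from stage_avg_witness[OF this qs(2)[OF j], of ed F W] obtain h where
      h: "\<forall>q\<in>Q j. h q \<in> insert {} (ed q ` Om q)" "F (W - (\<Union>q\<in>Q j. h q)) \<le> G W"
      unfolding qs(1)[OF j] G_def by (elim exE conjE)
    define k where "k = (\<lambda>q. if q \<in> Q j then h q else g q)"
    have kg: "k q = g q" if "i < j" "q \<in> Q i" for i q
      using disj[of i j] that j by (auto simp: k_def)
    have kh: "k q = h q" if "q \<in> Q j" for q using that by (simp add: k_def)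
    have "(\<Union>i<Suc j. \<Union>q\<in>Q i. k q) = (\<Union>q\<in>Q j. k q) \<union> (\<Union>i<j. \<Union>q\<in>Q i. k q)"
      by (simp add: lessThan_Suc)
    also have "(\<Union>q\<in>Q j. k q) = (\<Union>q\<in>Q j. h q)" by (intro SUP_cong refl kh)
    also have "(\<Union>i<j. \<Union>q\<in>Q i. k q) = (\<Union>i<j. \<Union>q\<in>Q i. g q)"
      by (intro SUP_cong refl kg) auto
    finally have kU: "(\<Union>i<Suc j. \<Union>q\<in>Q i. k q) = (\<Union>q\<in>Q j. h q) \<union> (\<Union>i<j. \<Union>q\<in>Q i. g q)" .
    have "V - (H \<union> G) = (V - G) - H" for G H :: "'v set" by blast
    hence "V - (\<Union>i<Suc j. \<Union>q\<in>Q i. k q) = W - (\<Union>q\<in>Q j. h q)"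
      unfolding W_def kU .
    moreover have "F (W - (\<Union>q\<in>Q j. h q)) \<le> \<Phi> (Suc j) F"
    proof -
      have "\<Phi> (Suc j) F = \<Phi> j G" by (simp add: \<Phi>_def G_def)
      thus ?thesis using order.trans[OF h(2) g(2)[folded W_def]] by (simp only:)
    qed
    ultimately have "F (V - (\<Union>i<Suc j. \<Union>q\<in>Q i. k q)) \<le> \<Phi> (Suc j) F" by simp
    moreover have "\<forall>i<Suc j. \<forall>q\<in>Q i. k q \<in> insert {} (ed q ` Om q)"
    proof (intro allI impI ballI)
      fix i q assume iq: "i < Suc j" "q \<in> Q i"
      show "k q \<in> insert {} (ed q ` Om q)"
      proof (cases "i = j")
        case True
        thus ?thesis using kh[of q] h(1) iq by simp
      next
        case False
        hence "i < j" using iq by simp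
        thus ?thesis using kg[of i q] g(1) iq by simp
      qed
    qed
    ultimately show ?case by blast
  qed
  obtain g where g: "\<forall>j<m. \<forall>q\<in>Q j. g q \<in> insert {} (ed q ` Om q)"
    "real (card (V - (\<Union>i<m. \<Union>q\<in>Q i. g q))) \<le> \<Phi> m (\<lambda>W. real (card W))"
    using wit[OF order.refl, of "\<lambda>W. real (card W)"] by (elim exE conjE)
  have av: "averaging V (\<Phi> m)" using inv by auto
  have "\<Phi> m (\<lambda>W. real (card W)) = \<Phi> m (\<lambda>W. \<Sum>v\<in>V. of_bool ({v} \<subseteq> W))"
  proof (rule averaging_cong[OF av])
    fix W assume "W \<subseteq> V"
    thus "real (card W) = (\<Sum>v\<in>V. of_bool ({v} \<subseteq> W))"
      using sum_of_bool_mem[OF finV, of W] by (simp add: Int_absorb1)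
  qed
  also have "\<dots> = (\<Sum>v\<in>V. \<Phi> m (\<lambda>W. of_bool ({v} \<subseteq> W)))" by (rule averaging_sum[OF av finV])
  also have "\<dots> \<le> (\<Sum>v\<in>V. 2 * (1 / \<kappa>) ^ m)"
  proof (rule sum_mono)
    fix v assume "v \<in> V"
    hence "\<bar>\<Phi> m (\<lambda>W. of_bool ({v} \<subseteq> W)) - ((1 / \<kappa>) ^ m) ^ card {v}\<bar> \<le> E m" using inv[of m] r1 by force
    thus "\<Phi> m (\<lambda>W. of_bool ({v} \<subseteq> W)) \<le> 2 * (1 / \<kappa>) ^ m" using Em by simp
  qed
  finally show ?thesis using g by (intro exI[of _ g]) (auto simp: mult.commute)
qed

section \<open>Random thinning of edges to equal degrees\<close>

definition thin_weight :: "'v set \<Rightarrow> ('v \<Rightarrow> real) \<Rightarrow> 'v set \<Rightarrow> real" where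
  "thin_weight V \<theta> T = (\<Prod>u\<in>T. \<theta> u) * (\<Prod>u\<in>V - T. 1 - \<theta> u)"

lemma thin_weight_sum:
  assumes "finite V"
  shows "(\<Sum>T\<in>Pow V. thin_weight V \<theta> T) = 1"
  using prod_add[OF assms, of \<theta> "\<lambda>u. 1 - \<theta> u"] by (simp add: thin_weight_def)

text \<open>For this product Bernoulli law on subsets, forcing \<open>v\<close> into
  \<open>T\<close> amounts to setting the factor for the absence of \<open>v\<close> to 0 before the
  product over \<open>V\<close> is expanded.\<close>

lemma thin_weight_sum_mem:
  assumes "finite V" "v \<in> V"
  shows "(\<Sum>T\<in>Pow V. thin_weight V \<theta> T * of_bool (v \<in> T)) = \<theta> v"
proof -
  define h where "h = (\<lambda>u. if u = v then 0 else 1 - \<theta> u)"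
  have "(\<Sum>T\<in>Pow V. thin_weight V \<theta> T * of_bool (v \<in> T)) = (\<Sum>T\<in>Pow V. (\<Prod>u\<in>T. \<theta> u) * (\<Prod>u\<in>V - T. h u))"
  proof (rule sum.cong[OF refl])
    fix T assume T: "T \<in> Pow V"
    show "thin_weight V \<theta> T * of_bool (v \<in> T) = (\<Prod>u\<in>T. \<theta> u) * (\<Prod>u\<in>V - T. h u)"
    proof (cases "v \<in> T")
      case True
      have "(\<Prod>u\<in>V - T. h u) = (\<Prod>u\<in>V - T. 1 - \<theta> u)" using True by (intro prod.cong refl) (auto simp: h_def)
      thus ?thesis using True by (simp add: thin_weight_def)
    next
      case False
      hence "(\<Prod>u\<in>V - T. h u) = 0" using assms by (intro prod_zero) (auto simp: h_def)
      thus ?thesis using False by simp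
    qed
  qed
  also have "\<dots> = (\<Prod>u\<in>V. \<theta> u + h u)" using prod_add[OF assms(1), of \<theta> h] by simp
  also have "\<dots> = (\<theta> v + h v) * (\<Prod>u\<in>V - {v}. \<theta> u + h u)" using assms by (intro prod.remove) auto
  also have "(\<Prod>u\<in>V - {v}. \<theta> u + h u) = 1" by (intro prod.neutral) (auto simp: h_def)
  finally show ?thesis by (simp add: h_def)
qed

text \<open>Vertices of too large degree are made regular by randomly deleting them from the edges.\<close>

theorem nibble_covering:
  fixes V :: "'v set" and Q :: "nat \<Rightarrow> 'q set" and Om :: "'q \<Rightarrow> 'o set" and r m :: nat
  assumes finV: "finite V" and finQ: "\<And>j. j < m \<Longrightarrow> finite (Q j)"
    and disj: "\<And>i j. i < m \<Longrightarrow> j < m \<Longrightarrow> i \<noteq> j \<Longrightarrow> Q i \<inter> Q j = {}"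
    and prob: "\<And>j q. j < m \<Longrightarrow> q \<in> Q j \<Longrightarrow> subprob (Om q) (\<mu> q)"
    and edge: "\<And>j q \<omega>. j < m \<Longrightarrow> q \<in> Q j \<Longrightarrow> \<omega> \<in> Om q \<Longrightarrow> ed q \<omega> \<subseteq> V \<and> card (ed q \<omega>) \<le> r"
    and small: "\<And>j q v. j < m \<Longrightarrow> q \<in> Q j \<Longrightarrow> v \<in> V \<Longrightarrow> (\<Sum>\<omega>\<in>Om q. \<mu> q \<omega> * of_bool (v \<in> ed q \<omega>)) \<le> \<eta>"
    and codeg: "\<And>j u v. j < m \<Longrightarrow> u \<in> V \<Longrightarrow> v \<in> V \<Longrightarrow> u \<noteq> v \<Longrightarrow>
      (\<Sum>q\<in>Q j. \<Sum>\<omega>\<in>Om q. \<mu> q \<omega> * of_bool (u \<in> ed q \<omega> \<and> v \<in> ed q \<omega>)) \<le> \<eta>"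
    and deg: "\<And>j v. j < m \<Longrightarrow> v \<in> V \<Longrightarrow>
      (\<Sum>q\<in>Q j. \<Sum>\<omega>\<in>Om q. \<mu> q \<omega> * of_bool (v \<in> ed q \<omega>)) \<ge> (1 + t) * (1 / \<kappa>) ^ j * ln \<kappa>"
    and r1: "r \<ge> 1" and \<eta>: "\<eta> > 0" and t: "0 < t" "t \<le> 1" and \<kappa>: "\<kappa> > 1" "(1 + t) * ln \<kappa> \<le> 1"
    and num: "(24 * (real r)\<^sup>2 * \<kappa> ^ (4 * r * m) / t\<^sup>2)\<^sup>2 * \<eta> powr (1 / 2 ^ m) \<le> (1 / \<kappa>) ^ m"
  shows "\<exists>g. (\<forall>j<m. \<forall>q\<in>Q j. g q \<in> insert {} (ed q ` Om q))
           \<and> real (card (V - (\<Union>j<m. \<Union>q\<in>Q j. g q))) \<le> 2 * (1 / \<kappa>) ^ m * card V"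
proof -
  define D where "D = (\<lambda>j. (1 + t) * (1 / \<kappa>) ^ j * ln \<kappa>)"
  define dg where "dg = (\<lambda>j v. \<Sum>q\<in>Q j. \<Sum>\<omega>\<in>Om q. \<mu> q \<omega> * of_bool (v \<in> ed q \<omega>))"
  define J where "J = (\<lambda>q. SOME j. j < m \<and> q \<in> Q j)"
  have J: "J q = j" if "j < m" "q \<in> Q j" for j q
  proof -
    have Jq: "J q < m" "q \<in> Q (J q)"
      using someI[of "\<lambda>j. j < m \<and> q \<in> Q j" j] that unfolding J_def by simp_all
    show ?thesis
    proof (rule ccontr)
      assume "J q \<noteq> j"
      hence "Q (J q) \<inter> Q j = {}" using Jq(1) that(1) by (intro disj)
      thus False using Jq(2) that(2) by (simp add: disjoint_iff)
    qed
  qed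
  \<comment> \<open>The degree \<open>dg j v\<close> is at least \<open>D j\<close>, so this
    quotient is a probability, and keeping \<open>v\<close> in an edge with this probability brings
    its degree to exactly \<open>D j\<close>.\<close>
  define \<theta> where "\<theta> = (\<lambda>j v. if v \<in> V \<and> j < m then D j / dg j v else 0)"
  have D0: "D j > 0" for j using \<kappa> t by (simp add: D_def)
  have dgD: "dg j v \<ge> D j" if "j < m" "v \<in> V" for j v using deg[OF that] by (simp add: dg_def D_def)
  have \<theta>: "0 \<le> \<theta> j v \<and> \<theta> j v \<le> 1" for j v
  proof (cases "v \<in> V \<and> j < m")
    case True
    thus ?thesis using dgD[of j v] D0[of j] by (simp add: \<theta>_def)
  qed (auto simp: \<theta>_def)
  have tw0: "thin_weight V (\<theta> j) T \<ge> 0" for j T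
    unfolding thin_weight_def using \<theta> by (intro mult_nonneg_nonneg prod_nonneg) auto
  \<comment> \<open>The random deletion becomes part of the outcome, drawn separately for every
    index, so the regular case applies to the enlarged outcome sets.\<close>
  define Om' where "Om' = (\<lambda>q. Om q \<times> Pow V)"
  define \<mu>' where "\<mu>' = (\<lambda>q p. \<mu> q (fst p) * thin_weight V (\<theta> (J q)) (snd p))"
  define ed' where "ed' = (\<lambda>q p. ed q (fst p) \<inter> snd p)"
  have sum': "(\<Sum>p\<in>Om' q. \<mu>' q p * of_bool (R (fst p)) * f (snd p)) =
     (\<Sum>\<omega>\<in>Om q. \<mu> q \<omega> * of_bool (R \<omega>)) * (\<Sum>T\<in>Pow V. thin_weight V (\<theta> (J q)) T * f T)" for q R and f :: "'v set \<Rightarrow> real"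
    unfolding Om'_def \<mu>'_def sum_product sum.cartesian_product
    by (intro sum.cong refl) (simp add: case_prod_beta mult_ac)
  have degv: "(\<Sum>p\<in>Om' q. \<mu>' q p * of_bool (v \<in> ed' q p)) = (\<Sum>\<omega>\<in>Om q. \<mu> q \<omega> * of_bool (v \<in> ed q \<omega>)) * \<theta> (J q) v"
    if "v \<in> V" for q v
  proof -
    have "(\<Sum>p\<in>Om' q. \<mu>' q p * of_bool (v \<in> ed' q p)) = (\<Sum>p\<in>Om' q. \<mu>' q p * of_bool (v \<in> ed q (fst p)) * of_bool (v \<in> snd p))"
      by (intro sum.cong refl) (auto simp: ed'_def of_bool_def)
    also have "\<dots> = (\<Sum>\<omega>\<in>Om q. \<mu> q \<omega> * of_bool (v \<in> ed q \<omega>)) * (\<Sum>T\<in>Pow V. thin_weight V (\<theta> (J q)) T * of_bool (v \<in> T))"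
      by (rule sum')
    finally show ?thesis by (simp only: thin_weight_sum_mem[OF finV that])
  qed
  have total: "(\<Sum>p\<in>Om' q. \<mu>' q p * of_bool (R (fst p))) = (\<Sum>\<omega>\<in>Om q. \<mu> q \<omega> * of_bool (R \<omega>))" for q R
    using sum'[of q R "\<lambda>_. 1"] thin_weight_sum[OF finV, of "\<theta> (J q)"] by simp
  have \<mu>0: "\<mu> q \<omega> \<ge> 0" if "j < m" "q \<in> Q j" "\<omega> \<in> Om q" for j q \<omega>
    using prob[OF that(1,2)] that(3) by (simp add: subprob_def)
  have \<mu>'0: "\<mu>' q p \<ge> 0" if "j < m" "q \<in> Q j" "p \<in> Om' q" for j q p
    using \<mu>0[OF that(1,2), of "fst p"] tw0 that(3) by (auto simp: \<mu>'_def Om'_def)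
  have "\<exists>g. (\<forall>j<m. \<forall>q\<in>Q j. g q \<in> insert {} (ed' q ` Om' q))
           \<and> real (card (V - (\<Union>j<m. \<Union>q\<in>Q j. g q))) \<le> 2 * (1 / \<kappa>) ^ m * card V"
  proof (rule nibble_covering_regular[where \<mu> = \<mu>' and r = r and \<eta> = \<eta> and t = t, OF finV finQ disj _ _ _ _ _ r1 \<eta> t \<kappa> num])
    fix j q assume jq: "j < m" "q \<in> Q j"
    have "finite (Om' q)" using prob[OF jq] finV by (simp add: Om'_def subprob_def)
    moreover have "(\<Sum>p\<in>Om' q. \<mu>' q p) \<le> 1"
      using total[of q "\<lambda>_. True"] prob[OF jq] by (simp add: subprob_def)
    ultimately show "subprob (Om' q) (\<mu>' q)" using \<mu>'0[OF jq] by (simp add: subprob_def)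
    fix v assume v: "v \<in> V"
    have "(\<Sum>\<omega>\<in>Om q. \<mu> q \<omega> * of_bool (v \<in> ed q \<omega>)) * \<theta> (J q) v \<le> (\<Sum>\<omega>\<in>Om q. \<mu> q \<omega> * of_bool (v \<in> ed q \<omega>)) * 1"
      using \<theta> \<mu>0[OF jq] by (intro mult_left_mono sum_nonneg) auto
    thus "(\<Sum>p\<in>Om' q. \<mu>' q p * of_bool (v \<in> ed' q p)) \<le> \<eta>" using small[OF jq v] degv[OF v, of q] by simp
  next
    fix j q p assume jq: "j < m" "q \<in> Q j" and p: "p \<in> Om' q"
    have e: "ed q (fst p) \<subseteq> V \<and> card (ed q (fst p)) \<le> r" using edge[OF jq, of "fst p"] p by (simp add: Om'_def mem_Times_iff)
    hence "card (ed' q p) \<le> card (ed q (fst p))"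
      unfolding ed'_def by (intro card_mono) (auto intro: finite_subset[OF _ finV])
    thus "ed' q p \<subseteq> V \<and> card (ed' q p) \<le> r" using e by (auto simp: ed'_def)
  next
    fix j u v assume j: "j < m" and uv: "u \<in> V" "v \<in> V" "u \<noteq> v"
    have "(\<Sum>q\<in>Q j. \<Sum>p\<in>Om' q. \<mu>' q p * of_bool (u \<in> ed' q p \<and> v \<in> ed' q p))
        \<le> (\<Sum>q\<in>Q j. \<Sum>p\<in>Om' q. \<mu>' q p * of_bool (u \<in> ed q (fst p) \<and> v \<in> ed q (fst p)))"
      using \<mu>'0[OF j] by (intro sum_mono mult_left_mono) (auto simp: ed'_def of_bool_def)
    also have "\<dots> = (\<Sum>q\<in>Q j. \<Sum>\<omega>\<in>Om q. \<mu> q \<omega> * of_bool (u \<in> ed q \<omega> \<and> v \<in> ed q \<omega>))"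
      by (intro sum.cong refl total)
    also have "\<dots> \<le> \<eta>" by (rule codeg[OF j uv])
    finally show "(\<Sum>q\<in>Q j. \<Sum>p\<in>Om' q. \<mu>' q p * of_bool (u \<in> ed' q p \<and> v \<in> ed' q p)) \<le> \<eta>" .
  next
    fix j v assume j: "j < m" and v: "v \<in> V"
    have "(\<Sum>q\<in>Q j. \<Sum>p\<in>Om' q. \<mu>' q p * of_bool (v \<in> ed' q p)) = (\<Sum>q\<in>Q j. (\<Sum>\<omega>\<in>Om q. \<mu> q \<omega> * of_bool (v \<in> ed q \<omega>)) * \<theta> j v)"
      using degv[OF v] J[OF j] by (intro sum.cong refl) auto
    also have "\<dots> = dg j v * \<theta> j v" by (simp only: dg_def sum_distrib_right)
    also have "\<dots> = D j" using dgD[OF j v] D0[of j] j v by (simp add: \<theta>_def)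
    finally show "(\<Sum>q\<in>Q j. \<Sum>p\<in>Om' q. \<mu>' q p * of_bool (v \<in> ed' q p)) = (1 + t) * (1 / \<kappa>) ^ j * ln \<kappa>"
      by (simp add: D_def)
  qed
  then obtain g where g: "\<forall>j<m. \<forall>q\<in>Q j. g q \<in> insert {} (ed' q ` Om' q)"
    "real (card (V - (\<Union>j<m. \<Union>q\<in>Q j. g q))) \<le> 2 * (1 / \<kappa>) ^ m * card V" by blast
  \<comment> \<open>A thinned edge lies in an edge of the original system, and passing to the latter
    can only cover more.\<close>
  have "\<forall>q. \<exists>X. (\<forall>j<m. q \<in> Q j \<longrightarrow> X \<in> insert {} (ed q ` Om q) \<and> g q \<subseteq> X)"
  proof
    fix q
    show "\<exists>X. (\<forall>j<m. q \<in> Q j \<longrightarrow> X \<in> insert {} (ed q ` Om q) \<and> g q \<subseteq> X)"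
    proof (cases "\<exists>j<m. q \<in> Q j \<and> g q \<noteq> {}")
      case True
      then obtain i where "i < m" "q \<in> Q i" "g q \<noteq> {}" by (elim exE conjE)
      hence "g q \<in> ed' q ` Om' q" using g(1)[rule_format, of i q] by simp
      then obtain p where "p \<in> Om' q" "g q = ed' q p" by (rule imageE)
      thus ?thesis by (intro exI[of _ "ed q (fst p)"]) (auto simp: ed'_def Om'_def)
    next
      case False
      thus ?thesis by (intro exI[of _ "{}"]) auto
    qed
  qed
  from choice[OF this] obtain h where
    "\<forall>q. \<forall>j<m. q \<in> Q j \<longrightarrow> h q \<in> insert {} (ed q ` Om q) \<and> g q \<subseteq> h q" ..
  hence h: "h q \<in> insert {} (ed q ` Om q)" "g q \<subseteq> h q" if "j < m" "q \<in> Q j" for j q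
    using that by simp_all
  have "card (V - (\<Union>j<m. \<Union>q\<in>Q j. h q)) \<le> card (V - (\<Union>j<m. \<Union>q\<in>Q j. g q))"
  proof (intro card_mono)
    show "V - (\<Union>j<m. \<Union>q\<in>Q j. h q) \<subseteq> V - (\<Union>j<m. \<Union>q\<in>Q j. g q)"
      using h(2) by fast
  qed (use finV in simp)
  hence "real (card (V - (\<Union>j<m. \<Union>q\<in>Q j. h q))) \<le> 2 * (1 / \<kappa>) ^ m * card V" using g(2) by linarith
  thus ?thesis using h(1) by (intro exI[of _ h]) simp
qed

section \<open>Random residues and conditioned progressions\<close>

definition residue_vectors :: "nat set \<Rightarrow> (nat \<Rightarrow> int) set" where
  "residue_vectors P = PiE P (\<lambda>p. {0..<int p})"

definition sieve_avg :: "nat set \<Rightarrow> ((nat \<Rightarrow> int) \<Rightarrow> real) \<Rightarrow> real" where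
  "sieve_avg P F = (\<Sum>b\<in>residue_vectors P. F b) / (\<Prod>p\<in>P. real p)"

lemma finite_residue_vectors: "finite P \<Longrightarrow> finite (residue_vectors P)"
  unfolding residue_vectors_def by (intro finite_PiE) auto

lemma card_residue_vectors: "finite P \<Longrightarrow> real (card (residue_vectors P)) = (\<Prod>p\<in>P. real p)"
  unfolding residue_vectors_def by (simp add: card_PiE)

lemma sieve_avg_add: "sieve_avg P (\<lambda>b. F b + G b) = sieve_avg P F + sieve_avg P G"
  by (simp add: sieve_avg_def sum.distrib add_divide_distrib)

lemma sieve_avg_diff: "sieve_avg P (\<lambda>b. F b - G b) = sieve_avg P F - sieve_avg P G"
  by (simp add: sieve_avg_def sum_subtractf diff_divide_distrib)

lemma sieve_avg_scale: "sieve_avg P (\<lambda>b. c * F b) = c * sieve_avg P F"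
  by (simp add: sieve_avg_def sum_distrib_left)

lemma sieve_avg_sum: "sieve_avg P (\<lambda>b. \<Sum>i\<in>S. F i b) = (\<Sum>i\<in>S. sieve_avg P (F i))"
  unfolding sieve_avg_def sum_divide_distrib by (subst sum.swap) (simp add: sum_divide_distrib)

lemma sieve_avg_mono:
  "(\<And>b. b \<in> residue_vectors P \<Longrightarrow> F b \<le> G b) \<Longrightarrow> sieve_avg P F \<le> sieve_avg P G"
  unfolding sieve_avg_def by (intro divide_right_mono sum_mono prod_nonneg) auto

lemma sieve_avg_cong:
  "(\<And>b. b \<in> residue_vectors P \<Longrightarrow> F b = G b) \<Longrightarrow> sieve_avg P F = sieve_avg P G"
  unfolding sieve_avg_def by (simp cong: sum.cong)

lemma sieve_avg_const:
  assumes "finite P" "\<And>p. p \<in> P \<Longrightarrow> p > 0"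
  shows "sieve_avg P (\<lambda>_. c) = c"
proof -
  have "(\<Prod>p\<in>P. real p) > 0" using assms by (intro prod_pos) auto
  thus ?thesis using card_residue_vectors[OF assms(1)] by (simp add: sieve_avg_def)
qed

lemma sieve_avg_witness:
  assumes "finite P" "\<And>p. p \<in> P \<Longrightarrow> p > 0"
  shows "\<exists>b\<in>residue_vectors P. F b \<le> sieve_avg P F"
proof (rule ccontr)
  assume "\<not> ?thesis"
  hence gt: "\<And>b. b \<in> residue_vectors P \<Longrightarrow> sieve_avg P F < F b" by force
  have pp: "(\<Prod>p\<in>P. real p) > 0" using assms by (intro prod_pos) auto
  hence ne: "residue_vectors P \<noteq> {}" using card_residue_vectors[OF assms(1)] by (metis card.empty of_nat_0 less_irrefl)
  have "(\<Sum>b\<in>residue_vectors P. sieve_avg P F) < (\<Sum>b\<in>residue_vectors P. F b)"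
    using ne gt finite_residue_vectors[OF assms(1)] by (intro sum_strict_mono) auto
  hence "(\<Prod>p\<in>P. real p) * sieve_avg P F < (\<Sum>b\<in>residue_vectors P. F b)"
    using card_residue_vectors[OF assms(1)] by simp
  thus False using pp by (simp add: sieve_avg_def)
qed

text \<open>Fubini for residue vectors: once the coordinates in \<open>P1\<close> are fixed, those
  in \<open>P2\<close> are independent, so a product over \<open>P2\<close> averages factor by
  factor even if the factors depend on the first coordinates.\<close>

lemma sieve_avg_split:
  assumes fin: "finite P1" "finite P2" and disj: "P1 \<inter> P2 = {}"
  shows "sieve_avg (P1 \<union> P2) (\<lambda>b. f (restrict b P1) * (\<Prod>p\<in>P2. g (restrict b P1) p (b p))) =
     sieve_avg P1 (\<lambda>b. f b * (\<Prod>p\<in>P2. (\<Sum>c\<in>{0..<int p}. g b p c) / real p))"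
proof -
  let ?j = "\<lambda>b. (restrict b P1, restrict b P2)"
  let ?i = "\<lambda>(b1, b2). (\<lambda>p. if p \<in> P1 then b1 p else b2 p)"
  have "(\<Sum>b\<in>residue_vectors (P1 \<union> P2). f (restrict b P1) * (\<Prod>p\<in>P2. g (restrict b P1) p (b p)))
    = (\<Sum>(b1, b2)\<in>residue_vectors P1 \<times> residue_vectors P2. f b1 * (\<Prod>p\<in>P2. g b1 p (b2 p)))"
  proof (rule sum.reindex_bij_witness[where i = ?i and j = ?j])
    fix b assume b: "b \<in> residue_vectors (P1 \<union> P2)"
    show "?i (?j b) = b"
      using b by (auto simp: residue_vectors_def fun_eq_iff PiE_def extensional_def)
    show "?j b \<in> residue_vectors P1 \<times> residue_vectors P2"
      using b by (auto simp: residue_vectors_def)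
    have "(\<Prod>p\<in>P2. g (restrict b P1) p (restrict b P2 p)) = (\<Prod>p\<in>P2. g (restrict b P1) p (b p))"
      by (intro prod.cong refl) auto
    thus "(case ?j b of (b1, b2) \<Rightarrow> f b1 * (\<Prod>p\<in>P2. g b1 p (b2 p))) = f (restrict b P1) * (\<Prod>p\<in>P2. g (restrict b P1) p (b p))"
      by simp
  next
    fix a assume a: "a \<in> residue_vectors P1 \<times> residue_vectors P2"
    obtain b1 b2 where ab: "a = (b1, b2)" by (cases a)
    have b: "b1 \<in> residue_vectors P1" "b2 \<in> residue_vectors P2" using a ab by auto
    have 1: "restrict (?i a) P1 = b1"
      using b ab by (auto simp: residue_vectors_def fun_eq_iff PiE_def extensional_def)
    have 2: "restrict (?i a) P2 = b2"
      using b ab disj by (auto simp: residue_vectors_def fun_eq_iff PiE_def extensional_def)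
    show "?j (?i a) = a" using 1 2 ab by simp
    show "?i a \<in> residue_vectors (P1 \<union> P2)"
      using b ab by (auto simp: residue_vectors_def PiE_def extensional_def Pi_def)
  qed
  also have "\<dots> = (\<Sum>b1\<in>residue_vectors P1. f b1 * (\<Sum>b2\<in>residue_vectors P2. \<Prod>p\<in>P2. g b1 p (b2 p)))"
    by (simp add: sum.cartesian_product[symmetric] sum_distrib_left)
  also have "\<dots> = (\<Sum>b1\<in>residue_vectors P1. f b1 * (\<Prod>p\<in>P2. \<Sum>c\<in>{0..<int p}. g b1 p c))"
    unfolding residue_vectors_def using fin by (simp add: prod_sum_PiE)
  finally show ?thesis
    using fin disj unfolding sieve_avg_def prod_dividef
    by (simp add: prod.union_disjoint sum_divide_distrib mult.commute)
qed

section \<open>Survival probabilities and conditioned weights\<close>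

locale sieve =
  fixes I :: "nat \<Rightarrow> int set" and B Y :: nat and P :: "nat set"
  assumes I_sub: "\<And>p. prime p \<Longrightarrow> I p \<subseteq> {0..<int p}"
    and I_card: "\<And>p. prime p \<Longrightarrow> card (I p) \<le> p - 1" "\<And>p. prime p \<Longrightarrow> card (I p) \<le> B"
    and finP: "finite P" and primeP: "\<And>p. p \<in> P \<Longrightarrow> prime p"
begin

text \<open>\<open>b p\<close> acts as a translation of \<open>I p\<close>: the prime
  \<open>p\<close> removes \<open>n\<close> when \<open>n - b p\<close> lies in \<open>I p\<close>
  modulo \<open>p\<close>. A uniform translation spares all of \<open>A\<close> with probability
  \<open>gd p A\<close>, and independent translations for the primes in \<open>Q\<close> spare a
  single point with probability \<open>sig Q\<close>.\<close>

definition bad :: "nat \<Rightarrow> int set \<Rightarrow> int set" where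
  "bad p A = {c \<in> {0..<int p}. \<exists>a\<in>A. (a - c) mod int p \<in> I p}"

definition gd :: "nat \<Rightarrow> int set \<Rightarrow> real" where
  "gd p A = 1 - real (card (bad p A)) / real p"

definition sig :: "nat set \<Rightarrow> real" where
  "sig Q = (\<Prod>p\<in>Q. 1 - real (card (I p)) / real p)"

definition surv :: "nat set \<Rightarrow> (nat \<Rightarrow> int) \<Rightarrow> int set" where
  "surv Q b = {n \<in> {1..int Y}. \<forall>p\<in>Q. b p \<notin> bad p {n}}"

definition lo :: "real \<Rightarrow> nat set" where "lo w = {p \<in> P. real p \<le> w}"
definition hi :: "real \<Rightarrow> nat set" where "hi w = {p \<in> P. w < real p}"

text \<open>For admissible \<open>w\<close> and given residues in \<open>lo w\<close>, the factors
  are independent with mean 1. Hence \<open>lam\<close> has conditional mean 1 whatever part of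
  \<open>F\<close> is left.\<close>

definition lam :: "real \<Rightarrow> int set \<Rightarrow> (nat \<Rightarrow> int) \<Rightarrow> real" where
  "lam w F b = (\<Prod>p\<in>hi w. if b p \<notin> bad p (F \<inter> surv (lo w) b) then 1 / gd p (F \<inter> surv (lo w) b) else 0)"

lemma lo_hi: "lo w \<union> hi w = P" "lo w \<inter> hi w = {}" "finite (lo w)" "finite (hi w)"
  using finP by (auto simp: lo_def hi_def)

lemma lo_sub: "lo w \<subseteq> P" and hi_sub: "hi w \<subseteq> P" by (auto simp: lo_def hi_def)

lemma finite_bad: "finite (bad p A)"
  by (rule finite_subset[of _ "{0..<int p}"]) (auto simp: bad_def)

lemma bad_Un: "bad p (A \<union> A') = bad p A \<union> bad p A'" by (auto simp: bad_def)

lemma bad_mono: "A \<subseteq> A' \<Longrightarrow> bad p A \<subseteq> bad p A'" by (auto simp: bad_def)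

lemma bad_UN: "bad p A = (\<Union>a\<in>A. bad p {a})" by (auto simp: bad_def)

lemma bad_empty: "bad p {} = {}" by (simp add: bad_def)

lemma finite_I: "prime p \<Longrightarrow> finite (I p)"
  using I_sub finite_subset by blast

lemma card_bad_single:
  assumes "prime p"
  shows "card (bad p {a}) = card (I p)"
proof -
  have p0: "int p > 0" using prime_gt_0_nat[OF assms] by simp
  have "bij_betw (\<lambda>i. (a - i) mod int p) (I p) (bad p {a})"
  proof (rule bij_betw_byWitness[where f' = "\<lambda>c. (a - c) mod int p"])
    show "\<forall>i\<in>I p. (a - (a - i) mod int p) mod int p = i"
      using I_sub[OF assms] by (auto simp: mod_diff_right_eq)
    show "\<forall>c\<in>bad p {a}. (a - (a - c) mod int p) mod int p = c"
      by (auto simp: bad_def mod_diff_right_eq)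
    show "(\<lambda>i. (a - i) mod int p) ` I p \<subseteq> bad p {a}"
      using I_sub[OF assms] p0 by (auto simp: bad_def mod_diff_right_eq)
    show "(\<lambda>c. (a - c) mod int p) ` bad p {a} \<subseteq> I p" by (auto simp: bad_def)
  qed
  thus ?thesis by (simp add: bij_betw_same_card)
qed

lemma card_bad_le:
  assumes "prime p" "finite A"
  shows "card (bad p A) \<le> card A * card (I p)"
proof -
  have "card (bad p A) \<le> (\<Sum>a\<in>A. card (bad p {a}))"
    by (subst bad_UN) (rule card_UN_le[OF assms(2)])
  thus ?thesis by (simp add: card_bad_single[OF assms(1)])
qed

lemma card_bad_le_p: "card (bad p A) \<le> p"
proof -
  have "card (bad p A) \<le> card {0..<int p}" by (intro card_mono) (auto simp: bad_def)
  thus ?thesis by simp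
qed

lemma gd_nonneg: "gd p A \<ge> 0"
  using card_bad_le_p[of p A] by (cases "p = 0") (auto simp: gd_def divide_le_eq)

lemma gd_empty: "gd p {} = 1" by (simp add: gd_def bad_empty)

lemma gd_single: "prime p \<Longrightarrow> gd p {a} = 1 - real (card (I p)) / real p"
  by (simp add: gd_def card_bad_single)

lemma sum_not_bad: "prime p \<Longrightarrow> (\<Sum>c\<in>{0..<int p}. of_bool (c \<notin> bad p A)) / real p = gd p A"
proof -
  assume p: "prime p"
  have "(\<Sum>c\<in>{0..<int p}. of_bool (c \<notin> bad p A)) = real (card ({0..<int p} - bad p A))"
    by (simp add: of_bool_def sum.If_cases set_diff_eq Int_def conj_commute)
  also have "\<dots> = real (p - card (bad p A))"
    by (subst card_Diff_subset) (rule finite_bad, auto simp: bad_def)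
  also have "\<dots> = real p - real (card (bad p A))" using card_bad_le_p by (simp add: of_nat_diff)
  finally show ?thesis using prime_gt_0_nat[OF p] by (simp add: gd_def diff_divide_distrib)
qed

lemma avg_not_bad:
  assumes "prime p"
  shows "(\<Sum>c\<in>{0..<int p}. if c \<notin> bad p A then k else 0) / real p = gd p A * k"
proof -
  have "(\<Sum>c\<in>{0..<int p}. if c \<notin> bad p A then k else 0) = (\<Sum>c\<in>{0..<int p}. of_bool (c \<notin> bad p A)) * k"
    unfolding sum_distrib_right by (intro sum.cong refl) simp
  thus ?thesis using sum_not_bad[OF assms, of A] by (simp only: times_divide_eq_left[symmetric])
qed

lemma factor_pos:
  assumes "prime p" shows "0 < 1 - real (card (I p)) / real p" "1 - real (card (I p)) / real p \<le> 1"
proof -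
  have "card (I p) < p" using I_card(1)[OF assms] prime_gt_0_nat[OF assms] by linarith
  thus "0 < 1 - real (card (I p)) / real p" by simp
qed simp

lemma sig_pos: "Q \<subseteq> P \<Longrightarrow> sig Q > 0"
  unfolding sig_def using factor_pos(1) primeP by (auto intro!: prod_pos)

lemma sig_le_1: "Q \<subseteq> P \<Longrightarrow> sig Q \<le> 1"
  unfolding sig_def using factor_pos primeP by (intro prod_le_1 conjI less_imp_le[OF factor_pos(1)] factor_pos(2)) auto

lemma sig_split: "sig P = sig (lo w) * sig (hi w)"
  using prod.union_disjoint[OF lo_hi(3,4,2), of "\<lambda>p. 1 - real (card (I p)) / real p" w]
  unfolding sig_def lo_hi(1) .

lemma surv_restrict: "surv (lo w) (restrict b (lo w)) = surv (lo w) b"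
  by (auto simp: surv_def)

lemma surv_split: "surv P b = {n \<in> surv (lo w) b. \<forall>p\<in>hi w. b p \<notin> bad p {n}}"
  using lo_hi(1)[of w] by (auto simp: surv_def)

lemma surv_prob:
  assumes C: "C \<subseteq> {1..int Y}" and Q: "Q \<subseteq> P"
  shows "sieve_avg Q (\<lambda>b. of_bool (C \<subseteq> surv Q b)) = (\<Prod>p\<in>Q. gd p C)"
proof -
  have fQ: "finite Q" using Q finP finite_subset by blast
  have "(of_bool (C \<subseteq> surv Q b) :: real) = (\<Prod>p\<in>Q. of_bool (b p \<notin> bad p C))" for b
  proof -
    have "C \<subseteq> surv Q b \<longleftrightarrow> (\<forall>p\<in>Q. b p \<notin> bad p C)"
      using C by (auto simp: surv_def bad_def)
    thus ?thesis using fQ by (cases "\<forall>p\<in>Q. b p \<notin> bad p C") (auto simp: of_bool_def)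
  qed
  hence "sieve_avg Q (\<lambda>b. of_bool (C \<subseteq> surv Q b)) = sieve_avg ({} \<union> Q) (\<lambda>b. 1 * (\<Prod>p\<in>Q. of_bool (b p \<notin> bad p C)))"
    by simp
  also have "\<dots> = sieve_avg {} (\<lambda>b. 1 * (\<Prod>p\<in>Q. (\<Sum>c\<in>{0..<int p}. of_bool (c \<notin> bad p C)) / real p))"
    using sieve_avg_split[of "{}" Q "\<lambda>_. 1" "\<lambda>_ p c. of_bool (c \<notin> bad p C)"] fQ by simp
  also have "\<dots> = (\<Prod>p\<in>Q. (\<Sum>c\<in>{0..<int p}. of_bool (c \<notin> bad p C)) / real p)"
    by (simp only: mult_1_left) (rule sieve_avg_const, auto)
  also have "\<dots> = (\<Prod>p\<in>Q. gd p C)"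
    using Q primeP by (intro prod.cong refl sum_not_bad) auto
  finally show ?thesis .
qed

lemma surv_single_prob:
  assumes "s \<in> {1..int Y}" shows "sieve_avg P (\<lambda>b. of_bool (s \<in> surv P b)) = sig P"
  using surv_prob[of "{s}" P] assms by (simp add: sig_def gd_single primeP cong: prod.cong)

text \<open>For primes above \<open>w\<close> at most half of all residues are then bad for a set of
  at most \<open>T\<close> points, so no factor of \<open>lam\<close> exceeds 2.\<close>

definition admissible :: "real \<Rightarrow> nat \<Rightarrow> bool" where
  "admissible w T \<longleftrightarrow> 2 * real T * real B \<le> w \<and> w > 0"

lemma gd_ge_half:
  assumes "admissible w T" "p \<in> hi w" "finite A" "card A \<le> T"
  shows "gd p A \<ge> 1 / 2"
proof -
  have p: "prime p" "w < real p" using assms(2) primeP by (auto simp: hi_def)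
  have "card (bad p A) \<le> T * B"
    using card_bad_le[OF p(1) assms(3)] I_card(2)[OF p(1)] assms(4) by (meson le_trans mult_le_mono)
  hence "real (card (bad p A)) \<le> real T * real B" by (metis of_nat_le_iff of_nat_mult)
  hence "2 * real (card (bad p A)) \<le> real p" using assms(1) p(2) by (simp add: admissible_def)
  thus ?thesis using p(2) assms(1) by (simp add: gd_def admissible_def field_simps)
qed

lemma lam_nonneg: "lam w F b \<ge> 0"
  unfolding lam_def using gd_nonneg by (intro prod_nonneg) auto

text \<open>Survivors at the small primes determine \<open>A\<close>; averaging over the large primes is exact since
  \<open>lam\<close> is normalised by the true probability that \<open>A\<close> survives them.\<close>

lemma lam_first_moment:
  assumes F: "F \<subseteq> {1..int Y}" "card F \<le> T" and adm: "admissible w T" and C: "C \<subseteq> F"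
  shows "sieve_avg P (\<lambda>b. of_bool (C \<subseteq> surv P b) * lam w F b) = (\<Prod>p\<in>lo w. gd p C)"
proof -
  define A where "A = (\<lambda>b. F \<inter> surv (lo w) b)"
  have finF: "finite F" using F finite_subset by blast
  have Ab: "finite (A b)" "card (A b) \<le> T" for b
    using finF F card_mono[OF finF, of "A b"] by (auto simp: A_def)
  have AR: "A (restrict b (lo w)) = A b" for b by (simp add: A_def surv_restrict)
  let ?g = "\<lambda>b p c. if c \<notin> bad p (A b) then 1 / gd p (A b) else 0"
  have "sieve_avg P (\<lambda>b. of_bool (C \<subseteq> surv P b) * lam w F b) =
     sieve_avg (lo w \<union> hi w) (\<lambda>b. of_bool (C \<subseteq> surv (lo w) (restrict b (lo w))) * (\<Prod>p\<in>hi w. ?g (restrict b (lo w)) p (b p)))"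
    unfolding lo_hi(1)
  proof (rule sieve_avg_cong)
    fix b
    have lam: "lam w F b = (\<Prod>p\<in>hi w. ?g b p (b p))" by (simp only: lam_def A_def)
    \<comment> \<open>Survival of \<open>C\<close> at the large primes is automatic: one that
      removes a point of \<open>C\<close> left by the small primes makes \<open>lam\<close>
      zero.\<close>
    have "of_bool (C \<subseteq> surv P b) * lam w F b = of_bool (C \<subseteq> surv (lo w) b) * lam w F b"
    proof (cases "C \<subseteq> surv (lo w) b \<and> \<not> C \<subseteq> surv P b")
      case True
      then obtain n p where np: "n \<in> C" "p \<in> hi w" "b p \<in> bad p {n}"
        unfolding surv_split[of b w] by blast
      have "n \<in> A b" using np True C by (auto simp: A_def)
      hence "b p \<in> bad p (A b)" using np bad_mono[of "{n}" "A b" p] by auto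
      hence "lam w F b = 0" unfolding lam using np lo_hi(4) by (intro prod_zero) auto
      thus ?thesis by simp
    qed (use surv_split[of b w] in auto)
    thus "of_bool (C \<subseteq> surv P b) * lam w F b = of_bool (C \<subseteq> surv (lo w) (restrict b (lo w))) * (\<Prod>p\<in>hi w. ?g (restrict b (lo w)) p (b p))"
      by (simp only: AR surv_restrict lam)
  qed
  also have "\<dots> = sieve_avg (lo w) (\<lambda>b. of_bool (C \<subseteq> surv (lo w) b) * (\<Prod>p\<in>hi w. (\<Sum>c\<in>{0..<int p}. ?g b p c) / real p))"
    by (rule sieve_avg_split[OF lo_hi(3,4,2)])
  also have "\<dots> = sieve_avg (lo w) (\<lambda>b. of_bool (C \<subseteq> surv (lo w) b))"
  proof (rule sieve_avg_cong)
    fix b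
    have "(\<Sum>c\<in>{0..<int p}. ?g b p c) / real p = 1" if p: "p \<in> hi w" for p
    proof -
      have pr: "prime p" using p primeP hi_sub by blast
      show ?thesis unfolding avg_not_bad[OF pr] using gd_ge_half[OF adm p Ab, of b] by simp
    qed
    hence "(\<Prod>p\<in>hi w. (\<Sum>c\<in>{0..<int p}. ?g b p c) / real p) = 1" by (intro prod.neutral ballI)
    thus "of_bool (C \<subseteq> surv (lo w) b) * (\<Prod>p\<in>hi w. (\<Sum>c\<in>{0..<int p}. ?g b p c) / real p) = of_bool (C \<subseteq> surv (lo w) b)"
      by (simp only: mult_1_right)
  qed
  also have "\<dots> = (\<Prod>p\<in>lo w. gd p C)" using C F lo_sub by (intro surv_prob) auto
  finally show ?thesis .
qed

text \<open>Residues bad for both sets but not for \<open>C\<close> are the only source of positive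
  correlation. Without them inclusion-exclusion gives gd p (A \<union> A') * gd p C \<le> gd p A *
  gd p A', because (\<alpha> - \<gamma>) (\<alpha>' - \<gamma>) is nonnegative. Their proportion
  \<open>\<kappa>\<close> is absorbed into exp (4 * \<kappa>), both \<open>gd p A\<close> and
  \<open>gd p A'\<close> being at least 1/2.\<close>

lemma gd_pair_ratio:
  assumes adm: "admissible w T" and p: "p \<in> hi w"
    and A: "finite A" "card A \<le> T" and A': "finite A'" "card A' \<le> T" and C: "C \<subseteq> A" "C \<subseteq> A'"
  shows "gd p (A \<union> A') * gd p C \<le> exp (4 * real (card (bad p A \<inter> bad p A' - bad p C)) / real p) * (gd p A * gd p A')"
proof -
  define \<alpha> \<alpha>' \<gamma> \<kappa> where "\<alpha> = real (card (bad p A)) / real p" and "\<alpha>' = real (card (bad p A')) / real p"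
    and "\<gamma> = real (card (bad p C)) / real p" and "\<kappa> = real (card (bad p A \<inter> bad p A' - bad p C)) / real p"
  have p0: "real p > 0" using p primeP hi_sub prime_gt_0_nat by (metis of_nat_0_less_iff subsetD)
  have h: "1 - \<alpha> \<ge> 1 / 2" "1 - \<alpha>' \<ge> 1 / 2"
    using gd_ge_half[OF adm p A] gd_ge_half[OF adm p A'] by (simp_all add: gd_def \<alpha>_def \<alpha>'_def)
  have "card (bad p C) \<le> card (bad p A)" "card (bad p C) \<le> card (bad p A')"
    using C by (auto intro!: card_mono finite_bad bad_mono)
  hence \<gamma>: "0 \<le> \<gamma>" "\<gamma> \<le> \<alpha>" "\<gamma> \<le> \<alpha>'"
    using p0 by (auto simp: \<gamma>_def \<alpha>_def \<alpha>'_def divide_right_mono)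
  have \<kappa>0: "\<kappa> \<ge> 0" by (simp add: \<kappa>_def)
  have c1: "card (bad p A \<union> bad p A') + card (bad p A \<inter> bad p A') = card (bad p A) + card (bad p A')"
    using card_Un_Int[OF finite_bad finite_bad] by simp
  have "card (bad p A \<inter> bad p A') \<le> card ((bad p A \<inter> bad p A' - bad p C) \<union> bad p C)"
    by (intro card_mono) (auto simp: finite_bad)
  also have "\<dots> \<le> card (bad p A \<inter> bad p A' - bad p C) + card (bad p C)" by (rule card_Un_le)
  finally have "real (card (bad p A)) + real (card (bad p A')) \<le> real (card (bad p A \<union> bad p A')) + real (card (bad p A \<inter> bad p A' - bad p C)) + real (card (bad p C))"
    using c1 by linarith
  hence "\<alpha> + \<alpha>' \<le> real (card (bad p A \<union> bad p A')) / real p + \<kappa> + \<gamma>"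
    unfolding \<alpha>_def \<alpha>'_def \<kappa>_def \<gamma>_def add_divide_distrib[symmetric] using p0 by (intro divide_right_mono) auto
  hence "gd p (A \<union> A') \<le> 1 - \<alpha> - \<alpha>' + \<gamma> + \<kappa>" by (simp add: gd_def bad_Un)
  hence "gd p (A \<union> A') * (1 - \<gamma>) \<le> (1 - \<alpha> - \<alpha>' + \<gamma> + \<kappa>) * (1 - \<gamma>)"
    using \<gamma> h by (intro mult_right_mono) auto
  also have "\<dots> = (1 - \<alpha>) * (1 - \<alpha>') - (\<alpha> - \<gamma>) * (\<alpha>' - \<gamma>) + \<kappa> * (1 - \<gamma>)" by (simp add: algebra_simps)
  also have "\<dots> \<le> (1 - \<alpha>) * (1 - \<alpha>') + \<kappa>"
  proof -
    have "(\<alpha> - \<gamma>) * (\<alpha>' - \<gamma>) \<ge> 0" using \<gamma> by (intro mult_nonneg_nonneg) auto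
    moreover have "\<kappa> * (1 - \<gamma>) \<le> \<kappa>" using \<gamma> \<kappa>0 by (intro mult_left_le) auto
    ultimately show ?thesis by linarith
  qed
  also have "\<dots> \<le> (1 - \<alpha>) * (1 - \<alpha>') * (1 + 4 * \<kappa>)"
  proof -
    have "1 / 2 * (1 / 2) \<le> (1 - \<alpha>) * (1 - \<alpha>')" using h by (intro mult_mono) auto
    hence "1 * \<kappa> \<le> (4 * ((1 - \<alpha>) * (1 - \<alpha>'))) * \<kappa>" using \<kappa>0 by (intro mult_right_mono) auto
    thus ?thesis by (simp add: algebra_simps)
  qed
  also have "\<dots> \<le> (1 - \<alpha>) * (1 - \<alpha>') * exp (4 * \<kappa>)"
    using h by (intro mult_left_mono exp_ge_add_one_self mult_nonneg_nonneg) auto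
  finally show ?thesis by (simp add: gd_def \<alpha>_def \<alpha>'_def \<gamma>_def \<kappa>_def mult_ac)
qed

text \<open>The link to \<open>num_diff_primes\<close>: a single translation of \<open>I p\<close>
  that hits both \<open>a\<close> and \<open>a'\<close> puts their difference into a difference
  class.\<close>

lemma bad_coincidence:
  assumes p: "prime p" and c: "c \<in> bad p A" "c \<in> bad p A'" "c \<notin> bad p C"
  shows "\<exists>a\<in>A - C. \<exists>a'\<in>A' - C. c \<in> bad p {a} \<and> p \<in> diff_primes I (a - a')"
proof -
  obtain a a' where a: "a \<in> A" "(a - c) mod int p \<in> I p" and a': "a' \<in> A'" "(a' - c) mod int p \<in> I p"
    using c by (auto simp: bad_def)
  have cp: "c \<in> {0..<int p}" using c by (simp add: bad_def)
  have "a \<notin> C" "a' \<notin> C" using c a a' cp by (auto simp: bad_def)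
  moreover have "(a - a') mod int p = ((a - c) mod int p - (a' - c) mod int p) mod int p"
    by (simp add: mod_diff_eq)
  hence "(a - a') mod int p \<in> diff_classes p (I p)" unfolding diff_classes_def using a a' by blast
  ultimately show ?thesis using a a' cp p by (auto simp: diff_primes_def bad_def)
qed

text \<open>Finiteness is demanded because \<open>num_diff_primes\<close> is 0 for an infinite set.
  In particular a common point of \<open>F\<close> and \<open>F'\<close> outside \<open>C\<close> is
  excluded as soon as infinitely many \<open>I p\<close> are nonempty, since its difference with
  itself is 0.\<close>

definition good_pair :: "nat \<Rightarrow> int set \<Rightarrow> int set \<Rightarrow> int set \<Rightarrow> bool" where
  "good_pair k C F F' \<longleftrightarrow> (\<forall>a\<in>F - C. \<forall>a'\<in>F' - C.
     finite (diff_primes I (a - a')) \<and> num_diff_primes I (a - a') \<le> k)"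

text \<open>Each pair of points is responsible for at most \<open>k\<close> primes, all larger than
  \<open>w\<close>, and for at most \<open>B\<close> residues at each of them; there are at most
  \<open>T * T\<close> pairs.\<close>

lemma coincidence_sum:
  assumes F: "finite F" "card F \<le> T" "finite F'" "card F' \<le> T" and A: "A \<subseteq> F" "A' \<subseteq> F'"
    and good: "good_pair k C F F'" and w: "w > 0"
  shows "(\<Sum>p\<in>hi w. real (card (bad p A \<inter> bad p A' - bad p C)) / real p) \<le> real B * (real T)\<^sup>2 * real k / w"
proof -
  let ?d = "\<lambda>a a'. diff_primes I (a - a')"
  have finA: "finite A" "finite A'" using F A finite_subset by blast+
  have "(\<Sum>p\<in>hi w. real (card (bad p A \<inter> bad p A' - bad p C)) / real p)
     \<le> (\<Sum>p\<in>hi w. (\<Sum>a\<in>A - C. \<Sum>a'\<in>A' - C. real B * of_bool (p \<in> ?d a a')) / w)"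
  proof (rule sum_mono)
    fix p assume "p \<in> hi w"
    hence p: "prime p" "w < real p" using primeP by (auto simp: hi_def)
    have "bad p A \<inter> bad p A' - bad p C \<subseteq> (\<Union>a\<in>A - C. \<Union>a'\<in>A' - C. if p \<in> ?d a a' then bad p {a} else {})"
    proof
      fix c assume "c \<in> bad p A \<inter> bad p A' - bad p C"
      then obtain a a' where "a \<in> A - C" "a' \<in> A' - C" "c \<in> bad p {a}" "p \<in> ?d a a'"
        using bad_coincidence[OF p(1), of c A A' C] by auto
      thus "c \<in> (\<Union>a\<in>A - C. \<Union>a'\<in>A' - C. if p \<in> ?d a a' then bad p {a} else {})" by auto
    qed
    hence "card (bad p A \<inter> bad p A' - bad p C) \<le> card (\<Union>a\<in>A - C. \<Union>a'\<in>A' - C. if p \<in> ?d a a' then bad p {a} else {})"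
      using finA by (intro card_mono) (auto intro!: finite_UN_I finite_bad)
    also have "\<dots> \<le> (\<Sum>a\<in>A - C. card (\<Union>a'\<in>A' - C. if p \<in> ?d a a' then bad p {a} else {}))"
      using finA by (intro card_UN_le) auto
    also have "\<dots> \<le> (\<Sum>a\<in>A - C. \<Sum>a'\<in>A' - C. card (if p \<in> ?d a a' then bad p {a} else {}))"
      using finA by (intro sum_mono card_UN_le) auto
    also have "\<dots> \<le> (\<Sum>a\<in>A - C. \<Sum>a'\<in>A' - C. B * of_bool (p \<in> ?d a a'))"
      using card_bad_single[OF p(1)] I_card(2)[OF p(1)] by (intro sum_mono) auto
    finally have le: "real (card (bad p A \<inter> bad p A' - bad p C)) \<le> (\<Sum>a\<in>A - C. \<Sum>a'\<in>A' - C. real B * of_bool (p \<in> ?d a a'))"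
      by (simp only: of_nat_le_iff[symmetric, where 'a=real] of_nat_sum of_nat_mult of_nat_of_bool)
    show "real (card (bad p A \<inter> bad p A' - bad p C)) / real p \<le> (\<Sum>a\<in>A - C. \<Sum>a'\<in>A' - C. real B * of_bool (p \<in> ?d a a')) / w"
      using le p w by (intro frac_le) auto
  qed
  also have "\<dots> = (\<Sum>a\<in>A - C. \<Sum>a'\<in>A' - C. real B * (\<Sum>p\<in>hi w. of_bool (p \<in> ?d a a'))) / w"
    unfolding sum_divide_distrib[symmetric] sum_distrib_left
    by (subst sum.swap, rule arg_cong[where f = "\<lambda>x. x / w"], rule sum.cong[OF refl], rule sum.swap)
  also have "\<dots> \<le> (\<Sum>a\<in>A - C. \<Sum>a'\<in>A' - C. real B * real k) / w"
  proof (intro divide_right_mono sum_mono mult_left_mono)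
    fix a a' assume aa: "a \<in> A - C" "a' \<in> A' - C"
    have fd: "finite (?d a a')" "card (?d a a') \<le> k"
      using good aa A by (auto simp: good_pair_def num_diff_primes_def)
    have "(\<Sum>p\<in>hi w. of_bool (p \<in> ?d a a')) = real (card (hi w \<inter> ?d a a'))"
      using lo_hi(4) by (simp add: of_bool_def sum.If_cases Int_def)
    also have "\<dots> \<le> real k" using card_mono[OF fd(1), of "hi w \<inter> ?d a a'"] fd(2) by simp
    finally show "(\<Sum>p\<in>hi w. of_bool (p \<in> ?d a a')) \<le> real k" .
  qed (use w in auto)
  also have "\<dots> = real (card (A - C)) * real (card (A' - C)) * (real B * real k) / w" by simp
  also have "\<dots> \<le> real T * real T * (real B * real k) / w"
  proof (intro divide_right_mono mult_right_mono mult_mono)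
    have "card (A - C) \<le> card F" "card (A' - C) \<le> card F'" using A F by (auto intro!: card_mono)
    thus "real (card (A - C)) \<le> real T" "real (card (A' - C)) \<le> real T" using F by linarith+
  qed (use w in auto)
  finally show ?thesis by (simp add: power2_eq_square mult_ac)
qed

text \<open>After conditioning on the primes up to \<open>w\<close> the two products are compared
  prime by prime. For \<open>C\<close> = {s} the main term is (sig (lo w))^2 / sig P, the square of
  the first moment divided by the probability that \<open>s\<close> survives: given this survival,
  the upper bound shows almost no positive correlation between the weights.\<close>

lemma lam_second_moment:
  assumes F: "F \<subseteq> {1..int Y}" "card F \<le> T" and F': "F' \<subseteq> {1..int Y}" "card F' \<le> T"
    and adm: "admissible w T" and C: "C \<subseteq> F" "C \<subseteq> F'" and Cpos: "\<And>p. p \<in> P \<Longrightarrow> gd p C > 0"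
    and good: "good_pair k C F F'"
  shows "sieve_avg P (\<lambda>b. of_bool (C \<subseteq> surv P b) * (lam w F b * lam w F' b))
     \<le> exp (4 * (real B * (real T)\<^sup>2 * real k / w)) * ((\<Prod>p\<in>lo w. gd p C) / (\<Prod>p\<in>hi w. gd p C))"
proof -
  define A where "A = (\<lambda>b. F \<inter> surv (lo w) b)"
  define A' where "A' = (\<lambda>b. F' \<inter> surv (lo w) b)"
  have finF: "finite F" "finite F'" using F F' finite_subset by blast+
  have Ab: "finite (A b)" "card (A b) \<le> T" for b
    using finF F card_mono[OF finF(1), of "A b"] by (auto simp: A_def)
  have Ab': "finite (A' b)" "card (A' b) \<le> T" for b
    using finF F' card_mono[OF finF(2), of "A' b"] by (auto simp: A'_def)
  have AR: "A (restrict b (lo w)) = A b" "A' (restrict b (lo w)) = A' b" for b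
    by (simp_all add: A_def A'_def surv_restrict)
  define X where "X = exp (4 * (real B * (real T)\<^sup>2 * real k / w))"
  let ?g = "\<lambda>b p c. if c \<notin> bad p (A b \<union> A' b) then 1 / (gd p (A b) * gd p (A' b)) else 0"
  have w0: "w > 0" using adm by (simp add: admissible_def)
  have "sieve_avg P (\<lambda>b. of_bool (C \<subseteq> surv P b) * (lam w F b * lam w F' b)) \<le>
     sieve_avg (lo w \<union> hi w) (\<lambda>b. of_bool (C \<subseteq> surv (lo w) (restrict b (lo w))) * (\<Prod>p\<in>hi w. ?g (restrict b (lo w)) p (b p)))"
    unfolding lo_hi(1)
  proof (rule sieve_avg_mono)
    fix b
    have lam: "lam w F b * lam w F' b = (\<Prod>p\<in>hi w. ?g b p (b p))"
      unfolding lam_def A_def A'_def prod.distrib[symmetric]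
      by (intro prod.cong refl) (auto simp: bad_Un)
    have "of_bool (C \<subseteq> surv P b) \<le> (of_bool (C \<subseteq> surv (lo w) b) :: real)"
      using surv_split[of b w] by auto
    hence "of_bool (C \<subseteq> surv P b) * (lam w F b * lam w F' b) \<le> of_bool (C \<subseteq> surv (lo w) b) * (lam w F b * lam w F' b)"
      by (intro mult_right_mono mult_nonneg_nonneg lam_nonneg)
    thus "of_bool (C \<subseteq> surv P b) * (lam w F b * lam w F' b) \<le> of_bool (C \<subseteq> surv (lo w) (restrict b (lo w))) * (\<Prod>p\<in>hi w. ?g (restrict b (lo w)) p (b p))"
      by (simp only: AR surv_restrict lam)
  qed
  also have "\<dots> = sieve_avg (lo w) (\<lambda>b. of_bool (C \<subseteq> surv (lo w) b) * (\<Prod>p\<in>hi w. (\<Sum>c\<in>{0..<int p}. ?g b p c) / real p))"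
    by (rule sieve_avg_split[OF lo_hi(3,4,2)])
  also have "\<dots> \<le> sieve_avg (lo w) (\<lambda>b. (X / (\<Prod>p\<in>hi w. gd p C)) * of_bool (C \<subseteq> surv (lo w) b))"
  proof (rule sieve_avg_mono)
    fix b
    show "of_bool (C \<subseteq> surv (lo w) b) * (\<Prod>p\<in>hi w. (\<Sum>c\<in>{0..<int p}. ?g b p c) / real p) \<le> (X / (\<Prod>p\<in>hi w. gd p C)) * of_bool (C \<subseteq> surv (lo w) b)"
    proof (cases "C \<subseteq> surv (lo w) b")
      case True
      have CA: "C \<subseteq> A b" "C \<subseteq> A' b" using True C by (auto simp: A_def A'_def)
      let ?e = "\<lambda>p. real (card (bad p (A b) \<inter> bad p (A' b) - bad p C)) / real p"
      have "(\<Prod>p\<in>hi w. (\<Sum>c\<in>{0..<int p}. ?g b p c) / real p) \<le> (\<Prod>p\<in>hi w. exp (4 * ?e p) / gd p C)"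
      proof (rule prod_mono)
        fix p assume p: "p \<in> hi w"
        have pr: "prime p" using p primeP hi_sub by blast
        have g: "gd p (A b) > 0" "gd p (A' b) > 0" using gd_ge_half[OF adm p Ab, of b] gd_ge_half[OF adm p Ab', of b] by linarith+
        have gC: "gd p C > 0" using p hi_sub Cpos by blast
        have eq: "(\<Sum>c\<in>{0..<int p}. ?g b p c) / real p = gd p (A b \<union> A' b) / (gd p (A b) * gd p (A' b))"
          unfolding avg_not_bad[OF pr] by simp
        have "gd p (A b \<union> A' b) * gd p C \<le> exp (4 * ?e p) * (gd p (A b) * gd p (A' b))"
          using gd_pair_ratio[OF adm p Ab Ab' CA] by simp
        hence "gd p (A b \<union> A' b) / (gd p (A b) * gd p (A' b)) \<le> exp (4 * ?e p) / gd p C"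
          using g gC by (simp add: divide_le_eq le_divide_eq mult_ac)
        thus "0 \<le> (\<Sum>c\<in>{0..<int p}. ?g b p c) / real p \<and> (\<Sum>c\<in>{0..<int p}. ?g b p c) / real p \<le> exp (4 * ?e p) / gd p C"
          unfolding eq using gd_nonneg[of p] by simp
      qed
      also have "\<dots> = exp (4 * (\<Sum>p\<in>hi w. ?e p)) / (\<Prod>p\<in>hi w. gd p C)"
        using lo_hi(4) by (simp add: prod_dividef exp_sum sum_distrib_left)
      also have "\<dots> \<le> X / (\<Prod>p\<in>hi w. gd p C)"
      proof (rule divide_right_mono)
        have "(\<Sum>p\<in>hi w. ?e p) \<le> real B * (real T)\<^sup>2 * real k / w"
          using finF F F' good w0 by (intro coincidence_sum) (auto simp: A_def A'_def)
        thus "exp (4 * (\<Sum>p\<in>hi w. ?e p)) \<le> X" by (simp add: X_def)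
      qed (intro prod_nonneg gd_nonneg)
      finally show ?thesis using True by simp
    qed simp
  qed
  also have "\<dots> = (X / (\<Prod>p\<in>hi w. gd p C)) * (\<Prod>p\<in>lo w. gd p C)"
    unfolding sieve_avg_scale using C F lo_sub by (subst surv_prob) auto
  finally show ?thesis by (simp add: X_def)
qed

text \<open>A converse of Bernoulli's inequality at the price of a doubled exponent. It allows
  \<open>gd\<close> of a set to be bounded below by a power of the factor for one point.\<close>

lemma power_le_one_minus:
  fixes u :: real assumes "0 \<le> u" "real n * u \<le> 1 / 2" "u \<le> 1"
  shows "(1 - u) ^ (2 * n) \<le> 1 - real n * u"
proof -
  define v where "v = real n * u"
  have v: "0 \<le> v" "v \<le> 1 / 2" using assms by (auto simp: v_def)
  have "(1 - u) ^ (2 * n) \<le> exp (- u) ^ (2 * n)"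
    using assms exp_ge_add_one_self[of "- u"] by (intro power_mono) auto
  also have "\<dots> = exp (- (2 * v))" by (simp add: exp_of_nat_mult[symmetric] v_def)
  also have "\<dots> \<le> 1 / (1 + 2 * v)"
    using exp_ge_add_one_self[of "2 * v"] v by (simp add: exp_minus inverse_eq_divide frac_le)
  also have "\<dots> \<le> 1 - v"
  proof -
    have "2 * v * v \<le> 1 * v" using v by (intro mult_right_mono) auto
    hence "1 \<le> (1 - v) * (1 + 2 * v)" by (simp add: algebra_simps)
    thus ?thesis using v by (simp add: pos_divide_le_eq)
  qed
  finally show ?thesis by (simp add: v_def)
qed

text \<open>A prime \<open>p\<close> spares the at most \<open>T\<close> points with probability at
  least 1 - T u, where u = card (I p) / p, and this exceeds the power 2 T of 1 - u. The crude bound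
  serves where moments do not help: for exceptional pairs of progressions and for the largest weight
  of an edge.\<close>

lemma lam_le:
  assumes F: "F \<subseteq> {1..int Y}" "card F \<le> T" and adm: "admissible w T"
  shows "lam w F b \<le> (1 / sig P) ^ (2 * T)"
proof -
  define A where "A = F \<inter> surv (lo w) b"
  have finF: "finite F" using F finite_subset by blast
  have A: "finite A" "card A \<le> T"
    using finF F card_mono[OF finF, of A] by (auto simp: A_def)
  have "lam w F b \<le> (\<Prod>p\<in>hi w. (1 / (1 - real (card (I p)) / real p)) ^ (2 * T))"
    unfolding lam_def A_def[symmetric]
  proof (rule prod_mono)
    fix p assume p: "p \<in> hi w"
    have pr: "prime p" "w < real p" using p primeP by (auto simp: hi_def)
    define u where "u = real (card (I p)) / real p"
    have p0: "real p > 0" using prime_gt_0_nat[OF pr(1)] by simp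
    have u: "0 \<le> u" "u < 1" using factor_pos[OF pr(1)] by (auto simp: u_def)
    have "2 * (real T * real (card (I p))) \<le> 2 * (real T * real B)"
      using I_card(2)[OF pr(1)] by (intro mult_left_mono) auto
    also have "\<dots> \<le> real p" using adm pr by (simp add: admissible_def)
    finally have Tu: "real T * u \<le> 1 / 2" using p0 by (simp add: u_def field_simps)
    have "real (card (bad p A)) \<le> real T * real (card (I p))"
      using card_bad_le[OF pr(1) A(1)] A(2) by (metis le_trans mult_le_mono1 of_nat_le_iff of_nat_mult)
    hence "real (card (bad p A)) / real p \<le> real T * u"
      using p0 by (simp add: u_def divide_right_mono)
    hence "(1 - u) ^ (2 * T) \<le> gd p A"
      using power_le_one_minus[OF u(1) Tu] u by (simp add: gd_def)
    moreover have "(1 - u) ^ (2 * T) > 0" using u by simp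
    ultimately have "1 / gd p A \<le> 1 / (1 - u) ^ (2 * T)" "0 \<le> 1 / gd p A" "0 < (1 - u) ^ (2 * T)"
      using gd_nonneg[of p A] by (auto intro!: frac_le)
    thus "0 \<le> (if b p \<notin> bad p A then 1 / gd p A else 0) \<and>
         (if b p \<notin> bad p A then 1 / gd p A else 0) \<le> (1 / (1 - real (card (I p)) / real p)) ^ (2 * T)"
      by (auto simp: u_def[symmetric] power_one_over)
  qed
  also have "\<dots> = (1 / sig (hi w)) ^ (2 * T)"
    by (simp add: prod_power_distrib[symmetric] sig_def prod_dividef)
  also have "\<dots> \<le> (1 / sig P) ^ (2 * T)"
  proof (intro power_mono frac_le)
    show "sig P \<le> sig (hi w)"
      unfolding sig_split[of w] using sig_le_1[OF lo_sub] sig_pos[OF hi_sub] by (simp add: mult_le_cancel_right1)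
    show "0 < sig P" by (intro sig_pos) auto
    show "0 \<le> 1 / sig (hi w)" using sig_pos[OF hi_sub, of w] by simp
  qed auto
  finally show ?thesis .
qed

end

section \<open>Progressions removed by a single prime\<close>

lemma card_residue_class_le:
  assumes "q > 0"
  shows "card {n \<in> {1..int Y}. n mod int q = c} \<le> Y div q + 1"
proof -
  have "inj_on (\<lambda>n. n div int q) {n \<in> {1..int Y}. n mod int q = c}"
  proof (rule inj_onI)
    fix m n assume "m \<in> {n \<in> {1..int Y}. n mod int q = c}" "n \<in> {n \<in> {1..int Y}. n mod int q = c}" "m div int q = n div int q"
    thus "m = n" using mult_div_mod_eq[of "int q" m] mult_div_mod_eq[of "int q" n] by simp
  qed
  moreover have "(\<lambda>n. n div int q) ` {n \<in> {1..int Y}. n mod int q = c} \<subseteq> {0..int (Y div q)}"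
    using assms by (auto simp: zdiv_int zdiv_mono1 pos_imp_zdiv_nonneg_iff)
  ultimately have "card {n \<in> {1..int Y}. n mod int q = c} \<le> card {0..int (Y div q)}"
    by (intro card_inj_on_le) auto
  thus ?thesis by simp
qed

context sieve begin

definition prog :: "nat \<Rightarrow> int \<Rightarrow> int set" where
  "prog q r = {n \<in> {1..int Y}. (n - r) mod int q \<in> I q}"

lemma prog_sub: "prog q r \<subseteq> {1..int Y}" by (auto simp: prog_def)

lemma finite_prog: "finite (prog q r)" using prog_sub finite_subset by blast

lemma mem_prog_iff: "s \<in> {1..int Y} \<Longrightarrow> r \<in> {0..<int q} \<Longrightarrow> s \<in> prog q r \<longleftrightarrow> r \<in> bad q {s}"
  by (auto simp: prog_def bad_def)

lemma bad_imp_prog: "s \<in> {1..int Y} \<Longrightarrow> r \<in> bad q {s} \<Longrightarrow> s \<in> prog q r"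
  by (auto simp: prog_def bad_def)

lemma card_prog_le:
  assumes q: "prime q"
  shows "card (prog q r) \<le> card (I q) * (Y div q + 1)"
proof -
  have q0: "q > 0" using prime_gt_0_nat[OF q] .
  have "prog q r \<subseteq> (\<Union>i\<in>I q. {n \<in> {1..int Y}. n mod int q = (r + i) mod int q})"
  proof
    fix n assume n: "n \<in> prog q r"
    have "n mod int q = (r + (n - r) mod int q) mod int q" by (simp add: mod_add_right_eq)
    thus "n \<in> (\<Union>i\<in>I q. {n \<in> {1..int Y}. n mod int q = (r + i) mod int q})"
      using n by (auto simp: prog_def)
  qed
  hence "card (prog q r) \<le> card (\<Union>i\<in>I q. {n \<in> {1..int Y}. n mod int q = (r + i) mod int q})"
    using finite_I[OF q] by (intro card_mono finite_UN_I) (auto intro: finite_subset[of _ "{1..int Y}"])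
  also have "\<dots> \<le> (\<Sum>i\<in>I q. card {n \<in> {1..int Y}. n mod int q = (r + i) mod int q})"
    by (rule card_UN_le[OF finite_I[OF q]])
  also have "\<dots> \<le> (\<Sum>i\<in>I q. Y div q + 1)" by (intro sum_mono card_residue_class_le q0)
  finally show ?thesis by simp
qed

lemma prog_diff_class:
  assumes "a \<in> prog q r" "s \<in> prog q r"
  shows "(a - s) mod int q \<in> diff_classes q (I q)"
proof -
  have "(a - s) mod int q = ((a - r) mod int q - (s - r) mod int q) mod int q"
    by (simp add: mod_diff_eq)
  thus ?thesis using assms unfolding diff_classes_def prog_def by blast
qed

lemma zero_diff_class: "card (I q) \<ge> 1 \<Longrightarrow> 0 \<in> diff_classes q (I q)"
proof -
  assume "card (I q) \<ge> 1"
  then obtain i where "i \<in> I q" by (metis card.empty not_one_le_zero ex_in_conv)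
  thus ?thesis unfolding diff_classes_def by (intro CollectI exI[of _ i]) auto
qed

end

text \<open>The primes \<open>q \<in> J\<close> remove progressions; \<open>n1\<close> and \<open>n2\<close> are the bounds supplied by (f) and (g).\<close>

locale sieve_level = sieve +
  fixes w H :: real and T k0 :: nat and J :: "nat set" and n1 n2 :: real
  assumes adm: "admissible w T" and finJ: "finite J"
    and J: "\<And>q. q \<in> J \<Longrightarrow> prime q \<and> card (I q) \<ge> 1 \<and> q \<le> Y \<and> real Y / H \<le> real q"
    and JT: "\<And>q. q \<in> J \<Longrightarrow> B * (Y div q + 1) \<le> T"
    and H1: "H \<ge> 1" and Y1: "Y \<ge> 1" and cardJ: "card J \<le> Y"
    and N1: "\<And>v. v \<noteq> 0 \<Longrightarrow> finite (diff_primes I v)"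
            "\<And>v. v \<noteq> 0 \<Longrightarrow> \<bar>v\<bar> \<le> int Y \<Longrightarrow> real (num_diff_primes I v) \<le> n1"
    and N2: "\<And>m u. (\<And>q. prime q \<Longrightarrow> card (I q) \<ge> 1 \<Longrightarrow> m q \<noteq> 0 \<and> m q mod int q \<in> diff_classes q (I q)) \<Longrightarrow>
       \<bar>u\<bar> \<le> 2 * int Y \<Longrightarrow>
       finite {q. prime q \<and> card (I q) \<ge> 1 \<and> 0 < \<bar>m q\<bar> \<and> \<bar>m q\<bar> \<le> 2 * int Y \<and> m q + u \<noteq> 0 \<and> num_diff_primes I (m q + u) \<ge> k0 + 1}
       \<and> real (card {q. prime q \<and> card (I q) \<ge> 1 \<and> 0 < \<bar>m q\<bar> \<and> \<bar>m q\<bar> \<le> 2 * int Y \<and> m q + u \<noteq> 0 \<and> num_diff_primes I (m q + u) \<ge> k0 + 1}) \<le> n2"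
begin

text \<open>\<open>lvl_err\<close> is the relative excess allowed in second moments of good pairs
  and \<open>lvl_max\<close> the pointwise bound for \<open>lam\<close>. \<open>lvl_deg\<close> is
  the mean of the degree \<open>dg s\<close> conditioned on the survival of
  \<open>s\<close>.\<close>

definition lvl_err :: real where "lvl_err = exp (4 * (real B * (real T)\<^sup>2 * real k0 / w)) - 1"
definition lvl_max :: real where "lvl_max = (1 / sig P) ^ (2 * T)"
definition lvl_sum :: real where "lvl_sum = (\<Sum>q\<in>J. real (card (I q)) / real q)"
definition lvl_deg :: real where "lvl_deg = lvl_sum * sig (lo w) / sig P"

definition dg :: "int \<Rightarrow> (nat \<Rightarrow> int) \<Rightarrow> real" where
  "dg s b = (\<Sum>q\<in>J. \<Sum>r\<in>bad q {s}. lam w (prog q r) b / real q)"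

definition wt :: "nat \<Rightarrow> (nat \<Rightarrow> int) \<Rightarrow> real" where
  "wt q b = (\<Sum>r\<in>{0..<int q}. lam w (prog q r) b) / real q"

section \<open>Second moments of the degrees\<close>

lemma primeJ: "q \<in> J \<Longrightarrow> prime q" and q0: "q \<in> J \<Longrightarrow> real q > 0"
  using J prime_gt_0_nat by auto

lemma IJ: "q \<in> J \<Longrightarrow> 1 \<le> card (I q)" "q \<in> J \<Longrightarrow> card (I q) \<le> B"
  using J I_card(2) by auto

lemma progT: "q \<in> J \<Longrightarrow> card (prog q r) \<le> T"
  using card_prog_le[OF primeJ, of q r] JT[of q] IJ(2)[of q] by (meson le_trans mult_le_mono1)

lemma inv_q_le: "q \<in> J \<Longrightarrow> 1 / real q \<le> H / real Y"
proof -
  assume q: "q \<in> J"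
  have "real Y / H \<le> real q" using J[OF q] by simp
  hence "1 / real q \<le> 1 / (real Y / H)" using q0[OF q] H1 Y1 by (intro divide_left_mono) auto
  thus ?thesis by simp
qed

lemma sigP: "sig P > 0" by (rule sig_pos) simp

lemma lvl_max_ge_1: "lvl_max \<ge> 1"
  unfolding lvl_max_def using sigP sig_le_1[of P] by (intro one_le_power) simp

lemma lvl_err_nonneg: "lvl_err \<ge> 0"
  using adm by (simp add: lvl_err_def admissible_def)

lemma lam_bounds: "q \<in> J \<Longrightarrow> 0 \<le> lam w (prog q r) b \<and> lam w (prog q r) b \<le> lvl_max"
  using lam_nonneg lam_le[OF prog_sub progT adm] by (simp add: lvl_max_def)

lemma n2_nonneg: "n2 \<ge> 0"
proof -
  have mok: "(int q \<noteq> 0) \<and> int q mod int q \<in> diff_classes q (I q)" if "prime q" "card (I q) \<ge> 1" for q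
    using that zero_diff_class prime_gt_0_nat[of q] by auto
  have z: "\<bar>0 :: int\<bar> \<le> 2 * int Y" by simp
  show ?thesis by (rule order_trans[OF of_nat_0_le_iff conjunct2[OF N2[of int 0, OF mok z]]])
qed

lemma n1_nonneg: "n1 \<ge> 0"
proof -
  have "real (num_diff_primes I 1) \<le> n1" using Y1 by (intro N1) auto
  thus ?thesis by (rule order_trans[OF of_nat_0_le_iff])
qed

text \<open>For fixed \<open>q'\<close> there are at most \<open>B * T\<close> points
  \<open>a'\<close> to consider. If a point \<open>a\<close> of a progression of \<open>q\<close>
  through \<open>s\<close> equals \<open>a'\<close>, then \<open>q\<close> is among the primes
  counted by N(a' - s), hence the term \<open>n1\<close>. Otherwise N(a - a') is large, and with m_q
  = a - s and the shift s - a' such \<open>q\<close> are counted by (g), hence the term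
  \<open>n2\<close>.\<close>

lemma not_good_pair_count:
  assumes s: "s \<in> {1..int Y}" and q': "q' \<in> J"
  shows "real (card {q \<in> J. \<not> (\<forall>r\<in>bad q {s}. \<forall>r'\<in>bad q' {s}. good_pair k0 {s} (prog q r) (prog q' r'))})
           \<le> real B * real T * (n1 + n2)"
proof -
  define N where "N = (\<Union>r'\<in>bad q' {s}. prog q' r') - {s}"
  define R where "R = (\<lambda>a' q a. (\<exists>r\<in>bad q {s}. a \<in> prog q r) \<and> a \<noteq> s \<and> a \<noteq> a' \<and> num_diff_primes I (a - a') \<ge> k0 + 1)"
  \<comment> \<open>(g) wants a value at every prime with nonempty \<open>I q\<close>. The default
    \<open>int q\<close> is nonzero and lies in the class 0, which is always a difference
    class.\<close>
  define m where "m = (\<lambda>a' q. if \<exists>a. R a' q a then (SOME a. R a' q a) - s else int q)"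
  define S where "S = (\<lambda>a'. {q. prime q \<and> card (I q) \<ge> 1 \<and> 0 < \<bar>m a' q\<bar> \<and> \<bar>m a' q\<bar> \<le> 2 * int Y \<and> m a' q + (s - a') \<noteq> 0 \<and> num_diff_primes I (m a' q + (s - a')) \<ge> k0 + 1})"
  have finN: "finite N" unfolding N_def using finite_bad finite_prog by auto
  have N_U: "a' \<in> {1..int Y} \<and> a' \<noteq> s" if "a' \<in> N" for a'
    using that prog_sub unfolding N_def by blast
  have Rm: "R a' q (m a' q + s)" if "R a' q a" for a' q a
  proof -
    have "R a' q (SOME a. R a' q a)" using that by (rule someI)
    thus ?thesis using that by (auto simp: m_def)
  qed
  have mok: "m a' q \<noteq> 0 \<and> m a' q mod int q \<in> diff_classes q (I q)" if q: "prime q" "card (I q) \<ge> 1" for a' q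
  proof (cases "\<exists>a. R a' q a")
    case True
    then obtain a where "R a' q a" ..
    hence Rq: "R a' q (m a' q + s)" by (rule Rm)
    then obtain r where r: "r \<in> bad q {s}" "m a' q + s \<in> prog q r" by (auto simp: R_def)
    have "(m a' q + s - s) mod int q \<in> diff_classes q (I q)"
      by (rule prog_diff_class[OF r(2) bad_imp_prog[OF s r(1)]])
    thus ?thesis using Rq by (auto simp: R_def)
  next
    case False
    have "m a' q = int q" by (simp only: m_def if_not_P[OF False])
    thus ?thesis using zero_diff_class[OF q(2)] prime_gt_0_nat[OF q(1)] by simp
  qed
  have S: "finite (S a') \<and> real (card (S a')) \<le> n2" if "a' \<in> N" for a'
    unfolding S_def using N_U[OF that] s by (intro N2 mok) auto
  have D: "finite (diff_primes I (a' - s)) \<and> real (card (diff_primes I (a' - s))) \<le> n1" if "a' \<in> N" for a'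
    using N1[of "a' - s"] N_U[OF that] s by (auto simp: num_diff_primes_def)
  have "{q \<in> J. \<not> (\<forall>r\<in>bad q {s}. \<forall>r'\<in>bad q' {s}. good_pair k0 {s} (prog q r) (prog q' r'))}
     \<subseteq> (\<Union>a'\<in>N. diff_primes I (a' - s) \<union> S a')"
  proof
    fix q assume "q \<in> {q \<in> J. \<not> (\<forall>r\<in>bad q {s}. \<forall>r'\<in>bad q' {s}. good_pair k0 {s} (prog q r) (prog q' r'))}"
    then obtain r r' a a' where q: "q \<in> J" and r: "r \<in> bad q {s}" "r' \<in> bad q' {s}"
      and a: "a \<in> prog q r - {s}" "a' \<in> prog q' r' - {s}"
      and no: "\<not> (finite (diff_primes I (a - a')) \<and> num_diff_primes I (a - a') \<le> k0)"
      by (auto simp: good_pair_def)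
    have a'N: "a' \<in> N" using r a by (auto simp: N_def)
    show "q \<in> (\<Union>a'\<in>N. diff_primes I (a' - s) \<union> S a')"
    proof (cases "a = a'")
      case True
      have "(a - s) mod int q \<in> diff_classes q (I q)"
        using a bad_imp_prog[OF s r(1)] by (intro prog_diff_class) auto
      hence "q \<in> diff_primes I (a' - s)" using primeJ[OF q] True by (simp add: diff_primes_def)
      thus ?thesis using a'N by blast
    next
      case False
      have "R a' q a" using r a no False N1(1)[of "a - a'"] by (auto simp: R_def)
      hence Rq: "R a' q (m a' q + s)" by (rule Rm)
      then obtain r1 where "m a' q + s \<in> prog q r1" by (auto simp: R_def)
      hence mU0: "m a' q + s \<in> {1..int Y}" using prog_sub by blast
      have mU: "m a' q + s \<noteq> s" "m a' q + s \<noteq> a'" "num_diff_primes I (m a' q + s - a') \<ge> k0 + 1"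
        using Rq by (auto simp: R_def)
      have "q \<in> S a'" unfolding S_def using mU0 mU s J[OF q] by (auto simp: algebra_simps)
      thus ?thesis using a'N by blast
    qed
  qed
  hence "card {q \<in> J. \<not> (\<forall>r\<in>bad q {s}. \<forall>r'\<in>bad q' {s}. good_pair k0 {s} (prog q r) (prog q' r'))}
     \<le> card (\<Union>a'\<in>N. diff_primes I (a' - s) \<union> S a')"
    using finN S D by (intro card_mono) auto
  also have "\<dots> \<le> (\<Sum>a'\<in>N. card (diff_primes I (a' - s) \<union> S a'))" by (rule card_UN_le[OF finN])
  finally have "real (card {q \<in> J. \<not> (\<forall>r\<in>bad q {s}. \<forall>r'\<in>bad q' {s}. good_pair k0 {s} (prog q r) (prog q' r'))})
     \<le> (\<Sum>a'\<in>N. real (card (diff_primes I (a' - s) \<union> S a')))" by (simp only: of_nat_le_iff of_nat_sum[symmetric])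
  also have "\<dots> \<le> (\<Sum>a'\<in>N. n1 + n2)"
  proof (rule sum_mono)
    fix a' assume a': "a' \<in> N"
    have "real (card (diff_primes I (a' - s) \<union> S a')) \<le> real (card (diff_primes I (a' - s))) + real (card (S a'))"
      using card_Un_le[of "diff_primes I (a' - s)" "S a'"] by linarith
    thus "real (card (diff_primes I (a' - s) \<union> S a')) \<le> n1 + n2" using S[OF a'] D[OF a'] by linarith
  qed
  also have "\<dots> = real (card N) * (n1 + n2)" by simp
  also have "\<dots> \<le> real B * real T * (n1 + n2)"
  proof (rule mult_right_mono)
    have "card N \<le> card (\<Union>r'\<in>bad q' {s}. prog q' r')"
      unfolding N_def using finite_bad finite_prog by (intro card_mono) auto
    also have "\<dots> \<le> (\<Sum>r'\<in>bad q' {s}. card (prog q' r'))" by (rule card_UN_le[OF finite_bad])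
    also have "\<dots> \<le> (\<Sum>r'\<in>bad q' {s}. T)" by (intro sum_mono progT q')
    also have "\<dots> \<le> B * T" using card_bad_single[OF primeJ[OF q'], of s] IJ[OF q'] by simp
    finally show "real (card N) \<le> real B * real T" by (metis of_nat_le_iff of_nat_mult)
  qed (use n1_nonneg n2_nonneg in simp)
  finally show ?thesis .
qed

lemma degree_mean:
  assumes s: "s \<in> {1..int Y}"
  shows "sieve_avg P (\<lambda>b. of_bool (s \<in> surv P b) * dg s b) = lvl_deg * sig P"
proof -
  have m1: "sieve_avg P (\<lambda>b. of_bool (s \<in> surv P b) * lam w (prog q r) b) = sig (lo w)"
    if q: "q \<in> J" and r: "r \<in> bad q {s}" for q r
  proof -
    have "sieve_avg P (\<lambda>b. of_bool ({s} \<subseteq> surv P b) * lam w (prog q r) b) = (\<Prod>p\<in>lo w. gd p {s})"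
      using bad_imp_prog[OF s r] by (intro lam_first_moment[OF prog_sub progT[OF q] adm]) auto
    also have "\<dots> = sig (lo w)"
      unfolding sig_def using lo_sub primeP by (intro prod.cong refl gd_single) auto
    finally show ?thesis by simp
  qed
  have "sieve_avg P (\<lambda>b. of_bool (s \<in> surv P b) * dg s b) =
     sieve_avg P (\<lambda>b. \<Sum>q\<in>J. \<Sum>r\<in>bad q {s}. (1 / real q) * (of_bool (s \<in> surv P b) * lam w (prog q r) b))"
    unfolding dg_def sum_distrib_left by (intro sieve_avg_cong sum.cong refl) simp
  also have "\<dots> = (\<Sum>q\<in>J. \<Sum>r\<in>bad q {s}. (1 / real q) * sig (lo w))"
    unfolding sieve_avg_sum sieve_avg_scale using m1 by (intro sum.cong refl) simp
  also have "\<dots> = (\<Sum>q\<in>J. real (card (I q)) / real q * sig (lo w))"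
    using card_bad_single[OF primeJ] by (intro sum.cong refl) simp
  also have "\<dots> = lvl_deg * sig P"
    using sigP unfolding lvl_deg_def lvl_sum_def sum_distrib_right[symmetric] by simp
  finally show ?thesis .
qed

text \<open>Good pairs of primes give the square of the mean up to the factor
  \<open>1 + lvl_err\<close>. For the others one weight is bounded by \<open>lvl_max\<close> and the
  other has mean 1; there are at most card J * B T (n1 + n2) of them, each of weight at most (B H /
  Y)^2, which with card J \<le> Y gives the second term.\<close>

lemma degree_variance:
  assumes s: "s \<in> {1..int Y}"
  shows "sieve_avg P (\<lambda>b. of_bool (s \<in> surv P b) * (dg s b - lvl_deg)\<^sup>2)
     \<le> lvl_err * lvl_deg\<^sup>2 * sig P + (real B)\<^sup>2 * lvl_max * (H\<^sup>2 / real Y) * (real B * real T * (n1 + n2))"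
proof -
  define G where "G = (\<lambda>q q'. \<forall>r\<in>bad q {s}. \<forall>r'\<in>bad q' {s}. good_pair k0 {s} (prog q r) (prog q' r'))"
  define V where "V = (1 + lvl_err) * ((sig (lo w))\<^sup>2 / sig P)"
  have V0: "V \<ge> 0" using lvl_err_nonneg sigP by (simp add: V_def)
  have hi_lo: "sig (lo w) / sig (hi w) = (sig (lo w))\<^sup>2 / sig P"
    using sig_pos[OF lo_sub, of w] sig_pos[OF hi_sub, of w] unfolding sig_split[of w] by (simp add: power2_eq_square)
  have m2: "sieve_avg P (\<lambda>b. of_bool (s \<in> surv P b) * (lam w (prog q r) b * lam w (prog q' r') b)) \<le> V + of_bool (\<not> G q q') * lvl_max"
    if q: "q \<in> J" "q' \<in> J" and r: "r \<in> bad q {s}" "r' \<in> bad q' {s}" for q q' r r'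
  proof (cases "G q q'")
    case True
    have "sieve_avg P (\<lambda>b. of_bool ({s} \<subseteq> surv P b) * (lam w (prog q r) b * lam w (prog q' r') b))
       \<le> exp (4 * (real B * (real T)\<^sup>2 * real k0 / w)) * ((\<Prod>p\<in>lo w. gd p {s}) / (\<Prod>p\<in>hi w. gd p {s}))"
      using True r bad_imp_prog[OF s r(1)] bad_imp_prog[OF s r(2)] gd_single primeP factor_pos
      by (intro lam_second_moment prog_sub progT adm q) (auto simp: G_def)
    also have "(\<Prod>p\<in>lo w. gd p {s}) = sig (lo w)"
      unfolding sig_def using lo_sub primeP by (intro prod.cong refl gd_single) auto
    also have "(\<Prod>p\<in>hi w. gd p {s}) = sig (hi w)"
      unfolding sig_def using hi_sub primeP by (intro prod.cong refl gd_single) auto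
    finally show ?thesis using True by (simp add: V_def lvl_err_def hi_lo)
  next
    case False
    have "sieve_avg P (\<lambda>b. of_bool (s \<in> surv P b) * (lam w (prog q r) b * lam w (prog q' r') b)) \<le>
       sieve_avg P (\<lambda>b. lvl_max * (of_bool ({} \<subseteq> surv P b) * lam w (prog q' r') b))"
    proof (rule sieve_avg_mono)
      fix b
      have "lam w (prog q r) b * lam w (prog q' r') b \<le> lvl_max * lam w (prog q' r') b"
        using lam_bounds[OF q(1), of r b] lam_bounds[OF q(2), of r' b] by (intro mult_right_mono) auto
      moreover have "0 \<le> lvl_max * lam w (prog q' r') b"
        using lvl_max_ge_1 lam_bounds[OF q(2), of r' b] by simp
      ultimately show "of_bool (s \<in> surv P b) * (lam w (prog q r) b * lam w (prog q' r') b)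
        \<le> lvl_max * (of_bool ({} \<subseteq> surv P b) * lam w (prog q' r') b)"
        by (cases "s \<in> surv P b") auto
    qed
    also have "\<dots> = lvl_max * (\<Prod>p\<in>lo w. gd p {})"
      unfolding sieve_avg_scale using lam_first_moment[OF prog_sub progT[OF q(2)] adm, of "{}" r'] by simp
    finally show ?thesis using False V0 by (simp add: gd_empty)
  qed
  have sq: "sieve_avg P (\<lambda>b. of_bool (s \<in> surv P b) * (dg s b)\<^sup>2) \<le>
     V * lvl_sum\<^sup>2 + (real B)\<^sup>2 * lvl_max * (H\<^sup>2 / real Y) * (real B * real T * (n1 + n2))"
  proof -
    have "sieve_avg P (\<lambda>b. of_bool (s \<in> surv P b) * (dg s b)\<^sup>2) =
      sieve_avg P (\<lambda>b. \<Sum>q\<in>J. \<Sum>q'\<in>J. \<Sum>r\<in>bad q {s}. \<Sum>r'\<in>bad q' {s}.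
        (1 / real q * (1 / real q')) * (of_bool (s \<in> surv P b) * (lam w (prog q r) b * lam w (prog q' r') b)))"
    proof (rule sieve_avg_cong)
      fix b
      have "(dg s b)\<^sup>2 = (\<Sum>q\<in>J. \<Sum>q'\<in>J. \<Sum>r\<in>bad q {s}. \<Sum>r'\<in>bad q' {s}.
        (lam w (prog q r) b / real q) * (lam w (prog q' r') b / real q'))"
        unfolding dg_def power2_eq_square by (simp only: sum_product)
      thus "of_bool (s \<in> surv P b) * (dg s b)\<^sup>2 = (\<Sum>q\<in>J. \<Sum>q'\<in>J. \<Sum>r\<in>bad q {s}. \<Sum>r'\<in>bad q' {s}.
        (1 / real q * (1 / real q')) * (of_bool (s \<in> surv P b) * (lam w (prog q r) b * lam w (prog q' r') b)))"
        by (simp only: sum_distrib_left) (intro sum.cong refl, simp)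
    qed
    also have "\<dots> = (\<Sum>q\<in>J. \<Sum>q'\<in>J. \<Sum>r\<in>bad q {s}. \<Sum>r'\<in>bad q' {s}.
        (1 / real q * (1 / real q')) * sieve_avg P (\<lambda>b. of_bool (s \<in> surv P b) * (lam w (prog q r) b * lam w (prog q' r') b)))"
      unfolding sieve_avg_sum sieve_avg_scale ..
    also have "\<dots> \<le> (\<Sum>q\<in>J. \<Sum>q'\<in>J. \<Sum>r\<in>bad q {s}. \<Sum>r'\<in>bad q' {s}.
        (1 / real q * (1 / real q')) * (V + of_bool (\<not> G q q') * lvl_max))"
      by (intro sum_mono mult_left_mono m2) auto
    also have "\<dots> = (\<Sum>q\<in>J. \<Sum>q'\<in>J. (real (card (I q)) / real q * (real (card (I q')) / real q')) * (V + of_bool (\<not> G q q') * lvl_max))"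
      using card_bad_single[OF primeJ] by (intro sum.cong refl) simp
    also have "\<dots> = (\<Sum>q\<in>J. \<Sum>q'\<in>J. (real (card (I q)) / real q * (real (card (I q')) / real q')) * V)
       + (\<Sum>q\<in>J. \<Sum>q'\<in>J. (real (card (I q)) / real q * (real (card (I q')) / real q')) * (of_bool (\<not> G q q') * lvl_max))"
      by (simp only: distrib_left sum.distrib)
    also have "(\<Sum>q\<in>J. \<Sum>q'\<in>J. (real (card (I q)) / real q * (real (card (I q')) / real q')) * V) = V * lvl_sum\<^sup>2"
      unfolding sum_distrib_right[symmetric] sum_product[symmetric] lvl_sum_def power2_eq_square by (simp only: mult.commute)
    also have "(\<Sum>q\<in>J. \<Sum>q'\<in>J. (real (card (I q)) / real q * (real (card (I q')) / real q')) * (of_bool (\<not> G q q') * lvl_max))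
      \<le> (\<Sum>q\<in>J. \<Sum>q'\<in>J. (real B * (H / real Y) * (real B * (H / real Y))) * (of_bool (\<not> G q q') * lvl_max))"
    proof (intro sum_mono mult_right_mono mult_mono)
      have *: "real (card (I q)) / real q \<le> real B * (H / real Y)" if "q \<in> J" for q
      proof -
        have "real (card (I q)) * (1 / real q) \<le> real B * (H / real Y)"
          using IJ[OF that] inv_q_le[OF that] by (intro mult_mono) auto
        thus ?thesis by simp
      qed
      fix q q' assume "q \<in> J" "q' \<in> J"
      thus "real (card (I q)) / real q \<le> real B * (H / real Y)" "real (card (I q')) / real q' \<le> real B * (H / real Y)"
        using * by auto
    qed (use H1 lvl_max_ge_1 in auto)
    also have "\<dots> = (\<Sum>q'\<in>J. real (card {q \<in> J. \<not> G q q'}) * ((real B * (H / real Y) * (real B * (H / real Y))) * lvl_max))"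
    proof -
      have cnt: "(\<Sum>q\<in>J. k * (of_bool (\<not> G q q') * lvl_max)) = real (card {q \<in> J. \<not> G q q'}) * (k * lvl_max)" for q' and k :: real
      proof -
        have "(\<Sum>q\<in>J. k * (of_bool (\<not> G q q') * lvl_max)) = (\<Sum>q\<in>J. of_bool (\<not> G q q')) * (k * lvl_max)"
          unfolding sum_distrib_right by (intro sum.cong refl) (simp add: mult_ac)
        also have "(\<Sum>q\<in>J. of_bool (\<not> G q q')) = real (card {q \<in> J. \<not> G q q'})"
          using finJ by (simp add: of_bool_def sum.If_cases Int_def)
        finally show ?thesis .
      qed
      show ?thesis by (subst sum.swap) (simp only: cnt)
    qed
    also have "\<dots> \<le> (\<Sum>q'\<in>J. (real B * real T * (n1 + n2)) * ((real B * (H / real Y) * (real B * (H / real Y))) * lvl_max))"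
      using not_good_pair_count[OF s] H1 lvl_max_ge_1
      by (intro sum_mono mult_right_mono) (auto simp: G_def)
    also have "\<dots> = real (card J) * ((real B * real T * (n1 + n2)) * ((real B * (H / real Y) * (real B * (H / real Y))) * lvl_max))" by simp
    also have "\<dots> \<le> real Y * ((real B * real T * (n1 + n2)) * ((real B * (H / real Y) * (real B * (H / real Y))) * lvl_max))"
    proof (intro mult_right_mono)
      show "0 \<le> (real B * real T * (n1 + n2)) * ((real B * (H / real Y) * (real B * (H / real Y))) * lvl_max)"
        by (intro mult_nonneg_nonneg add_nonneg_nonneg n1_nonneg n2_nonneg) (use H1 lvl_max_ge_1 in auto)
    qed (use cardJ in simp)
    also have "\<dots> = (real B)\<^sup>2 * lvl_max * (H\<^sup>2 / real Y) * (real B * real T * (n1 + n2))"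
      using Y1 by (simp add: power2_eq_square)
    finally show ?thesis by simp
  qed
  have "sieve_avg P (\<lambda>b. of_bool (s \<in> surv P b) * (dg s b - lvl_deg)\<^sup>2) =
     sieve_avg P (\<lambda>b. of_bool (s \<in> surv P b) * (dg s b)\<^sup>2) - 2 * lvl_deg * sieve_avg P (\<lambda>b. of_bool (s \<in> surv P b) * dg s b)
      + lvl_deg\<^sup>2 * sieve_avg P (\<lambda>b. of_bool (s \<in> surv P b))"
    unfolding sieve_avg_scale[symmetric] sieve_avg_diff[symmetric] sieve_avg_add[symmetric]
    by (intro sieve_avg_cong) (simp add: power2_diff algebra_simps)
  also have "\<dots> = sieve_avg P (\<lambda>b. of_bool (s \<in> surv P b) * (dg s b)\<^sup>2) - lvl_deg\<^sup>2 * sig P"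
    unfolding degree_mean[OF s] surv_single_prob[OF s] by (simp add: power2_eq_square)
  also have "V * lvl_sum\<^sup>2 = (1 + lvl_err) * lvl_deg\<^sup>2 * sig P"
    using sigP by (simp add: V_def lvl_deg_def power2_eq_square)
  hence "sieve_avg P (\<lambda>b. of_bool (s \<in> surv P b) * (dg s b)\<^sup>2) - lvl_deg\<^sup>2 * sig P \<le>
     lvl_err * lvl_deg\<^sup>2 * sig P + (real B)\<^sup>2 * lvl_max * (H\<^sup>2 / real Y) * (real B * real T * (n1 + n2))"
    using sq by (simp add: algebra_simps)
  finally show ?thesis .
qed

section \<open>Second moments of the index weights\<close>

definition bad_rr :: "nat \<Rightarrow> (int \<times> int) set" where
  "bad_rr q = {(r, r') \<in> {0..<int q} \<times> {0..<int q}. \<not> good_pair k0 {} (prog q r) (prog q r')}"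

lemma index_mean: "q \<in> J \<Longrightarrow> sieve_avg P (wt q) = 1"
proof -
  assume q: "q \<in> J"
  have m1: "sieve_avg P (\<lambda>b. lam w (prog q r) b) = 1" for r
    using lam_first_moment[OF prog_sub progT[OF q] adm, of "{}" r] by (simp add: gd_empty)
  have "sieve_avg P (wt q) = sieve_avg P (\<lambda>b. 1 / real q * (\<Sum>r\<in>{0..<int q}. lam w (prog q r) b))"
    unfolding wt_def by (intro sieve_avg_cong) simp
  also have "\<dots> = 1" unfolding sieve_avg_scale sieve_avg_sum using m1 q0[OF q] by simp
  finally show ?thesis .
qed

text \<open>The case of empty \<open>C\<close>: good pairs of residues contribute at most
  \<open>1 + lvl_err\<close>, and a pair in \<open>bad_rr\<close> contributes an additional
  \<open>lvl_max\<close> at most.\<close>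

lemma index_variance:
  assumes q: "q \<in> J"
  shows "sieve_avg P (\<lambda>b. (wt q b - 1)\<^sup>2) \<le> lvl_err + lvl_max * real (card (bad_rr q)) / (real q)\<^sup>2"
proof -
  have Ppos: "p > 0" if "p \<in> P" for p using primeP[OF that] prime_gt_0_nat by blast
  have m2: "sieve_avg P (\<lambda>b. lam w (prog q r) b * lam w (prog q r') b) \<le> (1 + lvl_err) + of_bool ((r, r') \<in> bad_rr q) * lvl_max"
    if r: "r \<in> {0..<int q}" "r' \<in> {0..<int q}" for r r'
  proof (cases "(r, r') \<in> bad_rr q")
    case False
    hence "good_pair k0 {} (prog q r) (prog q r')" using r by (auto simp: bad_rr_def)
    hence "sieve_avg P (\<lambda>b. of_bool ({} \<subseteq> surv P b) * (lam w (prog q r) b * lam w (prog q r') b))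
       \<le> exp (4 * (real B * (real T)\<^sup>2 * real k0 / w)) * ((\<Prod>p\<in>lo w. gd p {}) / (\<Prod>p\<in>hi w. gd p {}))"
      by (intro lam_second_moment prog_sub progT adm q) (auto simp: gd_empty)
    thus ?thesis using False by (simp add: lvl_err_def gd_empty)
  next
    case True
    have "sieve_avg P (\<lambda>b. lam w (prog q r) b * lam w (prog q r') b) \<le> sieve_avg P (\<lambda>b. lvl_max * lam w (prog q r') b)"
      using lam_bounds[OF q] by (intro sieve_avg_mono mult_right_mono) auto
    also have "\<dots> = lvl_max"
      unfolding sieve_avg_scale using lam_first_moment[OF prog_sub progT[OF q] adm, of "{}" r'] by (simp add: gd_empty)
    finally show ?thesis using True lvl_err_nonneg by simp
  qed
  let ?R = "{0..<int q}"
  have "sieve_avg P (\<lambda>b. (wt q b)\<^sup>2) = sieve_avg P (\<lambda>b. (1 / (real q)\<^sup>2) * (\<Sum>r\<in>?R. \<Sum>r'\<in>?R. lam w (prog q r) b * lam w (prog q r') b))"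
    unfolding wt_def by (intro sieve_avg_cong) (simp add: power2_eq_square sum_product)
  also have "\<dots> = (1 / (real q)\<^sup>2) * (\<Sum>r\<in>?R. \<Sum>r'\<in>?R. sieve_avg P (\<lambda>b. lam w (prog q r) b * lam w (prog q r') b))"
    unfolding sieve_avg_scale sieve_avg_sum ..
  also have "\<dots> \<le> (1 / (real q)\<^sup>2) * (\<Sum>r\<in>?R. \<Sum>r'\<in>?R. (1 + lvl_err) + of_bool ((r, r') \<in> bad_rr q) * lvl_max)"
    by (intro mult_left_mono sum_mono m2) auto
  also have "(\<Sum>r\<in>?R. \<Sum>r'\<in>?R. (1 + lvl_err) + of_bool ((r, r') \<in> bad_rr q) * lvl_max) = (real q)\<^sup>2 * (1 + lvl_err) + real (card (bad_rr q)) * lvl_max"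
  proof -
    have "(\<Sum>r\<in>?R. \<Sum>r'\<in>?R. of_bool ((r, r') \<in> bad_rr q) :: real) = (\<Sum>p\<in>?R \<times> ?R. of_bool (p \<in> bad_rr q))"
      unfolding sum.cartesian_product by (intro sum.cong refl) auto
    also have "\<dots> = real (card ((?R \<times> ?R) \<inter> bad_rr q))" by (simp add: of_bool_def sum.If_cases Int_def)
    also have "(?R \<times> ?R) \<inter> bad_rr q = bad_rr q" by (auto simp: bad_rr_def)
    finally show ?thesis
      by (simp add: sum.distrib sum_distrib_right[symmetric] power2_eq_square)
  qed
  also have "(1 / (real q)\<^sup>2) * \<dots> = 1 + lvl_err + lvl_max * real (card (bad_rr q)) / (real q)\<^sup>2"
    using q0[OF q] by (simp add: field_simps)
  finally have m: "sieve_avg P (\<lambda>b. (wt q b)\<^sup>2) \<le> 1 + lvl_err + lvl_max * real (card (bad_rr q)) / (real q)\<^sup>2" .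
  have "sieve_avg P (\<lambda>b. (wt q b - 1)\<^sup>2) = sieve_avg P (\<lambda>b. (wt q b)\<^sup>2) - 2 * sieve_avg P (wt q) + sieve_avg P (\<lambda>b. 1)"
    unfolding sieve_avg_scale[symmetric] sieve_avg_diff[symmetric] sieve_avg_add[symmetric]
    by (intro sieve_avg_cong) (simp add: power2_diff)
  thus ?thesis using m index_mean[OF q] sieve_avg_const[OF finP Ppos, of 1] by simp
qed

definition exc :: "int \<Rightarrow> nat set" where
  "exc u = {q \<in> J. \<exists>m. m \<noteq> 0 \<and> m mod int q \<in> diff_classes q (I q) \<and> \<bar>m\<bar> \<le> 2 * int Y \<and> m + u \<noteq> 0
     \<and> num_diff_primes I (m + u) \<ge> k0 + 1}"

text \<open>(g) applies to one function \<open>m\<close>, whereas \<open>exc\<close> asks only for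
  the existence of a value at each prime. A choice of witnesses, completed by the default
  \<open>int q\<close>, bridges the two.\<close>

lemma card_exc: "\<bar>u\<bar> \<le> 2 * int Y \<Longrightarrow> real (card (exc u)) \<le> n2"
proof -
  assume u: "\<bar>u\<bar> \<le> 2 * int Y"
  define R where "R = (\<lambda>q m. m \<noteq> 0 \<and> m mod int q \<in> diff_classes q (I q) \<and> \<bar>m\<bar> \<le> 2 * int Y \<and> m + u \<noteq> 0
     \<and> num_diff_primes I (m + u) \<ge> k0 + 1)"
  define m where "m = (\<lambda>q. if \<exists>x. R q x then SOME x. R q x else int q)"
  have Rm: "R q (m q)" if "\<exists>x. R q x" for q using someI_ex[OF that] that by (simp add: m_def)
  have mok: "m q \<noteq> 0 \<and> m q mod int q \<in> diff_classes q (I q)" if q: "prime q" "card (I q) \<ge> 1" for q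
  proof (cases "\<exists>x. R q x")
    case True
    thus ?thesis using Rm[of q] by (simp add: R_def)
  next
    case False
    have "m q = int q" by (simp only: m_def if_not_P[OF False])
    thus ?thesis using zero_diff_class[OF q(2)] prime_gt_0_nat[OF q(1)] by simp
  qed
  let ?S = "{q. prime q \<and> card (I q) \<ge> 1 \<and> 0 < \<bar>m q\<bar> \<and> \<bar>m q\<bar> \<le> 2 * int Y \<and> m q + u \<noteq> 0 \<and> num_diff_primes I (m q + u) \<ge> k0 + 1}"
  have S: "finite ?S \<and> real (card ?S) \<le> n2" by (intro N2 mok u)
  have "exc u \<subseteq> ?S"
  proof
    fix q assume "q \<in> exc u"
    hence q: "q \<in> J" "\<exists>x. R q x" by (auto simp: exc_def R_def)
    show "q \<in> ?S" using Rm[OF q(2)] J[OF q(1)] by (simp add: R_def)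
  qed
  hence "card (exc u) \<le> card ?S" using S by (intro card_mono) auto
  thus ?thesis using S by linarith
qed

text \<open>Let \<open>a\<close> and \<open>a'\<close> witness that the pair is bad. If they
  coincide, \<open>r'\<close> is determined by \<open>r\<close> and two classes of
  \<open>I q\<close>, which gives \<open>q * B * B\<close> pairs. Otherwise a - a' = m + (r - r')
  with \<open>m\<close> in a difference class modulo \<open>q\<close>, so \<open>q\<close> is
  exceptional for a shift that determines \<open>r'\<close> from \<open>r\<close>.\<close>

lemma card_bad_rr:
  assumes q: "q \<in> J"
  shows "real (card (bad_rr q)) \<le> real q * ((real B)\<^sup>2 + 2 * real (card {u \<in> {- 2 * int Y..2 * int Y}. q \<in> exc u}))"
proof -
  define E where "E = {u \<in> {- 2 * int Y..2 * int Y}. q \<in> exc u}"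
  let ?R = "{0..<int q}"
  let ?O = "(\<lambda>(r, i, j). (r, (r + i - j) mod int q)) ` (?R \<times> I q \<times> I q)"
  let ?A = "(\<lambda>(r, u). (r, r - u)) ` (?R \<times> E)"
  let ?B = "(\<lambda>(r, u). (r, r - u - int q)) ` (?R \<times> E)"
  have finI: "finite (I q)" by (rule finite_I[OF primeJ[OF q]])
  have finE: "finite E" by (rule finite_subset[of _ "{- 2 * int Y..2 * int Y}"]) (auto simp: E_def)
  have qY: "q \<le> Y" "prime q" "card (I q) \<ge> 1" using J[OF q] by auto
  have "bad_rr q \<subseteq> ?O \<union> (?A \<union> ?B)"
  proof
    fix p assume "p \<in> bad_rr q"
    then obtain r r' a a' where p: "p = (r, r')" and r: "r \<in> ?R" "r' \<in> ?R" and a: "a \<in> prog q r" "a' \<in> prog q r'"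
      and no: "\<not> (finite (diff_primes I (a - a')) \<and> num_diff_primes I (a - a') \<le> k0)"
      by (auto simp: bad_rr_def good_pair_def)
    define i j where "i = (a - r) mod int q" and "j = (a' - r') mod int q"
    have ij: "i \<in> I q" "j \<in> I q" using a by (auto simp: prog_def i_def j_def)
    show "p \<in> ?O \<union> (?A \<union> ?B)"
    proof (cases "a = a'")
      case True
      have "(r + i - j) mod int q = (r + (a - r) - (a - r')) mod int q"
        unfolding i_def j_def True by (metis mod_add_right_eq mod_diff_cong mod_mod_trivial)
      also have "\<dots> = r'" using r by simp
      finally have "p = (\<lambda>(r, i, j). (r, (r + i - j) mod int q)) (r, i, j)" using p by simp
      thus ?thesis using r ij by blast
    next
      case False
      have num: "num_diff_primes I (a - a') \<ge> k0 + 1" using no N1(1)[of "a - a'"] False by auto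
      have aY: "a \<in> {1..int Y}" "a' \<in> {1..int Y}" using a prog_sub[of q r] prog_sub[of q r'] by blast+
      define m where "m = a - a' - (r - r')"
      have mc: "m mod int q \<in> diff_classes q (I q)"
      proof -
        have "m mod int q = (i - j) mod int q"
          unfolding i_def j_def m_def mod_diff_eq by (rule arg_cong[where f = "\<lambda>x. x mod int q"]) simp
        thus ?thesis using ij unfolding diff_classes_def by blast
      qed
      show ?thesis
      proof (cases "m = 0")
        case False
        have "r - r' \<in> E" unfolding E_def exc_def
          using mc False num q aY r qY \<open>a \<noteq> a'\<close> by (auto intro!: exI[of _ m] simp: m_def)
        moreover have "p = (\<lambda>(r, u). (r, r - u)) (r, r - r')" using p by simp
        ultimately show ?thesis using r by blast
      next
        case True
        \<comment> \<open>The value m = 0 is forbidden in (g). It is replaced by m = q with the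
          shift lowered by \<open>q\<close>, which accounts for the second image set and the factor
          2; as q \<le> Y the shift stays within 2 Y.\<close>
        have "r - r' - int q \<in> E" unfolding E_def exc_def
          using zero_diff_class[OF qY(3)] True num q aY r qY \<open>a \<noteq> a'\<close> prime_gt_0_nat[OF qY(2)]
          by (auto intro!: exI[of _ "int q"] simp: m_def)
        moreover have "p = (\<lambda>(r, u). (r, r - u - int q)) (r, r - r' - int q)" using p by simp
        ultimately show ?thesis using r by blast
      qed
    qed
  qed
  hence "card (bad_rr q) \<le> card (?O \<union> (?A \<union> ?B))" using finI finE by (intro card_mono) auto
  also have "\<dots> \<le> card ?O + (card ?A + card ?B)" by (meson add_left_mono card_Un_le order_trans)
  also have "\<dots> \<le> card (?R \<times> I q \<times> I q) + (card (?R \<times> E) + card (?R \<times> E))"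
    using finI finE by (intro add_mono card_image_le) auto
  also have "\<dots> = q * (card (I q) * card (I q) + 2 * card E)" by (simp add: card_cartesian_product algebra_simps)
  also have "\<dots> \<le> q * (B * B + 2 * card E)" using IJ[OF q] by (intro mult_left_mono add_right_mono mult_mono) auto
  finally have "real (card (bad_rr q)) \<le> real (q * (B * B + 2 * card E))" by (simp only: of_nat_le_iff)
  thus ?thesis by (simp add: E_def power2_eq_square)
qed

definition wt_err :: real where
  "wt_err = lvl_err * lvl_sum + real B * lvl_max * (H / real Y)\<^sup>2 * ((real B)\<^sup>2 * real Y + 2 * ((4 * real Y + 1) * n2))"

text \<open>(g) counts primes and says nothing about an individual \<open>q\<close>. Summation over
  \<open>q\<close> turns the numbers of bad pairs into a sum over shifts \<open>u\<close> of card
  (exc u), to which it applies.\<close>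

lemma weighted_index_variance:
  "(\<Sum>q\<in>J. real (card (I q)) / real q * sieve_avg P (\<lambda>b. (wt q b - 1)\<^sup>2)) \<le> wt_err"
proof -
  let ?E = "\<lambda>q. {u \<in> {- 2 * int Y..2 * int Y}. q \<in> exc u}"
  have "(\<Sum>q\<in>J. real (card (I q)) / real q * sieve_avg P (\<lambda>b. (wt q b - 1)\<^sup>2))
     \<le> (\<Sum>q\<in>J. real (card (I q)) / real q * lvl_err + (real B * lvl_max * (H / real Y)\<^sup>2) * ((real B)\<^sup>2 + 2 * real (card (?E q))))"
  proof (rule sum_mono)
    fix q assume q: "q \<in> J"
    have "real (card (I q)) / real q * sieve_avg P (\<lambda>b. (wt q b - 1)\<^sup>2)
       \<le> real (card (I q)) / real q * (lvl_err + lvl_max * real (card (bad_rr q)) / (real q)\<^sup>2)"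
      by (intro mult_left_mono index_variance[OF q]) auto
    also have "\<dots> = real (card (I q)) / real q * lvl_err + real (card (I q)) * lvl_max * (1 / real q)\<^sup>2 * (real (card (bad_rr q)) / real q)"
      by (simp add: distrib_left power2_eq_square)
    also have "\<dots> \<le> real (card (I q)) / real q * lvl_err + real B * lvl_max * (H / real Y)\<^sup>2 * ((real B)\<^sup>2 + 2 * real (card (?E q)))"
    proof (intro add_left_mono mult_mono power_mono inv_q_le q)
      show "real (card (I q)) \<le> real B" using IJ[OF q] by simp
      show "real (card (bad_rr q)) / real q \<le> (real B)\<^sup>2 + 2 * real (card (?E q))"
        using card_bad_rr[OF q] q0[OF q] by (simp add: divide_le_eq mult.commute)
    qed (use lvl_max_ge_1 in auto)
    finally show "real (card (I q)) / real q * sieve_avg P (\<lambda>b. (wt q b - 1)\<^sup>2)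
       \<le> real (card (I q)) / real q * lvl_err + (real B * lvl_max * (H / real Y)\<^sup>2) * ((real B)\<^sup>2 + 2 * real (card (?E q)))" .
  qed
  also have "\<dots> = lvl_err * lvl_sum + (real B * lvl_max * (H / real Y)\<^sup>2) * (\<Sum>q\<in>J. (real B)\<^sup>2 + 2 * real (card (?E q)))"
    by (simp only: sum.distrib sum_distrib_left[symmetric] sum_distrib_right[symmetric] lvl_sum_def mult.commute)
  also have "\<dots> \<le> wt_err"
    unfolding wt_err_def
  proof (intro add_left_mono mult_left_mono)
    have "(\<Sum>q\<in>J. real (card (?E q))) = (\<Sum>q\<in>J. \<Sum>u\<in>{- 2 * int Y..2 * int Y}. of_bool (q \<in> exc u))"
      by (intro sum.cong refl) (simp add: of_bool_def sum.If_cases Int_def)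
    also have "\<dots> = (\<Sum>u\<in>{- 2 * int Y..2 * int Y}. \<Sum>q\<in>J. of_bool (q \<in> exc u))" by (rule sum.swap)
    also have "\<dots> = (\<Sum>u\<in>{- 2 * int Y..2 * int Y}. real (card (exc u)))"
    proof (rule sum.cong[OF refl])
      fix u
      have "(\<Sum>q\<in>J. of_bool (q \<in> exc u)) = real (card (J \<inter> exc u))"
        using finJ by (simp add: of_bool_def sum.If_cases Int_def)
      also have "J \<inter> exc u = exc u" by (auto simp: exc_def)
      finally show "(\<Sum>q\<in>J. of_bool (q \<in> exc u)) = real (card (exc u))" .
    qed
    also have "\<dots> \<le> (\<Sum>u\<in>{- 2 * int Y..2 * int Y}. n2)" by (intro sum_mono card_exc) auto
    also have "\<dots> = (4 * real Y + 1) * n2" by simp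
    finally have E: "(\<Sum>q\<in>J. real (card (?E q))) \<le> (4 * real Y + 1) * n2" .
    have "(\<Sum>q\<in>J. (real B)\<^sup>2 + 2 * real (card (?E q))) = real (card J) * (real B)\<^sup>2 + 2 * (\<Sum>q\<in>J. real (card (?E q)))"
      by (simp only: sum.distrib sum_distrib_left sum_constant)
    also have "\<dots> \<le> real Y * (real B)\<^sup>2 + 2 * ((4 * real Y + 1) * n2)"
      using E cardJ by (intro add_mono mult_left_mono mult_right_mono) auto
    finally show "(\<Sum>q\<in>J. (real B)\<^sup>2 + 2 * real (card (?E q))) \<le> (real B)\<^sup>2 * real Y + 2 * ((4 * real Y + 1) * n2)"
      by (simp add: mult.commute)
  qed (use lvl_max_ge_1 in auto)
  finally show ?thesis .
qed

text \<open>The part of the degree carried by primes whose total weight exceeds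
  \<open>1 + c\<close>. Such primes cannot be normalised to a probability and are given up
  later.\<close>

definition loss :: "real \<Rightarrow> int \<Rightarrow> (nat \<Rightarrow> int) \<Rightarrow> real" where
  "loss c s b = (\<Sum>q\<in>J. of_bool (wt q b > 1 + c) * (\<Sum>r\<in>bad q {s}. lam w (prog q r) b / real q))"

lemma loss_nonneg: "loss c s b \<ge> 0"
  unfolding loss_def using lam_nonneg by (intro sum_nonneg mult_nonneg_nonneg divide_nonneg_nonneg) auto

text \<open>Summation over \<open>s\<close> comes first: every progression of \<open>q\<close> has
  at most 2 Y card (I q) / q points, so the total loss is governed by the part of
  \<open>wt q\<close> above \<open>1 + c\<close>, and this is dominated by its variance.\<close>

lemma mean_total_loss:
  assumes c: "c > 0"
  shows "sieve_avg P (\<lambda>b. \<Sum>s\<in>{1..int Y}. of_bool (s \<in> surv P b) * loss c s b) \<le> 2 * real Y * ((1 + c) / c\<^sup>2) * wt_err"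
proof -
  have wt0: "wt q b \<ge> 0" for q b unfolding wt_def using lam_nonneg by (intro divide_nonneg_nonneg sum_nonneg) auto
  have "sieve_avg P (\<lambda>b. \<Sum>s\<in>{1..int Y}. of_bool (s \<in> surv P b) * loss c s b)
     \<le> sieve_avg P (\<lambda>b. \<Sum>q\<in>J. (2 * real Y * ((1 + c) / c\<^sup>2) * (real (card (I q)) / real q)) * (wt q b - 1)\<^sup>2)"
  proof (rule sieve_avg_mono)
    fix b
    have "(\<Sum>s\<in>{1..int Y}. of_bool (s \<in> surv P b) * loss c s b) \<le> (\<Sum>s\<in>{1..int Y}. loss c s b)"
      using loss_nonneg by (intro sum_mono) (auto simp: of_bool_def)
    also have "\<dots> = (\<Sum>q\<in>J. of_bool (wt q b > 1 + c) * (\<Sum>s\<in>{1..int Y}. \<Sum>r\<in>bad q {s}. lam w (prog q r) b / real q))"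
      unfolding loss_def by (subst sum.swap) (simp only: sum_distrib_left)
    also have "\<dots> \<le> (\<Sum>q\<in>J. (2 * real Y * ((1 + c) / c\<^sup>2) * (real (card (I q)) / real q)) * (wt q b - 1)\<^sup>2)"
    proof (rule sum_mono)
      fix q assume q: "q \<in> J"
      have card2: "real (card (prog q r)) \<le> 2 * real Y * (real (card (I q)) / real q)" for r
      proof -
        have "real (card (prog q r)) \<le> real (card (I q) * (Y div q + 1))"
          using card_prog_le[OF primeJ[OF q]] by (simp only: of_nat_le_iff)
        also have "\<dots> = real (card (I q)) * (real (Y div q) + 1)" by (simp add: algebra_simps)
        also have "\<dots> \<le> real (card (I q)) * (real Y / real q + real Y / real q)"
          using J[OF q] q0[OF q] by (intro mult_left_mono add_mono) (auto simp: of_nat_div_le_of_nat)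
        finally show ?thesis by (simp add: mult_ac)
      qed
      have bq: "bad q {s} = {r \<in> {0..<int q}. s \<in> prog q r}" if "s \<in> {1..int Y}" for s
        using mem_prog_iff[OF that] by (auto simp: bad_def)
      have "(\<Sum>s\<in>{1..int Y}. \<Sum>r\<in>bad q {s}. lam w (prog q r) b / real q) =
         (\<Sum>s\<in>{1..int Y}. \<Sum>r\<in>{0..<int q}. of_bool (s \<in> prog q r) * (lam w (prog q r) b / real q))"
      proof (rule sum.cong[OF refl])
        fix s assume s: "s \<in> {1..int Y}"
        show "(\<Sum>r\<in>bad q {s}. lam w (prog q r) b / real q) = (\<Sum>r\<in>{0..<int q}. of_bool (s \<in> prog q r) * (lam w (prog q r) b / real q))"
          unfolding bq[OF s] by (rule sum.mono_neutral_cong_left) auto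
      qed
      also have "\<dots> = (\<Sum>r\<in>{0..<int q}. (\<Sum>s\<in>{1..int Y}. of_bool (s \<in> prog q r)) * (lam w (prog q r) b / real q))"
        by (subst sum.swap) (simp only: sum_distrib_right)
      also have "\<dots> = (\<Sum>r\<in>{0..<int q}. real (card (prog q r)) * (lam w (prog q r) b / real q))"
      proof (intro sum.cong refl arg_cong2[where f = "(*)"])
        fix r
        have "(\<Sum>s\<in>{1..int Y}. of_bool (s \<in> prog q r)) = real (card ({1..int Y} \<inter> prog q r))"
          by (simp add: of_bool_def sum.If_cases Int_def)
        also have "{1..int Y} \<inter> prog q r = prog q r" using prog_sub by blast
        finally show "(\<Sum>s\<in>{1..int Y}. of_bool (s \<in> prog q r)) = real (card (prog q r))" .
      qed
      also have "\<dots> \<le> (\<Sum>r\<in>{0..<int q}. 2 * real Y * (real (card (I q)) / real q) * (lam w (prog q r) b / real q))"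
        using lam_nonneg q0[OF q] by (intro sum_mono mult_right_mono card2) auto
      also have "\<dots> = 2 * real Y * (real (card (I q)) / real q) * wt q b"
        unfolding wt_def sum_divide_distrib sum_distrib_left ..
      finally have A: "(\<Sum>s\<in>{1..int Y}. \<Sum>r\<in>bad q {s}. lam w (prog q r) b / real q) \<le> 2 * real Y * (real (card (I q)) / real q) * wt q b" .
      \<comment> \<open>With x = wt q b - 1 the quotient (1 + x) / x^2 decreases for positive
        \<open>x\<close>, so the constant is its value at x = c.\<close>
      have B: "of_bool (wt q b > 1 + c) * wt q b \<le> (1 + c) / c\<^sup>2 * (wt q b - 1)\<^sup>2"
      proof (cases "wt q b > 1 + c")
        case True
        define x where "x = wt q b - 1"
        have x: "x > c" using True by (simp add: x_def)
        have "c\<^sup>2 * (1 + x) \<le> (1 + c) * x\<^sup>2"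
        proof -
          have "0 \<le> (x - c) * (x + c + c * x)" using x c by (intro mult_nonneg_nonneg) auto
          thus ?thesis by (simp add: algebra_simps power2_eq_square)
        qed
        hence "1 + x \<le> (1 + c) / c\<^sup>2 * x\<^sup>2" using c by (simp add: field_simps)
        thus ?thesis using True by (simp add: x_def)
      qed (use c in simp)
      have "of_bool (wt q b > 1 + c) * (\<Sum>s\<in>{1..int Y}. \<Sum>r\<in>bad q {s}. lam w (prog q r) b / real q)
        \<le> of_bool (wt q b > 1 + c) * (2 * real Y * (real (card (I q)) / real q) * wt q b)"
        by (intro mult_left_mono A) auto
      also have "\<dots> = 2 * real Y * (real (card (I q)) / real q) * (of_bool (wt q b > 1 + c) * wt q b)" by simp
      also have "\<dots> \<le> 2 * real Y * (real (card (I q)) / real q) * ((1 + c) / c\<^sup>2 * (wt q b - 1)\<^sup>2)"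
        by (intro mult_left_mono B) auto
      also have "\<dots> = (2 * real Y * ((1 + c) / c\<^sup>2) * (real (card (I q)) / real q)) * (wt q b - 1)\<^sup>2"
        by (simp only: mult_ac)
      finally show "of_bool (wt q b > 1 + c) * (\<Sum>s\<in>{1..int Y}. \<Sum>r\<in>bad q {s}. lam w (prog q r) b / real q)
        \<le> (2 * real Y * ((1 + c) / c\<^sup>2) * (real (card (I q)) / real q)) * (wt q b - 1)\<^sup>2" .
    qed
    finally show "(\<Sum>s\<in>{1..int Y}. of_bool (s \<in> surv P b) * loss c s b)
      \<le> (\<Sum>q\<in>J. (2 * real Y * ((1 + c) / c\<^sup>2) * (real (card (I q)) / real q)) * (wt q b - 1)\<^sup>2)" .
  qed
  also have "\<dots> = 2 * real Y * ((1 + c) / c\<^sup>2) * (\<Sum>q\<in>J. real (card (I q)) / real q * sieve_avg P (\<lambda>b. (wt q b - 1)\<^sup>2))"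
    unfolding sieve_avg_sum sieve_avg_scale sum_distrib_left by (simp only: mult.assoc)
  also have "\<dots> \<le> 2 * real Y * ((1 + c) / c\<^sup>2) * wt_err"
    using c by (intro mult_left_mono weighted_index_variance) auto
  finally show ?thesis .
qed

end

section \<open>Densities of the sieving primes\<close>

definition primes_in :: "real \<Rightarrow> real \<Rightarrow> nat set" where
  "primes_in u v = {p. prime p \<and> u < real p \<and> real p \<le> v}"

lemma finite_primes_in: "finite (primes_in u v)"
proof -
  have "primes_in u v \<subseteq> {..nat \<lfloor>v\<rfloor>}" by (auto simp: primes_in_def le_nat_floor)
  thus ?thesis using finite_subset by blast
qed

lemma primes_in_0: "primes_in 0 x = {p. prime p \<and> real p \<le> x}"
  by (auto simp: primes_in_def prime_gt_0_nat)

lemma primes_in_split: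
  assumes "u \<le> v" "v \<le> x"
  shows "primes_in u x = primes_in u v \<union> primes_in v x" "primes_in u v \<inter> primes_in v x = {}"
  using assms by (auto simp: primes_in_def)

lemma sum_primes_in_split:
  assumes "u \<le> v" "v \<le> x"
  shows "sum f (primes_in u x) = sum f (primes_in u v) + sum f (primes_in v x)"
  using primes_in_split[OF assms] finite_primes_in by (simp add: sum.union_disjoint)

locale sieve_density =
  fixes I :: "nat \<Rightarrow> int set" and B :: nat and C1 :: real
  assumes I_card: "\<And>p. prime p \<Longrightarrow> card (I p) \<le> p - 1" "\<And>p. prime p \<Longrightarrow> card (I p) \<le> B"
    and C1: "C1 > 0"
    and mertens: "asymp_equiv (\<lambda>x::real. \<Prod>p | prime p \<and> real p \<le> x. 1 - real (card (I p)) / real p)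
              at_top (\<lambda>x. C1 / ln x)"
    and densities: "\<And>\<nu>. \<nu> \<in> {1..B} \<Longrightarrow> \<exists>\<rho>::real.
              ((\<lambda>x::real. real (card {p. prime p \<and> real p \<le> x \<and> card (I p) = \<nu>}) / (x / ln x))
                 \<longlongrightarrow> \<rho>) at_top"
begin

definition cnt :: "real \<Rightarrow> real \<Rightarrow> real" where
  "cnt u v = (\<Sum>p\<in>primes_in u v. real (card (I p)))"

definition mass :: "real \<Rightarrow> real \<Rightarrow> real" where
  "mass u v = (\<Sum>p\<in>primes_in u v. real (card (I p)) / real p)"

definition dens :: "real \<Rightarrow> real" where
  "dens x = (\<Prod>p | prime p \<and> real p \<le> x. 1 - real (card (I p)) / real p)"

lemma dens_factor_pos:
  assumes "prime p" shows "0 < 1 - real (card (I p)) / real p"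
proof -
  have "card (I p) < p" using I_card(1)[OF assms] prime_gt_0_nat[OF assms] by linarith
  thus ?thesis by simp
qed

lemma dens_pos: "dens x > 0"
  unfolding dens_def using dens_factor_pos by (intro prod_pos) auto

lemma dens_ln_tendsto: "((\<lambda>x. dens x * ln x) \<longlongrightarrow> C1) at_top"
proof -
  have "((\<lambda>x. dens x / (C1 / ln x)) \<longlongrightarrow> 1) at_top"
  proof (rule asymp_equivD_strong[OF mertens[folded dens_def]])
    show "\<forall>\<^sub>F x in at_top. dens x \<noteq> 0 \<or> C1 / ln x \<noteq> 0" using dens_pos by (simp add: less_imp_neq[symmetric])
  qed
  hence "((\<lambda>x. C1 * (dens x / (C1 / ln x))) \<longlongrightarrow> C1 * 1) at_top" by (intro tendsto_intros)
  thus ?thesis using C1 by simp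
qed

text \<open>The primes are sorted by \<nu> = card (I p), so the limit is the sum of the \<nu>
  \<rho>_\<nu>, the mean number of classes per prime.\<close>

lemma cnt_tendsto: "\<exists>\<rho>. ((\<lambda>x. cnt 0 x / (x / ln x)) \<longlongrightarrow> \<rho>) at_top"
proof -
  have "\<forall>\<nu>\<in>{1..B}. \<exists>\<rho>. ((\<lambda>x::real. real (card {p. prime p \<and> real p \<le> x \<and> card (I p) = \<nu>}) / (x / ln x)) \<longlongrightarrow> \<rho>) at_top"
    using densities by blast
  from bchoice[OF this] obtain \<rho> where \<rho>: "\<And>\<nu>. \<nu> \<in> {1..B} \<Longrightarrow>
     ((\<lambda>x::real. real (card {p. prime p \<and> real p \<le> x \<and> card (I p) = \<nu>}) / (x / ln x)) \<longlongrightarrow> \<rho> \<nu>) at_top"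
    by blast
  have eq: "cnt 0 x / (x / ln x) = (\<Sum>\<nu>\<in>{1..B}. real \<nu> * (real (card {p. prime p \<and> real p \<le> x \<and> card (I p) = \<nu>}) / (x / ln x)))" for x
  proof -
    have "real (card (I p)) = (\<Sum>\<nu>\<in>{1..B}. real \<nu> * of_bool (card (I p) = \<nu>))" if "p \<in> primes_in 0 x" for p
    proof -
      have cB: "card (I p) \<le> B" using that I_card by (auto simp: primes_in_def)
      have "(\<Sum>\<nu>\<in>{1..B}. real \<nu> * of_bool (card (I p) = \<nu>)) = (\<Sum>\<nu>\<in>{1..B}. if \<nu> = card (I p) then real \<nu> else 0)"
        by (intro sum.cong refl) auto
      also have "\<dots> = real (card (I p))" using cB by (cases "card (I p) = 0") (auto simp: sum.delta)
      finally show ?thesis ..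
    qed
    hence "cnt 0 x = (\<Sum>p\<in>primes_in 0 x. \<Sum>\<nu>\<in>{1..B}. real \<nu> * of_bool (card (I p) = \<nu>))"
      unfolding cnt_def by (intro sum.cong refl)
    also have "\<dots> = (\<Sum>\<nu>\<in>{1..B}. real \<nu> * (\<Sum>p\<in>primes_in 0 x. of_bool (card (I p) = \<nu>)))"
      by (subst sum.swap) (simp only: sum_distrib_left)
    also have "\<dots> = (\<Sum>\<nu>\<in>{1..B}. real \<nu> * real (card {p. prime p \<and> real p \<le> x \<and> card (I p) = \<nu>}))"
    proof (intro sum.cong refl arg_cong2[where f = "(*)"])
      fix \<nu>
      have "(\<Sum>p\<in>primes_in 0 x. of_bool (card (I p) = \<nu>)) = real (card (primes_in 0 x \<inter> {p. card (I p) = \<nu>}))"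
        using finite_primes_in by (simp add: of_bool_def sum.If_cases)
      also have "primes_in 0 x \<inter> {p. card (I p) = \<nu>} = {p. prime p \<and> real p \<le> x \<and> card (I p) = \<nu>}"
        by (auto simp: primes_in_0)
      finally show "(\<Sum>p\<in>primes_in 0 x. of_bool (card (I p) = \<nu>)) = real (card {p. prime p \<and> real p \<le> x \<and> card (I p) = \<nu>})" .
    qed
    finally show ?thesis by (simp only: sum_divide_distrib times_divide_eq_right)
  qed
  have "((\<lambda>x. cnt 0 x / (x / ln x)) \<longlongrightarrow> (\<Sum>\<nu>\<in>{1..B}. real \<nu> * \<rho> \<nu>)) at_top"
    unfolding eq by (intro tendsto_sum tendsto_mult tendsto_const \<rho>)
  thus ?thesis ..
qed

lemma cnt_block_tendsto:
  assumes \<rho>: "((\<lambda>x. cnt 0 x / (x / ln x)) \<longlongrightarrow> \<rho>) at_top" and \<xi>: "\<xi> > 1"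
  shows "((\<lambda>u. cnt u (\<xi> * u) / (u / ln u)) \<longlongrightarrow> \<rho> * (\<xi> - 1)) at_top"
proof -
  have lim: "filterlim (\<lambda>u::real. \<xi> * u) at_top at_top"
    using \<xi> by (intro filterlim_tendsto_pos_mult_at_top[OF tendsto_const _ filterlim_ident]) auto
  have 1: "((\<lambda>u. cnt 0 (\<xi> * u) / (\<xi> * u / ln (\<xi> * u))) \<longlongrightarrow> \<rho>) at_top"
    by (rule filterlim_compose[OF \<rho> lim])
  have 2: "((\<lambda>u::real. \<xi> * (ln u / ln (\<xi> * u))) \<longlongrightarrow> \<xi>) at_top"
    using \<xi> by real_asymp
  have 3: "((\<lambda>u. cnt 0 (\<xi> * u) / (\<xi> * u / ln (\<xi> * u)) * (\<xi> * (ln u / ln (\<xi> * u))) - cnt 0 u / (u / ln u)) \<longlongrightarrow> \<rho> * \<xi> - \<rho>) at_top"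
    by (intro tendsto_intros 1 2 \<rho>)
  have "\<forall>\<^sub>F u in at_top. cnt 0 (\<xi> * u) / (\<xi> * u / ln (\<xi> * u)) * (\<xi> * (ln u / ln (\<xi> * u))) - cnt 0 u / (u / ln u) = cnt u (\<xi> * u) / (u / ln u)"
    using eventually_gt_at_top[of 1]
  proof eventually_elim
    case (elim u)
    have "\<xi> * u > 1" using \<xi> elim mult_strict_mono[of 1 \<xi> 1 u] by simp
    hence l: "ln (\<xi> * u) > 0" by simp
    have "u \<le> \<xi> * u" using \<xi> elim by simp
    hence "cnt 0 (\<xi> * u) = cnt 0 u + cnt u (\<xi> * u)"
      unfolding cnt_def using elim by (intro sum_primes_in_split) auto
    thus ?case using l elim \<xi> by (simp add: field_simps)
  qed
  from Lim_transform_eventually[OF 3 this] show ?thesis by (simp add: algebra_simps)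
qed

lemma sum_inverse_squares_le:
  assumes "finite A" "\<And>p. p \<in> A \<Longrightarrow> p \<ge> 1"
  shows "(\<Sum>p\<in>A. 1 / (real p)\<^sup>2) \<le> 2"
proof -
  have up: "(\<Sum>p=1..Suc N. 1 / (real p)\<^sup>2) \<le> 2 - 1 / real (Suc N)" for N
  proof (induction N)
    case (Suc N)
    have "1 / (real (Suc (Suc N)))\<^sup>2 \<le> 1 / (real (Suc N) * real (Suc (Suc N)))"
      unfolding power2_eq_square by (intro divide_left_mono mult_right_mono mult_pos_pos) auto
    also have "\<dots> = 1 / real (Suc N) - 1 / real (Suc (Suc N))" by (simp add: divide_simps)
    finally show ?case using Suc.IH by simp
  qed simp
  have "A \<subseteq> {1..Suc (Max (insert 0 A))}"
  proof
    fix p assume p: "p \<in> A"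
    have "p \<le> Max (insert 0 A)" using assms(1) p by (intro Max_ge) auto
    thus "p \<in> {1..Suc (Max (insert 0 A))}" using assms(2)[OF p] by simp
  qed
  hence "(\<Sum>p\<in>A. 1 / (real p)\<^sup>2) \<le> (\<Sum>p=1..Suc (Max (insert 0 A)). 1 / (real p)\<^sup>2)"
    by (intro sum_mono2) auto
  also have "\<dots> \<le> 2 - 1 / real (Suc (Max (insert 0 A)))" by (rule up)
  also have "\<dots> \<le> 2" by simp
  finally show ?thesis .
qed

text \<open>By ln (1 - x) \<ge> - x - 2 x^2 and the convergence of the sum of 1 / p^2, replacing the
  product by exp (- mass) costs a constant factor only.\<close>

lemma dens_lower:
  assumes u: "2 * real B \<le> u" "0 \<le> u" "u \<le> v"
  shows "dens v \<ge> dens u * exp (- mass u v - 2 * (real B)\<^sup>2 * 2)"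
proof -
  have split: "{p. prime p \<and> real p \<le> v} = {p. prime p \<and> real p \<le> u} \<union> primes_in u v"
    "{p. prime p \<and> real p \<le> u} \<inter> primes_in u v = {}"
    using u by (auto simp: primes_in_def)
  have "dens v = dens u * (\<Prod>p\<in>primes_in u v. 1 - real (card (I p)) / real p)"
    unfolding dens_def split(1)
    using split(2) finite_primes_in[of u v] finite_primes_in[of 0 u] by (intro prod.union_disjoint) (auto simp: primes_in_0)
  moreover have "(\<Prod>p\<in>primes_in u v. 1 - real (card (I p)) / real p) \<ge> exp (- mass u v - 2 * (real B)\<^sup>2 * 2)"
  proof -
    have "(\<Sum>p\<in>primes_in u v. 1 / (real p)\<^sup>2) \<le> 2"
      by (intro sum_inverse_squares_le finite_primes_in) (auto simp: primes_in_def intro: prime_ge_1_nat[unfolded One_nat_def])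
    hence "- mass u v - 2 * (real B)\<^sup>2 * 2 \<le> - mass u v - 2 * (real B)\<^sup>2 * (\<Sum>p\<in>primes_in u v. 1 / (real p)\<^sup>2)"
      by (intro diff_left_mono mult_left_mono) auto
    also have "\<dots> = (\<Sum>p\<in>primes_in u v. - (real (card (I p)) / real p) - 2 * (real B)\<^sup>2 * (1 / (real p)\<^sup>2))"
      by (simp only: mass_def sum_subtractf sum_negf sum_distrib_left)
    finally have "exp (- mass u v - 2 * (real B)\<^sup>2 * 2) \<le>
      exp (\<Sum>p\<in>primes_in u v. - (real (card (I p)) / real p) - 2 * (real B)\<^sup>2 * (1 / (real p)\<^sup>2))" by simp
    also have "\<dots> = (\<Prod>p\<in>primes_in u v. exp (- (real (card (I p)) / real p) - 2 * (real B)\<^sup>2 * (1 / (real p)\<^sup>2)))"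
      by (rule exp_sum[OF finite_primes_in])
    also have "\<dots> \<le> (\<Prod>p\<in>primes_in u v. 1 - real (card (I p)) / real p)"
    proof (rule prod_mono)
      fix p assume p: "p \<in> primes_in u v"
      hence pr: "prime p" "u < real p" by (auto simp: primes_in_def)
      have p0: "real p > 0" using pr(1) prime_gt_0_nat by simp
      define x where "x = real (card (I p)) / real p"
      have cB: "real (card (I p)) \<le> real B" using I_card(2)[OF pr(1)] by simp
      have x: "0 \<le> x" "x \<le> 1 / 2" using cB u pr p0 by (auto simp: x_def divide_le_eq)
      have "- x - 2 * (real B)\<^sup>2 * (1 / (real p)\<^sup>2) \<le> - x - 2 * x\<^sup>2"
      proof -
        have "x\<^sup>2 \<le> (real B / real p)\<^sup>2" unfolding x_def using cB p0 by (intro power_mono divide_right_mono) auto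
        thus ?thesis by (simp add: power_divide)
      qed
      also have "\<dots> \<le> ln (1 - x)" using x by (rule ln_one_minus_pos_lower_bound)
      finally have "exp (- x - 2 * (real B)\<^sup>2 * (1 / (real p)\<^sup>2)) \<le> exp (ln (1 - x))" by simp
      also have "\<dots> = 1 - x" using x by simp
      finally show "0 \<le> exp (- (real (card (I p)) / real p) - 2 * (real B)\<^sup>2 * (1 / (real p)\<^sup>2)) \<and>
         exp (- (real (card (I p)) / real p) - 2 * (real B)\<^sup>2 * (1 / (real p)\<^sup>2)) \<le> 1 - real (card (I p)) / real p"
        by (simp add: x_def)
    qed
    finally show ?thesis .
  qed
  ultimately show ?thesis using dens_pos[of u] by (simp add: mult_left_mono)
qed

text \<open>If the mean value \<open>\<rho>\<close> of \<open>card (I p)\<close> were too small, \<open>dens\<close> would decay like a power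
  \<open>(ln x) powr (- \<theta>)\<close> with \<open>\<theta> < 1\<close>.\<close>

lemma mean_lower:
  assumes \<rho>: "((\<lambda>x. cnt 0 x / (x / ln x)) \<longlongrightarrow> \<rho>) at_top" and \<xi>: "\<xi> > 1"
  shows "\<rho> * (\<xi> - 1) \<ge> ln \<xi>"
proof (rule ccontr)
  assume "\<not> ?thesis"
  hence lt: "\<rho> * (\<xi> - 1) < ln \<xi>" by simp
  have l\<xi>: "ln \<xi> > 0" using \<xi> by simp
  \<comment> \<open>The midpoint between \<rho> (\<xi> - 1) / ln \<xi> and 1, raised to 1/2 if
    necessary to keep \<open>\<theta>\<close> positive.\<close>
  define \<theta> where "\<theta> = max (1 / 2) ((\<rho> * (\<xi> - 1) / ln \<xi> + 1) / 2)"
  have "\<rho> * (\<xi> - 1) / ln \<xi> < 1" using lt l\<xi> by simp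
  moreover have "a < (a + 1) / 2" "(a + 1) / 2 < 1" if "a < 1" for a :: real using that by simp_all
  ultimately have "\<rho> * (\<xi> - 1) / ln \<xi> < (\<rho> * (\<xi> - 1) / ln \<xi> + 1) / 2" "(\<rho> * (\<xi> - 1) / ln \<xi> + 1) / 2 < 1"
    by blast+
  hence \<theta>: "\<theta> < 1" "\<rho> * (\<xi> - 1) / ln \<xi> < \<theta>" "\<theta> > 0" by (auto simp: \<theta>_def less_max_iff_disj)
  have "\<rho> * (\<xi> - 1) < \<theta> * ln \<xi>" using \<theta>(2) l\<xi> by (simp add: divide_less_eq)
  hence "\<forall>\<^sub>F u in at_top. cnt u (\<xi> * u) / (u / ln u) < \<theta> * ln \<xi>"
    by (rule order_tendstoD(2)[OF cnt_block_tendsto[OF \<rho> \<xi>]])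
  then obtain u0 where u0: "\<And>u. u \<ge> u0 \<Longrightarrow> cnt u (\<xi> * u) / (u / ln u) < \<theta> * ln \<xi>"
    by (auto simp: eventually_at_top_linorder)
  have powlim: "filterlim (\<lambda>n::nat. \<xi> ^ n) at_top at_top"
    using \<xi> by real_asymp
  have "\<forall>\<^sub>F n in sequentially. \<xi> ^ n \<ge> max u0 (2 * real B)"
    using powlim unfolding filterlim_at_top by blast
  then obtain k1 where k1: "\<And>n. n \<ge> k1 \<Longrightarrow> \<xi> ^ n \<ge> max u0 (2 * real B)"
    by (auto simp: eventually_at_top_linorder)
  define k0 where "k0 = max k1 2"
  have k0: "k0 \<ge> 2" "\<And>n. n \<ge> k0 \<Longrightarrow> \<xi> ^ n \<ge> u0 \<and> \<xi> ^ n \<ge> 2 * real B"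
    using k1 by (auto simp: k0_def)
  \<comment> \<open>The mass of the block from \<xi>^k to \<xi>^(k+1) is at most \<theta> / k; the
    bound of 1 / k by a difference of logarithms makes the sum over blocks telescope to \<theta> ln
    n.\<close>
  have block: "mass (\<xi> ^ k) (\<xi> ^ Suc k) \<le> \<theta> * (ln (real k) - ln (real k - 1))" if k: "k \<ge> k0" for k
  proof -
    have k2: "real k \<ge> 2" using k k0(1) by linarith
    have xk: "\<xi> ^ k > 1" using \<xi> k2 by (intro one_less_power) auto
    have "mass (\<xi> ^ k) (\<xi> ^ Suc k) \<le> (\<Sum>p\<in>primes_in (\<xi> ^ k) (\<xi> ^ Suc k). real (card (I p)) / \<xi> ^ k)"
      unfolding mass_def using xk by (intro sum_mono divide_left_mono mult_pos_pos) (auto simp: primes_in_def)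
    also have "\<dots> = cnt (\<xi> ^ k) (\<xi> * \<xi> ^ k) / \<xi> ^ k" by (simp add: cnt_def sum_divide_distrib)
    also have "\<dots> = cnt (\<xi> ^ k) (\<xi> * \<xi> ^ k) / (\<xi> ^ k / ln (\<xi> ^ k)) / ln (\<xi> ^ k)"
      using xk by simp
    also have "\<dots> \<le> \<theta> * ln \<xi> / ln (\<xi> ^ k)"
      using u0[of "\<xi> ^ k"] k0(2)[OF k] xk by (intro divide_right_mono less_imp_le) auto
    also have "\<dots> = \<theta> * (1 / real k)" using \<xi> l\<xi> k2 by (simp add: ln_realpow)
    also have "1 / real k \<le> ln (real k) - ln (real k - 1)"
    proof -
      have "ln (1 - 1 / real k) \<le> - (1 / real k)"
        using ln_add_one_self_le_self2[of "- (1 / real k)"] k2 by simp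
      moreover have "1 - 1 / real k = (real k - 1) / real k" using k2 by (simp add: field_simps)
      ultimately show ?thesis using k2 by (simp add: ln_div)
    qed
    finally show ?thesis using \<theta> by (simp add: mult_left_mono)
  qed
  have massn: "mass (\<xi> ^ k0) (\<xi> ^ n) \<le> \<theta> * ln (real n)" if n: "n \<ge> k0" for n
  proof -
    have "mass (\<xi> ^ k0) (\<xi> ^ n) \<le> \<theta> * (ln (real n - 1) - ln (real k0 - 1))"
      using n
    proof (induction n rule: dec_induct)
      case base
      have "primes_in (\<xi> ^ k0) (\<xi> ^ k0) = {}" by (auto simp: primes_in_def)
      thus ?case by (simp add: mass_def)
    next
      case (step k)
      have "mass (\<xi> ^ k0) (\<xi> ^ Suc k) = mass (\<xi> ^ k0) (\<xi> ^ k) + mass (\<xi> ^ k) (\<xi> ^ Suc k)"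
        unfolding mass_def using \<xi> step.hyps by (intro sum_primes_in_split power_increasing) auto
      also have "\<dots> \<le> \<theta> * (ln (real k - 1) - ln (real k0 - 1)) + \<theta> * (ln (real k) - ln (real k - 1))"
        by (intro add_mono step.IH block step.hyps)
      also have "\<dots> = \<theta> * (ln (real (Suc k) - 1) - ln (real k0 - 1))" by (simp add: algebra_simps)
      finally show ?case .
    qed
    also have "\<dots> \<le> \<theta> * (ln (real n) - 0)"
      using n k0(1) \<theta> by (intro mult_left_mono diff_mono) auto
    finally show ?thesis by simp
  qed
  define c where "c = dens (\<xi> ^ k0) * exp (- 2 * (real B)\<^sup>2 * 2)"
  have c0: "c > 0" by (simp add: c_def dens_pos)
  have low: "dens (\<xi> ^ n) \<ge> c * real n powr (- \<theta>)" if n: "n \<ge> k0" for n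
  proof -
    have n2: "real n \<ge> 2" using n k0(1) by linarith
    have "c * real n powr (- \<theta>) = dens (\<xi> ^ k0) * exp (- (\<theta> * ln (real n)) - 2 * (real B)\<^sup>2 * 2)"
      using n2 by (simp add: c_def powr_def exp_diff exp_minus field_simps)
    also have "\<dots> \<le> dens (\<xi> ^ k0) * exp (- mass (\<xi> ^ k0) (\<xi> ^ n) - 2 * (real B)\<^sup>2 * 2)"
      using massn[OF n] dens_pos[of "\<xi> ^ k0"] by (intro mult_left_mono) auto
    also have "\<dots> \<le> dens (\<xi> ^ n)"
      using k0(2)[of k0] \<xi> n by (intro dens_lower power_increasing) auto
    finally show ?thesis .
  qed
  have "((\<lambda>n. dens (\<xi> ^ n) * ln (\<xi> ^ n)) \<longlongrightarrow> C1) sequentially"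
    by (rule filterlim_compose[OF dens_ln_tendsto powlim])
  hence up: "\<forall>\<^sub>F n in sequentially. dens (\<xi> ^ n) * ln (\<xi> ^ n) < C1 + 1"
    by (rule order_tendstoD(2)) simp
  have "filterlim (\<lambda>n::nat. (c * ln \<xi>) * real n powr (1 - \<theta>)) at_top sequentially"
    using c0 l\<xi> \<theta>(1) by (intro filterlim_tendsto_pos_mult_at_top[OF tendsto_const] ) (simp, real_asymp)
  hence big: "\<forall>\<^sub>F n in sequentially. (c * ln \<xi>) * real n powr (1 - \<theta>) \<ge> C1 + 1"
    by (simp add: filterlim_at_top)
  \<comment> \<open>At \<xi>^n the product of \<open>dens\<close> and the logarithm is at least a
    constant times n powr (1 - \<theta>), which is unbounded, whereas it tends to
    \<open>C1\<close>.\<close>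
  have "\<forall>\<^sub>F n::nat in sequentially. False"
    using up big eventually_ge_at_top[of k0]
  proof eventually_elim
    case (elim n)
    have n2: "real n \<ge> 2" using elim(3) k0(1) by linarith
    have "(c * ln \<xi>) * real n powr (1 - \<theta>) = (c * real n powr (- \<theta>)) * (real n * ln \<xi>)"
      using n2 by (simp add: powr_diff powr_minus divide_inverse)
    also have "\<dots> \<le> dens (\<xi> ^ n) * (real n * ln \<xi>)"
      using low[OF elim(3)] l\<xi> by (intro mult_right_mono) auto
    also have "real n * ln \<xi> = ln (\<xi> ^ n)" using \<xi> by (simp add: ln_realpow)
    finally show ?case using elim by linarith
  qed
  thus False by simp
qed

text \<open>The Mertens condition keeps the mean number of classes at or above ln \<xi> / (\<xi> -
  1), a value near 1 for ratios near 1; any \<open>\<theta>\<close> below 1 then leaves room for the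
  limit to take effect.\<close>

lemma cnt_block_lower:
  assumes \<xi>: "\<xi> > 1" and \<theta>: "\<theta> < 1"
  shows "\<forall>\<^sub>F u in at_top. cnt u (\<xi> * u) \<ge> \<theta> * ln \<xi> * (u / ln u)"
proof -
  obtain \<rho> where \<rho>: "((\<lambda>x. cnt 0 x / (x / ln x)) \<longlongrightarrow> \<rho>) at_top" using cnt_tendsto by blast
  have "\<theta> * ln \<xi> < \<rho> * (\<xi> - 1)"
  proof -
    have "\<theta> * ln \<xi> < 1 * ln \<xi>" using \<theta> \<xi> by (intro mult_strict_right_mono) auto
    thus ?thesis using mean_lower[OF \<rho> \<xi>] by simp
  qed
  hence "\<forall>\<^sub>F u in at_top. \<theta> * ln \<xi> < cnt u (\<xi> * u) / (u / ln u)"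
    by (rule order_tendstoD(1)[OF cnt_block_tendsto[OF \<rho> \<xi>]])
  thus ?thesis using eventually_gt_at_top[of 1]
  proof eventually_elim
    case (elim u)
    hence "u / ln u > 0" by simp
    thus ?case using elim(1) by (simp only: pos_less_divide_eq less_imp_le)
  qed
qed

text \<open>Blocks of ratio \<open>\<xi>\<close> are chained; bounding 1 / p below over a block
  costs the factor \<open>\<xi>\<close> in the denominator. The number \<open>n\<close> of blocks is
  quantified inside the eventuality because it will depend on \<open>x\<close>.\<close>

lemma mass_lower:
  assumes \<xi>: "\<xi> > 1" and \<theta>: "0 < \<theta>" "\<theta> < 1"
  shows "\<forall>\<^sub>F u in at_top. \<forall>n. mass u (\<xi> ^ n * u) \<ge> real n * (\<theta> * ln \<xi> / (\<xi> * ln (\<xi> ^ n * u)))"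
proof -
  obtain u0 where u0: "\<And>u. u \<ge> u0 \<Longrightarrow> cnt u (\<xi> * u) \<ge> \<theta> * ln \<xi> * (u / ln u)"
    using cnt_block_lower[OF \<xi> \<theta>(2)] by (auto simp: eventually_at_top_linorder)
  show ?thesis using eventually_ge_at_top[of u0] eventually_gt_at_top[of 1]
  proof eventually_elim
    case (elim u)
    show ?case
    proof
      fix N
      have g: "\<xi> ^ n * u \<ge> u" for n using \<xi> elim by (simp add: one_le_power)
      have "mass u (\<xi> ^ n * u) \<ge> real n * (\<theta> * ln \<xi> / (\<xi> * ln (\<xi> ^ N * u)))" if "n \<le> N" for n
        using that
      proof (induction n)
        case 0
        thus ?case by (auto simp: mass_def intro!: sum_nonneg)
      next
        case (Suc n)
        define v where "v = \<xi> ^ n * u"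
        have v: "v \<ge> u" unfolding v_def by (rule g)
        have v1: "v > 1" using v elim by simp
        have vN: "ln v \<le> ln (\<xi> ^ N * u)"
          using Suc.prems \<xi> elim v1 by (auto simp: v_def intro!: mult_right_mono power_increasing)
        have lv: "ln v > 0" using v1 by simp
        have "\<theta> * ln \<xi> / (\<xi> * ln (\<xi> ^ N * u)) \<le> \<theta> * ln \<xi> / (\<xi> * ln v)"
          using vN lv \<xi> \<theta> by (intro divide_left_mono mult_left_mono mult_pos_pos) auto
        also have "\<dots> = \<theta> * ln \<xi> * (v / ln v) / (\<xi> * v)" using v1 \<xi> by simp
        also have "\<dots> \<le> cnt v (\<xi> * v) / (\<xi> * v)"
          using u0[of v] v elim v1 \<xi> by (intro divide_right_mono) auto
        also have "\<dots> = (\<Sum>p\<in>primes_in v (\<xi> * v). real (card (I p)) / (\<xi> * v))" by (simp add: cnt_def sum_divide_distrib)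
        also have "\<dots> \<le> mass v (\<xi> * v)"
          unfolding mass_def using v1 \<xi> by (intro sum_mono divide_left_mono) (auto simp: primes_in_def)
        finally have b: "\<theta> * ln \<xi> / (\<xi> * ln (\<xi> ^ N * u)) \<le> mass v (\<xi> * v)" .
        have "mass u (\<xi> ^ Suc n * u) = mass u v + mass v (\<xi> * v)"
          unfolding mass_def v_def using \<xi> elim g[of n] by (subst sum_primes_in_split[of u "\<xi> ^ n * u"]) (auto simp: mult_ac)
        moreover have "mass u v \<ge> real n * (\<theta> * ln \<xi> / (\<xi> * ln (\<xi> ^ N * u)))"
          using Suc by (simp add: v_def)
        moreover have "real (Suc n) * x = real n * x + x" for x by (simp add: algebra_simps)
        ultimately show ?case using b by (simp only:)
      qed
      thus "mass u (\<xi> ^ N * u) \<ge> real N * (\<theta> * ln \<xi> / (\<xi> * ln (\<xi> ^ N * u)))" by simp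
    qed
  qed
qed

text \<open>These primes serve to remove the last points individually. The count weighted by card (I
  p) is bounded below on a block of ratio 2, and card (I p) \<le> B turns it into a count of
  primes.\<close>

lemma many_large_primes:
  "\<forall>\<^sub>F x in at_top. real (card {p \<in> primes_in (x / 2) x. card (I p) \<ge> 1}) * real B \<ge> x / (8 * ln x)"
proof -
  have lim: "filterlim (\<lambda>x::real. x / 2) at_top at_top" by real_asymp
  have "\<forall>\<^sub>F u in at_top. cnt u (2 * u) \<ge> 1 / 2 * ln 2 * (u / ln u)" by (rule cnt_block_lower) auto
  from eventually_compose_filterlim[OF this lim]
  have "\<forall>\<^sub>F x in at_top. cnt (x / 2) x \<ge> 1 / 2 * ln 2 * (x / 2 / ln (x / 2))" by simp
  thus ?thesis using eventually_gt_at_top[of 2]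
  proof eventually_elim
    case (elim x)
    have "x / (8 * ln x) = 1 / 2 * (1 / 2) * (x / 2 / ln x)" by simp
    also have "\<dots> \<le> 1 / 2 * ln 2 * (x / 2 / ln (x / 2))"
    proof (intro mult_mono divide_left_mono mult_pos_pos)
      show "(1 / 2 :: real) \<le> ln 2" using ln_le_minus_one[of "1 / 2 :: real"] by (simp add: ln_div)
    qed (use elim in auto)
    also have "\<dots> \<le> cnt (x / 2) x" by (rule elim(1))
    also have "\<dots> = (\<Sum>p\<in>{p \<in> primes_in (x / 2) x. card (I p) \<ge> 1}. real (card (I p)))"
      unfolding cnt_def using finite_primes_in by (intro sum.mono_neutral_right) auto
    also have "\<dots> \<le> (\<Sum>p\<in>{p \<in> primes_in (x / 2) x. card (I p) \<ge> 1}. real B)"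
      using I_card by (intro sum_mono) (auto simp: primes_in_def)
    finally show ?case by simp
  qed
qed

end

section \<open>Covering an interval by translates\<close>

text \<open>If N is congruent to - c p modulo every p \<le> x, then N + n lies in the same class as
  n - c p. The open interval from N to N + Y + 1 contains exactly the integers N + n with 1 \<le> n
  \<le> Y.\<close>

lemma gap_from_shifts:
  assumes cover: "\<And>n. n \<in> {1..int Y} \<Longrightarrow> \<exists>p. prime p \<and> real p \<le> x \<and> (n - c p) mod int p \<in> I p"
    and L: "L \<le> real Y"
  shows "has_gap (sieved_set I x) L"
proof -
  define A where "A = {p. prime p \<and> real p \<le> x}"
  have finA: "finite A" using finite_primes_in[of 0 x] by (simp add: A_def primes_in_0)
  have "\<exists>N. \<forall>p\<in>A. [N = nat ((- c p) mod int p)] (mod p)"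
  proof (rule chinese_remainder_nat[OF finA])
    show "\<forall>i\<in>A. \<forall>j\<in>A. i \<noteq> j \<longrightarrow> coprime i j" by (simp add: A_def primes_coprime)
  qed
  then obtain N where N: "\<And>p. p \<in> A \<Longrightarrow> [N = nat ((- c p) mod int p)] (mod p)" by blast
  have shift: "(int N + n) mod int p = (n - c p) mod int p" if p: "p \<in> A" for p n
  proof -
    have p0: "int p > 0" using p prime_gt_0_nat by (auto simp: A_def)
    have "int N mod int p = int (nat ((- c p) mod int p)) mod int p"
    proof -
      have "int N mod int p = int (N mod p)" by (rule zmod_int[symmetric])
      also have "N mod p = nat ((- c p) mod int p) mod p" using N[OF p] by (simp only: cong_def)
      finally show ?thesis by (simp only: zmod_int)
    qed
    also have "\<dots> = (- c p) mod int p" using p0 by simp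
    finally have "(int N + n) mod int p = (- c p + n) mod int p" by (rule mod_add_cong) simp
    thus ?thesis by (simp add: algebra_simps)
  qed
  have "{real N<..<real N + real Y + 1} \<inter> of_int ` sieved_set I x = {}"
  proof (rule ccontr)
    assume "\<not> ?thesis"
    then obtain k where k: "k \<in> sieved_set I x" "real N < of_int k" "of_int k < real N + real Y + 1" by auto
    define n where "n = k - int N"
    have "int N < k" "k < int N + int Y + 1" using k(2,3) by linarith+
    hence "n \<in> {1..int Y}" by (simp add: n_def)
    from cover[OF this] obtain p where p: "prime p" "real p \<le> x" "(n - c p) mod int p \<in> I p" by blast
    have "k mod int p \<in> I p" using shift[of p n] p by (simp add: A_def n_def)
    thus False using k(1) p by (auto simp: sieved_set_def)
  qed
  moreover have "(real N + real Y + 1) - real N \<ge> L" using L by simp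
  ultimately show ?thesis unfolding has_gap_def by blast
qed

lemma subset_sum_between:
  fixes g :: "'a \<Rightarrow> real"
  assumes "finite Q" "\<And>q. q \<in> Q \<Longrightarrow> g q \<le> M" "0 \<le> M" "0 \<le> f" "f \<le> sum g Q"
  shows "\<exists>A\<subseteq>Q. f \<le> sum g A \<and> sum g A \<le> f + M"
  using assms
proof (induction Q rule: finite_induct)
  case empty
  thus ?case by auto
next
  case (insert q Q)
  show ?case
  proof (cases "f \<le> sum g Q")
    case True
    then obtain A where "A \<subseteq> Q" "f \<le> sum g A" "sum g A \<le> f + M" using insert by auto
    thus ?thesis by (intro exI[of _ A]) auto
  next
    case False
    have "g q \<le> M" by (rule insert.prems(1)) simp
    hence "sum g (insert q Q) \<le> f + M" using False insert.hyps by simp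
    thus ?thesis using insert.prems(4) by (intro exI[of _ "insert q Q"]) auto
  qed
qed

text \<open>Blocks are split off greedily. Each overshoots its target by at most the largest weight
  \<open>M\<close>, which is why the total must cover \<open>M\<close> once more per block.\<close>

lemma partition_into_blocks:
  fixes g :: "'a \<Rightarrow> real" and f :: "nat \<Rightarrow> real"
  assumes "finite Q" "\<And>q. q \<in> Q \<Longrightarrow> g q \<le> M" "0 \<le> M" "\<And>j. j < m \<Longrightarrow> 0 \<le> f j"
    and "(\<Sum>j<m. f j + M) \<le> sum g Q"
  shows "\<exists>K. (\<forall>j<m. K j \<subseteq> Q \<and> f j \<le> sum g (K j)) \<and> (\<forall>i<m. \<forall>j<m. i \<noteq> j \<longrightarrow> K i \<inter> K j = {})"
  using assms
proof (induction m arbitrary: Q)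
  case (Suc m)
  have rest: "0 \<le> (\<Sum>j<m. f j + M)" using Suc.prems by (intro sum_nonneg) auto
  have "f m \<le> sum g Q" using Suc.prems(3,5) rest by simp
  then obtain A where A: "A \<subseteq> Q" "f m \<le> sum g A" "sum g A \<le> f m + M"
    using subset_sum_between[of Q g M "f m"] Suc.prems by auto
  have "sum g (Q - A) = sum g Q - sum g A" using Suc.prems(1) A(1) by (rule sum_diff)
  hence "(\<Sum>j<m. f j + M) \<le> sum g (Q - A)" using A(3) Suc.prems(5) by simp
  then obtain K where K: "\<forall>j<m. K j \<subseteq> Q - A \<and> f j \<le> sum g (K j)" "\<forall>i<m. \<forall>j<m. i \<noteq> j \<longrightarrow> K i \<inter> K j = {}"
    using Suc.IH[of "Q - A"] Suc.prems by auto
  define K' where "K' = (\<lambda>j. if j = m then A else K j)"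
  have "K' j \<subseteq> Q \<and> f j \<le> sum g (K' j)" if "j < Suc m" for j
    using K(1)[rule_format, of j] A that by (cases "j = m") (auto simp: K'_def)
  moreover have "K' i \<inter> K' j = {}" if ij: "i < Suc m" "j < Suc m" "i \<noteq> j" for i j
  proof (cases "i = m \<or> j = m")
    case True
    thus ?thesis using K(1)[rule_format, of i] K(1)[rule_format, of j] ij by (auto simp: K'_def)
  next
    case False
    thus ?thesis using K(2) ij by (simp add: K'_def)
  qed
  ultimately show ?case by blast
qed simp

section \<open>Typical residues and the covering\<close>

context sieve begin

text \<open>The points left over are sent injectively into \<open>R\<close>, and each prime used
  there is translated so that one fixed class of \<open>I p\<close> falls on its point.\<close>

lemma shifts_from_cover:
  assumes b: "\<And>p. p \<in> P \<Longrightarrow> real p \<le> x"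
    and Q: "\<And>q. q \<in> Q \<Longrightarrow> prime q \<and> real q \<le> x \<and> q \<notin> P"
    and R: "finite R" "\<And>p. p \<in> R \<Longrightarrow> prime p \<and> real p \<le> x \<and> p \<notin> P \<and> p \<notin> Q \<and> card (I p) \<ge> 1"
    and left: "card {s \<in> surv P b. \<not> (\<exists>q\<in>Q. s \<in> prog q (r q))} \<le> card R"
  shows "\<exists>c. \<forall>n\<in>{1..int Y}. \<exists>p. prime p \<and> real p \<le> x \<and> (n - c p) mod int p \<in> I p"
proof -
  define Lf where "Lf = {s \<in> surv P b. \<not> (\<exists>q\<in>Q. s \<in> prog q (r q))}"
  have "finite Lf" by (rule finite_subset[of _ "{1..int Y}"]) (auto simp: Lf_def surv_def)
  then obtain f where f: "inj_on f Lf" "f ` Lf \<subseteq> R"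
    using card_le_inj[of Lf R] R(1) left by (auto simp: Lf_def)
  define i where "i = (\<lambda>p. SOME i. i \<in> I p)"
  have i: "i p \<in> I p" if "p \<in> R" for p
  proof -
    have "I p \<noteq> {}" using R(2)[OF that] by auto
    thus ?thesis unfolding i_def by (rule some_in_eq[THEN iffD2])
  qed
  define c where "c = (\<lambda>p. if p \<in> P then b p else if p \<in> Q then r p else the_inv_into Lf f p - i p)"
  have "\<exists>p. prime p \<and> real p \<le> x \<and> (n - c p) mod int p \<in> I p" if n: "n \<in> {1..int Y}" for n
  proof -
    consider "n \<notin> surv P b" | q where "q \<in> Q" "n \<in> prog q (r q)" | "n \<in> Lf" by (auto simp: Lf_def)
    thus ?thesis
    proof cases
      case 1
      then obtain p where "p \<in> P" "b p \<in> bad p {n}" using n by (auto simp: surv_def)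
      thus ?thesis using b primeP by (intro exI[of _ p]) (auto simp: c_def bad_def)
    next
      case 2
      thus ?thesis using Q[of q] by (intro exI[of _ q]) (auto simp: c_def prog_def)
    next
      case 3
      define p where "p = f n"
      have p: "p \<in> R" using 3 f by (auto simp: p_def)
      have "the_inv_into Lf f p = n" using 3 f by (simp add: p_def the_inv_into_f_f)
      hence "n - c p = i p" using R(2)[OF p] by (simp add: c_def)
      moreover have "i p mod int p = i p" using i[OF p] I_sub[of p] R(2)[OF p] by auto
      ultimately show ?thesis using i[OF p] R(2)[OF p] by (intro exI[of _ p]) auto
    qed
  qed
  thus ?thesis by blast
qed

text \<open>The mean number of survivors, and Markov's inequality for those at which some block has an
  abnormal degree or a large loss, leave a common choice of the residues \<open>b\<close>.\<close>

lemma good_residues_exist: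
  fixes m Lv :: nat and w H :: "nat \<Rightarrow> real" and T k :: "nat \<Rightarrow> nat" and K :: "nat \<Rightarrow> nat \<Rightarrow> nat set"
    and n1 c e1 :: real and n2 :: "nat \<Rightarrow> real"
  assumes lvl: "\<And>l j. l < Lv \<Longrightarrow> j < m \<Longrightarrow> sieve_level I B Y P (w l) (H l) (T l) (k l) (K l j) n1 (n2 l)"
    and Lm: "Lv > 0" "m > 0" and Y1: "Y \<ge> 1" and c: "c > 0" and e1: "e1 > 0"
    and deg0: "\<And>l j. l < Lv \<Longrightarrow> j < m \<Longrightarrow> sieve_level.lvl_deg I P (w l) (K l j) > 0"
    and err: "\<And>l j. l < Lv \<Longrightarrow> j < m \<Longrightarrow>
        real Y * ((sieve_level.lvl_err B (w l) (T l) (k l) * (sieve_level.lvl_deg I P (w l) (K l j))\<^sup>2 * sig P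
            + (real B)\<^sup>2 * sieve_level.lvl_max I P (T l) * ((H l)\<^sup>2 / real Y) * (real B * real (T l) * (n1 + n2 l)))
          / (c * sieve_level.lvl_deg I P (w l) (K l j))\<^sup>2)
        + 2 * real Y * ((1 + c) / c\<^sup>2) * sieve_level.wt_err I B Y P (w l) (H l) (T l) (k l) (K l j) (n2 l) / (c * sieve_level.lvl_deg I P (w l) (K l j))
        \<le> e1 * (real Y * sig P)"
  shows "\<exists>b. real (card (surv P b)) \<le> 2 * (real Y * sig P) \<and>
     real (card {s \<in> surv P b. \<exists>l<Lv. \<exists>j<m. \<not> ((1 - c) * sieve_level.lvl_deg I P (w l) (K l j) \<le> sieve_level.dg I Y P (w l) (K l j) s b
        \<and> sieve_level.loss I Y P (w l) (K l j) c s b \<le> c * sieve_level.lvl_deg I P (w l) (K l j))})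
       \<le> 2 * real Lv * real m * e1 * (real Y * sig P)"
proof -
  define de where "de = (\<lambda>l j. sieve_level.lvl_deg I P (w l) (K l j))"
  define d where "d = (\<lambda>l j. sieve_level.dg I Y P (w l) (K l j))"
  define ls where "ls = (\<lambda>l j. sieve_level.loss I Y P (w l) (K l j) c)"
  define Ex where "Ex = (\<lambda>b. {s \<in> surv P b. \<exists>l<Lv. \<exists>j<m. \<not> ((1 - c) * de l j \<le> d l j s b \<and> ls l j s b \<le> c * de l j)})"
  define Z where "Z = (\<lambda>l j b. \<Sum>s\<in>{1..int Y}. (1 / (c * de l j)\<^sup>2) * (of_bool (s \<in> surv P b) * (d l j s b - de l j)\<^sup>2)
      + (1 / (c * de l j)) * (of_bool (s \<in> surv P b) * ls l j s b))"
  define M where "M = real Y * sig P"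
  have Ppos: "p > 0" if "p \<in> P" for p using primeP[OF that] prime_gt_0_nat by blast
  have M0: "M > 0" using Y1 sig_pos[of P] by (simp add: M_def)
  have surv_sum: "real (card (surv P b)) = (\<Sum>s\<in>{1..int Y}. of_bool (s \<in> surv P b))" for b
  proof -
    have "(\<Sum>s\<in>{1..int Y}. of_bool (s \<in> surv P b) :: real) = real (card ({1..int Y} \<inter> surv P b))"
      by (simp add: of_bool_def sum.If_cases Int_def)
    also have "{1..int Y} \<inter> surv P b = surv P b" by (auto simp: surv_def)
    finally show ?thesis ..
  qed
  have ES: "sieve_avg P (\<lambda>b. real (card (surv P b))) = M"
    unfolding surv_sum sieve_avg_sum using surv_single_prob by (simp add: M_def)
  have EZ: "sieve_avg P (Z l j) \<le> e1 * M" if lj: "l < Lv" "j < m" for l j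
  proof -
    interpret L: sieve_level I B Y P "w l" "H l" "T l" "k l" "K l j" n1 "n2 l" by (rule lvl[OF lj])
    have d0: "de l j > 0" using deg0[OF lj] by (simp add: de_def)
    have "sieve_avg P (Z l j) = (\<Sum>s\<in>{1..int Y}. (1 / (c * de l j)\<^sup>2) * sieve_avg P (\<lambda>b. of_bool (s \<in> surv P b) * (d l j s b - de l j)\<^sup>2))
       + (1 / (c * de l j)) * sieve_avg P (\<lambda>b. \<Sum>s\<in>{1..int Y}. of_bool (s \<in> surv P b) * ls l j s b)"
      unfolding Z_def sieve_avg_sum sieve_avg_add sieve_avg_scale sum.distrib sum_distrib_left ..
    also have "\<dots> \<le> (\<Sum>s\<in>{1..int Y}. (1 / (c * de l j)\<^sup>2) * (L.lvl_err * L.lvl_deg\<^sup>2 * sig P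
        + (real B)\<^sup>2 * L.lvl_max * ((H l)\<^sup>2 / real Y) * (real B * real (T l) * (n1 + n2 l))))
       + (1 / (c * de l j)) * (2 * real Y * ((1 + c) / c\<^sup>2) * L.wt_err)"
      unfolding d_def de_def ls_def using c d0
      by (intro add_mono sum_mono mult_left_mono L.degree_variance L.mean_total_loss) (auto simp: de_def)
    also have "\<dots> \<le> e1 * M"
      using err[OF lj] by (simp add: de_def M_def mult_ac)
    finally show ?thesis .
  qed
  have Ex_le: "real (card (Ex b)) \<le> (\<Sum>l<Lv. \<Sum>j<m. Z l j b)" for b
  proof -
    have nn: "0 \<le> (1 / (c * de l j)\<^sup>2) * (of_bool (s \<in> surv P b) * (d l j s b - de l j)\<^sup>2)"
       "0 \<le> (1 / (c * de l j)) * (of_bool (s \<in> surv P b) * ls l j s b)" if lj: "l < Lv" "j < m" for l j s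
    proof -
      interpret L: sieve_level I B Y P "w l" "H l" "T l" "k l" "K l j" n1 "n2 l" by (rule lvl[OF lj])
      show "0 \<le> (1 / (c * de l j)) * (of_bool (s \<in> surv P b) * ls l j s b)"
        using c deg0[OF lj] L.loss_nonneg by (auto simp: de_def ls_def intro!: mult_nonneg_nonneg divide_nonneg_nonneg)
    qed simp
    have "real (card (Ex b)) = (\<Sum>s\<in>{1..int Y}. of_bool (s \<in> Ex b))"
    proof -
      have "(\<Sum>s\<in>{1..int Y}. of_bool (s \<in> Ex b) :: real) = real (card ({1..int Y} \<inter> Ex b))"
        by (simp add: of_bool_def sum.If_cases Int_def)
      also have "{1..int Y} \<inter> Ex b = Ex b" by (auto simp: Ex_def surv_def)
      finally show ?thesis ..
    qed
    also have "\<dots> \<le> (\<Sum>s\<in>{1..int Y}. \<Sum>l<Lv. \<Sum>j<m. (1 / (c * de l j)\<^sup>2) * (of_bool (s \<in> surv P b) * (d l j s b - de l j)\<^sup>2)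
      + (1 / (c * de l j)) * (of_bool (s \<in> surv P b) * ls l j s b))"
    proof (rule sum_mono)
      fix s
      let ?g = "\<lambda>l j. (1 / (c * de l j)\<^sup>2) * (of_bool (s \<in> surv P b) * (d l j s b - de l j)\<^sup>2)
      + (1 / (c * de l j)) * (of_bool (s \<in> surv P b) * ls l j s b)"
      have g0: "0 \<le> ?g l j" if "l < Lv" "j < m" for l j using nn[OF that] by (intro add_nonneg_nonneg)
      show "of_bool (s \<in> Ex b) \<le> (\<Sum>l<Lv. \<Sum>j<m. ?g l j)"
      proof (cases "s \<in> Ex b")
        case True
        then obtain l j where lj: "l < Lv" "j < m" and s: "s \<in> surv P b"
          and no: "\<not> ((1 - c) * de l j \<le> d l j s b \<and> ls l j s b \<le> c * de l j)" by (auto simp: Ex_def)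
        have cd: "c * de l j > 0" using c deg0[OF lj] by (simp add: de_def)
        \<comment> \<open>An exceptional pair of level and block fails either by its degree, where
          Chebyshev applies, or by its loss, where Markov applies; the two summands of
          \<open>?g\<close> correspond to these cases.\<close>
        have "1 \<le> ?g l j"
        proof (cases "ls l j s b \<le> c * de l j")
          case True
          hence "d l j s b < (1 - c) * de l j" using no by simp
          hence "c * de l j \<le> \<bar>d l j s b - de l j\<bar>" by (simp add: algebra_simps)
          hence "(c * de l j)\<^sup>2 \<le> (d l j s b - de l j)\<^sup>2" using cd by (metis abs_of_pos abs_le_square_iff)
          hence "1 \<le> (1 / (c * de l j)\<^sup>2) * (of_bool (s \<in> surv P b) * (d l j s b - de l j)\<^sup>2)"
          proof -
            have "(c * de l j)\<^sup>2 > 0" using cd by (rule zero_less_power)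
            hence "1 \<le> (d l j s b - de l j)\<^sup>2 / (c * de l j)\<^sup>2" using \<open>(c * de l j)\<^sup>2 \<le> _\<close> by (simp only: le_divide_eq_1_pos)
            thus ?thesis using s by simp
          qed
          thus ?thesis using nn(2)[OF lj, of s] by linarith
        next
          case False
          hence "1 \<le> (1 / (c * de l j)) * (of_bool (s \<in> surv P b) * ls l j s b)"
            using s cd by (simp add: le_divide_eq)
          thus ?thesis using nn(1)[OF lj, of s] by linarith
        qed
        also have "?g l j \<le> (\<Sum>j<m. ?g l j)" using lj g0 by (intro member_le_sum) auto
        also have "\<dots> \<le> (\<Sum>l<Lv. \<Sum>j<m. ?g l j)"
          using lj g0 by (intro member_le_sum[of l "{..<Lv}" "\<lambda>l. \<Sum>j<m. ?g l j"] sum_nonneg) auto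
        finally show ?thesis using True by simp
      next
        case False
        thus ?thesis using g0 by (auto intro!: sum_nonneg)
      qed
    qed
    also have "\<dots> = (\<Sum>l<Lv. \<Sum>j<m. Z l j b)"
      unfolding Z_def by (subst sum.swap, rule sum.cong[OF refl], rule sum.swap)
    finally show ?thesis .
  qed
  define N where "N = real Lv * real m * (e1 * M)"
  have N0: "N > 0" using Lm e1 M0 by (simp add: N_def)
  have EEx: "sieve_avg P (\<lambda>b. real (card (Ex b))) \<le> N"
  proof -
    have "sieve_avg P (\<lambda>b. real (card (Ex b))) \<le> sieve_avg P (\<lambda>b. \<Sum>l<Lv. \<Sum>j<m. Z l j b)"
      by (intro sieve_avg_mono Ex_le)
    also have "\<dots> = (\<Sum>l<Lv. \<Sum>j<m. sieve_avg P (Z l j))"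
      unfolding sieve_avg_sum ..
    also have "\<dots> \<le> (\<Sum>l<Lv. \<Sum>j<m. e1 * M)" by (intro sum_mono EZ) auto
    also have "\<dots> = N" by (simp add: N_def)
    finally show ?thesis .
  qed
  \<comment> \<open>Both cardinalities are divided by bounds for their means, so the sum has mean at
    most 2 and one \<open>b\<close> keeps each of them within twice its bound.\<close>
  obtain b where b: "(1 / M) * real (card (surv P b)) + (1 / N) * real (card (Ex b)) \<le> sieve_avg P (\<lambda>b. (1 / M) * real (card (surv P b)) + (1 / N) * real (card (Ex b)))"
    using sieve_avg_witness[OF finP Ppos, of "\<lambda>b. (1 / M) * real (card (surv P b)) + (1 / N) * real (card (Ex b))"] by blast
  have "sieve_avg P (\<lambda>b. (1 / M) * real (card (surv P b)) + (1 / N) * real (card (Ex b))) \<le> (1 / M) * M + (1 / N) * N"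
    unfolding sieve_avg_add sieve_avg_scale ES using EEx N0 by (intro add_left_mono mult_left_mono) auto
  hence le2: "(1 / M) * real (card (surv P b)) + (1 / N) * real (card (Ex b)) \<le> 2" using b M0 N0 by simp
  have "0 \<le> (1 / M) * real (card (surv P b))" "0 \<le> (1 / N) * real (card (Ex b))" using M0 N0 by auto
  hence "(1 / M) * real (card (surv P b)) \<le> 2" "(1 / N) * real (card (Ex b)) \<le> 2" using le2 by linarith+
  hence "real (card (surv P b)) \<le> 2 * M" "real (card (Ex b)) \<le> 2 * N" using M0 N0 by (auto simp: divide_le_eq mult.commute)
  thus ?thesis unfolding Ex_def de_def d_def ls_def M_def N_def by (intro exI[of _ b]) (simp add: mult_ac)
qed

end

context sieve begin

text \<open>The moment estimates are fed into the nibble. The vertices are the typical survivors,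
  the edges are progressions restricted to them, and stage \<open>j\<close> uses the
  \<open>j\<close>-th block of every level at once, so the degrees of all levels add up.\<close>

lemma shifts_exist:
  fixes m Lv r :: nat and w H :: "nat \<Rightarrow> real" and T k :: "nat \<Rightarrow> nat" and K :: "nat \<Rightarrow> nat \<Rightarrow> nat set"
    and n1 c e1 t \<kappa> \<eta> x :: real and n2 :: "nat \<Rightarrow> real" and R :: "nat set"
  assumes lvl: "\<And>l j. l < Lv \<Longrightarrow> j < m \<Longrightarrow> sieve_level I B Y P (w l) (H l) (T l) (k l) (K l j) n1 (n2 l)"
    and Lm: "Lv > 0" "m > 0" and Y1: "Y \<ge> 1" and c: "c > 0" and e1: "e1 > 0"
    and deg0: "\<And>l j. l < Lv \<Longrightarrow> j < m \<Longrightarrow> sieve_level.lvl_deg I P (w l) (K l j) > 0"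
    and err: "\<And>l j. l < Lv \<Longrightarrow> j < m \<Longrightarrow>
        real Y * ((sieve_level.lvl_err B (w l) (T l) (k l) * (sieve_level.lvl_deg I P (w l) (K l j))\<^sup>2 * sig P
            + (real B)\<^sup>2 * sieve_level.lvl_max I P (T l) * ((H l)\<^sup>2 / real Y) * (real B * real (T l) * (n1 + n2 l)))
          / (c * sieve_level.lvl_deg I P (w l) (K l j))\<^sup>2)
        + 2 * real Y * ((1 + c) / c\<^sup>2) * sieve_level.wt_err I B Y P (w l) (H l) (T l) (k l) (K l j) (n2 l) / (c * sieve_level.lvl_deg I P (w l) (K l j))
        \<le> e1 * (real Y * sig P)"
    and disj: "\<And>l j l' j'. l < Lv \<Longrightarrow> j < m \<Longrightarrow> l' < Lv \<Longrightarrow> j' < m \<Longrightarrow> (l, j) \<noteq> (l', j') \<Longrightarrow> K l j \<inter> K l' j' = {}"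
    and Px: "\<And>p. p \<in> P \<Longrightarrow> real p \<le> x"
    and Kx: "\<And>l j q. l < Lv \<Longrightarrow> j < m \<Longrightarrow> q \<in> K l j \<Longrightarrow> real q \<le> x \<and> q \<notin> P"
    and R: "finite R" "\<And>p. p \<in> R \<Longrightarrow> prime p \<and> real p \<le> x \<and> p \<notin> P \<and> card (I p) \<ge> 1"
    and RK: "\<And>l j p. l < Lv \<Longrightarrow> j < m \<Longrightarrow> p \<in> R \<Longrightarrow> p \<notin> K l j"
    and r1: "r \<ge> 1" and Tr: "\<And>l. l < Lv \<Longrightarrow> T l \<le> r"
    and \<eta>: "\<eta> > 0" "\<And>l. l < Lv \<Longrightarrow> real B * (sieve_level.lvl_max I P (T l) * (H l / real Y)) * max 1 n1 \<le> \<eta>"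
    and t: "0 < t" "t \<le> 1" and \<kappa>: "\<kappa> > 1" "(1 + t) * ln \<kappa> \<le> 1"
    and stage: "\<And>j. j < m \<Longrightarrow> (\<Sum>l<Lv. (1 - 2 * c) / (1 + c) * sieve_level.lvl_deg I P (w l) (K l j)) \<ge> (1 + t) * (1 / \<kappa>) ^ j * ln \<kappa>"
    and num: "(24 * (real r)\<^sup>2 * \<kappa> ^ (4 * r * m) / t\<^sup>2)\<^sup>2 * \<eta> powr (1 / 2 ^ m) \<le> (1 / \<kappa>) ^ m"
    and cardR: "2 * real Lv * real m * e1 * (real Y * sig P) + 4 * (1 / \<kappa>) ^ m * (real Y * sig P) \<le> real (card R)"
  shows "\<exists>c. \<forall>n\<in>{1..int Y}. \<exists>p. prime p \<and> real p \<le> x \<and> (n - c p) mod int p \<in> I p"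
proof -
  define M where "M = real Y * sig P"
  define E where "E = (\<lambda>b. {s \<in> surv P b. \<exists>l<Lv. \<exists>j<m. \<not> ((1 - c) * sieve_level.lvl_deg I P (w l) (K l j) \<le> sieve_level.dg I Y P (w l) (K l j) s b
        \<and> sieve_level.loss I Y P (w l) (K l j) c s b \<le> c * sieve_level.lvl_deg I P (w l) (K l j))})"
  have "\<exists>b. real (card (surv P b)) \<le> 2 * M \<and> real (card (E b)) \<le> 2 * real Lv * real m * e1 * M"
    unfolding M_def E_def by (rule good_residues_exist) (fact lvl Lm Y1 c e1 deg0 err)+
  then obtain b where b: "real (card (surv P b)) \<le> 2 * M" "real (card (E b)) \<le> 2 * real Lv * real m * e1 * M"
    by blast
  have finS: "finite (surv P b)" by (rule finite_subset[of _ "{1..int Y}"]) (auto simp: surv_def)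
  \<comment> \<open>The nibble needs enough degree at every single vertex. Exceptional survivors are
    therefore set aside and left to the primes in \<open>R\<close>.\<close>
  define V where "V = surv P b - E b"
  have finV: "finite V" using finS by (simp add: V_def)
  have VU: "v \<in> {1..int Y}" if "v \<in> V" for v using that by (simp add: V_def surv_def)
  define lv where "lv = (\<lambda>q. SOME l. l < Lv \<and> (\<exists>j<m. q \<in> K l j))"
  have lv: "lv q = l" if lj: "l < Lv" "j < m" and q: "q \<in> K l j" for l j q
  proof (rule ccontr)
    assume ne: "lv q \<noteq> l"
    have "\<exists>l. l < Lv \<and> (\<exists>j<m. q \<in> K l j)" using lj q by blast
    hence "lv q < Lv \<and> (\<exists>j<m. q \<in> K (lv q) j)" unfolding lv_def by (rule someI_ex)
    then obtain j' where j': "lv q < Lv" "j' < m" "q \<in> K (lv q) j'" by blast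
    have "K l j \<inter> K (lv q) j' = {}" using lj j' ne by (intro disj) auto
    thus False using q j'(3) by (simp add: disjoint_iff)
  qed
  define wq where "wq = (\<lambda>q. (\<Sum>r\<in>{0..<int q}. lam (w (lv q)) (prog q r) b) / real q)"
  \<comment> \<open>Overweight primes get the zero law, and division by \<open>1 + c\<close> turns
    the remaining weights into subprobabilities.\<close>
  define \<mu> where "\<mu> = (\<lambda>q r. if wq q \<le> 1 + c then lam (w (lv q)) (prog q r) b / ((1 + c) * real q) else 0)"
  define ed where "ed = (\<lambda>q r. prog q r \<inter> V)"
  define Om where "Om = (\<lambda>q::nat. {0..<int q})"
  define Q where "Q = (\<lambda>j. \<Union>l<Lv. K l j)"
  have QD: "\<exists>l<Lv. q \<in> K l j" if "q \<in> Q j" for q j using that by (auto simp: Q_def)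
  have finK: "finite (K l j)" if "l < Lv" "j < m" for l j using sieve_level.finJ[OF lvl[OF that]] .
  have \<mu>0: "\<mu> q r \<ge> 0" for q r using c lam_nonneg by (simp add: \<mu>_def)
  have prob: "subprob (Om q) (\<mu> q)" for q
  proof -
    have "(\<Sum>r\<in>Om q. \<mu> q r) \<le> 1"
    proof (cases "wq q \<le> 1 + c")
      case True
      hence "(\<Sum>r\<in>Om q. \<mu> q r) = wq q / (1 + c)"
        by (simp add: \<mu>_def Om_def wq_def sum_divide_distrib mult.commute)
      thus ?thesis using True c by simp
    qed (simp add: \<mu>_def)
    thus ?thesis using \<mu>0 by (simp add: subprob_def Om_def)
  qed
  have hits: "(\<Sum>r\<in>Om q. f r * of_bool (v \<in> ed q r)) = (\<Sum>r\<in>bad q {v}. f r)" if v: "v \<in> V" for q v and f :: "int \<Rightarrow> real"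
  proof -
    have "bad q {v} = {r \<in> Om q. v \<in> ed q r}"
      using mem_prog_iff[OF VU[OF v], of _ q] v by (auto simp: bad_def Om_def ed_def)
    moreover have "(\<Sum>r\<in>Om q. f r * of_bool (v \<in> ed q r)) = sum f {r \<in> Om q. v \<in> ed q r}"
      by (rule sum.mono_neutral_cong_right) (auto simp: Om_def)
    ultimately show ?thesis by simp
  qed
  have pt: "\<mu> q r \<le> sieve_level.lvl_max I P (T l) * (H l / real Y)" if lj: "l < Lv" "j < m" and q: "q \<in> K l j" for l j q r
  proof -
    interpret L: sieve_level I B Y P "w l" "H l" "T l" "k l" "K l j" n1 "n2 l" by (rule lvl[OF lj])
    have "\<mu> q r \<le> lam (w l) (prog q r) b / ((1 + c) * real q)"
      using lam_nonneg c by (simp add: \<mu>_def lv[OF lj q])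
    also have "\<dots> \<le> lam (w l) (prog q r) b / (1 * real q)"
      using lam_nonneg c L.q0[OF q] by (intro divide_left_mono mult_right_mono) auto
    also have "\<dots> = lam (w l) (prog q r) b * (1 / real q)" by simp
    also have "\<dots> \<le> L.lvl_max * (H l / real Y)"
      using L.lam_bounds[OF q, of r b] L.inv_q_le[OF q] by (intro mult_mono) auto
    finally show ?thesis .
  qed
  \<comment> \<open>The bound is sharper than \<open>\<eta>\<close> by the factor
    \<open>max 1 n1\<close>, since a codegree sums over as many as \<open>n1\<close> primes.\<close>
  have hit1: "(\<Sum>r\<in>bad q {v}. \<mu> q r) \<le> \<eta> / max 1 n1" if lj: "l < Lv" "j < m" and q: "q \<in> K l j" for l j q v
  proof -
    interpret L: sieve_level I B Y P "w l" "H l" "T l" "k l" "K l j" n1 "n2 l" by (rule lvl[OF lj])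
    have h0: "0 \<le> L.lvl_max * (H l / real Y)" using L.lvl_max_ge_1 L.H1 by simp
    have "(\<Sum>r\<in>bad q {v}. \<mu> q r) \<le> (\<Sum>r\<in>bad q {v}. L.lvl_max * (H l / real Y))"
      by (intro sum_mono pt[OF lj q])
    also have "\<dots> = real (card (bad q {v})) * (L.lvl_max * (H l / real Y))" by simp
    also have "\<dots> \<le> real B * (L.lvl_max * (H l / real Y))"
      using card_bad_single[OF L.primeJ[OF q], of v] L.IJ(2)[OF q] h0 by (intro mult_right_mono) auto
    also have "\<dots> \<le> \<eta> / max 1 n1" using \<eta>(2)[OF lj(1)] by (simp add: pos_le_divide_eq less_max_iff_disj)
    finally show ?thesis .
  qed
  have \<eta>1: "\<eta> / max 1 n1 \<le> \<eta>"
  proof -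
    have "\<eta> / max 1 n1 \<le> \<eta> / 1" using \<eta>(1) by (intro divide_left_mono) auto
    thus ?thesis by simp
  qed
  have "\<exists>g. (\<forall>j<m. \<forall>q\<in>Q j. g q \<in> insert {} (ed q ` Om q))
           \<and> real (card (V - (\<Union>j<m. \<Union>q\<in>Q j. g q))) \<le> 2 * (1 / \<kappa>) ^ m * card V"
  proof (rule nibble_covering[where \<mu> = \<mu> and r = r and \<eta> = \<eta> and t = t, OF finV _ _ prob _ _ _ _ r1 \<eta>(1) t \<kappa> num])
    fix j assume j: "j < m"
    show "finite (Q j)" unfolding Q_def using finK j by auto
    show "Q i \<inter> Q j = {}" if i: "i < m" "i \<noteq> j" for i
    proof -
      have "K l i \<inter> K l' j = {}" if "l < Lv" "l' < Lv" for l l' using disj[OF that(1) i(1) that(2) j] i(2) by simp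
      thus ?thesis unfolding Q_def by (simp add: disjoint_iff) blast
    qed
    fix q assume q: "q \<in> Q j"
    then obtain l where l: "l < Lv" "q \<in> K l j" using QD by blast
    interpret L: sieve_level I B Y P "w l" "H l" "T l" "k l" "K l j" n1 "n2 l" by (rule lvl[OF l(1) j])
    show "ed q \<omega> \<subseteq> V \<and> card (ed q \<omega>) \<le> r" if "\<omega> \<in> Om q" for \<omega>
    proof -
      have "card (ed q \<omega>) \<le> card (prog q \<omega>)" unfolding ed_def by (intro card_mono finite_prog) auto
      also have "\<dots> \<le> r" using L.progT[OF l(2)] Tr[OF l(1)] by (rule le_trans)
      finally show ?thesis by (simp add: ed_def)
    qed
    show "(\<Sum>\<omega>\<in>Om q. \<mu> q \<omega> * of_bool (v \<in> ed q \<omega>)) \<le> \<eta>" if v: "v \<in> V" for v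
      unfolding hits[OF v] using hit1[OF l(1) j l(2), of v] \<eta>1 by linarith
  next
    fix j u v assume j: "j < m" and uv: "u \<in> V" "v \<in> V" "u \<noteq> v"
    \<comment> \<open>Two points share an edge of \<open>q\<close> only if their difference lies in
      a difference class of \<open>q\<close>, and by (f) few primes qualify.\<close>
    define Dp where "Dp = diff_primes I (u - v)"
    obtain l0 where l0: "l0 < Lv" using Lm by blast
    interpret L0: sieve_level I B Y P "w l0" "H l0" "T l0" "k l0" "K l0 j" n1 "n2 l0" by (rule lvl[OF l0 j])
    have Dp: "finite Dp" "real (card Dp) \<le> n1"
      using L0.N1[of "u - v"] uv VU[OF uv(1)] VU[OF uv(2)] by (auto simp: Dp_def num_diff_primes_def)
    have finQ: "finite (Q j)" unfolding Q_def using finK j by auto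
    have "(\<Sum>q\<in>Q j. \<Sum>\<omega>\<in>Om q. \<mu> q \<omega> * of_bool (u \<in> ed q \<omega> \<and> v \<in> ed q \<omega>)) \<le> (\<Sum>q\<in>Q j. of_bool (q \<in> Dp) * (\<eta> / max 1 n1))"
    proof (rule sum_mono)
      fix q assume q: "q \<in> Q j"
      then obtain l where l: "l < Lv" "q \<in> K l j" using QD by blast
      interpret L: sieve_level I B Y P "w l" "H l" "T l" "k l" "K l j" n1 "n2 l" by (rule lvl[OF l(1) j])
      show "(\<Sum>\<omega>\<in>Om q. \<mu> q \<omega> * of_bool (u \<in> ed q \<omega> \<and> v \<in> ed q \<omega>)) \<le> of_bool (q \<in> Dp) * (\<eta> / max 1 n1)"
      proof (cases "q \<in> Dp")
        case True
        have "(\<Sum>\<omega>\<in>Om q. \<mu> q \<omega> * of_bool (u \<in> ed q \<omega> \<and> v \<in> ed q \<omega>)) \<le> (\<Sum>\<omega>\<in>Om q. \<mu> q \<omega> * of_bool (v \<in> ed q \<omega>))"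
          using \<mu>0 by (intro sum_mono mult_left_mono) auto
        also have "\<dots> \<le> \<eta> / max 1 n1" unfolding hits[OF uv(2)] by (rule hit1[OF l(1) j l(2)])
        finally show ?thesis using True by simp
      next
        case False
        have no: "\<not> (u \<in> ed q \<omega> \<and> v \<in> ed q \<omega>)" for \<omega>
          using False prog_diff_class[of u q \<omega> v] L.primeJ[OF l(2)] by (auto simp: Dp_def diff_primes_def ed_def)
        have "(\<Sum>\<omega>\<in>Om q. \<mu> q \<omega> * of_bool (u \<in> ed q \<omega> \<and> v \<in> ed q \<omega>)) = 0"
        proof (intro sum.neutral ballI)
          fix \<omega>
          show "\<mu> q \<omega> * of_bool (u \<in> ed q \<omega> \<and> v \<in> ed q \<omega>) = 0" unfolding of_bool_def if_not_P[OF no] by simp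
        qed
        thus ?thesis using False by simp
      qed
    qed
    also have "\<dots> = real (card (Q j \<inter> Dp)) * (\<eta> / max 1 n1)"
    proof -
      have "(\<Sum>q\<in>Q j. of_bool (q \<in> Dp)) = real (card (Q j \<inter> Dp))"
        using finQ by (simp add: of_bool_def sum.If_cases Int_def)
      thus ?thesis by (simp only: sum_distrib_right[symmetric])
    qed
    also have "\<dots> \<le> max 1 n1 * (\<eta> / max 1 n1)"
    proof (intro mult_right_mono)
      have "card (Q j \<inter> Dp) \<le> card Dp" using Dp(1) by (intro card_mono) auto
      thus "real (card (Q j \<inter> Dp)) \<le> max 1 n1" using Dp(2) by linarith
    qed (use \<eta>(1) in simp)
    also have "\<dots> = \<eta>" by simp
    finally show "(\<Sum>q\<in>Q j. \<Sum>\<omega>\<in>Om q. \<mu> q \<omega> * of_bool (u \<in> ed q \<omega> \<and> v \<in> ed q \<omega>)) \<le> \<eta>" .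
  next
    fix j v assume j: "j < m" and v: "v \<in> V"
    have "(1 + t) * (1 / \<kappa>) ^ j * ln \<kappa> \<le> (\<Sum>l<Lv. (1 - 2 * c) / (1 + c) * sieve_level.lvl_deg I P (w l) (K l j))"
      by (rule stage[OF j])
    also have "\<dots> \<le> (\<Sum>l<Lv. \<Sum>q\<in>K l j. \<Sum>\<omega>\<in>Om q. \<mu> q \<omega> * of_bool (v \<in> ed q \<omega>))"
    proof (rule sum_mono)
      fix l assume "l \<in> {..<Lv}"
      hence l: "l < Lv" by simp
      interpret L: sieve_level I B Y P "w l" "H l" "T l" "k l" "K l j" n1 "n2 l" by (rule lvl[OF l j])
      have "v \<notin> E b" "v \<in> surv P b" using v by (auto simp: V_def)
      hence good: "(1 - c) * L.lvl_deg \<le> L.dg v b" "L.loss c v b \<le> c * L.lvl_deg"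
        using l j unfolding E_def by blast+
      have "(\<Sum>q\<in>K l j. \<Sum>\<omega>\<in>Om q. \<mu> q \<omega> * of_bool (v \<in> ed q \<omega>)) = (\<Sum>q\<in>K l j. (1 / (1 + c)) * ((1 - of_bool (L.wt q b > 1 + c)) * (\<Sum>r\<in>bad q {v}. lam (w l) (prog q r) b / real q)))"
      proof (rule sum.cong[OF refl])
        fix q assume q: "q \<in> K l j"
        have wq: "wq q = L.wt q b" by (simp add: wq_def L.wt_def lv[OF l j q])
        have "(\<Sum>r\<in>bad q {v}. \<mu> q r) = (\<Sum>r\<in>bad q {v}. (1 / (1 + c)) * ((1 - of_bool (L.wt q b > 1 + c)) * (lam (w l) (prog q r) b / real q)))"
          by (intro sum.cong refl) (simp add: \<mu>_def wq lv[OF l j q])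
        thus "(\<Sum>\<omega>\<in>Om q. \<mu> q \<omega> * of_bool (v \<in> ed q \<omega>)) = (1 / (1 + c)) * ((1 - of_bool (L.wt q b > 1 + c)) * (\<Sum>r\<in>bad q {v}. lam (w l) (prog q r) b / real q))"
          unfolding hits[OF v] by (simp only: sum_distrib_left)
      qed
      also have "\<dots> = (1 / (1 + c)) * (L.dg v b - L.loss c v b)"
        unfolding L.dg_def L.loss_def sum_subtractf[symmetric] sum_distrib_left[symmetric]
        by (rule arg_cong[where f = "\<lambda>x. (1 / (1 + c)) * x"], rule sum.cong[OF refl]) (simp add: left_diff_distrib)
      \<comment> \<open>A typical vertex has degree at least 1 - c and loss at most c times the
        mean, so the proportion 1 - 2 c remains.\<close>
      also have "\<dots> \<ge> (1 / (1 + c)) * ((1 - 2 * c) * L.lvl_deg)"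
        using good c by (intro mult_left_mono) (auto simp: algebra_simps)
      finally show "(1 - 2 * c) / (1 + c) * L.lvl_deg \<le> (\<Sum>q\<in>K l j. \<Sum>\<omega>\<in>Om q. \<mu> q \<omega> * of_bool (v \<in> ed q \<omega>))" by simp
    qed
    also have "\<dots> = (\<Sum>q\<in>Q j. \<Sum>\<omega>\<in>Om q. \<mu> q \<omega> * of_bool (v \<in> ed q \<omega>))"
      unfolding Q_def
    proof (rule sum.UNION_disjoint[symmetric])
      show "\<forall>l\<in>{..<Lv}. finite (K l j)" using finK j by auto
      show "\<forall>l\<in>{..<Lv}. \<forall>l'\<in>{..<Lv}. l \<noteq> l' \<longrightarrow> K l j \<inter> K l' j = {}"
      proof (intro ballI impI)
        fix l l' assume "l \<in> {..<Lv}" "l' \<in> {..<Lv}" "l \<noteq> l'"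
        thus "K l j \<inter> K l' j = {}" using j by (intro disj) auto
      qed
    qed simp
    finally show "(1 + t) * (1 / \<kappa>) ^ j * ln \<kappa> \<le> (\<Sum>q\<in>Q j. \<Sum>\<omega>\<in>Om q. \<mu> q \<omega> * of_bool (v \<in> ed q \<omega>))" .
  qed
  then obtain g where g: "\<forall>j<m. \<forall>q\<in>Q j. g q \<in> insert {} (ed q ` Om q)"
    "real (card (V - (\<Union>j<m. \<Union>q\<in>Q j. g q))) \<le> 2 * (1 / \<kappa>) ^ m * card V" by (elim exE conjE)
  have "\<forall>q. \<exists>r. (\<exists>j<m. q \<in> Q j) \<longrightarrow> g q \<subseteq> prog q r"
  proof
    fix q
    show "\<exists>r. (\<exists>j<m. q \<in> Q j) \<longrightarrow> g q \<subseteq> prog q r"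
    proof (cases "\<exists>j<m. q \<in> Q j")
      case True
      then obtain j where "j < m" "q \<in> Q j" by blast
      hence "g q \<in> insert {} (ed q ` Om q)" using g(1) by blast
      thus ?thesis by (auto simp: ed_def)
    next
      case False
      thus ?thesis by blast
    qed
  qed
  from choice[OF this] obtain rr where rr: "\<And>q j. j < m \<Longrightarrow> q \<in> Q j \<Longrightarrow> g q \<subseteq> prog q (rr q)" by blast
  define QQ where "QQ = (\<Union>j<m. Q j)"
  have QQD: "\<exists>l<Lv. \<exists>j<m. q \<in> K l j" if "q \<in> QQ" for q using that by (auto simp: QQ_def Q_def)
  define Lf where "Lf = {s \<in> surv P b. \<not> (\<exists>q\<in>QQ. s \<in> prog q (rr q))}"
  have "Lf \<subseteq> E b \<union> (V - (\<Union>j<m. \<Union>q\<in>Q j. g q))"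
  proof
    fix s assume s: "s \<in> Lf"
    show "s \<in> E b \<union> (V - (\<Union>j<m. \<Union>q\<in>Q j. g q))"
    proof (cases "s \<in> E b")
      case False
      hence "s \<in> V" using s by (simp add: V_def Lf_def)
      moreover have "s \<notin> g q" if "j < m" "q \<in> Q j" for j q
        using s rr[OF that] that by (auto simp: Lf_def QQ_def)
      ultimately show ?thesis by blast
    qed simp
  qed
  moreover have "finite (E b)" by (rule finite_subset[OF _ finS]) (auto simp: E_def)
  ultimately have "card Lf \<le> card (E b \<union> (V - (\<Union>j<m. \<Union>q\<in>Q j. g q)))"
    using finV by (intro card_mono) auto
  also have "\<dots> \<le> card (E b) + card (V - (\<Union>j<m. \<Union>q\<in>Q j. g q))" by (rule card_Un_le)
  finally have "real (card Lf) \<le> real (card (E b)) + real (card (V - (\<Union>j<m. \<Union>q\<in>Q j. g q)))" by linarith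
  also have "\<dots> \<le> 2 * real Lv * real m * e1 * M + 2 * (1 / \<kappa>) ^ m * (2 * M)"
  proof (intro add_mono b(2) order_trans[OF g(2)] mult_left_mono)
    have "card V \<le> card (surv P b)" unfolding V_def using finS by (intro card_mono) auto
    thus "real (card V) \<le> 2 * M" using b(1) by linarith
  qed (use \<kappa> in simp)
  also have "\<dots> \<le> real (card R)" using cardR by (simp add: M_def)
  finally have left: "card Lf \<le> card R" by simp
  show ?thesis
  proof (rule shifts_from_cover[where b = b and Q = QQ and R = R and r = rr, OF Px _ R(1) _ left[unfolded Lf_def]])
    fix q assume "q \<in> QQ"
    then obtain l j where lj: "l < Lv" "j < m" "q \<in> K l j" using QQD by blast
    show "prime q \<and> real q \<le> x \<and> q \<notin> P"
      using sieve_level.primeJ[OF lvl[OF lj(1,2)] lj(3)] Kx[OF lj] by blast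
  next
    fix p assume p: "p \<in> R"
    have "p \<notin> QQ" using RK p QQD by blast
    thus "prime p \<and> real p \<le> x \<and> p \<notin> P \<and> p \<notin> QQ \<and> card (I p) \<ge> 1" using R(2)[OF p] by blast
  qed
qed

end

section \<open>Choice of parameters\<close>

locale gap_setup = sieve_density I B C1 for I :: "nat \<Rightarrow> int set" and B :: nat and C1 :: real +
  fixes \<delta> Kf Kg c1 c2 :: real
  assumes I_sub: "\<And>p. prime p \<Longrightarrow> I p \<subseteq> {0..<int p}"
    and \<delta>: "0 < \<delta>" "\<delta> \<le> 1 / 800"
    and F: "Kf \<ge> 0" "\<And>v. v \<ge> 1 \<Longrightarrow> finite (diff_primes I v) \<and> real (num_diff_primes I v) \<le> Kf * (real_of_int v) powr 0.49"
    and G0: "Kg \<ge> 0" "c1 > 0" "c2 > 0"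
    and G: "\<And>(u::real) (m :: nat \<Rightarrow> int) (w::int) (k::nat).
                u \<ge> 10 \<Longrightarrow>
                (\<forall>q. prime q \<and> card (I q) \<ge> 1 \<longrightarrow>
                   m q \<noteq> 0 \<and> m q mod int q \<in> diff_classes q (I q)) \<Longrightarrow>
                \<bar>real_of_int w\<bar> \<le> u \<Longrightarrow> k \<ge> 1 \<Longrightarrow>
                finite {q. prime q \<and> card (I q) \<ge> 1 \<and> 0 < \<bar>m q\<bar> \<and> \<bar>real_of_int (m q)\<bar> \<le> u \<and>
                             m q + w \<noteq> 0 \<and> num_diff_primes I (m q + w) \<ge> k} \<and>
                real (card {q. prime q \<and> card (I q) \<ge> 1 \<and> 0 < \<bar>m q\<bar> \<and> \<bar>real_of_int (m q)\<bar> \<le> u \<and>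
                             m q + w \<noteq> 0 \<and> num_diff_primes I (m q + w) \<ge> k}) \<le> Kg * (u * ln u powr c1 * exp (- c2 * real k))"
begin

text \<open>The medium primes fall into 60 levels \<open>Y / Gv (l + 1) < q \<le> Y / Gv l\<close>. At each of them \<open>w\<close> is
  \<open>Gv (l + 1) ^ 4\<close>, so each level contributes about \<open>(1 - 1 / 1.1) / 4 = 1 / 44\<close> to the normalised
  degrees, and 60 levels suffice for \<open>11 * ln (11/10)\<close>. Since \<open>\<delta> \<le> 1 / 800\<close>, all exponents
  \<open>av l\<close> stay below \<open>0.4\<close>.\<close>

definition av :: "nat \<Rightarrow> real" where "av l = 1.05 * \<delta> * 1.1 ^ l"
definition Gv :: "nat \<Rightarrow> real \<Rightarrow> real" where "Gv l x = ln x powr av l"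
definition Yv :: "real \<Rightarrow> nat" where "Yv x = nat \<lceil>x * ln x powr \<delta>\<rceil>"
definition zv :: "real \<Rightarrow> real" where "zv x = x / ln x"
text \<open>With this constant exp (- c2 k) outweighs the maximal weight, which is at most exp (12 B
  H ln ln x) for H = Gv (Suc l) x, as well as the factor (ln x) powr c1 in (g), and still leaves (ln
  x) powr (-20).\<close>

definition C3 :: real where "C3 = (12 * real B + 20 + c1) / c2"
text \<open>A prime above Y / Gv (Suc l) x leaves at most Y / q + 1 \<le> 2 Gv (Suc l) x points in
  each of its at most \<open>B\<close> classes.\<close>

definition Tv :: "nat \<Rightarrow> real \<Rightarrow> nat" where "Tv l x = nat \<lceil>2 * real B * Gv (Suc l) x\<rceil>"
definition kv :: "nat \<Rightarrow> real \<Rightarrow> nat" where "kv l x = nat \<lceil>C3 * Gv (Suc l) x * ln (ln x)\<rceil>"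
definition n1v :: "real \<Rightarrow> real" where "n1v x = Kf * real (Yv x) powr 0.49"
definition n2v :: "nat \<Rightarrow> real \<Rightarrow> real" where
  "n2v l x = Kg * (2 * real (Yv x) * ln (2 * real (Yv x)) powr c1 * exp (- c2 * real (kv l x + 1)))"
text \<open>Large enough for the points left by the nibble to need at most half of the primes
  available in (x/2, x]; the summand 1 ensures L0 \<ge> 1.\<close>

definition L0 :: real where "L0 = 512 * C1 * real B + 1"
definition mv :: "real \<Rightarrow> nat" where "mv x = nat \<lceil>ln (L0 * ln x powr \<delta>) / ln 1.1\<rceil>"
definition rv :: "real \<Rightarrow> nat" where "rv x = nat \<lceil>3 * real B * ln x powr 0.4\<rceil>"
definition Lmax :: "nat \<Rightarrow> real \<Rightarrow> real" where "Lmax l x = (1 / dens (zv x)) ^ (2 * Tv l x)"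
definition lev :: "nat \<Rightarrow> real \<Rightarrow> nat set" where
  "lev l x = {q \<in> primes_in (real (Yv x) / Gv (Suc l) x) (real (Yv x) / Gv l x). card (I q) \<ge> 1}"

section \<open>Sizes of the parameters\<close>

lemma B1: "B \<ge> 1"
proof (rule ccontr)
  assume "\<not> B \<ge> 1"
  hence B0: "real B = 0" by simp
  have "\<forall>\<^sub>F x::real in at_top. 0 \<ge> x / (8 * ln x)"
    using many_large_primes unfolding B0 mult_zero_right .
  hence "\<forall>\<^sub>F x::real in at_top. False"
    using eventually_gt_at_top[of 1]
  proof eventually_elim
    case (elim x)
    hence "x / (8 * ln x) > 0" by simp
    thus ?case using elim by linarith
  qed
  thus False by simp
qed

lemma av_pos: "av l > 0" using \<delta> by (simp add: av_def)

lemma av_Suc: "av (Suc l) = 1.1 * av l" by (simp add: av_def)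

lemma av_bounds: "l \<le> 60 \<Longrightarrow> av l \<le> 0.4" "1.05 * \<delta> \<le> av l" "1.155 * \<delta> \<le> av (Suc l)"
proof -
  assume l: "l \<le> 60"
  have "(1.1::real) ^ l \<le> 1.1 ^ 60" using l by (intro power_increasing) auto
  \<comment> \<open>Sixty levels and \<delta> \<le> 1 / 800 just fit together: 1.05 * 304.5 / 800 is
    slightly below 0.4.\<close>
  also have "\<dots> \<le> 304.5" by (simp add: power_divide)
  finally have "1.05 * \<delta> * 1.1 ^ l \<le> 1.05 * (1 / 800) * 304.5" using \<delta> by (intro mult_mono) auto
  thus "av l \<le> 0.4" by (simp add: av_def)
next
  have *: "(1::real) \<le> 1.1 ^ l" by (intro one_le_power) simp
  have "1.05 * \<delta> * 1 \<le> 1.05 * \<delta> * 1.1 ^ l" using * \<delta> by (intro mult_left_mono) auto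
  thus a: "1.05 * \<delta> \<le> av l" by (simp add: av_def)
  thus "1.155 * \<delta> \<le> av (Suc l)" by (simp add: av_Suc)
qed

lemma Gv_bounds:
  assumes x: "ln x \<ge> 1" and l: "l \<le> 60"
  shows "1 \<le> Gv l x" "Gv l x \<le> ln x powr 0.4" "ln x powr (1.05 * \<delta>) \<le> Gv l x"
    "l < 60 \<Longrightarrow> Gv l x \<le> Gv (Suc l) x" "ln x powr (1.155 * \<delta>) \<le> Gv (Suc l) x"
proof -
  show "1 \<le> Gv l x" unfolding Gv_def using x av_pos[of l] by (intro ge_one_powr_ge_zero) auto
  show "Gv l x \<le> ln x powr 0.4" unfolding Gv_def using x av_bounds(1)[OF l] by (intro powr_mono) auto
  show "ln x powr (1.05 * \<delta>) \<le> Gv l x" unfolding Gv_def using x av_bounds(2) by (intro powr_mono) auto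
  show "Gv l x \<le> Gv (Suc l) x" unfolding Gv_def using x av_Suc[of l] av_pos[of l] by (intro powr_mono) auto
  show "ln x powr (1.155 * \<delta>) \<le> Gv (Suc l) x" unfolding Gv_def using x av_bounds(3) by (intro powr_mono) auto
qed

lemma Yv_bounds:
  assumes x: "x \<ge> 1" "ln x \<ge> 1"
  shows "x * ln x powr \<delta> \<le> real (Yv x)" "real (Yv x) \<le> 2 * (x * ln x powr \<delta>)" "x \<le> real (Yv x)" "real (Yv x) \<le> 2 * x * ln x"
proof -
  define y where "y = x * ln x powr \<delta>"
  have l1: "1 \<le> ln x powr \<delta>" using x \<delta> by (intro ge_one_powr_ge_zero) auto
  have "x * 1 \<le> y" unfolding y_def using l1 x by (intro mult_left_mono) auto
  hence xy: "x \<le> y" by simp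
  have Y: "real (Yv x) = of_int \<lceil>y\<rceil>" using xy x by (simp add: Yv_def y_def)
  have c: "y \<le> of_int \<lceil>y\<rceil>" "of_int \<lceil>y\<rceil> \<le> y + 1" by linarith+
  show "x * ln x powr \<delta> \<le> real (Yv x)" using Y c y_def by simp
  show 2: "real (Yv x) \<le> 2 * (x * ln x powr \<delta>)" using Y c xy x unfolding y_def by linarith
  show "x \<le> real (Yv x)" using Y c xy by linarith
  have "ln x powr \<delta> \<le> ln x powr 1" using x \<delta> by (intro powr_mono) auto
  hence "x * ln x powr \<delta> \<le> x * ln x" using x by (intro mult_left_mono) auto
  thus "real (Yv x) \<le> 2 * x * ln x" using 2 by simp
qed

lemma dens_z_bounds:
  "\<forall>\<^sub>F x in at_top. C1 / (2 * ln x) \<le> dens (zv x) \<and> dens (zv x) \<le> 2 * C1 / ln x"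
proof -
  have zlim: "filterlim zv at_top at_top" unfolding zv_def by real_asymp
  have 1: "((\<lambda>x. dens (zv x) * ln (zv x)) \<longlongrightarrow> C1) at_top"
    by (rule filterlim_compose[OF dens_ln_tendsto zlim])
  have 2: "((\<lambda>x::real. ln x / ln (zv x)) \<longlongrightarrow> 1) at_top" unfolding zv_def by real_asymp
  have "((\<lambda>x. dens (zv x) * ln (zv x) * (ln x / ln (zv x))) \<longlongrightarrow> C1 * 1) at_top"
    by (intro tendsto_mult 1 2)
  from order_tendstoD(1)[OF this, of "C1 / 2"] order_tendstoD(2)[OF this, of "2 * C1"]
  have "\<forall>\<^sub>F x in at_top. C1 / 2 < dens (zv x) * ln (zv x) * (ln x / ln (zv x))"
    "\<forall>\<^sub>F x in at_top. dens (zv x) * ln (zv x) * (ln x / ln (zv x)) < 2 * C1"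
    using C1 by simp_all
  moreover have "\<forall>\<^sub>F x::real in at_top. ln (zv x) > 0" unfolding zv_def by real_asymp
  ultimately show ?thesis using eventually_gt_at_top[of 1]
  proof eventually_elim
    case (elim x)
    hence "ln x > 0" by simp
    thus ?case using elim by (auto simp: field_simps)
  qed
qed

lemma dens_w_bounds:
  "\<forall>\<^sub>F x in at_top. C1 / (8 * ln (ln x)) \<le> dens (Gv (Suc l) x ^ 4)" if l: "l < 60"
proof -
  have a: "av (Suc l) > 0" by (rule av_pos)
  have wlim: "filterlim (\<lambda>x. Gv (Suc l) x ^ 4) at_top at_top" unfolding Gv_def using a by real_asymp
  have "((\<lambda>x. dens (Gv (Suc l) x ^ 4) * ln (Gv (Suc l) x ^ 4)) \<longlongrightarrow> C1) at_top"
    by (rule filterlim_compose[OF dens_ln_tendsto wlim])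
  hence "\<forall>\<^sub>F x in at_top. C1 / 2 < dens (Gv (Suc l) x ^ 4) * ln (Gv (Suc l) x ^ 4)"
    using C1 by (intro order_tendstoD(1)) auto
  moreover have "\<forall>\<^sub>F x::real in at_top. ln (ln x) > 1" by real_asymp
  moreover have "\<forall>\<^sub>F x::real in at_top. ln x > 1" by real_asymp
  ultimately show ?thesis
  proof eventually_elim
    case (elim x)
    have "ln (Gv (Suc l) x ^ 4) = 4 * av (Suc l) * ln (ln x)"
      using elim by (simp add: Gv_def ln_realpow ln_powr)
    also have "\<dots> \<le> 4 * 1 * ln (ln x)"
      using elim av_bounds(1)[of "Suc l"] l by (intro mult_right_mono mult_left_mono) auto
    finally have "dens (Gv (Suc l) x ^ 4) * ln (Gv (Suc l) x ^ 4) \<le> dens (Gv (Suc l) x ^ 4) * (4 * ln (ln x))"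
      using dens_pos by (intro mult_left_mono) (auto simp: less_imp_le)
    hence "C1 / 2 \<le> dens (Gv (Suc l) x ^ 4) * (4 * ln (ln x))" using elim by linarith
    thus ?case using elim by (simp add: field_simps)
  qed
qed

lemma mass_mono: "v \<le> v' \<Longrightarrow> mass u v \<le> mass u v'"
  unfolding mass_def using finite_primes_in by (intro sum_mono2) (auto simp: primes_in_def)

text \<open>With a = av l and a' = av (Suc l), the sum of card (I q) / q over the level is bounded
  below by nearly (a' - a) ln ln x / (1.1 ln x), while the quotient of densities is about ln x / (4
  a' ln ln x). The dependence on \<open>x\<close> cancels, and since a' = 1.1 a so does that on the
  level.\<close>

lemma level_mass:
  assumes l: "l < 60"
  shows "\<forall>\<^sub>F x in at_top. mass (real (Yv x) / Gv (Suc l) x) (real (Yv x) / Gv l x)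
            * dens (Gv (Suc l) x ^ 4) / dens (zv x) \<ge> 1 / 49"
proof -
  define a where "a = av l"
  define a' where "a' = av (Suc l)"
  have a: "a > 0" "a' = 1.1 * a" by (auto simp: a_def a'_def av_pos av_Suc)
  have a'0: "a' > 0" using a by simp
  have ulim: "filterlim (\<lambda>x. real (Yv x) / Gv (Suc l) x) at_top at_top"
  proof (rule filterlim_at_top_mono)
    show "filterlim (\<lambda>x::real. x / ln x powr 0.4) at_top at_top" by real_asymp
    show "\<forall>\<^sub>F x in at_top. x / ln x powr 0.4 \<le> real (Yv x) / Gv (Suc l) x"
      using eventually_ge_at_top[of "exp 1"]
    proof eventually_elim
      case (elim x)
      have x: "x \<ge> 1" "ln x \<ge> 1"
        using elim exp_ge_add_one_self[of 1] by (auto simp: ln_ge_iff)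
      show ?case using Yv_bounds[OF x] Gv_bounds[OF x(2), of "Suc l"] l x by (intro frac_le) auto
    qed
  qed
  have ml: "\<forall>\<^sub>F u in at_top. \<forall>n. mass u (1.1 ^ n * u) \<ge> real n * (0.999 * ln 1.1 / (1.1 * ln (1.1 ^ n * u)))"
    by (rule mass_lower) auto
  have m1: "\<forall>\<^sub>F x in at_top. \<forall>n. mass (real (Yv x) / Gv (Suc l) x) (1.1 ^ n * (real (Yv x) / Gv (Suc l) x))
     \<ge> real n * (0.999 * ln 1.1 / (1.1 * ln (1.1 ^ n * (real (Yv x) / Gv (Suc l) x))))"
    by (rule eventually_compose_filterlim[OF ml ulim])
  have u2: "\<forall>\<^sub>F x in at_top. real (Yv x) / Gv (Suc l) x > 2" using ulim by (simp add: filterlim_at_top_dense)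
  define lo where "lo = (\<lambda>x::real. ((a' - a) * ln (ln x) - ln 1.1) * 0.999 / (1.1 * ln (2 * (x * ln x powr \<delta>))))"
  have wlim: "filterlim (\<lambda>x. Gv (Suc l) x ^ 4) at_top at_top" unfolding Gv_def a'_def[symmetric] using a'0 by real_asymp
  have zlim: "filterlim zv at_top at_top" unfolding zv_def by real_asymp
  have d1: "((\<lambda>x. dens (Gv (Suc l) x ^ 4) * ln (Gv (Suc l) x ^ 4)) \<longlongrightarrow> C1) at_top"
    by (rule filterlim_compose[OF dens_ln_tendsto wlim])
  have d2: "((\<lambda>x. dens (zv x) * ln (zv x)) \<longlongrightarrow> C1) at_top"
    by (rule filterlim_compose[OF dens_ln_tendsto zlim])
  have d3: "((\<lambda>x. lo x * (ln (x / ln x) / (4 * a' * ln (ln x)))) \<longlongrightarrow> (a' - a) * 0.999 / (4.4 * a')) at_top"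
    unfolding lo_def using a'0 a \<delta> by (real_asymp simp: field_simps)
  \<comment> \<open>The left side is 0.999 / 48.4. The ideal 1 / 44 has lost a factor 1.1 because 1
    / p is bounded below on whole blocks of ratio 1.1.\<close>
  have "(a' - a) * 0.999 / (4.4 * a') > 1 / 49" using a by simp
  moreover have "((\<lambda>x. (lo x * (ln (x / ln x) / (4 * a' * ln (ln x)))) * ((dens (Gv (Suc l) x ^ 4) * ln (Gv (Suc l) x ^ 4)) / (dens (zv x) * ln (zv x)))) \<longlongrightarrow> (a' - a) * 0.999 / (4.4 * a') * (C1 / C1)) at_top"
    using C1 by (intro tendsto_mult tendsto_divide d1 d2 d3) auto
  ultimately have big: "\<forall>\<^sub>F x in at_top. 1 / 49 < (lo x * (ln (x / ln x) / (4 * a' * ln (ln x)))) * ((dens (Gv (Suc l) x ^ 4) * ln (Gv (Suc l) x ^ 4)) / (dens (zv x) * ln (zv x)))"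
    using C1 by (intro order_tendstoD(1)) auto
  have e1: "\<forall>\<^sub>F x::real in at_top. ln (ln x) > 1" by real_asymp
  have e2: "\<forall>\<^sub>F x::real in at_top. ln (x / ln x) > 0" by real_asymp
  have e3: "\<forall>\<^sub>F x::real in at_top. x \<ge> 1 \<and> ln x \<ge> 1" by (intro eventually_conj; real_asymp)
  show ?thesis using big m1 u2 e1 e2 e3
  proof eventually_elim
    case (elim x)
    have x: "x \<ge> 1" "ln x \<ge> 1" using elim by auto
    define u where "u = real (Yv x) / Gv (Suc l) x"
    \<comment> \<open>The number of full blocks of ratio 1.1 that fit between the end points of the
      level.\<close>
    define n where "n = nat \<lfloor>(a' - a) * ln (ln x) / ln 1.1\<rfloor>"
    have l11: "ln (1.1::real) > 0" by simp
    have q0: "(a' - a) * ln (ln x) / ln 1.1 \<ge> 0" using a elim by simp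
    have n1: "real n \<le> (a' - a) * ln (ln x) / ln 1.1" "real n \<ge> (a' - a) * ln (ln x) / ln 1.1 - 1"
      unfolding n_def using q0 by linarith+
    have n2: "real n * ln 1.1 \<le> (a' - a) * ln (ln x)" "real n * ln 1.1 \<ge> (a' - a) * ln (ln x) - ln 1.1"
      using n1 l11 by (simp_all add: field_simps)
    have "(1.1::real) ^ n = exp (real n * ln 1.1)" by (simp add: exp_of_nat_mult)
    also have "\<dots> \<le> exp ((a' - a) * ln (ln x))" using n2 by simp
    also have "\<dots> = Gv (Suc l) x / Gv l x"
    proof -
      have "ln x \<noteq> 0" using x by linarith
      thus ?thesis by (simp only: Gv_def a_def a'_def powr_def left_diff_distrib exp_diff if_False)
    qed
    finally have pn: "1.1 ^ n \<le> Gv (Suc l) x / Gv l x" .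
    have g: "Gv (Suc l) x \<ge> 1" "Gv l x \<ge> 1" using Gv_bounds(1)[OF x(2)] l by auto
    have u2: "u > 2" using elim by (simp add: u_def)
    have "1.1 ^ n * u \<le> Gv (Suc l) x / Gv l x * u" using pn u2 by (intro mult_right_mono) auto
    also have "\<dots> = real (Yv x) / Gv l x" using g by (simp add: u_def)
    finally have v1: "1.1 ^ n * u \<le> real (Yv x) / Gv l x" .
    also have "\<dots> \<le> real (Yv x) / 1" using g by (intro divide_left_mono) auto
    also have "\<dots> \<le> 2 * (x * ln x powr \<delta>)" using Yv_bounds[OF x] by simp
    finally have v2: "1.1 ^ n * u \<le> 2 * (x * ln x powr \<delta>)" .
    have v0: "1.1 ^ n * u > 1"
    proof -
      have "1 * u \<le> 1.1 ^ n * u" using u2 by (intro mult_right_mono one_le_power) auto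
      thus ?thesis using u2 by linarith
    qed
    have lv: "0 < ln (1.1 ^ n * u)" "ln (1.1 ^ n * u) \<le> ln (2 * (x * ln x powr \<delta>))" using v0 v2 by auto
    have "lo x \<le> real n * ln 1.1 * 0.999 / (1.1 * ln (2 * (x * ln x powr \<delta>)))"
      unfolding lo_def using n2 lv by (intro divide_right_mono mult_right_mono) auto
    also have "\<dots> \<le> real n * ln 1.1 * 0.999 / (1.1 * ln (1.1 ^ n * u))"
      using lv by (intro divide_left_mono mult_left_mono mult_pos_pos) auto
    also have "\<dots> = real n * (0.999 * ln 1.1 / (1.1 * ln (1.1 ^ n * u)))" by simp
    also have "\<dots> \<le> mass u (1.1 ^ n * u)" using elim(2) unfolding u_def by blast
    also have "\<dots> \<le> mass u (real (Yv x) / Gv l x)" by (rule mass_mono[OF v1])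
    finally have lo: "lo x \<le> mass u (real (Yv x) / Gv l x)" .
    have lw: "ln (Gv (Suc l) x ^ 4) = 4 * a' * ln (ln x)"
      using x by (simp add: Gv_def a'_def ln_realpow ln_powr)
    have lz: "ln (zv x) > 0" using elim by (simp add: zv_def)
    have "(lo x * (ln (x / ln x) / (4 * a' * ln (ln x)))) * ((dens (Gv (Suc l) x ^ 4) * ln (Gv (Suc l) x ^ 4)) / (dens (zv x) * ln (zv x)))
       = lo x * (dens (Gv (Suc l) x ^ 4) / dens (zv x))"
      unfolding lw zv_def[symmetric] using lz a'0 elim dens_pos[of "zv x"] by simp
    also have "\<dots> \<le> mass u (real (Yv x) / Gv l x) * (dens (Gv (Suc l) x ^ 4) / dens (zv x))"
      using lo dens_pos by (intro mult_right_mono divide_nonneg_nonneg) (auto simp: less_imp_le)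
    finally show ?case using elim(1) by (simp add: u_def)
  qed
qed

end

section \<open>Error terms for large x\<close>

context gap_setup begin

lemma basic_eventually:
  "\<forall>\<^sub>F x::real in at_top. x \<ge> 10 \<and> ln x \<ge> 2 \<and> ln (ln x) \<ge> 1 \<and> ln x powr 0.4 \<le> ln x \<and> (ln x powr 0.4) ^ 4 \<le> zv x
     \<and> 4 \<le> ln x powr (0.05 * \<delta>) \<and> C3 * ln (ln x) \<ge> 1 \<and> 6 * (real B)\<^sup>2 \<le> ln x powr (1.155 * \<delta>)
     \<and> 2 * ln x / C1 \<le> (ln x)\<^sup>2"
proof (intro eventually_conj)
  have C3: "C3 > 0" using B1 G0 by (simp add: C3_def)
  show "\<forall>\<^sub>F x::real in at_top. x \<ge> 10" by real_asymp
  show "\<forall>\<^sub>F x::real in at_top. ln x \<ge> 2" by real_asymp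
  show "\<forall>\<^sub>F x::real in at_top. ln (ln x) \<ge> 1" by real_asymp
  show "\<forall>\<^sub>F x::real in at_top. ln x powr 0.4 \<le> ln x" by real_asymp
  show "\<forall>\<^sub>F x::real in at_top. (ln x powr 0.4) ^ 4 \<le> zv x" unfolding zv_def by real_asymp
  have "0.05 * \<delta> > 0" using \<delta> by simp
  thus "\<forall>\<^sub>F x::real in at_top. 4 \<le> ln x powr (0.05 * \<delta>)" by real_asymp
  show "\<forall>\<^sub>F x::real in at_top. C3 * ln (ln x) \<ge> 1" using C3 by real_asymp
  define b where "b = 6 * (real B)\<^sup>2"
  have "1.155 * \<delta> > 0" using \<delta> by simp
  hence "\<forall>\<^sub>F x::real in at_top. b \<le> ln x powr (1.155 * \<delta>)" by real_asymp
  thus "\<forall>\<^sub>F x::real in at_top. 6 * (real B)\<^sup>2 \<le> ln x powr (1.155 * \<delta>)" by (simp add: b_def)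
  have "1 / C1 > 0" using C1 by simp
  thus "\<forall>\<^sub>F x::real in at_top. 2 * ln x / C1 \<le> (ln x)\<^sup>2" using C1 by real_asymp
qed

lemma Tv_bounds:
  assumes "ln x \<ge> 1" "l < 60"
  shows "2 * real B * Gv (Suc l) x \<le> real (Tv l x)" "real (Tv l x) \<le> 3 * real B * Gv (Suc l) x"
proof -
  have g: "Gv (Suc l) x \<ge> 1" using Gv_bounds(1)[of x "Suc l"] assms by simp
  have b: "real B \<ge> 1" using B1 by simp
  have bg: "1 * 1 \<le> real B * Gv (Suc l) x" using b g by (intro mult_mono) auto
  have T: "real (Tv l x) = of_int \<lceil>2 * real B * Gv (Suc l) x\<rceil>" using bg by (simp add: Tv_def)
  show "2 * real B * Gv (Suc l) x \<le> real (Tv l x)" unfolding T by linarith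
  have "of_int \<lceil>2 * real B * Gv (Suc l) x\<rceil> \<le> 2 * real B * Gv (Suc l) x + 1" by linarith
  thus "real (Tv l x) \<le> 3 * real B * Gv (Suc l) x" unfolding T using bg by linarith
qed

lemma kv_bounds:
  assumes "ln x \<ge> 1" "l < 60" "C3 * ln (ln x) \<ge> 1"
  shows "C3 * Gv (Suc l) x * ln (ln x) \<le> real (kv l x)" "real (kv l x) \<le> 2 * C3 * Gv (Suc l) x * ln (ln x)"
proof -
  have g: "Gv (Suc l) x \<ge> 1" using Gv_bounds(1)[of x "Suc l"] assms by simp
  have "1 * 1 \<le> Gv (Suc l) x * (C3 * ln (ln x))" using assms g by (intro mult_mono) auto
  hence bg: "1 \<le> C3 * Gv (Suc l) x * ln (ln x)" by (simp add: mult_ac)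
  have k: "real (kv l x) = of_int \<lceil>C3 * Gv (Suc l) x * ln (ln x)\<rceil>" using bg by (simp add: kv_def)
  show "C3 * Gv (Suc l) x * ln (ln x) \<le> real (kv l x)" unfolding k by linarith
  have "of_int \<lceil>C3 * Gv (Suc l) x * ln (ln x)\<rceil> \<le> C3 * Gv (Suc l) x * ln (ln x) + 1" by linarith
  thus "real (kv l x) \<le> 2 * C3 * Gv (Suc l) x * ln (ln x)" unfolding k using bg by linarith
qed

lemma mv_bounds:
  assumes "ln x \<ge> 2"
  shows "L0 * ln x powr \<delta> \<le> (11 / 10) ^ mv x" "(11 / 10) ^ mv x \<le> 11 / 10 * (L0 * ln x powr \<delta>)"
    "real (mv x) \<le> ln (L0 * ln x powr \<delta>) / ln 1.1 + 1" "mv x > 0"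
proof -
  have L0: "L0 \<ge> 1" using C1 by (simp add: L0_def)
  have lx: "ln x powr \<delta> > 1" using assms \<delta> by (intro gr_one_powr) auto
  have gt: "L0 * ln x powr \<delta> > 1"
  proof -
    have "1 * (ln x powr \<delta>) \<le> L0 * ln x powr \<delta>" using L0 by (intro mult_right_mono) auto
    thus ?thesis using lx by linarith
  qed
  define q where "q = ln (L0 * ln x powr \<delta>) / ln 1.1"
  have l11: "ln (1.1::real) > 0" by simp
  have q0: "q > 0" using gt l11 by (simp add: q_def)
  have m: "real (mv x) = of_int \<lceil>q\<rceil>" using q0 by (simp add: mv_def q_def)
  have mq: "q \<le> real (mv x)" "real (mv x) \<le> q + 1" unfolding m by linarith+
  show "mv x > 0" using mq q0 by (metis gr0I le_less_trans less_le_not_le of_nat_0)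
  show "real (mv x) \<le> ln (L0 * ln x powr \<delta>) / ln 1.1 + 1" using mq by (simp add: q_def)
  have pw: "(11 / 10 :: real) ^ mv x = exp (real (mv x) * ln 1.1)"
    by (simp add: exp_of_nat_mult)
  have eq: "exp (q * ln 1.1) = L0 * ln x powr \<delta>" using gt l11 by (simp add: q_def)
  show "L0 * ln x powr \<delta> \<le> (11 / 10) ^ mv x"
    unfolding pw eq[symmetric] using mq l11 by simp
  have "exp (real (mv x) * ln 1.1) \<le> exp ((q + 1) * ln 1.1)" using mq l11 by simp
  also have "\<dots> = 11 / 10 * exp (q * ln 1.1)" by (simp add: distrib_right exp_add)
  finally show "(11 / 10) ^ mv x \<le> 11 / 10 * (L0 * ln x powr \<delta>)" unfolding pw eq .
qed

text \<open>The base 1 / dens (zv x) is at most (ln x)^2 and the exponent is 2 Tv l x \<le> 6 B Gv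
  (Suc l) x. As Gv (Suc l) x \<le> (ln x) powr 0.4, the result is smaller than any fixed power of
  \<open>x\<close>.\<close>

lemma Lmax_bounds:
  assumes l: "l < 60"
  shows "\<forall>\<^sub>F x in at_top. 1 \<le> Lmax l x \<and> Lmax l x \<le> exp (12 * real B * Gv (Suc l) x * ln (ln x)) \<and> Lmax l x \<le> exp (ln x powr 0.5)"
proof -
  have "real B > 0" using B1 by simp
  hence ev: "\<forall>\<^sub>F x::real in at_top. 12 * real B * (ln x powr 0.4) * ln (ln x) \<le> ln x powr 0.5" by real_asymp
  show ?thesis using ev basic_eventually dens_z_bounds
  proof eventually_elim
    case (elim x)
    have lx: "ln x \<ge> 2" "ln (ln x) \<ge> 1" using elim by auto
    have T: "real (Tv l x) \<le> 3 * real B * Gv (Suc l) x" using Tv_bounds(2)[of x l] lx l by simp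
    have d: "dens (zv x) > 0" by (rule dens_pos)
    have "dens (zv x) \<le> 1"
      unfolding dens_def using dens_factor_pos by (intro prod_le_1) (auto simp: less_imp_le)
    hence 1: "1 \<le> 1 / dens (zv x)" using d by simp
    have "1 / dens (zv x) \<le> 1 / (C1 / (2 * ln x))"
      using elim C1 lx d by (intro divide_left_mono mult_pos_pos divide_pos_pos) auto
    also have "\<dots> = 2 * ln x / C1" by simp
    also have "\<dots> \<le> (ln x)\<^sup>2" using elim by simp
    finally have b: "1 / dens (zv x) \<le> (ln x)\<^sup>2" .
    have "Lmax l x \<le> ((ln x)\<^sup>2) ^ (2 * Tv l x)" unfolding Lmax_def using b d by (intro power_mono) (auto simp: less_imp_le)
    also have "\<dots> = exp (ln (ln x)) ^ (4 * Tv l x)" using lx by (simp add: power_mult[symmetric])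
    also have "\<dots> = exp (4 * real (Tv l x) * ln (ln x))" by (simp add: exp_of_nat_mult[symmetric])
    also have "\<dots> \<le> exp (4 * (3 * real B * Gv (Suc l) x) * ln (ln x))" using T lx by simp
    finally have A: "Lmax l x \<le> exp (12 * real B * Gv (Suc l) x * ln (ln x))" by (simp add: mult_ac)
    have "12 * real B * Gv (Suc l) x * ln (ln x) \<le> 12 * real B * (ln x powr 0.4) * ln (ln x)"
      using Gv_bounds(2)[of x "Suc l"] lx l by (intro mult_right_mono mult_left_mono) auto
    hence "exp (12 * real B * Gv (Suc l) x * ln (ln x)) \<le> exp (ln x powr 0.5)" using elim by simp
    hence "Lmax l x \<le> exp (ln x powr 0.5)" using A by (rule order_trans[rotated])
    moreover have "1 \<le> Lmax l x" unfolding Lmax_def using 1 by (rule one_le_power)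
    ultimately show ?case using A by simp
  qed
qed

text \<open>The first and third quotients gain a power of \<open>x\<close>. The second gains only
  through the exponential in (g), with \<open>C3\<close> chosen for this purpose. The exponent 19
  leaves room for the powers of ln x that accompany these terms later, of which there are at most
  six.\<close>

lemma tail_bounds:
  assumes l: "l < 60"
  shows "\<forall>\<^sub>F x in at_top. Lmax l x * n1v x / real (Yv x) \<le> ln x powr (-19) \<and> Lmax l x * n2v l x / real (Yv x) \<le> ln x powr (-19)
     \<and> Lmax l x / real (Yv x) \<le> ln x powr (-19)"
proof -
  have K1: "Kf + 1 > 0" using F by simp
  have ev1: "\<forall>\<^sub>F x::real in at_top. exp (ln x powr 0.5) * ((Kf + 1) * (2 * x * ln x) powr 0.49) / x \<le> ln x powr (-19)"
    using K1 by real_asymp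
  have ev2: "\<forall>\<^sub>F x::real in at_top. exp (ln x powr 0.5) / x \<le> ln x powr (-19)" by real_asymp
  have ev3: "\<forall>\<^sub>F x::real in at_top. ln (4 * x * ln x) \<le> 2 * ln x" by real_asymp
  define D where "D = 2 * (Kg + 1) * 2 powr c1"
  have "D > 0" using G0 by (simp add: D_def)
  hence ev4: "\<forall>\<^sub>F x::real in at_top. D \<le> ln x" by real_asymp
  show ?thesis using ev1 ev2 ev3 ev4 basic_eventually Lmax_bounds[OF l]
  proof eventually_elim
    case (elim x)
    have x: "x \<ge> 10" "ln x \<ge> 2" "ln (ln x) \<ge> 1" "C3 * ln (ln x) \<ge> 1" using elim by auto
    have Y: "x \<le> real (Yv x)" "real (Yv x) \<le> 2 * x * ln x" using Yv_bounds[of x] x by auto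
    have Lm: "1 \<le> Lmax l x" "Lmax l x \<le> exp (12 * real B * Gv (Suc l) x * ln (ln x))" "Lmax l x \<le> exp (ln x powr 0.5)" using elim by auto
    have "Lmax l x * n1v x / real (Yv x) \<le> exp (ln x powr 0.5) * ((Kf + 1) * (2 * x * ln x) powr 0.49) / x"
      unfolding n1v_def using Lm Y x F(1) by (intro frac_le mult_mono powr_mono2) auto
    also have "\<dots> \<le> ln x powr (-19)" by (rule elim(1))
    finally have 1: "Lmax l x * n1v x / real (Yv x) \<le> ln x powr (-19)" .
    have "Lmax l x / real (Yv x) \<le> exp (ln x powr 0.5) / x" using Lm Y x by (intro frac_le) auto
    also have "\<dots> \<le> ln x powr (-19)" by (rule elim(2))
    finally have 2: "Lmax l x / real (Yv x) \<le> ln x powr (-19)" .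
    have g: "Gv (Suc l) x \<ge> 1" using Gv_bounds(1)[of x "Suc l"] x l by simp
    have k: "C3 * Gv (Suc l) x * ln (ln x) \<le> real (kv l x)" using kv_bounds(1)[of x l] x l by simp
    have "Lmax l x * exp (- c2 * real (kv l x + 1)) \<le> exp (12 * real B * Gv (Suc l) x * ln (ln x)) * exp (- c2 * (C3 * Gv (Suc l) x * ln (ln x)))"
      using Lm k G0 by (intro mult_mono) auto
    also have "\<dots> = exp (- ((20 + c1) * (Gv (Suc l) x * ln (ln x))))"
    proof -
      have "c2 * C3 = 12 * real B + 20 + c1" using G0 by (simp add: C3_def)
      hence "c2 * (C3 * Gv (Suc l) x * ln (ln x)) = (12 * real B + 20 + c1) * (Gv (Suc l) x * ln (ln x))"
        by (metis mult.assoc)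
      thus ?thesis by (simp add: exp_add[symmetric] algebra_simps)
    qed
    also have "\<dots> \<le> exp (- ((20 + c1) * (1 * ln (ln x))))"
      using g x G0 by (simp add: mult_le_cancel_left_pos)
    also have "\<dots> = ln x powr (- (20 + c1))" using x by (simp add: powr_def algebra_simps)
    finally have E: "Lmax l x * exp (- c2 * real (kv l x + 1)) \<le> ln x powr (- (20 + c1))" .
    have "ln (2 * real (Yv x)) \<le> ln (4 * x * ln x)" using Y x by simp
    hence lnY: "ln (2 * real (Yv x)) \<le> 2 * ln x" using elim(3) by linarith
    have lnY0: "ln (2 * real (Yv x)) \<ge> 0" using Y x by simp
    have "Lmax l x * n2v l x / real (Yv x) = 2 * Kg * ln (2 * real (Yv x)) powr c1 * (Lmax l x * exp (- c2 * real (kv l x + 1)))"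
      unfolding n2v_def using Y x by simp
    also have "\<dots> \<le> 2 * (Kg + 1) * (2 * ln x) powr c1 * ln x powr (- (20 + c1))"
      using lnY lnY0 E G0 Lm by (intro mult_mono powr_mono2) auto
    also have "\<dots> = D * ln x powr (-20)"
      using x by (simp add: D_def powr_mult powr_add[symmetric])
    also have "\<dots> \<le> ln x * ln x powr (-20)" using elim(4) by (intro mult_right_mono) auto
    also have "\<dots> = ln x powr (-19)" using x powr_add[of "ln x" 1 "-20"] by simp
    finally show ?case using 1 2 by simp
  qed
qed

text \<open>The three error terms of \<open>good_residues_exist\<close>, for degrees not smaller than \<open>1 / ln x\<close>.\<close>

lemma error_eventually:
  assumes l: "l < 60"
  shows "\<forall>\<^sub>F x in at_top. \<forall>d\<ge>1 / ln x.
     real (Yv x) * (((exp (4 * (real B * (real (Tv l x))\<^sup>2 * real (kv l x) / Gv (Suc l) x ^ 4)) - 1) * d\<^sup>2 * dens (zv x)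
            + (real B)\<^sup>2 * Lmax l x * ((Gv (Suc l) x)\<^sup>2 / real (Yv x)) * (real B * real (Tv l x) * (n1v x + n2v l x)))
          / (1 / 100 * d)\<^sup>2)
        + 2 * real (Yv x) * ((1 + 1 / 100) / (1 / 100)\<^sup>2) *
          ((exp (4 * (real B * (real (Tv l x))\<^sup>2 * real (kv l x) / Gv (Suc l) x ^ 4)) - 1) * (d * dens (zv x) / dens (Gv (Suc l) x ^ 4))
            + real B * Lmax l x * (Gv (Suc l) x / real (Yv x))\<^sup>2 * ((real B)\<^sup>2 * real (Yv x) + 2 * ((4 * real (Yv x) + 1) * n2v l x))) / (1 / 100 * d)
        \<le> ln x powr (- (1.02 * \<delta>)) * (real (Yv x) * dens (zv x))"
    (is "\<forall>\<^sub>F x in at_top. \<forall>d\<ge>_. ?L x d \<le> ?R x")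
proof -
  define b where "b = real B"
  have b: "b \<ge> 1" using B1 by (simp add: b_def)
  have C3: "C3 > 0" using B1 G0 by (simp add: C3_def)
  define A where "A = 72 * b ^ 3 * C3"
  have A: "A > 0" using b C3 by (simp add: A_def)
  have d1: "1.155 * \<delta> > 0" using \<delta> by simp
  have ev1: "\<forall>\<^sub>F x::real in at_top. A * (ln (ln x) / ln x powr (1.155 * \<delta>)) \<le> 1"
    using A d1 by real_asymp
  define A1 A2 A3 where "A1 = 10000 * (2 * A)" and "A2 = 10000 * (6 * b ^ 4 * 2 / C1) + 2020000 * (11 * b ^ 3 * 2 / C1)" and "A3 = 2020000 * (2 * A * 8 / C1)"
  have A': "A1 > 0" "A2 > 0" "A3 > 0" using A b C1 by (auto simp: A1_def A2_def A3_def intro!: add_pos_pos)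
  \<comment> \<open>The smallest \<open>Gv (Suc l) x\<close> is (ln x) powr (1.155 \<delta>), with
    1.155 = 1.05 * 1.1. Since 1.155 exceeds 1.02, constants and powers of ln ln x are
    absorbed.\<close>
  have ev2: "\<forall>\<^sub>F x::real in at_top. A1 * (ln (ln x) / ln x powr (1.155 * \<delta>)) + A2 * ln x powr (-10)
     + A3 * ((ln (ln x))\<^sup>2 / ln x powr (1.155 * \<delta>)) \<le> ln x powr (- (1.02 * \<delta>))"
    using A' \<delta> by real_asymp
  show ?thesis using ev1 ev2 basic_eventually tail_bounds[OF l] dens_z_bounds dens_w_bounds[OF l]
  proof eventually_elim
    case (elim x)
    show ?case
    proof (intro allI impI)
    fix d assume dx: "1 / ln x \<le> d"
    have x: "x \<ge> 10" "ln x \<ge> 2" "ln (ln x) \<ge> 1" "C3 * ln (ln x) \<ge> 1" "ln x powr 0.4 \<le> ln x" using elim by auto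
    have d: "d \<ge> 1 / ln x" "d > 0" using dx x by (auto intro: less_le_trans[of 0 "1 / ln x"])
    define h where "h = Gv (Suc l) x"
    define y where "y = real (Yv x)"
    define T where "T = real (Tv l x)"
    define s where "s = dens (zv x)"
    define \<sigma> where "\<sigma> = dens (h ^ 4)"
    define \<epsilon> where "\<epsilon> = exp (4 * (b * T\<^sup>2 * real (kv l x) / h ^ 4)) - 1"
    define X1 where "X1 = b\<^sup>2 * Lmax l x * (h\<^sup>2 / y) * (b * T * (n1v x + n2v l x))"
    define X2 where "X2 = b * Lmax l x * (h / y)\<^sup>2 * (b\<^sup>2 * y + 2 * ((4 * y + 1) * n2v l x))"
    have h: "h \<ge> 1" "h \<le> ln x powr 0.4" "ln x powr (1.155 * \<delta>) \<le> h"
      using Gv_bounds[of x "Suc l"] Gv_bounds(5)[of x l] x l by (auto simp: h_def)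
    have hl: "h \<le> ln x" using h x by linarith
    have y: "y \<ge> 10" using Yv_bounds(3)[of x] x by (simp add: y_def)
    have T: "0 \<le> T" "T \<le> 3 * b * h" using Tv_bounds(2)[of x l] x l by (auto simp: T_def h_def b_def)
    have k: "real (kv l x) \<le> 2 * C3 * h * ln (ln x)" using kv_bounds(2)[of x l] x l by (simp add: h_def)
    have s: "s > 0" "1 / s \<le> 2 / C1 * ln x"
    proof -
      show s0: "s > 0" by (simp add: s_def dens_pos)
      have "1 / s \<le> 1 / (C1 / (2 * ln x))" using elim(5) s0 C1 x by (intro divide_left_mono) (auto simp: s_def)
      thus "1 / s \<le> 2 / C1 * ln x" by simp
    qed
    have \<sigma>: "\<sigma> > 0" "1 / \<sigma> \<le> 8 / C1 * ln (ln x)"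
    proof -
      show s0: "\<sigma> > 0" by (simp add: \<sigma>_def dens_pos)
      have "1 / \<sigma> \<le> 1 / (C1 / (8 * ln (ln x)))" using elim(6) s0 C1 x by (intro divide_left_mono) (auto simp: \<sigma>_def h_def)
      thus "1 / \<sigma> \<le> 8 / C1 * ln (ln x)" by simp
    qed
    define L where "L = ln (ln x) / ln x powr (1.155 * \<delta>)"
    have L0: "L \<ge> 0" using x by (simp add: L_def)
    \<comment> \<open>This is what the fourth power in \<open>w\<close> is for: T^2 is of order h^2
      and k of order h ln ln x, so the exponent is of order ln ln x / h.\<close>
    have eps: "0 \<le> \<epsilon>" "\<epsilon> \<le> 2 * A * L"
    proof -
      define v where "v = 4 * (b * T\<^sup>2 * real (kv l x) / h ^ 4)"
      have v0: "v \<ge> 0" using b h by (simp add: v_def)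
      have "v \<le> 4 * (b * (3 * b * h)\<^sup>2 * (2 * C3 * h * ln (ln x)) / h ^ 4)"
        unfolding v_def using b T k h by (intro mult_left_mono divide_right_mono mult_mono power_mono) auto
      also have "\<dots> = A * (ln (ln x) / h)"
        using h by (simp add: A_def power2_eq_square power3_eq_cube power4_eq_xxxx)
      also have "\<dots> \<le> A * L"
        unfolding L_def using h A x by (intro mult_left_mono divide_left_mono mult_pos_pos) auto
      finally have v: "v \<le> A * L" .
      hence v1: "v \<le> 1" using elim(1) by (simp add: L_def)
      have "exp v \<le> 1 + v + v\<^sup>2" using v0 v1 by (rule exp_bound)
      also have "v\<^sup>2 \<le> v" using v0 v1 by (simp add: power2_eq_square mult_left_le)
      finally have "exp v - 1 \<le> 2 * v" by simp
      thus "\<epsilon> \<le> 2 * A * L" using v by (simp add: \<epsilon>_def v_def)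
      show "0 \<le> \<epsilon>" using v0 by (simp add: \<epsilon>_def v_def)
    qed
    have tb: "Lmax l x * n1v x / y \<le> ln x powr (-19)" "Lmax l x * n2v l x / y \<le> ln x powr (-19)" "Lmax l x / y \<le> ln x powr (-19)"
      using elim(4) by (auto simp: y_def)
    define w where "w = ln x powr (-19)"
    have w0: "w > 0" using x by (simp add: w_def)
    have nn: "0 \<le> n1v x" "0 \<le> n2v l x" "0 \<le> Lmax l x"
      using F(1) G0 y dens_pos[of "zv x"] by (auto simp: n1v_def n2v_def Lmax_def y_def)
    have X1: "0 \<le> X1" "X1 \<le> 6 * b ^ 4 * (ln x ^ 3 * w)"
    proof -
      have "X1 = b\<^sup>2 * h\<^sup>2 * (b * T) * (Lmax l x * n1v x / y + Lmax l x * n2v l x / y)"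
        by (simp add: X1_def distrib_left add_divide_distrib mult_ac)
      also have "\<dots> \<le> b\<^sup>2 * (ln x)\<^sup>2 * (b * (3 * b * ln x)) * (w + w)"
      proof (intro mult_mono add_mono power_mono)
        show "T \<le> 3 * b * ln x" using T hl b by (meson mult_left_mono order_trans zero_le_mult_iff zero_le_numeral zero_le_one)
      qed (use tb b h hl T nn y x in \<open>auto simp: w_def intro!: mult_nonneg_nonneg add_nonneg_nonneg\<close>)
      also have "\<dots> = 6 * b ^ 4 * (ln x ^ 3 * w)" by (simp add: power2_eq_square power3_eq_cube power4_eq_xxxx)
      finally show "X1 \<le> 6 * b ^ 4 * (ln x ^ 3 * w)" .
      show "0 \<le> X1" unfolding X1_def using b T nn y by (intro mult_nonneg_nonneg add_nonneg_nonneg) auto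
    qed
    have X2: "0 \<le> X2" "X2 \<le> 11 * b ^ 3 * (ln x ^ 2 * w)"
    proof -
      have "X2 = b * h\<^sup>2 * (b\<^sup>2 * (Lmax l x / y) + 2 * ((4 * y + 1) / y) * (Lmax l x * n2v l x / y))"
        using y by (simp add: X2_def power2_eq_square field_simps)
      also have "\<dots> \<le> b * (ln x)\<^sup>2 * (b\<^sup>2 * w + 2 * 5 * w)"
      proof (intro mult_mono add_mono power_mono)
        show "(4 * y + 1) / y \<le> 5" using y by (simp add: divide_le_eq)
      qed (use tb b h hl nn y x in \<open>auto simp: w_def intro!: mult_nonneg_nonneg add_nonneg_nonneg\<close>)
      also have "\<dots> \<le> b * (ln x)\<^sup>2 * (b\<^sup>2 * w + 10 * (b\<^sup>2 * w))"
      proof -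
        have "1 * w \<le> b\<^sup>2 * w" using b w0 by (intro mult_right_mono one_le_power) auto
        hence "b\<^sup>2 * w + 2 * 5 * w \<le> b\<^sup>2 * w + 10 * (b\<^sup>2 * w)" by linarith
        thus ?thesis using b by (intro mult_left_mono) auto
      qed
      also have "\<dots> = 11 * b ^ 3 * (ln x ^ 2 * w)" by (simp add: power2_eq_square power3_eq_cube)
      finally show "X2 \<le> 11 * b ^ 3 * (ln x ^ 2 * w)" .
      show "0 \<le> X2" unfolding X2_def using b nn y by (intro mult_nonneg_nonneg add_nonneg_nonneg) auto
    qed
    have id: "1 / d \<le> ln x"
    proof -
      have "1 / d \<le> 1 / (1 / ln x)" using d x by (intro divide_left_mono) auto
      thus ?thesis by simp
    qed
    have id2: "1 / d\<^sup>2 \<le> (ln x)\<^sup>2"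
    proof -
      have "(1 / d)\<^sup>2 \<le> (ln x)\<^sup>2" using id d by (intro power_mono) auto
      thus ?thesis by (simp add: power_divide)
    qed
    have main: "y * ((\<epsilon> * d\<^sup>2 * s + X1) / (1 / 100 * d)\<^sup>2) + 2 * y * ((1 + 1 / 100) / (1 / 100)\<^sup>2) * (\<epsilon> * (d * s / \<sigma>) + X2) / (1 / 100 * d)
      = y * s * (10000 * \<epsilon> + 10000 * (X1 * (1 / d\<^sup>2) * (1 / s)) + 2020000 * (\<epsilon> * (1 / \<sigma>) + X2 * (1 / d) * (1 / s)))"
    proof -
      have e1: "(\<epsilon> * d\<^sup>2 * s + X1) / (1 / 100 * d)\<^sup>2 = 10000 * (\<epsilon> * s) + 10000 * (X1 * (1 / d\<^sup>2))"
        using d by (simp add: power_mult_distrib add_divide_distrib power_divide)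
      have e2: "(\<epsilon> * (d * s / \<sigma>) + X2) / (1 / 100 * d) = 100 * (\<epsilon> * s * (1 / \<sigma>)) + 100 * (X2 * (1 / d))"
        using d by (simp add: add_divide_distrib mult_ac)
      have e3: "s * (10000 * \<epsilon> + 10000 * (p * (1 / s)) + 2020000 * (\<epsilon> * r + q * (1 / s)))
        = 10000 * (\<epsilon> * s) + 10000 * p + 2020000 * (\<epsilon> * s * r + q)" for p q r
        using s by (simp add: distrib_left mult_ac)
      have e4: "2 * y * ((1 + 1 / 100) / (1 / 100)\<^sup>2) = y * 20200" by (simp add: power2_eq_square)
      have e5: "y * a + y * 20200 * c / (1 / 100 * d) = y * (a + 20200 * (c / (1 / 100 * d)))" for a c
        by (simp add: distrib_left)
      have e6: "10000 * a + 10000 * p + 20200 * (100 * r + 100 * q) = 10000 * a + 10000 * p + 2020000 * (r + q)" for a p q r :: real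
        by simp
      show ?thesis unfolding e4 e5 mult.assoc[of y s] e3 e1 e2
        by (rule arg_cong[where f = "\<lambda>t. y * t"], rule e6)
    qed
    have wp: "ln x ^ 6 * w \<le> ln x powr (-10)" "ln x ^ 4 * w \<le> ln x powr (-10)"
    proof -
      have "ln x ^ 6 = ln x powr 6" using x by (simp add: powr_numeral)
      hence "ln x ^ 6 * w = ln x powr (6 + (-19))" by (simp only: w_def powr_add)
      hence "ln x ^ 6 * w = ln x powr (-13)" by simp
      also have "\<dots> \<le> ln x powr (-10)" using x by (intro powr_mono) auto
      finally show 6: "ln x ^ 6 * w \<le> ln x powr (-10)" .
      have "ln x ^ 4 * w \<le> ln x ^ 6 * w" using x w0 by (intro mult_right_mono power_increasing) auto
      thus "ln x ^ 4 * w \<le> ln x powr (-10)" using 6 by linarith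
    qed
    have t2: "X1 * (1 / d\<^sup>2) * (1 / s) \<le> 6 * b ^ 4 * 2 / C1 * ln x powr (-10)"
    proof -
      have "X1 * (1 / d\<^sup>2) * (1 / s) \<le> (6 * b ^ 4 * (ln x ^ 3 * w)) * (ln x)\<^sup>2 * (2 / C1 * ln x)"
        using X1 id2 s d b w0 x by (intro mult_mono) auto
      also have "\<dots> = 6 * b ^ 4 * 2 / C1 * (ln x ^ 6 * w)"
        by (simp add: eval_nat_numeral)
      also have "\<dots> \<le> 6 * b ^ 4 * 2 / C1 * ln x powr (-10)" using wp(1) b C1 by (intro mult_left_mono) auto
      finally show ?thesis .
    qed
    have t3: "X2 * (1 / d) * (1 / s) \<le> 11 * b ^ 3 * 2 / C1 * ln x powr (-10)"
    proof -
      have "X2 * (1 / d) * (1 / s) \<le> (11 * b ^ 3 * (ln x ^ 2 * w)) * ln x * (2 / C1 * ln x)"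
        using X2 id s d b w0 x by (intro mult_mono) auto
      also have "\<dots> = 11 * b ^ 3 * 2 / C1 * (ln x ^ 4 * w)"
        by (simp add: eval_nat_numeral)
      also have "\<dots> \<le> 11 * b ^ 3 * 2 / C1 * ln x powr (-10)" using wp(2) b C1 by (intro mult_left_mono) auto
      finally show ?thesis .
    qed
    have t4: "\<epsilon> * (1 / \<sigma>) \<le> 2 * A * 8 / C1 * ((ln (ln x))\<^sup>2 / ln x powr (1.155 * \<delta>))"
    proof -
      have "\<epsilon> * (1 / \<sigma>) \<le> (2 * A * L) * (8 / C1 * ln (ln x))"
        using eps \<sigma> A L0 by (intro mult_mono) auto
      also have "\<dots> = 2 * A * 8 / C1 * ((ln (ln x))\<^sup>2 / ln x powr (1.155 * \<delta>))"
        by (simp add: L_def power2_eq_square mult_ac)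
      finally show ?thesis .
    qed
    have "10000 * \<epsilon> + 10000 * (X1 * (1 / d\<^sup>2) * (1 / s)) + 2020000 * (\<epsilon> * (1 / \<sigma>) + X2 * (1 / d) * (1 / s))
      \<le> 10000 * (2 * A * L) + 10000 * (6 * b ^ 4 * 2 / C1 * ln x powr (-10))
        + 2020000 * (2 * A * 8 / C1 * ((ln (ln x))\<^sup>2 / ln x powr (1.155 * \<delta>)) + 11 * b ^ 3 * 2 / C1 * ln x powr (-10))"
      by (intro add_mono mult_left_mono eps t2 t3 t4) auto
    also have "\<dots> = A1 * L + A2 * ln x powr (-10) + A3 * ((ln (ln x))\<^sup>2 / ln x powr (1.155 * \<delta>))"
      by (simp only: A1_def A2_def A3_def distrib_left distrib_right mult.assoc add.assoc add.left_commute add.commute)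
    also have "\<dots> \<le> ln x powr (- (1.02 * \<delta>))" using elim(2) by (simp only: L_def)
    finally have "y * s * (10000 * \<epsilon> + 10000 * (X1 * (1 / d\<^sup>2) * (1 / s)) + 2020000 * (\<epsilon> * (1 / \<sigma>) + X2 * (1 / d) * (1 / s)))
      \<le> y * s * ln x powr (- (1.02 * \<delta>))" using y s by (intro mult_left_mono) auto
    thus "?L x d \<le> ?R x" unfolding main[symmetric] unfolding \<epsilon>_def X1_def X2_def y_def s_def \<sigma>_def h_def T_def b_def by (simp only: mult.commute)
    qed
  qed
qed

end

section \<open>Numerical conditions of the nibble and the final count\<close>

context gap_setup begin

text \<open>In logarithms: the dominant cost has order r m \<le> (ln x) powr 0.402, up to a
  constant, because r is of order (ln x) powr 0.4 and m at most of order (ln x) powr 0.002. The gain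
  is 0.4 ln Y / 2 ^ m, where (11/10)^8 > 2 and \<delta> \<le> 0.002 bound 2 ^ m by a constant times
  (ln x) powr 0.016, so the gain wins.\<close>

lemma nibble_numeric_eventually:
  "\<forall>\<^sub>F x in at_top. (24 * (real (rv x))\<^sup>2 * (11 / 10) ^ (4 * rv x * mv x) / (1 / 50)\<^sup>2)\<^sup>2
     * (real (Yv x) powr (- 0.4)) powr (1 / 2 ^ mv x) \<le> (1 / (11 / 10)) ^ mv x \<and> rv x \<ge> 1"
proof -
  have L0: "L0 \<ge> 1" using C1 by (simp add: L0_def)
  define L1 where "L1 = 11 / 10 * L0"
  have L1: "L1 > 0" using L0 by (simp add: L1_def)
  define b where "b = real B"
  have b: "b \<ge> 1" using B1 by (simp add: b_def)
  define b1 where "b1 = 36 * b * (10 * L1)"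
  have b10: "b1 > 0" using b L1 by (simp add: b1_def)
  define D where "D = 24 * 2500 * (4 * b)\<^sup>2"
  have D: "D > 0" using b by (simp add: D_def)
  define L8 where "L8 = L1 ^ 8"
  have L8: "L8 > 0" using L1 by (simp add: L8_def)
  define b2 where "b2 = 10 * L1"
  have b20: "b2 > 0" using L1 by (simp add: b2_def)
  have ev: "\<forall>\<^sub>F x::real in at_top. 2 * ln (D * ln x powr 0.8) + (b1 * ln x powr 0.402 + b2 * ln x powr 0.002) \<le> 0.4 * ln x / (L8 * ln x powr 0.016)"
    using D b10 b20 L8 by real_asymp
  have ev2: "\<forall>\<^sub>F x::real in at_top. D * ln x powr 0.8 \<ge> 1" using D by real_asymp
  show ?thesis using ev ev2 basic_eventually
  proof eventually_elim
    case (elim x)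
    have x: "x \<ge> 10" "ln x \<ge> 2" using elim by auto
    define m where "m = mv x"
    define r where "r = real (rv x)"
    have p0: "1 \<le> ln x powr 0.4" using x by (intro ge_one_powr_ge_zero) auto
    have bp: "1 * 1 \<le> b * ln x powr 0.4" using b p0 by (intro mult_mono) auto
    have rr: "r = of_int \<lceil>3 * b * ln x powr 0.4\<rceil>" using bp by (simp add: r_def rv_def b_def)
    have r: "1 \<le> r" "r \<le> 4 * b * ln x powr 0.4" unfolding rr using bp by linarith+
    have K: "(11 / 10) ^ m \<le> L1 * ln x powr 0.002"
    proof -
      have "(11 / 10) ^ m \<le> L1 * ln x powr \<delta>" using mv_bounds(2)[OF x(2)] by (simp add: m_def L1_def)
      also have "\<dots> \<le> L1 * ln x powr 0.002" using x \<delta> L1 by (intro mult_left_mono powr_mono) auto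
      finally show ?thesis .
    qed
    have "1 + real m * (1 / 10) \<le> (1 + 1 / 10) ^ m" by (rule Bernoulli_inequality) simp
    hence m10: "real m \<le> 10 * (L1 * ln x powr 0.002)" using K by simp
    have m2: "(2::real) ^ m \<le> L8 * ln x powr 0.016"
    proof -
      have "(2::real) ^ m \<le> ((11 / 10) ^ 8) ^ m" by (intro power_mono) (auto simp: power_divide)
      also have "\<dots> = ((11 / 10) ^ m) ^ 8" by (simp only: power_mult[symmetric] mult.commute)
      also have "\<dots> \<le> (L1 * ln x powr 0.002) ^ 8" using K by (intro power_mono) auto
      also have "\<dots> = L8 * ln x powr 0.016"
        using x by (simp add: L8_def power_mult_distrib powr_power)
      finally show ?thesis .
    qed
    have l11: "ln (11 / 10 :: real) \<le> 1 / 10" using ln_add_one_self_le_self[of "1 / 10"] by simp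
    have l11p: "ln (11 / 10 :: real) > 0" by simp
    define Q where "Q = 24 * r\<^sup>2 * (11 / 10) ^ (4 * rv x * m) / (1 / 50)\<^sup>2"
    have Q0: "Q > 0" using r by (simp add: Q_def)
    have lnQ: "ln Q = ln (24 * 2500 * r\<^sup>2) + 4 * r * real m * ln (11 / 10)"
      using r by (simp add: Q_def r_def ln_mult ln_realpow power2_eq_square mult_ac ln_div)
    have lnr: "ln (24 * 2500 * r\<^sup>2) \<le> ln (D * ln x powr 0.8)"
    proof -
      have "r\<^sup>2 \<le> (4 * b * ln x powr 0.4)\<^sup>2" using r by (intro power_mono) auto
      also have "\<dots> = (4 * b)\<^sup>2 * ln x powr 0.8"
        using x by (simp add: power_mult_distrib powr_power)
      finally have "24 * 2500 * r\<^sup>2 \<le> D * ln x powr 0.8" by (simp add: D_def)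
      thus ?thesis using r by (intro ln_mono) auto
    qed
    have rm: "4 * r * real m * ln (11 / 10) \<le> b1 / 2 * ln x powr 0.402 - 2 * b * L1 * ln x powr 0.402"
    proof -
      have "4 * r * real m * ln (11 / 10) \<le> 4 * (4 * b * ln x powr 0.4) * (10 * (L1 * ln x powr 0.002)) * (1 / 10)"
        using r m10 l11 l11p L1 b by (intro mult_mono) auto
      also have "\<dots> = 16 * b * L1 * (ln x powr 0.4 * ln x powr 0.002)" by simp
      also have "ln x powr 0.4 * ln x powr 0.002 = ln x powr 0.402" by (simp add: powr_add[symmetric])
      finally have "4 * r * real m * ln (11 / 10) \<le> 16 * b * L1 * ln x powr 0.402" .
      also have "\<dots> \<le> 178 * b * L1 * ln x powr 0.402" using b L1 by (intro mult_right_mono) auto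
      finally show ?thesis by (simp add: b1_def algebra_simps)
    qed
    have bl: "2 * b * L1 * ln x powr 0.402 \<ge> 0" using b L1 by simp
    have lm: "real m * ln (11 / 10) \<le> b2 * ln x powr 0.002"
    proof -
      have "real m * ln (11 / 10) \<le> (10 * (L1 * ln x powr 0.002)) * 1"
        using m10 l11 l11p L1 by (intro mult_mono) auto
      thus ?thesis by (simp add: b2_def)
    qed
    have lnY: "ln x \<le> ln (real (Yv x))" using Yv_bounds(3)[of x] x by simp
    have Y0: "real (Yv x) > 0" using Yv_bounds(3)[of x] x by linarith
    have "0.4 * ln x / (L8 * ln x powr 0.016) \<le> 0.4 * ln (real (Yv x)) / 2 ^ m"
      using lnY m2 x by (intro frac_le) auto
    hence "2 * ln Q + real m * ln (11 / 10) \<le> 0.4 * ln (real (Yv x)) / 2 ^ m"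
      using elim(1) lnQ lnr rm lm bl by linarith
    hence "2 * ln Q - 0.4 * ln (real (Yv x)) / 2 ^ m \<le> - (real m * ln (11 / 10))" by linarith
    hence "exp (2 * ln Q - 0.4 * ln (real (Yv x)) / 2 ^ m) \<le> exp (- (real m * ln (11 / 10)))" by simp
    moreover have "exp (2 * ln Q - 0.4 * ln (real (Yv x)) / 2 ^ m) = Q\<^sup>2 * (real (Yv x) powr (- 0.4)) powr (1 / 2 ^ m)"
    proof -
      have "exp (2 * ln Q) = Q\<^sup>2" using Q0 exp_of_nat_mult[of 2 "ln Q"] by simp
      moreover have "exp (- (0.4 * ln (real (Yv x)) / 2 ^ m)) = (real (Yv x) powr (- 0.4)) powr (1 / 2 ^ m)"
      proof -
        have "(real (Yv x) powr (- 0.4)) powr (1 / 2 ^ m) = real (Yv x) powr ((- 0.4) * (1 / 2 ^ m))" by (rule powr_powr)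
        also have "\<dots> = exp ((- 0.4) * (1 / 2 ^ m) * ln (real (Yv x)))" using Y0 unfolding powr_def by simp
        also have "(- 0.4) * (1 / 2 ^ m) * ln (real (Yv x)) = - (0.4 * ln (real (Yv x)) / 2 ^ m)" by simp
        finally show ?thesis by (rule sym)
      qed
      moreover have "exp (a - t) = exp a * exp (- t)" for a t :: real by (simp add: exp_diff exp_minus divide_inverse)
      ultimately show ?thesis by (simp only:)
    qed
    moreover have "exp (- (real m * ln (11 / 10))) = (1 / (11 / 10)) ^ m"
      by (simp add: exp_minus exp_of_nat_mult power_one_over[symmetric] inverse_eq_divide del: divide_divide_eq_right)
    ultimately have fin: "Q\<^sup>2 * (real (Yv x) powr (- 0.4)) powr (1 / 2 ^ m) \<le> (1 / (11 / 10)) ^ m"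
      by (simp only:)
    have "rv x \<ge> 1" using r(1) by (simp add: r_def)
    thus ?case using fin unfolding Q_def r_def m_def by (intro conjI)
  qed
qed

text \<open>The mean number of survivors is at most of order x (ln x) powr (\<delta> - 1), and at
  least x / (8 B ln x) primes are available. Half of them serves the exceptional survivors, where
  the surplus (ln x) powr (- 0.02 \<delta>) beats the number of stages; the other half serves the
  remainder of the nibble, by the choice of \<open>L0\<close>.\<close>

lemma leftover_eventually:
  "\<forall>\<^sub>F x in at_top. 2 * real 60 * real (mv x) * ln x powr (- (1.02 * \<delta>)) * (real (Yv x) * dens (zv x))
     + 4 * (1 / (11 / 10)) ^ mv x * (real (Yv x) * dens (zv x)) \<le> real (card {p \<in> primes_in (x / 2) x. card (I p) \<ge> 1})"
proof -
  have L0: "L0 \<ge> 1" using C1 by (simp add: L0_def)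
  define b where "b = real B"
  have b: "b \<ge> 1" using B1 by (simp add: b_def)
  define D where "D = 120 * 4 * C1 * (16 * b)"
  have D: "D > 0" using C1 b by (simp add: D_def)
  have ev: "\<forall>\<^sub>F x::real in at_top. D * ((ln (L0 * ln x powr \<delta>) / ln 1.1 + 1) * ln x powr (- (0.02 * \<delta>))) \<le> 1"
    using D L0 \<delta> by real_asymp
  show ?thesis using ev basic_eventually dens_z_bounds many_large_primes
  proof eventually_elim
    case (elim x)
    have x: "x \<ge> 10" "ln x \<ge> 2" using elim by auto
    note m = mv_bounds[OF x(2)]
    define M where "M = real (Yv x) * dens (zv x)"
    define lx where "lx = ln x"
    have lx: "lx \<ge> 2" using x by (simp add: lx_def)
    have M: "0 \<le> M" "M \<le> 4 * C1 * (x * lx powr \<delta> / lx)"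
    proof -
      show "0 \<le> M" using dens_pos[of "zv x"] by (simp add: M_def)
      have "M \<le> (2 * (x * ln x powr \<delta>)) * (2 * C1 / ln x)"
        unfolding M_def using Yv_bounds(2)[of x] elim(3) dens_pos[of "zv x"] x by (intro mult_mono) auto
      thus "M \<le> 4 * C1 * (x * lx powr \<delta> / lx)" by (simp add: lx_def mult_ac)
    qed
    have t1: "2 * real 60 * real (mv x) * lx powr (- (1.02 * \<delta>)) * M \<le> x / (16 * b * lx)"
    proof -
      have "2 * real 60 * real (mv x) * lx powr (- (1.02 * \<delta>)) * M
         \<le> 120 * (ln (L0 * ln x powr \<delta>) / ln 1.1 + 1) * lx powr (- (1.02 * \<delta>)) * (4 * C1 * (x * lx powr \<delta> / lx))"
        using m(3) M by (intro mult_mono) auto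
      also have "\<dots> = D * ((ln (L0 * ln x powr \<delta>) / ln 1.1 + 1) * (lx powr (- (1.02 * \<delta>)) * lx powr \<delta>)) * (x / (16 * b * lx))"
        using b by (simp add: D_def)
      also have "lx powr (- (1.02 * \<delta>)) * lx powr \<delta> = lx powr (- (0.02 * \<delta>))"
        by (simp add: powr_add[symmetric])
      also have "D * ((ln (L0 * ln x powr \<delta>) / ln 1.1 + 1) * lx powr (- (0.02 * \<delta>))) * (x / (16 * b * lx)) \<le> 1 * (x / (16 * b * lx))"
        using elim(1) x b by (intro mult_right_mono) (auto simp: lx_def)
      finally show ?thesis by simp
    qed
    have t2: "4 * (1 / (11 / 10)) ^ mv x * M \<le> x / (16 * b * lx)"
    proof -
      have lp: "lx powr \<delta> > 0" using lx by simp
      have "(1 / (11 / 10)) ^ mv x = 1 / (11 / 10 :: real) ^ mv x" by (simp only: power_one_over)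
      also have "\<dots> \<le> 1 / (L0 * lx powr \<delta>)"
        using m(1) L0 lp by (intro divide_left_mono mult_pos_pos) (auto simp: lx_def)
      finally have "4 * (1 / (11 / 10)) ^ mv x * M \<le> 4 * (1 / (L0 * lx powr \<delta>)) * (4 * C1 * (x * lx powr \<delta> / lx))"
        using M L0 lp by (intro mult_mono) (auto simp: zero_le_mult_iff)
      also have "\<dots> = 16 * C1 / L0 * (x / lx)" using lp by simp
      also have "\<dots> \<le> 1 / (16 * b) * (x / lx)"
      proof (intro mult_right_mono)
        have "16 * C1 * (16 * b) \<le> L0" using C1 b by (simp add: L0_def b_def)
        thus "16 * C1 / L0 \<le> 1 / (16 * b)" using L0 b by (simp add: divide_le_eq le_divide_eq)
      qed (use x lx in auto)
      finally show ?thesis by simp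
    qed
    have "x / (16 * b * lx) + x / (16 * b * lx) = x / (8 * lx) / b" by simp
    also have "\<dots> \<le> real (card {p \<in> primes_in (x / 2) x. card (I p) \<ge> 1})"
    proof -
      have "b > 0" using b by simp
      thus ?thesis unfolding pos_divide_le_eq[OF \<open>b > 0\<close>] using elim(4) by (simp only: b_def lx_def)
    qed
    finally show ?case using t1 t2 unfolding M_def lx_def by linarith
  qed
qed

text \<open>The nibble needs a fixed power of Y as saving. With Y powr 0.49 from (f), Y powr 0.11
  for all factors of subpolynomial size and the division by Y, the exponent is 0.49 + 0.11 - 1 = -
  0.4.\<close>

lemma pair_weight_eventually:
  assumes l: "l < 60"
  shows "\<forall>\<^sub>F x in at_top. real B * (Lmax l x * (Gv (Suc l) x / real (Yv x))) * max 1 (n1v x) \<le> real (Yv x) powr (- 0.4)"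
proof -
  define D where "D = real B * (1 + Kf)"
  have D: "D > 0" using B1 F(1) by (simp add: D_def)
  have ev: "\<forall>\<^sub>F x::real in at_top. D * exp (ln x powr 0.5) * ln x powr 0.4 \<le> x powr 0.11" using D by real_asymp
  show ?thesis using ev basic_eventually Lmax_bounds[OF l]
  proof eventually_elim
    case (elim x)
    have x: "x \<ge> 10" "ln x \<ge> 2" using elim by auto
    define y where "y = real (Yv x)"
    have y: "y \<ge> x" using Yv_bounds(3)[of x] x by (simp add: y_def)
    have y1: "y \<ge> 1" using y x by simp
    have h: "Gv (Suc l) x \<le> ln x powr 0.4" "Gv (Suc l) x \<ge> 1" using Gv_bounds[of x "Suc l"] x l by auto
    have "1 \<le> y powr 0.49" using y1 by (intro ge_one_powr_ge_zero) auto
    hence mx: "max 1 (n1v x) \<le> (1 + Kf) * y powr 0.49"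
    proof (intro max.boundedI)
      have "1 * 1 \<le> (1 + Kf) * y powr 0.49" using F(1) \<open>1 \<le> y powr 0.49\<close> by (intro mult_mono) auto
      thus "1 \<le> (1 + Kf) * y powr 0.49" by simp
      show "n1v x \<le> (1 + Kf) * y powr 0.49" unfolding n1v_def y_def[symmetric] by (intro mult_right_mono) auto
    qed
    have "real B * (Lmax l x * (Gv (Suc l) x / y)) * max 1 (n1v x) \<le> real B * (exp (ln x powr 0.5) * (ln x powr 0.4 / y)) * ((1 + Kf) * y powr 0.49)"
      using mx h elim(3) y1 F(1) by (intro mult_mono divide_right_mono) auto
    also have "\<dots> = (D * exp (ln x powr 0.5) * ln x powr 0.4) * (y powr 0.49 / y)" by (simp add: D_def mult_ac)
    also have "\<dots> \<le> x powr 0.11 * (y powr 0.49 / y)" using elim(1) y1 by (intro mult_right_mono) auto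
    also have "\<dots> \<le> y powr 0.11 * (y powr 0.49 / y)" using y y1 x by (intro mult_right_mono powr_mono2) auto
    also have "\<dots> = y powr (0.11 + 0.49 - 1)" using y1 by (simp only: powr_add powr_diff powr_one times_divide_eq_right)
    also have "\<dots> = y powr (- 0.4)" by simp
    finally show ?case by (simp add: y_def)
  qed
qed

text \<open>The total overshoot of the greedy blocks of a level fits into 1/2450 = 1/49 - 1/50, the
  gap between the supply of a level and the sum of its targets.\<close>

lemma block_slack_eventually:
  "\<forall>\<^sub>F x in at_top. real (mv x) * (real B * (ln x powr 0.4 / real (Yv x)) * (1 / dens (zv x))) \<le> 1 / 2450"
proof -
  have L0: "L0 \<ge> 1" using C1 by (simp add: L0_def)
  have "real B > 0" using B1 by simp
  hence ev: "\<forall>\<^sub>F x::real in at_top. (ln (L0 * ln x powr \<delta>) / ln 1.1 + 1) * (real B * (ln x powr 0.4 / x) * (2 * ln x / C1)) \<le> 1 / 2450"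
    using L0 C1 \<delta> by real_asymp
  show ?thesis using ev basic_eventually dens_z_bounds
  proof eventually_elim
    case (elim x)
    have x: "x \<ge> 10" "ln x \<ge> 2" using elim by auto
    have y: "real (Yv x) \<ge> x" using Yv_bounds(3)[of x] x by simp
    have d: "dens (zv x) > 0" by (rule dens_pos)
    have "1 / dens (zv x) \<le> 1 / (C1 / (2 * ln x))"
      using elim(3) C1 x d by (intro divide_left_mono mult_pos_pos divide_pos_pos) auto
    hence d2: "1 / dens (zv x) \<le> 2 * ln x / C1" by simp
    have "real (mv x) * (real B * (ln x powr 0.4 / real (Yv x)) * (1 / dens (zv x)))
       \<le> (ln (L0 * ln x powr \<delta>) / ln 1.1 + 1) * (real B * (ln x powr 0.4 / x) * (2 * ln x / C1))"
      using mv_bounds(3)[OF x(2)] y x d d2 by (intro mult_mono divide_left_mono) auto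
    thus ?case using elim(1) by linarith
  qed
qed

text \<open>Even the last block has a degree of order (ln x) powr (- \<delta>), far above the
  threshold 1 / ln x under which the error terms were estimated.\<close>

lemma degree_floor_eventually:
  "\<forall>\<^sub>F x in at_top. 1 / ln x \<le> (1 / (11 / 10)) ^ mv x / 550"
proof -
  have L0: "L0 \<ge> 1" using C1 by (simp add: L0_def)
  have ev: "\<forall>\<^sub>F x::real in at_top. 605 * L0 * ln x powr 0.5 \<le> ln x" using L0 by real_asymp
  show ?thesis using ev basic_eventually
  proof eventually_elim
    case (elim x)
    have x: "x \<ge> 10" "ln x \<ge> 2" using elim by auto
    have "(11 / 10) ^ mv x \<le> 11 / 10 * (L0 * ln x powr \<delta>)" by (rule mv_bounds(2)[OF x(2)])
    also have "\<dots> \<le> 11 / 10 * (L0 * ln x powr 0.5)" using L0 x \<delta> by (intro mult_left_mono powr_mono) auto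
    finally have "550 * (11 / 10) ^ mv x \<le> ln x" using elim(1) by linarith
    hence "1 / ln x \<le> 1 / (550 * (11 / 10 :: real) ^ mv x)" using x by (intro divide_left_mono) auto
    thus ?case by (simp add: power_divide)
  qed
qed

end

text \<open>I p - I p is symmetric. This extends the bound (f), given for v \<ge> 1, to all nonzero
  \<open>v\<close>.\<close>

lemma diff_primes_uminus: "diff_primes I (- v) = diff_primes I v"
proof -
  have "diff_primes I v \<subseteq> diff_primes I (- v)" for v
  proof
    fix p assume "p \<in> diff_primes I v"
    then obtain a a' where p: "prime p" and a: "a \<in> I p" "a' \<in> I p" "v mod int p = (a - a') mod int p"
      by (auto simp: diff_primes_def diff_classes_def)
    have "(- v) mod int p = (a' - a) mod int p" using mod_minus_cong[OF a(3)] by simp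
    thus "p \<in> diff_primes I (- v)" using p a unfolding diff_primes_def diff_classes_def by blast
  qed
  from this[of v] this[of "- v"] show ?thesis by auto
qed

lemma has_gap_mono: "has_gap S L \<Longrightarrow> L' \<le> L \<Longrightarrow> has_gap S L'"
  unfolding has_gap_def by (meson order_trans)

section \<open>Assembly of the covering\<close>

context gap_setup begin

lemma diff_primes_bound:
  assumes "v \<noteq> 0"
  shows "finite (diff_primes I v)" "\<bar>v\<bar> \<le> int N \<Longrightarrow> real (num_diff_primes I v) \<le> Kf * real N powr 0.49"
proof -
  have eq: "diff_primes I \<bar>v\<bar> = diff_primes I v" using diff_primes_uminus[of I v] by (simp add: abs_if)
  have v1: "\<bar>v\<bar> \<ge> 1" using assms by simp
  show "finite (diff_primes I v)" using F(2)[OF v1] eq by simp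
  assume vN: "\<bar>v\<bar> \<le> int N"
  have "real (num_diff_primes I v) \<le> Kf * real_of_int \<bar>v\<bar> powr 0.49"
    using F(2)[OF v1] eq by (simp add: num_diff_primes_def)
  also have "\<dots> \<le> Kf * real N powr 0.49"
    using F(1) vN v1 by (intro mult_left_mono powr_mono2) auto
  finally show "real (num_diff_primes I v) \<le> Kf * real N powr 0.49" .
qed

text \<open>(g) with the real bound 2 N, which is at least 10 because N \<ge> 5; for integers the
  real and the integral comparison agree.\<close>

lemma exceptional_bound:
  fixes m :: "nat \<Rightarrow> int" and N k :: nat and u :: int
  assumes m: "\<And>q. prime q \<Longrightarrow> card (I q) \<ge> 1 \<Longrightarrow> m q \<noteq> 0 \<and> m q mod int q \<in> diff_classes q (I q)"
    and u: "\<bar>u\<bar> \<le> 2 * int N" and N: "N \<ge> 5"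
  shows "finite {q. prime q \<and> card (I q) \<ge> 1 \<and> 0 < \<bar>m q\<bar> \<and> \<bar>m q\<bar> \<le> 2 * int N \<and> m q + u \<noteq> 0 \<and> num_diff_primes I (m q + u) \<ge> k + 1}
    \<and> real (card {q. prime q \<and> card (I q) \<ge> 1 \<and> 0 < \<bar>m q\<bar> \<and> \<bar>m q\<bar> \<le> 2 * int N \<and> m q + u \<noteq> 0 \<and> num_diff_primes I (m q + u) \<ge> k + 1})
      \<le> Kg * (2 * real N * ln (2 * real N) powr c1 * exp (- c2 * real (k + 1)))"
proof -
  have iff: "\<bar>real_of_int i\<bar> \<le> 2 * real N \<longleftrightarrow> \<bar>i\<bar> \<le> 2 * int N" for i by linarith
  have "2 * real N \<ge> 10" using N by simp
  moreover have "\<forall>q. prime q \<and> card (I q) \<ge> 1 \<longrightarrow> m q \<noteq> 0 \<and> m q mod int q \<in> diff_classes q (I q)" using m by blast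
  moreover have "\<bar>real_of_int u\<bar> \<le> 2 * real N" using u iff by blast
  moreover have "k + 1 \<ge> 1" by simp
  ultimately show ?thesis using G[of "2 * real N" m u "k + 1"] unfolding iff by blast
qed

text \<open>The targets (10/11)^j / 550 add up to less than 11 / 550 = 1/50, just below the supply
  1/49 of a level; the difference pays for the overshoot of the blocks.\<close>

lemma blocks_exist:
  assumes l: "l < 60" and x: "ln x \<ge> 2" "x \<ge> 10"
    and mass: "mass (real (Yv x) / Gv (Suc l) x) (real (Yv x) / Gv l x) * dens (Gv (Suc l) x ^ 4) / dens (zv x) \<ge> 1 / 49"
    and slack: "real (mv x) * (real B * (ln x powr 0.4 / real (Yv x)) * (1 / dens (zv x))) \<le> 1 / 2450"
  shows "\<exists>K. (\<forall>j<mv x. K j \<subseteq> lev l x \<and> (10 / 11) ^ j / 550 \<le> (\<Sum>q\<in>K j. real (card (I q)) / real q) * dens (Gv (Suc l) x ^ 4) / dens (zv x))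
     \<and> (\<forall>i<mv x. \<forall>j<mv x. i \<noteq> j \<longrightarrow> K i \<inter> K j = {})"
proof -
  define Y where "Y = real (Yv x)"
  define s where "s = dens (Gv (Suc l) x ^ 4) / dens (zv x)"
  define g where "g = (\<lambda>q. real (card (I q)) / real q * s)"
  define M where "M = real B * (ln x powr 0.4 / Y) * (1 / dens (zv x))"
  have Y: "Y \<ge> 10" using Yv_bounds(3)[of x] x by (simp add: Y_def)
  have h: "Gv (Suc l) x \<ge> 1" "Gv (Suc l) x \<le> ln x powr 0.4" using Gv_bounds[of x "Suc l"] x l by auto
  have d: "dens (zv x) > 0" by (rule dens_pos)
  have "dens (Gv (Suc l) x ^ 4) \<le> 1" unfolding dens_def using dens_factor_pos by (intro prod_le_1) (auto simp: less_imp_le)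
  hence s: "0 \<le> s" "s \<le> 1 / dens (zv x)" using d dens_pos[of "Gv (Suc l) x ^ 4"] by (auto simp: s_def divide_right_mono less_imp_le)
  have gM: "g q \<le> M" if "q \<in> lev l x" for q
  proof -
    have q: "prime q" "Y / Gv (Suc l) x < real q" using that by (auto simp: lev_def primes_in_def Y_def)
    have "Y / ln x powr 0.4 \<le> Y / Gv (Suc l) x" using h Y by (intro divide_left_mono mult_pos_pos) auto
    hence "Y / ln x powr 0.4 \<le> real q" using q by linarith
    hence "1 / real q \<le> 1 / (Y / ln x powr 0.4)" using Y h by (intro divide_left_mono mult_pos_pos divide_pos_pos) (auto simp: prime_gt_0_nat[OF q(1)])
    hence "real (card (I q)) * (1 / real q) * s \<le> real B * (ln x powr 0.4 / Y) * (1 / dens (zv x))"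
      using I_card(2)[OF q(1)] s h Y by (intro mult_mono) auto
    thus ?thesis by (simp add: g_def M_def)
  qed
  have sumg: "sum g (lev l x) \<ge> 1 / 49"
  proof -
    have "sum g (lev l x) = sum g (primes_in (Y / Gv (Suc l) x) (Y / Gv l x))"
      unfolding lev_def Y_def using finite_primes_in by (intro sum.mono_neutral_left) (auto simp: g_def)
    also have "\<dots> = mass (Y / Gv (Suc l) x) (Y / Gv l x) * s"
      unfolding g_def mass_def sum_distrib_right ..
    finally show ?thesis using mass by (simp add: Y_def s_def)
  qed
  have M0: "0 \<le> M" unfolding M_def using Y d by (intro mult_nonneg_nonneg divide_nonneg_nonneg) auto
  have tot: "(\<Sum>j<mv x. (10 / 11) ^ j / 550 + M) \<le> sum g (lev l x)"
  proof -
    have "(\<Sum>j<mv x. (10 / 11 :: real) ^ j) = (1 - (10 / 11) ^ mv x) * 11" by (subst sum_gp_strict) simp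
    also have "\<dots> \<le> 11" by simp
    finally have "(\<Sum>j<mv x. (10 / 11 :: real) ^ j) / 550 \<le> 11 / 550" by (intro divide_right_mono) auto
    moreover have "(\<Sum>j<mv x. (10 / 11) ^ j / 550 + M) = (\<Sum>j<mv x. (10 / 11 :: real) ^ j) / 550 + real (mv x) * M"
      by (simp add: sum.distrib sum_divide_distrib)
    moreover have "real (mv x) * M \<le> 1 / 2450" using slack by (simp add: M_def Y_def)
    ultimately show ?thesis using sumg by linarith
  qed
  have "finite (lev l x)" unfolding lev_def using finite_primes_in by simp
  from partition_into_blocks[OF this gM M0 _ tot] obtain K where
    K: "\<forall>j<mv x. K j \<subseteq> lev l x \<and> (10 / 11) ^ j / 550 \<le> sum g (K j)" "\<forall>i<mv x. \<forall>j<mv x. i \<noteq> j \<longrightarrow> K i \<inter> K j = {}" by auto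
  have "sum g A = (\<Sum>q\<in>A. real (card (I q)) / real q) * dens (Gv (Suc l) x ^ 4) / dens (zv x)" for A
    unfolding g_def s_def sum_distrib_right[symmetric] by simp
  thus ?thesis using K by (intro exI[of _ K]) simp
qed

lemma gap_eventually: "\<forall>\<^sub>F x in at_top. has_gap (sieved_set I x) (x * ln x powr \<delta>)"
proof -
  have ev6: "\<forall>\<^sub>F x in at_top. \<forall>l\<in>{..<60}. real B * (Lmax l x * (Gv (Suc l) x / real (Yv x))) * max 1 (n1v x) \<le> real (Yv x) powr (- 0.4)"
    by (intro eventually_ball_finite ballI pair_weight_eventually) auto
  have ev7: "\<forall>\<^sub>F x in at_top. \<forall>l\<in>{..<60}. mass (real (Yv x) / Gv (Suc l) x) (real (Yv x) / Gv l x)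
            * dens (Gv (Suc l) x ^ 4) / dens (zv x) \<ge> 1 / 49"
    by (intro eventually_ball_finite ballI level_mass) auto
  have ev8: "\<forall>\<^sub>F x in at_top. \<forall>l\<in>{..<60}. \<forall>d\<ge>1 / ln x.
     real (Yv x) * (((exp (4 * (real B * (real (Tv l x))\<^sup>2 * real (kv l x) / Gv (Suc l) x ^ 4)) - 1) * d\<^sup>2 * dens (zv x)
            + (real B)\<^sup>2 * Lmax l x * ((Gv (Suc l) x)\<^sup>2 / real (Yv x)) * (real B * real (Tv l x) * (n1v x + n2v l x)))
          / (1 / 100 * d)\<^sup>2)
        + 2 * real (Yv x) * ((1 + 1 / 100) / (1 / 100)\<^sup>2) *
          ((exp (4 * (real B * (real (Tv l x))\<^sup>2 * real (kv l x) / Gv (Suc l) x ^ 4)) - 1) * (d * dens (zv x) / dens (Gv (Suc l) x ^ 4))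
            + real B * Lmax l x * (Gv (Suc l) x / real (Yv x))\<^sup>2 * ((real B)\<^sup>2 * real (Yv x) + 2 * ((4 * real (Yv x) + 1) * n2v l x))) / (1 / 100 * d)
        \<le> ln x powr (- (1.02 * \<delta>)) * (real (Yv x) * dens (zv x))"
    by (intro eventually_ball_finite ballI error_eventually) auto
  show ?thesis
    using basic_eventually nibble_numeric_eventually leftover_eventually block_slack_eventually degree_floor_eventually
      ev6 ev7 ev8
  proof eventually_elim
    case (elim x)
    have x: "x \<ge> 10" "ln x \<ge> 2" "ln (ln x) \<ge> 1" "ln x powr 0.4 \<le> ln x" "(ln x powr 0.4) ^ 4 \<le> zv x"
      "4 \<le> ln x powr (0.05 * \<delta>)" "C3 * ln (ln x) \<ge> 1" "6 * (real B)\<^sup>2 \<le> ln x powr (1.155 * \<delta>)"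
      using elim(1) by auto
    define Y where "Y = Yv x"
    define P where "P = primes_in 0 (zv x)"
    define w where "w = (\<lambda>l. Gv (Suc l) x ^ 4)"
    define H where "H = (\<lambda>l. Gv (Suc l) x)"
    define m where "m = mv x"
    have Yb: "x * ln x powr \<delta> \<le> real Y" "real Y \<le> 2 * (x * ln x powr \<delta>)" "x \<le> real Y"
      using Yv_bounds[of x] x by (auto simp: Y_def)
    have Y10: "real Y \<ge> 10" using Yb(3) x by linarith
    have lxp: "ln x > 0" using x by linarith
    have zx: "zv x \<le> x / 2" "zv x \<le> x" unfolding zv_def using x by (auto simp: field_simps)
    interpret S: sieve I B Y P
    proof
      show "finite P" unfolding P_def by (rule finite_primes_in)
      show "prime p" if "p \<in> P" for p using that by (simp add: P_def primes_in_def)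
    qed (fact I_sub I_card)+
    have sigP: "S.sig P = dens (zv x)" by (simp add: S.sig_def dens_def P_def primes_in_0)
    have Hb: "1 \<le> H l" "H l \<le> ln x powr 0.4" "ln x powr (1.155 * \<delta>) \<le> H l" if "l < 60" for l
      using Gv_bounds[of x "Suc l"] Gv_bounds(5)[of x l] x that by (auto simp: H_def)
    have siglo: "S.sig (S.lo (w l)) = dens (w l)" if l: "l < 60" for l
    proof -
      have "w l \<le> (ln x powr 0.4) ^ 4" unfolding w_def using Hb[OF l] by (intro power_mono) (auto simp: H_def)
      hence "w l \<le> zv x" using x by linarith
      hence "S.lo (w l) = {p. prime p \<and> real p \<le> w l}" unfolding S.lo_def by (auto simp: P_def primes_in_0)
      thus ?thesis by (simp add: S.sig_def dens_def)
    qed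
    have "\<forall>l. \<exists>K. l < 60 \<longrightarrow> (\<forall>j<m. K j \<subseteq> lev l x \<and> (10 / 11) ^ j / 550 \<le> (\<Sum>q\<in>K j. real (card (I q)) / real q) * dens (w l) / dens (zv x))
       \<and> (\<forall>i<m. \<forall>j<m. i \<noteq> j \<longrightarrow> K i \<inter> K j = {})"
    proof
      fix l
      show "\<exists>K. l < 60 \<longrightarrow> (\<forall>j<m. K j \<subseteq> lev l x \<and> (10 / 11) ^ j / 550 \<le> (\<Sum>q\<in>K j. real (card (I q)) / real q) * dens (w l) / dens (zv x))
       \<and> (\<forall>i<m. \<forall>j<m. i \<noteq> j \<longrightarrow> K i \<inter> K j = {})"
      proof (cases "l < 60")
        case True
        thus ?thesis using blocks_exist[OF True x(2,1)] elim(4,7) by (simp add: m_def w_def)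
      qed simp
    qed
    from choice[OF this] obtain K where KK: "\<forall>l. l < 60 \<longrightarrow> (\<forall>j<m. K l j \<subseteq> lev l x \<and> (10 / 11) ^ j / 550 \<le> (\<Sum>q\<in>K l j. real (card (I q)) / real q) * dens (w l) / dens (zv x))
       \<and> (\<forall>i<m. \<forall>j<m. i \<noteq> j \<longrightarrow> K l i \<inter> K l j = {})" ..
    have K: "\<And>l j. l < 60 \<Longrightarrow> j < m \<Longrightarrow> K l j \<subseteq> lev l x"
         "\<And>l j. l < 60 \<Longrightarrow> j < m \<Longrightarrow> (10 / 11) ^ j / 550 \<le> (\<Sum>q\<in>K l j. real (card (I q)) / real q) * dens (w l) / dens (zv x)"
         "\<And>l i j. l < 60 \<Longrightarrow> i < m \<Longrightarrow> j < m \<Longrightarrow> i \<noteq> j \<Longrightarrow> K l i \<inter> K l j = {}"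
      using KK[rule_format, THEN conjunct1, rule_format, THEN conjunct1] KK[rule_format, THEN conjunct1, rule_format, THEN conjunct2]
        KK[rule_format, THEN conjunct2, rule_format] by - assumption+
    have levD: "prime q \<and> card (I q) \<ge> 1 \<and> real Y / H l < real q \<and> real q \<le> real Y / Gv l x" if "q \<in> lev l x" for q l
      using that by (auto simp: lev_def primes_in_def Y_def H_def)
    \<comment> \<open>The factor 1.05 in \<open>av\<close> is used here: Y is of order x (ln x) powr
      \<delta>, and dividing by at least (ln x) powr (1.05 \<delta>) brings every level below x / 2,
      away from the primes reserved in \<open>R\<close>.\<close>
    have YG: "real Y / Gv l x \<le> x / 2" "real Y / Gv l x \<le> real Y" if l: "l < 60" for l
    proof -
      have g: "Gv l x \<ge> ln x powr (1.05 * \<delta>)" "Gv l x \<ge> 1" using Gv_bounds[of x l] x l by auto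
      have "real Y / Gv l x \<le> 2 * (x * ln x powr \<delta>) / ln x powr (1.05 * \<delta>)"
        using Yb g lxp x by (intro frac_le) auto
      also have "\<dots> = 2 * x / ln x powr (0.05 * \<delta>)"
      proof -
        have "ln x powr (1.05 * \<delta>) = ln x powr \<delta> * ln x powr (0.05 * \<delta>)" by (simp add: powr_add[symmetric] algebra_simps)
        thus ?thesis using lxp by simp
      qed
      also have "\<dots> \<le> 2 * x / 4" using x by (intro divide_left_mono) auto
      finally show "real Y / Gv l x \<le> x / 2" by simp
      have "real Y / Gv l x \<le> real Y / 1" using g by (intro divide_left_mono) auto
      thus "real Y / Gv l x \<le> real Y" by simp
    qed
    have Kq: "prime q" "card (I q) \<ge> 1" "real Y / H l < real q" "real q \<le> x / 2" "real q \<le> real Y" "zv x \<le> real q"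
      if lj: "l < 60" "j < m" "q \<in> K l j" for l j q
    proof -
      have q: "q \<in> lev l x" using K(1) lj by blast
      show "prime q" "card (I q) \<ge> 1" "real Y / H l < real q" using levD[OF q] by auto
      have "real q \<le> real Y / Gv l x" using levD[OF q] by blast
      thus "real q \<le> x / 2" "real q \<le> real Y" using YG[OF lj(1)] by linarith+
      have "zv x = x / ln x" by (simp add: zv_def)
      also have "\<dots> \<le> real Y / H l" using Yb Hb[OF lj(1)] x by (intro frac_le) auto
      finally show "zv x \<le> real q" using levD[OF q] by simp
    qed
    \<comment> \<open>All levels lie above \<open>zv x\<close>, since \<open>Gv\<close> never
      exceeds (ln x) powr 0.4 and hence stays below ln x.\<close>
    have qP: "q \<notin> P" if "l < 60" "j < m" "q \<in> K l j" for l j q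
    proof -
      have "zv x < real q"
      proof -
        have "x / ln x \<le> real Y / H l" using Yb Hb[OF that(1)] x by (intro frac_le) auto
        thus ?thesis using Kq(3)[OF that] by (simp add: zv_def)
      qed
      thus ?thesis by (simp add: P_def primes_in_def)
    qed
    have lvl: "sieve_level I B Y P (w l) (H l) (Tv l x) (kv l x) (K l j) (n1v x) (n2v l x)" if lj: "l < 60" "j < m" for l j
    proof
      have T: "2 * real B * H l \<le> real (Tv l x)" "real (Tv l x) \<le> 3 * real B * H l"
        using Tv_bounds[of x l] lj x by (auto simp: H_def)
      have h: "1 \<le> H l" "6 * (real B)\<^sup>2 \<le> H l" using Hb[OF lj(1)] x by auto
      \<comment> \<open>T B is of order B^2 H, so already H^2 is large enough once H \<ge> 6
        B^2.\<close>
      show "S.admissible (w l) (Tv l x)"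
      proof -
        have "2 * real (Tv l x) * real B \<le> 2 * (3 * real B * H l) * real B" using T by (intro mult_right_mono mult_left_mono) auto
        also have "\<dots> = 6 * (real B)\<^sup>2 * H l" by (simp add: power2_eq_square)
        also have "\<dots> \<le> H l * H l" using h by (intro mult_right_mono) auto
        also have "\<dots> = H l ^ 2" by (simp add: power2_eq_square)
        also have "\<dots> \<le> H l ^ 4" using h by (intro power_increasing) auto
        finally have "2 * real (Tv l x) * real B \<le> H l ^ 4" .
        moreover have "H l ^ 4 > 0" using h by simp
        ultimately show ?thesis by (simp add: S.admissible_def w_def H_def)
      qed
      have sub: "K l j \<subseteq> {1..Y}"
      proof
        fix q assume q: "q \<in> K l j"
        show "q \<in> {1..Y}" using Kq(5)[OF lj q] prime_gt_0_nat[OF Kq(1)[OF lj q]] by simp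
      qed
      show "finite (K l j)" using sub finite_subset by blast
      show "card (K l j) \<le> Y" using card_mono[OF _ sub] by simp
      show "prime q \<and> 1 \<le> card (I q) \<and> q \<le> Y \<and> real Y / H l \<le> real q" if "q \<in> K l j" for q
        using Kq[OF lj that] by auto
      show "B * (Y div q + 1) \<le> Tv l x" if q: "q \<in> K l j" for q
      proof -
        have q0: "real q > 0" using prime_gt_0_nat[OF Kq(1)[OF lj q]] by simp
        have "real Y \<le> H l * real q" using Kq(3)[OF lj q] h by (simp add: divide_less_eq mult.commute)
        hence "real Y / real q \<le> H l" using q0 by (simp add: divide_le_eq)
        hence "real (Y div q) \<le> H l" using of_nat_div_le_of_nat[of Y q, where 'a = real] by linarith
        hence "real B * (real (Y div q) + 1) \<le> real B * (H l + H l)" using h by (intro mult_left_mono) auto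
        hence "real (B * (Y div q + 1)) \<le> real (Tv l x)" using T by (simp add: algebra_simps)
        thus ?thesis by (simp only: of_nat_le_iff)
      qed
      show "1 \<le> H l" by (rule h)
      show "1 \<le> Y" using Y10 by simp
      show "finite (diff_primes I v)" if "v \<noteq> 0" for v by (rule diff_primes_bound(1)[OF that])
      show "real (num_diff_primes I v) \<le> n1v x" if "v \<noteq> 0" "\<bar>v\<bar> \<le> int Y" for v
        using diff_primes_bound(2)[OF that] by (simp add: n1v_def Y_def)
      have "Y \<ge> 5" using Y10 by simp
      thus "finite {q. prime q \<and> 1 \<le> card (I q) \<and> 0 < \<bar>mm q\<bar> \<and> \<bar>mm q\<bar> \<le> 2 * int Y \<and> mm q + u \<noteq> 0 \<and> kv l x + 1 \<le> num_diff_primes I (mm q + u)} \<and>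
         real (card {q. prime q \<and> 1 \<le> card (I q) \<and> 0 < \<bar>mm q\<bar> \<and> \<bar>mm q\<bar> \<le> 2 * int Y \<and> mm q + u \<noteq> 0 \<and> kv l x + 1 \<le> num_diff_primes I (mm q + u)}) \<le> n2v l x"
        if "\<And>q. prime q \<Longrightarrow> 1 \<le> card (I q) \<Longrightarrow> mm q \<noteq> 0 \<and> mm q mod int q \<in> diff_classes q (I q)" "\<bar>u\<bar> \<le> 2 * int Y"
        for mm :: "nat \<Rightarrow> int" and u
        using exceptional_bound[of mm u Y "kv l x", OF that] by (simp only: n2v_def Y_def)
    qed
    define de where "de = (\<lambda>l j. sieve_level.lvl_deg I P (w l) (K l j))"
    have de_eq: "de l j = (\<Sum>q\<in>K l j. real (card (I q)) / real q) * dens (w l) / dens (zv x)" if lj: "l < 60" "j < m" for l j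
    proof -
      interpret L: sieve_level I B Y P "w l" "H l" "Tv l x" "kv l x" "K l j" "n1v x" "n2v l x" by (rule lvl[OF lj])
      show ?thesis by (simp add: de_def L.lvl_deg_def L.lvl_sum_def siglo[OF lj(1)] sigP)
    qed
    have de_f: "(10 / 11) ^ j / 550 \<le> de l j" if lj: "l < 60" "j < m" for l j
      using K(2)[OF lj] by (simp add: de_eq[OF lj])
    have de_lx: "1 / ln x \<le> de l j" if lj: "l < 60" "j < m" for l j
    proof -
      have "1 / ln x \<le> (10 / 11) ^ m / 550" using elim(5) by (simp add: m_def)
      also have "\<dots> \<le> (10 / 11) ^ j / 550" using lj by (intro divide_right_mono power_decreasing) auto
      finally show ?thesis using de_f[OF lj] by linarith
    qed
    have deg0: "sieve_level.lvl_deg I P (w l) (K l j) > 0" if lj: "l < 60" "j < m" for l j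
    proof -
      have "1 / ln x > 0" using lxp by simp
      also have "\<dots> \<le> de l j" by (rule de_lx[OF lj])
      finally show ?thesis by (simp add: de_def)
    qed
    have err: "real Y * ((sieve_level.lvl_err B (w l) (Tv l x) (kv l x) * (sieve_level.lvl_deg I P (w l) (K l j))\<^sup>2 * S.sig P
            + (real B)\<^sup>2 * sieve_level.lvl_max I P (Tv l x) * ((H l)\<^sup>2 / real Y) * (real B * real (Tv l x) * (n1v x + n2v l x)))
          / (1 / 100 * sieve_level.lvl_deg I P (w l) (K l j))\<^sup>2)
        + 2 * real Y * ((1 + 1 / 100) / (1 / 100)\<^sup>2) * sieve_level.wt_err I B Y P (w l) (H l) (Tv l x) (kv l x) (K l j) (n2v l x) / (1 / 100 * sieve_level.lvl_deg I P (w l) (K l j))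
        \<le> ln x powr (- (1.02 * \<delta>)) * (real Y * S.sig P)" if lj: "l < 60" "j < m" for l j
    proof -
      interpret L: sieve_level I B Y P "w l" "H l" "Tv l x" "kv l x" "K l j" "n1v x" "n2v l x" by (rule lvl[OF lj])
      have sm: "L.lvl_sum = L.lvl_deg * dens (zv x) / dens (w l)"
        using dens_pos[of "w l"] dens_pos[of "zv x"] by (simp add: L.lvl_deg_def siglo[OF lj(1)] sigP)
      have mx: "L.lvl_max = Lmax l x" by (simp add: L.lvl_max_def Lmax_def sigP)
      have "1 / ln x \<le> L.lvl_deg" using de_lx[OF lj] by (simp add: de_def)
      with elim(8) lj(1) show ?thesis
        unfolding L.lvl_err_def L.wt_err_def sm mx sigP unfolding w_def H_def Y_def by blast
    qed
    have disj: "K l j \<inter> K l' j' = {}" if "l < 60" "j < m" "l' < 60" "j' < m" "(l, j) \<noteq> (l', j')" for l j l' j'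
    proof (cases "l = l'")
      case True
      thus ?thesis using K(3) that by auto
    next
      case False
      have mono: "Gv a x \<le> Gv c x" if "a \<le> c" "c \<le> 60" for a c
        using that
      proof (induction c rule: dec_induct)
        case (step n)
        thus ?case using Gv_bounds(4)[of x n] x by simp
      qed simp
      \<comment> \<open>Levels occupy disjoint half-open intervals: the excluded lower end of level
        \<open>a\<close> is at or above the upper end of every later level.\<close>
      have less: "q \<notin> K b i'" if ab: "a < b" "b < 60" "i < m" "i' < m" and q: "q \<in> K a i" for a b i i' q
      proof
        assume q': "q \<in> K b i'"
        have "q \<in> lev a x" "q \<in> lev b x" using K(1) ab q q' by (meson less_trans subsetD)+
        hence "real Y / H a < real q" "real q \<le> real Y / Gv b x" using levD by blast+
        moreover have "real Y / Gv b x \<le> real Y / H a"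
        proof -
          have "H a \<le> Gv b x" unfolding H_def using ab by (intro mono) auto
          thus ?thesis using Hb(1)[of a] ab by (intro divide_left_mono mult_pos_pos) auto
        qed
        ultimately show False by linarith
      qed
      consider "l < l'" | "l' < l" using False by linarith
      thus ?thesis
      proof cases
        case 1
        thus ?thesis using less[OF 1] that by blast
      next
        case 2
        thus ?thesis using less[OF 2] that by blast
      qed
    qed
    define R where "R = {p \<in> primes_in (x / 2) x. card (I p) \<ge> 1}"
    have Px: "real p \<le> x" if "p \<in> P" for p using that zx by (simp add: P_def primes_in_def)
    have Kx: "real q \<le> x \<and> q \<notin> P" if "l < 60" "j < m" "q \<in> K l j" for l j q
      using Kq(4)[OF that] qP[OF that] x by auto
    have finR: "finite R" unfolding R_def using finite_primes_in by simp
    have R: "prime p \<and> real p \<le> x \<and> p \<notin> P \<and> card (I p) \<ge> 1" if "p \<in> R" for p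
      using that zx by (auto simp: R_def P_def primes_in_def)
    have RK: "p \<notin> K l j" if "l < 60" "j < m" "p \<in> R" for l j p
    proof
      assume "p \<in> K l j"
      hence "real p \<le> x / 2" using Kq(4) that by blast
      thus False using that(3) by (simp add: R_def primes_in_def)
    qed
    have r1: "rv x \<ge> 1" using elim(2) by blast
    have Tr: "Tv l x \<le> rv x" if l: "l < 60" for l
    proof -
      have "2 * real B * Gv (Suc l) x \<le> 2 * real B * ln x powr 0.4" using Hb(2)[OF l] by (intro mult_left_mono) (auto simp: H_def)
      also have "\<dots> \<le> 3 * real B * ln x powr 0.4" by (intro mult_right_mono) auto
      finally show ?thesis unfolding Tv_def rv_def by (intro nat_mono ceiling_mono)
    qed
    have \<eta>0: "real Y powr (- 0.4) > 0" using Y10 by simp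
    have \<eta>: "real B * (sieve_level.lvl_max I P (Tv l x) * (H l / real Y)) * max 1 (n1v x) \<le> real Y powr (- 0.4)" if l: "l < 60" for l
    proof -
      have "m > 0" unfolding m_def by (rule mv_bounds(4)[OF x(2)])
      then interpret L: sieve_level I B Y P "w l" "H l" "Tv l x" "kv l x" "K l 0" "n1v x" "n2v l x" using lvl[OF l] by blast
      have "L.lvl_max = Lmax l x" by (simp add: L.lvl_max_def Lmax_def sigP)
      thus ?thesis using elim(6) l by (simp add: H_def Y_def)
    qed
    have l11: "ln (11 / 10 :: real) \<le> 1 / 10" "ln (11 / 10 :: real) > 0" using ln_add_one_self_le_self[of "1 / 10"] by simp_all
    have stage: "(\<Sum>l<60. (1 - 2 * (1 / 100)) / (1 + 1 / 100) * sieve_level.lvl_deg I P (w l) (K l j)) \<ge> (1 + 1 / 50) * (1 / (11 / 10)) ^ j * ln (11 / 10)"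
      if j: "j < m" for j
    proof -
      have "(1 + 1 / 50) * (1 / (11 / 10)) ^ j * ln (11 / 10) \<le> (1 + 1 / 50) * (1 / (11 / 10)) ^ j * (1 / 10 :: real)"
        using l11 by (intro mult_left_mono) auto
      \<comment> \<open>Supply against demand in one stage: 60 * 98 / (101 * 550) is about 0.1058,
        whereas (1 + 1/50) / 10 = 0.102 is asked for. The quotient 98 / 101 is (1 - 2 c) / (1 + c)
        for c = 1/100.\<close>
      also have "\<dots> \<le> 60 * (98 / 101 / 550) * (10 / 11) ^ j" by simp
      also have "\<dots> = (\<Sum>l<60::nat. (1 - 2 * (1 / 100)) / (1 + 1 / 100) * ((10 / 11) ^ j / 550))" by simp
      also have "\<dots> \<le> (\<Sum>l<60. (1 - 2 * (1 / 100)) / (1 + 1 / 100) * sieve_level.lvl_deg I P (w l) (K l j))"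
        using de_f j by (intro sum_mono mult_left_mono) (auto simp: de_def)
      finally show ?thesis .
    qed
    have kap: "(1 + 1 / 50) * ln (11 / 10 :: real) \<le> 1" using l11 by simp
    have num: "(24 * (real (rv x))\<^sup>2 * (11 / 10) ^ (4 * rv x * m) / (1 / 50)\<^sup>2)\<^sup>2 * (real Y powr (- 0.4)) powr (1 / 2 ^ m) \<le> (1 / (11 / 10)) ^ m"
      using elim(2) unfolding m_def Y_def by blast
    have cardR: "2 * real 60 * real m * ln x powr (- (1.02 * \<delta>)) * (real Y * S.sig P) + 4 * (1 / (11 / 10)) ^ m * (real Y * S.sig P) \<le> real (card R)"
      using elim(3) unfolding m_def Y_def sigP R_def .
    have pos: "(0 :: nat) < 60" "m > 0" "Y \<ge> 1" "(0 :: real) < 1 / 100" "0 < ln x powr (- (1.02 * \<delta>))" "(0::real) < 1 / 50" "(1 / 50 :: real) \<le> 1" "(1 :: real) < 11 / 10"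
      using mv_bounds(4)[OF x(2)] Y10 lxp by (auto simp: m_def)
    have "\<exists>c. \<forall>n\<in>{1..int Y}. \<exists>p. prime p \<and> real p \<le> x \<and> (n - c p) mod int p \<in> I p"
      by (rule S.shifts_exist[where m = m and Lv = 60 and r = "rv x" and w = w and H = H and T = "\<lambda>l. Tv l x" and k = "\<lambda>l. kv l x"
            and K = K and ?n1.0 = "n1v x" and ?n2.0 = "\<lambda>l. n2v l x" and c = "1 / 100" and ?e1.0 = "ln x powr (- (1.02 * \<delta>))"
            and t = "1 / 50" and \<kappa> = "11 / 10" and \<eta> = "real Y powr (- 0.4)" and x = x and R = R])
         (fact lvl pos deg0 err disj Px Kx finR R RK r1 Tr \<eta>0 \<eta> kap stage num cardR)+
    then obtain c where c: "\<forall>n\<in>{1..int Y}. \<exists>p. prime p \<and> real p \<le> x \<and> (n - c p) mod int p \<in> I p" by blast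
    show ?case by (rule gap_from_shifts[where c = c and Y = Y]) (use c Yb in auto)
  qed
qed

end

text \<open>An admissible \<open>\<delta>\<close> satisfies 6 < ln (1 / (2 \<delta>)), hence 2
  \<delta> < exp (-6) < 1/400. The supremum itself need not be admissible, but values as close to it
  as desired are.\<close>

lemma gap_exponent_witness:
  assumes "\<epsilon> > 0"
  shows "\<exists>\<delta>. 0 < \<delta> \<and> \<delta> \<le> 1 / 800 \<and> gap_exponent 1 - \<epsilon> \<le> \<delta>"
proof -
  define A where "A = {\<delta>::real. 0 < \<delta> \<and> \<delta> < 1 / 2 \<and> 6 * 10 powr (2 * \<delta>) / ln (1 / (2 * \<delta>)) < 1}"
  \<comment> \<open>The supremum is meaningful only for a nonempty set. For this value 1 / (2
    \<delta>) is 10^6, whose logarithm 6 ln 10 is at least 12, while the numerator stays below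
    12.\<close>
  have "(1 / 2000000 :: real) \<in> A"
  proof -
    have e3: "exp (1::real) \<le> 3" by (rule exp_le)
    have "exp (2::real) = exp 1 ^ 2" using exp_of_nat_mult[of 2 "1::real"] by simp
    also have "\<dots> \<le> 3 ^ 2" using e3 by (intro power_mono) auto
    finally have "exp (2::real) \<le> 10" by simp
    hence l10: "ln (10::real) \<ge> 2" by (simp add: ln_ge_iff)
    have l10u: "ln (10::real) \<le> 9" using ln_le_minus_one[of "10::real"] by simp
    have "10 powr (1 / 1000000) = exp ((1 / 1000000) * ln (10::real))" by (simp add: powr_def)
    also have "\<dots> \<le> exp (1 / 10)" using l10u by simp
    also have "\<dots> \<le> 1 + 1 / 10 + (1 / 10)\<^sup>2" by (rule exp_bound) auto
    also have "\<dots> < 2" by (simp add: power2_eq_square)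
    finally have p: "10 powr (1 / 1000000) < (2::real)" .
    have "ln (1000000::real) = ln (10 ^ 6)" by simp
    also have "\<dots> = 6 * ln 10" by (subst ln_realpow) auto
    finally have "ln (1000000::real) \<ge> 12" using l10 by simp
    hence "6 * 10 powr (1 / 1000000) < ln (1000000::real)" using p by linarith
    thus ?thesis by (simp add: A_def)
  qed
  hence ne: "A \<noteq> {}" by blast
  have bdd: "bdd_above A" by (rule bdd_aboveI[of _ "1/2"]) (auto simp: A_def)
  have "Sup A - \<epsilon> < Sup A" using assms by simp
  then obtain \<delta> where \<delta>: "\<delta> \<in> A" "Sup A - \<epsilon> < \<delta>" using less_cSup_iff[OF ne bdd] by blast
  have d: "0 < \<delta>" "\<delta> < 1 / 2" "6 * 10 powr (2 * \<delta>) / ln (1 / (2 * \<delta>)) < 1" using \<delta>(1) by (auto simp: A_def)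
  have l0: "ln (1 / (2 * \<delta>)) > 0" using d by simp
  have "6 * 1 \<le> 6 * 10 powr (2 * \<delta>)" using d by (intro mult_left_mono ge_one_powr_ge_zero) auto
  also have "\<dots> < ln (1 / (2 * \<delta>))" using d(3) l0 by (simp add: divide_less_eq)
  finally have "exp 6 < exp (ln (1 / (2 * \<delta>)))" by simp
  hence e6: "exp 6 < 1 / (2 * \<delta>)" using d by simp
  \<comment> \<open>545 / 512 = 1 + 1/16 + 1/512 is the quadratic Taylor bound for exp (1/16), and
    96 / 16 = 6. The margin is small, as exp 6 is about 403.\<close>
  have "400 \<le> (545 / 512 :: real) ^ 96" by (simp add: power_divide)
  also have "\<dots> \<le> exp (1 / 16) ^ 96"
    using exp_lower_Taylor_quadratic[of "1 / 16 :: real"] by (intro power_mono) (auto simp: power2_eq_square)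
  also have "\<dots> = exp 6" by (simp add: exp_of_nat_mult[symmetric])
  finally have "400 < 1 / (2 * \<delta>)" using e6 by linarith
  hence "\<delta> \<le> 1 / 800" using d by (simp add: less_divide_eq)
  thus ?thesis using d \<delta>(2) unfolding gap_exponent_def A_def[symmetric] by (intro exI[of _ \<delta>]) auto
qed

theorem theorem2:
  fixes I :: "nat \<Rightarrow> int set" and B :: nat
  assumes "sieving_system I"
    and a: "\<And>p. prime p \<Longrightarrow> card (I p) \<le> p - 1"
    and b: "\<And>p. prime p \<Longrightarrow> card (I p) \<le> B"
    and c: "\<exists>C1 > 0. asymp_equiv
              (\<lambda>x::real. \<Prod>p | prime p \<and> real p \<le> x. 1 - real (card (I p)) / real p)
              at_top (\<lambda>x. C1 / ln x)"
    and e: "\<And>\<nu>. \<nu> \<in> {1..B} \<Longrightarrow> \<exists>\<rho>::real.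
              ((\<lambda>x::real. real (card {p. prime p \<and> real p \<le> x \<and> card (I p) = \<nu>}) / (x / ln x))
                 \<longlongrightarrow> \<rho>) at_top"
    and f: "\<exists>K::real. \<forall>v::int. v \<ge> 1 \<longrightarrow>
              finite (diff_primes I v) \<and> real (num_diff_primes I v) \<le> K * (real_of_int v) powr 0.49"
    and g: "\<exists>c1 > 0. \<exists>c2 > 0. \<exists>K::real.
              \<forall>(u::real) (m :: nat \<Rightarrow> int) (w::int) (k::nat).
                u \<ge> 10 \<longrightarrow>
                (\<forall>q. prime q \<and> card (I q) \<ge> 1 \<longrightarrow>
                   m q \<noteq> 0 \<and> m q mod int q \<in> diff_classes q (I q)) \<longrightarrow>
                \<bar>real_of_int w\<bar> \<le> u \<longrightarrow> k \<ge> 1 \<longrightarrow>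
                (let Q = {q. prime q \<and> card (I q) \<ge> 1 \<and> 0 < \<bar>m q\<bar> \<and> \<bar>real_of_int (m q)\<bar> \<le> u \<and>
                             m q + w \<noteq> 0 \<and> num_diff_primes I (m q + w) \<ge> k}
                 in finite Q \<and> real (card Q) \<le> K * (u * ln u powr c1 * exp (- c2 * real k)))"
  shows "\<forall>\<epsilon> > 0. \<forall>\<^sub>F x::real in at_top.
           has_gap (sieved_set I x) (x * ln x powr (gap_exponent 1 - \<epsilon>))"
proof (intro allI impI)
  fix \<epsilon> :: real assume "\<epsilon> > 0"
  then obtain \<delta> where del: "0 < \<delta>" "\<delta> \<le> 1 / 800" "gap_exponent 1 - \<epsilon> \<le> \<delta>" using gap_exponent_witness by blast
  obtain C1 where C1: "C1 > 0" "asymp_equiv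
              (\<lambda>x::real. \<Prod>p | prime p \<and> real p \<le> x. 1 - real (card (I p)) / real p)
              at_top (\<lambda>x. C1 / ln x)" using c by blast
  obtain K where K: "\<forall>v::int. v \<ge> 1 \<longrightarrow>
              finite (diff_primes I v) \<and> real (num_diff_primes I v) \<le> K * (real_of_int v) powr 0.49" using f by blast
  obtain c1 c2 K' where g': "c1 > 0" "c2 > 0" "\<forall>(u::real) (m :: nat \<Rightarrow> int) (w::int) (k::nat).
                u \<ge> 10 \<longrightarrow>
                (\<forall>q. prime q \<and> card (I q) \<ge> 1 \<longrightarrow>
                   m q \<noteq> 0 \<and> m q mod int q \<in> diff_classes q (I q)) \<longrightarrow>
                \<bar>real_of_int w\<bar> \<le> u \<longrightarrow> k \<ge> 1 \<longrightarrow>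
                (let Q = {q. prime q \<and> card (I q) \<ge> 1 \<and> 0 < \<bar>m q\<bar> \<and> \<bar>real_of_int (m q)\<bar> \<le> u \<and>
                             m q + w \<noteq> 0 \<and> num_diff_primes I (m q + w) \<ge> k}
                 in finite Q \<and> real (card Q) \<le> K' * (u * ln u powr c1 * exp (- c2 * real k)))"
    using g by blast
  interpret gap_setup I B C1 \<delta> "\<bar>K\<bar>" "\<bar>K'\<bar>" c1 c2
  proof
    show "I p \<subseteq> {0..<int p}" if "prime p" for p using assms(1) that by (simp add: sieving_system_def)
    show "finite (diff_primes I v) \<and> real (num_diff_primes I v) \<le> \<bar>K\<bar> * (real_of_int v) powr 0.49" if "v \<ge> 1" for v
    proof -
      have "K * (real_of_int v) powr 0.49 \<le> \<bar>K\<bar> * (real_of_int v) powr 0.49" by (intro mult_right_mono) auto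
      thus ?thesis using K that by (meson order_trans)
    qed
    fix u :: real and m :: "nat \<Rightarrow> int" and w :: int and k :: nat
    assume A: "u \<ge> 10" "\<forall>q. prime q \<and> card (I q) \<ge> 1 \<longrightarrow> m q \<noteq> 0 \<and> m q mod int q \<in> diff_classes q (I q)"
      "\<bar>real_of_int w\<bar> \<le> u" "k \<ge> 1"
    define Q where "Q = {q. prime q \<and> card (I q) \<ge> 1 \<and> 0 < \<bar>m q\<bar> \<and> \<bar>real_of_int (m q)\<bar> \<le> u \<and>
                             m q + w \<noteq> 0 \<and> num_diff_primes I (m q + w) \<ge> k}"
    have "finite Q \<and> real (card Q) \<le> K' * (u * ln u powr c1 * exp (- c2 * real k))"
      using g'(3)[rule_format, OF A(1) _ A(3,4), of m] A(2) unfolding Let_def Q_def by blast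
    moreover have "K' * (u * ln u powr c1 * exp (- c2 * real k)) \<le> \<bar>K'\<bar> * (u * ln u powr c1 * exp (- c2 * real k))"
      using A(1) by (intro mult_right_mono) auto
    ultimately show "finite Q \<and> real (card Q) \<le> \<bar>K'\<bar> * (u * ln u powr c1 * exp (- c2 * real k))" by linarith
  qed (use a b C1 e del g' in auto)
  show "\<forall>\<^sub>F x::real in at_top. has_gap (sieved_set I x) (x * ln x powr (gap_exponent 1 - \<epsilon>))"
    using gap_eventually basic_eventually
  proof eventually_elim
    case (elim x)
    have "x * ln x powr (gap_exponent 1 - \<epsilon>) \<le> x * ln x powr \<delta>"
      using elim(2) del(3) by (intro mult_left_mono powr_mono) auto
    thus ?case by (rule has_gap_mono[OF elim(1)])
  qed
qed

end
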